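(* Let $z,w$ be complex numbers with $|\arg z|<\pi/4$, $|\arg w|<\pi/4$ and $\operatorname{Re}(z)>\operatorname{Re}(w)$. Let $\rho>0$, and let $s,\lambda\in\mathbb{C}$ satisfy $\operatorname{Re}(s)>-1$, $\operatorname{Re}(\lambda)>-1/2$ and $\operatorname{Re}(s+\lambda)>-1$. With $F_s$ and $\mathcal{A}(t)=\mathcal{A}(s,\lambda,z,w,t)$ as defined in the context, $$\int_{0}^{\infty}t^{s+1}F_{s}(\rho t)\left(\mathcal{A}(t^2)+\mathcal{A}(-t^2)\right)dt=\frac{\Gamma(\lambda+1)}{\Gamma(s+\lambda+1)}(2\rho)^{s}\left\{I_{\lambda}\left(\frac{\rho\overline{\epsilon}(z-w)}{2}\right)K_{\lambda}\left(\frac{\rho\overline{\epsilon}(z+w)}{2}\right)+I_{\lambda}\left(\frac{\rho\epsilon(z-w)}{2}\right)K_{\lambda}\left(\frac{\rho\epsilon(z+w)}{2}\right)\right\}.$$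
   Context: Notation: $\epsilon=e^{i\pi/4}$, $\overline{\epsilon}=e^{-i\pi/4}$. $J_s,Y_s$ are the Bessel functions of the first and second kind and $I_s,K_s$ the modified Bessel functions of the first and second kind, of order $s$ (principal branches, $-\pi<\arg\le\pi$; at integer orders $Y_s,K_s$ are defined by the usual limits). The Koshliakov kernel is $$F_s(t):=\left(\frac{2}{\pi}K_s(t)-Y_s(t)\right)\cos\left(\frac{\pi s}{2}\right)-J_s(t)\sin\left(\frac{\pi s}{2}\right).$$ For real $t$, $$\mathcal{A}(t)=\mathcal{A}(s,\lambda,z,w,t):=\frac{1}{\sqrt{z^2+it}\,\sqrt{w^2+it}}\left(\frac{1}{\sqrt{z^2+it}}+\frac{1}{\sqrt{w^2+it}}\right)^{2s}\left(\frac{\sqrt{z^2+it}-\sqrt{w^2+it}}{\sqrt{z^2+it}+\sqrt{w^2+it}}\right)^{\lambda}{}_2F_1\left(\lambda-s,-s;\lambda+1;\left(\frac{\sqrt{z^2+it}-\sqrt{w^2+it}}{\sqrt{z^2+it}+\sqrt{w^2+it}}\right)^{2}\right),$$ where ${}_2F_1(a,b;c;\xi)=\sum_{n\ge0}\frac{(a)_n(b)_n}{(c)_n n!}\xi^n$ for $|\xi|<1$, with $(a)_n=a(a+1)\cdots(a+n-1)$. Square roots and the $2s$-th power are principal. The $\lambda$-th power of the quotient is the branch obtained by analytic continuation in $(z,w)$, within the convex region $|\arg z|<\pi/4$, $|\arg w|<\pi/4$, $\operatorname{Re}(z)>\operatorname{Re}(w)$ (where the quotient never vanishes), from real $z>w>0$,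 where it is the principal value. The integral over $(0,\infty)$ is an improper integral (it may converge only conditionally at infinity). *)

theory Defs
  imports "HOL-Complex_Analysis.Complex_Analysis"
begin

text \<open>
  Bessel functions of complex order \<open>s\<close>, principal branches. The library's \<open>0 powr s = 0\<close> makes the
  values at argument \<open>0\<close> meaningless. \<open>rGamma\<close> is the entire function \<open>1 / Gamma\<close>, so the two
  series are correct for negative integer orders too.
\<close>

definition Bessel_J :: "complex \<Rightarrow> complex \<Rightarrow> complex" where
  "Bessel_J s x = (x / 2) powr s *
     (\<Sum>n. (-1) ^ n * rGamma (s + of_nat n + 1) / fact n * (x / 2) ^ (2 * n))"

definition Bessel_I :: "complex \<Rightarrow> complex \<Rightarrow> complex" where
  "Bessel_I s x = (x / 2) powr s *
     (\<Sum>n. rGamma (s + of_nat n + 1) / fact n * (x / 2) ^ (2 * n))"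

definition Bessel_Y :: "complex \<Rightarrow> complex \<Rightarrow> complex" where
  "Bessel_Y s x =
     (let q = (\<lambda>\<nu>. (Bessel_J \<nu> x * cos (of_real pi * \<nu>) - Bessel_J (-\<nu>) x) / sin (of_real pi * \<nu>))
      in if s \<in> \<int> then Lim (at s) q else q s)"

definition Bessel_K :: "complex \<Rightarrow> complex \<Rightarrow> complex" where
  "Bessel_K s x =
     (let q = (\<lambda>\<nu>. of_real pi / 2 * (Bessel_I (-\<nu>) x - Bessel_I \<nu> x) / sin (of_real pi * \<nu>))
      in if s \<in> \<int> then Lim (at s) q else q s)"

definition Koshliakov_F :: "complex \<Rightarrow> complex \<Rightarrow> complex" where
  "Koshliakov_F s x =
     (2 / of_real pi * Bessel_K s x - Bessel_Y s x) * cos (of_real pi * s / 2)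
       - Bessel_J s x * sin (of_real pi * s / 2)"

definition hyp2F1 :: "complex \<Rightarrow> complex \<Rightarrow> complex \<Rightarrow> complex \<Rightarrow> complex" where
  "hyp2F1 a b c x = (\<Sum>n. pochhammer a n * pochhammer b n / (pochhammer c n * fact n) * x ^ n)"

definition root_quot :: "real \<Rightarrow> complex \<Rightarrow> complex \<Rightarrow> complex" where
  "root_quot t z w =
     (csqrt (z\<^sup>2 + \<i> * of_real t) - csqrt (w\<^sup>2 + \<i> * of_real t)) /
     (csqrt (z\<^sup>2 + \<i> * of_real t) + csqrt (w\<^sup>2 + \<i> * of_real t))"

text \<open>\<open>z\<close> and \<open>w\<close> must be required to be nonzero because \<open>Arg 0 = 0\<close> in the library.\<close>

definition zw_region :: "(complex \<times> complex) set" where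
  "zw_region = {(z, w). z \<noteq> 0 \<and> w \<noteq> 0 \<and> \<bar>Arg z\<bar> < pi / 4 \<and> \<bar>Arg w\<bar> < pi / 4 \<and> Re z > Re w}"

text \<open>
  Analytic continuation, in both variables jointly, of the principal power from the real points
  \<open>z > w > 0\<close> to the whole region: holomorphy in two variables means continuity together with
  holomorphy in each variable separately. Such a \<open>g\<close> is unique on the region by the identity
  theorem, applied first in \<open>z\<close> and then in \<open>w\<close> (the slices are convex).
\<close>

definition is_root_quot_power ::
    "complex \<Rightarrow> real \<Rightarrow> (complex \<Rightarrow> complex \<Rightarrow> complex) \<Rightarrow> bool" where
  "is_root_quot_power lam t g \<longleftrightarrow>
     continuous_on zw_region (\<lambda>(z, w). g z w) \<and>
     (\<forall>w. (\<lambda>z. g z w) holomorphic_on {z. (z, w) \<in> zw_region}) \<and>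
     (\<forall>z. (\<lambda>w. g z w) holomorphic_on {w. (z, w) \<in> zw_region}) \<and>
     (\<forall>x y :: real. x > y \<and> y > 0 \<longrightarrow>
        g (of_real x) (of_real y) = root_quot t (of_real x) (of_real y) powr lam)"

definition root_quot_power :: "complex \<Rightarrow> real \<Rightarrow> complex \<Rightarrow> complex \<Rightarrow> complex" where
  "root_quot_power lam t z w = (THE v. \<exists>g. is_root_quot_power lam t g \<and> v = g z w)"

definition kernel_A :: "complex \<Rightarrow> complex \<Rightarrow> complex \<Rightarrow> complex \<Rightarrow> real \<Rightarrow> complex" where
  "kernel_A s lam z w t =
     (let a = csqrt (z\<^sup>2 + \<i> * of_real t); b = csqrt (w\<^sup>2 + \<i> * of_real t)
      in 1 / (a * b) * (1 / a + 1 / b) powr (2 * s) * root_quot_power lam t z w *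
         hyp2F1 (lam - s) (- s) (lam + 1) ((root_quot t z w)\<^sup>2))"

text \<open>
  Improper integral over \<open>(0, \<infinity>)\<close>: the limits \<open>a \<rightarrow> 0+\<close> and \<open>b \<rightarrow> \<infinity>\<close> are taken independently of each
  other, and absolute convergence is not required.
\<close>

definition has_improper_integral :: "(real \<Rightarrow> complex) \<Rightarrow> complex \<Rightarrow> bool" where
  "has_improper_integral f I \<longleftrightarrow>
     (\<forall>a b. 0 < a \<and> a \<le> b \<longrightarrow> f integrable_on {a..b}) \<and>
     ((\<lambda>(a, b). integral {a..b} f) \<longlongrightarrow> I) (at_right 0 \<times>\<^sub>F at_top)"

end

theory Submission
  imports Defs "HOL-Real_Asymp.Real_Asymp"
begin

text \<open>
  Write \<open>t\<^bsup>s+1\<^esup> F\<^sub>s(t) dt\<close>, in the variable \<open>X = t\<^sup>2/4\<close>, as \<open>dV(X)\<close>. Instead of the conditionally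
  convergent integral one integrates \<open>V\<close> against \<open>\<A>'\<close>, which converges absolutely and allows Fubini.

  By Pizzetti's formula (Taylor expansion of a spherical mean in iterated Laplacians, in dimension
  \<open>2\<lambda> + 2\<close>) together with Euler's transformation of \<open>\<^sub>2F\<^sub>1\<close>, the kernel \<open>\<A>(\<plusminus>t)\<close> is a multiple of the mean
  of \<open>(\<zeta>\<^sub>x \<plusminus> it)\<^bsup>-(s+\<lambda>+1)\<^esup>\<close> against the Gegenbauer weight \<open>(1-x\<^sup>2)\<^bsup>\<lambda>-1/2\<^esup>\<close>, where \<open>\<zeta>\<^sub>x\<close> runs through the
  segment from \<open>z\<^sup>2\<close> to \<open>w\<^sup>2\<close>. For a single \<open>\<zeta>\<close> the power is a Laplace integral, and the Laplace
  transform of \<open>V\<close> is elementary up to a term that is even in the transform variable. Rotating the rays of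
  integration for \<open>+\<close> and \<open>-\<close> onto each other cancels the even terms and leaves the integral
  representations of \<open>K\<^sub>\<lambda>\<close> at arguments \<open>\<zeta>\<^sub>x\<close>. Averaging over \<open>x\<close>, now by Pizzetti's formula for \<open>K\<^sub>\<lambda>\<close>
  (Gegenbauer's addition theorem), produces the products \<open>I\<^sub>\<lambda> K\<^sub>\<lambda>\<close>.
\<close>

subsection \<open>Holomorphic parameter integrals\<close>

text \<open>Two exponents compete in the integration by parts: \<open>V\<close> grows like X^(Re s/2
  + 1/4), up to an arbitrarily small loss, while the kernel decays like X^(-Re \<mu>) with \<mu> = s
  + \<lambda> + 1. The lower bounds on Re \<lambda> and Re (s + \<lambda>) together open a positive
  gap between them. The obstacle in the evaluation is that the Laplace variable attached to (\<zeta>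
  + 4jX)^(-\<mu>), for j = i or j = -i, would be purely imaginary, where the transform of
  \<open>V\<close> need not converge. Turning the ray by e^(-j\<phi>) makes its real part positive
  and costs an angle \<phi> in the sector available to \<zeta>; the strict bounds on the arguments
  of z and w leave room for this. Differentiating the power brings down a factor j, of opposite sign
  for the two kernels, and this sign is what makes the even parts of the transforms cancel instead
  of adding up. Rays are written in logarithmic coordinates, where a rotation is an imaginary shift,
  and the Bessel functions through the entire series \<open>bser\<close> and the integral
  \<open>Kint\<close>, whose two arguments can be rotated separately.\<close>

lemma
  fixes f :: "complex \<Rightarrow> 'a \<Rightarrow> complex"
  assumes U: "open U"
    and meas: "\<And>z. z \<in> U \<Longrightarrow> f z \<in> borel_measurable M"
    and hol: "\<And>x. x \<in> space M \<Longrightarrow> (\<lambda>z. f z x) holomorphic_on U"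
    and dom: "\<And>z0. z0 \<in> U \<Longrightarrow> \<exists>r>0. \<exists>g. integrable M g \<and>
                (\<forall>z \<in> ball z0 r \<inter> U. \<forall>x \<in> space M. norm (f z x) \<le> g x)"
    and z0: "z0 \<in> U"
  shows integrable_param_integral: "integrable M (f z0)"
    and integrable_param_deriv: "integrable M (\<lambda>x. deriv (\<lambda>z. f z x) z0)"
    and has_field_derivative_param_integral:
      "((\<lambda>z. \<integral>x. f z x \<partial>M) has_field_derivative (\<integral>x. deriv (\<lambda>z. f z x) z0 \<partial>M)) (at z0)"
proof -
  have int: "integrable M (f z)" if "z \<in> U" for z
  proof -
    from dom[OF that] obtain r g where r: "r > 0" "integrable M g"
      "\<And>z'. z' \<in> ball z r \<inter> U \<Longrightarrow> \<forall>x \<in> space M. norm (f z' x) \<le> g x" by blast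
    have "norm (f z x) \<le> norm (g x)" if "x \<in> space M" for x
    proof -
      have "norm (f z x) \<le> g x" using r that \<open>z \<in> U\<close> by auto
      thus ?thesis by simp
    qed
    thus ?thesis
      by (intro Bochner_Integration.integrable_bound[OF r(2) meas[OF that]] AE_I2) auto
  qed
  thus "integrable M (f z0)" using z0 by blast
  obtain r1 g where r1: "r1 > 0" "integrable M g"
      "\<And>z' x. z' \<in> ball z0 r1 \<inter> U \<Longrightarrow> x \<in> space M \<Longrightarrow> norm (f z' x) \<le> g x" using dom[OF z0] by blast
  obtain r2 where r2: "r2 > 0" "ball z0 r2 \<subseteq> U" using U z0 openE by blast
  \<comment> \<open>Circles of radius \<open>r\<close> about points of \<open>cball z0 r\<close>
    have to stay inside \<open>ball z0 (3 * r)\<close>, where both the holomorphy and the bound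
    \<open>g\<close> are available.\<close>
  define r where "r = min r1 r2 / 3"
  have r: "r > 0" "ball z0 (3 * r) \<subseteq> U" "3 * r \<le> r1" using r1 r2 by (auto simp: r_def)
  \<comment> \<open>Cauchy's inequality turns the bound on \<open>f\<close> into a bound on its
    derivative. Hence \<open>g x / r\<close> dominates the difference quotients, and dominated
    convergence applies along every sequence tending to \<open>z0\<close>.\<close>
  have dbound: "norm (deriv (\<lambda>z. f z x) z) \<le> g x / r" if z: "z \<in> cball z0 r" and x: "x \<in> space M" for z x
  proof -
    have sub: "cball z r \<subseteq> ball z0 (3 * r)"
    proof
      fix y assume "y \<in> cball z r"
      hence "dist z0 y \<le> r + r" using z dist_triangle[of z0 y z] by (auto simp: )
      thus "y \<in> ball z0 (3 * r)" using r by auto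
    qed
    hence sub': "cball z r \<subseteq> U" using r by auto
    have "norm ((deriv ^^ 1) (\<lambda>z. f z x) z) \<le> fact 1 * g x / r ^ 1"
    proof (rule Cauchy_inequality)
      show "(\<lambda>z. f z x) holomorphic_on ball z r"
        by (rule holomorphic_on_subset[OF hol[OF x]]) (use sub' ball_subset_cball in blast)
      show "continuous_on (cball z r) (\<lambda>z. f z x)"
        by (rule continuous_on_subset[OF holomorphic_on_imp_continuous_on[OF hol[OF x]] sub'])
      fix y assume "norm (z - y) = r"
      hence "y \<in> cball z r" by (simp add: dist_norm)
      moreover from this have "y \<in> ball z0 (3 * r)" using sub by blast
      ultimately show "norm (f y x) \<le> g x" using r1(3)[of y x] sub' r(3) x by auto
    qed (use r in auto)
    thus ?thesis by simp
  qed
  have lip: "norm (f z x - f z0 x) \<le> g x / r * norm (z - z0)" if "z \<in> cball z0 r" "x \<in> space M" for z x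
  proof (rule field_differentiable_bound[of "cball z0 r" "\<lambda>z. f z x" "deriv (\<lambda>z. f z x)"])
    fix y assume "y \<in> cball z0 r"
    hence "y \<in> U" using r by auto
    thus "((\<lambda>z. f z x) has_field_derivative deriv (\<lambda>z. f z x) y) (at y within cball z0 r)"
      using hol[OF that(2)] U by (metis holomorphic_derivI)
  qed (use that r dbound in auto)
  have main: "integrable M (\<lambda>x. deriv (\<lambda>z. f z x) z0) \<and>
      (\<lambda>n. \<integral>x. (f (X n) x - f z0 x) / (X n - z0) \<partial>M) \<longlonglongrightarrow> (\<integral>x. deriv (\<lambda>z. f z x) z0 \<partial>M)"
    if X: "\<And>n. X n \<in> cball z0 r - {z0}" "X \<longlonglongrightarrow> z0" for X
  proof -
    have XU: "X n \<in> U" for n using X(1)[of n] r by auto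
    have m: "(\<lambda>x. (f (X n) x - f z0 x) / (X n - z0)) \<in> borel_measurable M" for n
      using meas[OF XU[of n]] meas[OF z0] by simp
    have lim: "(\<lambda>n. (f (X n) x - f z0 x) / (X n - z0)) \<longlonglongrightarrow> deriv (\<lambda>z. f z x) z0" if x: "x \<in> space M" for x
    proof -
      have "((\<lambda>z. f z x) has_field_derivative deriv (\<lambda>z. f z x) z0) (at z0)"
        using hol[OF x] U z0 by (metis holomorphic_derivI)
      hence "((\<lambda>y. (f y x - f z0 x) / (y - z0)) \<longlongrightarrow> deriv (\<lambda>z. f z x) z0) (at z0)"
        by (simp add: has_field_derivative_iff)
      thus ?thesis unfolding tendsto_at_iff_sequentially using X by (auto simp: o_def)
    qed
    have m': "(\<lambda>x. deriv (\<lambda>z. f z x) z0) \<in> borel_measurable M"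
      by (rule borel_measurable_LIMSEQ_metric[OF m lim])
    have b: "norm ((f (X n) x - f z0 x) / (X n - z0)) \<le> g x / r" if x: "x \<in> space M" for n x
    proof -
      have "X n \<noteq> z0" "X n \<in> cball z0 r" using X(1)[of n] by auto
      thus ?thesis using lip[of "X n" x] x r(1) by (simp add: norm_divide field_simps)
    qed
    have ig: "integrable M (\<lambda>x. g x / r)" using r1 by auto
    show ?thesis
    proof (intro conjI)
      have "AE x in M. (\<lambda>n. (f (X n) x - f z0 x) / (X n - z0)) \<longlonglongrightarrow> deriv (\<lambda>z. f z x) z0"
        by (rule AE_I2) (rule lim)
      thus "integrable M (\<lambda>x. deriv (\<lambda>z. f z x) z0)"
        by (rule integrable_dominated_convergence[OF m' m ig]) (use b in auto)
      show "(\<lambda>n. \<integral>x. (f (X n) x - f z0 x) / (X n - z0) \<partial>M) \<longlonglongrightarrow> (\<integral>x. deriv (\<lambda>z. f z x) z0 \<partial>M)"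
        by (rule integral_dominated_convergence[OF m' m ig]) (use lim b in auto)
    qed
  qed
  define X where "X n = z0 + of_real (r / real (Suc n))" for n
  have "X n \<in> cball z0 r - {z0}" for n
  proof -
    have "norm (X n - z0) = r / real (Suc n)" using r by (simp add: X_def norm_divide del: of_nat_Suc)
    moreover have "r / real (Suc n) \<le> r / 1" using r by (intro divide_left_mono) auto
    moreover have "r / real (Suc n) > 0" using r by simp
    ultimately show ?thesis by (auto simp: dist_norm norm_minus_commute)
  qed
  moreover have "X \<longlonglongrightarrow> z0 + of_real 0" unfolding X_def
    by (intro tendsto_intros) (use lim_const_over_n LIMSEQ_Suc in blast)
  ultimately show "integrable M (\<lambda>x. deriv (\<lambda>z. f z x) z0)" using main by auto
  show "((\<lambda>z. \<integral>x. f z x \<partial>M) has_field_derivative (\<integral>x. deriv (\<lambda>z. f z x) z0 \<partial>M)) (at z0)"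
    unfolding has_field_derivative_iff
  proof (rule Lim_transform_within)
    show "((\<lambda>z. \<integral>x. (f z x - f z0 x) / (z - z0) \<partial>M) \<longlongrightarrow> (\<integral>x. deriv (\<lambda>z. f z x) z0 \<partial>M)) (at z0)"
      unfolding tendsto_at_iff_sequentially
    proof (intro allI impI)
      fix X assume X: "\<forall>i. X i \<in> UNIV - {z0}" "X \<longlonglongrightarrow> z0"
      have "\<forall>\<^sub>F n in sequentially. X n \<in> ball z0 r"
        using X(2) r(1) by (metis centre_in_ball open_ball topological_tendstoD)
      then obtain N where N: "\<And>n. n \<ge> N \<Longrightarrow> X n \<in> ball z0 r" by (auto simp: eventually_sequentially)
      have "(\<lambda>n. \<integral>x. (f (X (n + N)) x - f z0 x) / (X (n + N) - z0) \<partial>M) \<longlonglongrightarrow> (\<integral>x. deriv (\<lambda>z. f z x) z0 \<partial>M)"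
      proof (rule main[THEN conjunct2])
        show "X (n + N) \<in> cball z0 r - {z0}" for n using N[of "n + N"] X(1) by auto
        show "(\<lambda>n. X (n + N)) \<longlonglongrightarrow> z0" using X(2) LIMSEQ_ignore_initial_segment by blast
      qed
      thus "((\<lambda>z. \<integral>x. (f z x - f z0 x) / (z - z0) \<partial>M) \<circ> X) \<longlonglongrightarrow> (\<integral>x. deriv (\<lambda>z. f z x) z0 \<partial>M)"
        unfolding o_def by (rule LIMSEQ_offset)
    qed
    show "(\<integral>x. (f z x - f z0 x) / (z - z0) \<partial>M) = ((\<integral>x. f z x \<partial>M) - (\<integral>x. f z0 x \<partial>M)) / (z - z0)"
      if "0 < dist z z0" "dist z z0 < r" for z
    proof -
      have "z \<in> U" using that r by (auto simp: dist_commute)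
      thus ?thesis using int z0 by simp
    qed
  qed (rule r)
qed

lemma holomorphic_param_integral:
  fixes f :: "complex \<Rightarrow> 'a \<Rightarrow> complex"
  assumes "open U"
    and "\<And>z. z \<in> U \<Longrightarrow> f z \<in> borel_measurable M"
    and "\<And>x. x \<in> space M \<Longrightarrow> (\<lambda>z. f z x) holomorphic_on U"
    and "\<And>z0. z0 \<in> U \<Longrightarrow> \<exists>r>0. \<exists>g. integrable M g \<and>
                (\<forall>z \<in> ball z0 r \<inter> U. \<forall>x \<in> space M. norm (f z x) \<le> g x)"
  shows "(\<lambda>z. \<integral>x. f z x \<partial>M) holomorphic_on U"
  using has_field_derivative_param_integral[OF assms] assms(1)
  by (auto simp: holomorphic_on_open)

text \<open>The midpoint of the real interval is an accumulation point of the interval, so the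
  identity theorem applies. Formulas are established below for real parameters, where substitutions
  on the real line are available, and extended to complex ones in this way.\<close>

lemma holomorphic_eqI_on_reals:
  assumes f: "f holomorphic_on S" and g: "g holomorphic_on S" and S: "open S" "connected S"
    and ab: "(a::real) < b" "\<And>x. a < x \<Longrightarrow> x < b \<Longrightarrow> of_real x \<in> S \<and> f (of_real x) = g (of_real x)"
    and w: "w \<in> S"
  shows "f w = g w"
proof -
  define U where "U = complex_of_real ` {a<..<b}"
  define m where "m = (a + b) / 2"
  have m: "a < m" "m < b" using ab by (auto simp: m_def)
  have "of_real m islimpt U"
    unfolding islimpt_approachable
  proof (intro allI impI)
    fix e :: real assume e: "e > 0"
    define h where "h = min (e / 2) ((b - m) / 2)"
    have "h > 0" "h < e" "m + h < b" using e m by (auto simp: h_def min_def field_simps)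
    moreover have "complex_of_real (m + h) \<in> U" unfolding U_def
      by (rule imageI) (use m calculation in auto)
    ultimately have "complex_of_real (m + h) \<in> U" "complex_of_real (m + h) \<noteq> of_real m"
      "dist (complex_of_real (m + h)) (of_real m) < e"
      by (auto simp: dist_norm)
    thus "\<exists>x'\<in>U. x' \<noteq> complex_of_real m \<and> dist x' (of_real m) < e" by blast
  qed
  moreover have "(\<lambda>z. f z - g z) holomorphic_on S" by (intro holomorphic_intros f g)
  moreover have "U \<subseteq> S" "of_real m \<in> S" unfolding U_def using ab(2) m by auto
  moreover have "f z - g z = 0" if "z \<in> U" for z using ab(2) that unfolding U_def by auto
  ultimately have "f w - g w = 0"
    using analytic_continuation[of "\<lambda>z. f z - g z" S U "of_real m" w] S w by blast
  thus ?thesis by simp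
qed

text \<open>The substitution t = e^x in Euler's integral. On the line, scaling t is a translation,
  and turning the ray of integration into the complex plane is an imaginary shift.\<close>

lemma exp_integral_one:
  fixes \<mu> :: complex and a :: real
  assumes "Re \<mu> > 0" "a > 0"
  shows "integrable lborel (\<lambda>x. exp (\<mu> * of_real x - of_real (a * exp x)))"
    and "(\<integral>x. exp (\<mu> * of_real x - of_real (exp x)) \<partial>lborel) = Gamma \<mu>"
proof -
  have ran: "range exp = {0::real<..}" by (auto intro: exp_total simp: image_iff) (metis exp_ln)
  have d: "(exp has_field_derivative exp x) (at x within UNIV)" for x :: real by (rule DERIV_exp)
  have eq: "\<bar>exp x\<bar> *\<^sub>R (complex_of_real (exp x) powr (\<mu> - 1) / of_real (exp (a * exp x))) =
     exp (\<mu> * of_real x - of_real (a * exp x))" for a x :: real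
  proof -
    have "complex_of_real (exp x) powr (\<mu> - 1) = exp ((\<mu> - 1) * of_real x)"
      by (simp add: powr_def Ln_of_real del: of_real_exp)
    thus ?thesis by (simp add: scaleR_conv_of_real exp_diff exp_of_real[symmetric] algebra_simps)
  qed
  have meas: "(\<lambda>x. exp (\<mu> * of_real x - of_real (a * exp x))) \<in> borel_measurable lborel" for a :: real
    unfolding measurable_lborel2 by (intro borel_measurable_continuous_onI continuous_intros)
  have "(\<lambda>x. exp (\<mu> * of_real x - of_real (a * exp x))) absolutely_integrable_on UNIV"
    using absolutely_integrable_Gamma_integral[OF assms]
      absolutely_integrable_change_of_variables_real[of UNIV exp exp "\<lambda>t. complex_of_real t powr (\<mu> - 1) / of_real (exp (a * t))"]
    unfolding ran eq by (simp add: DERIV_exp inj_on_def)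
  thus "integrable lborel (\<lambda>x. exp (\<mu> * of_real x - of_real (a * exp x)))"
    using meas by (simp add: set_integrable_def integrable_completion)
  have "(\<lambda>t. complex_of_real t powr (\<mu> - 1) / of_real (exp (1 * t))) absolutely_integrable_on range exp \<and>
    integral (range exp) (\<lambda>t. complex_of_real t powr (\<mu> - 1) / of_real (exp (1 * t))) = Gamma \<mu>"
    unfolding ran using absolutely_integrable_Gamma_integral[OF assms(1), of 1] Gamma_integral_complex'[OF assms(1)]
    by (simp add: integral_unique)
  hence *: "(\<lambda>x. exp (\<mu> * of_real x - of_real (1 * exp x))) absolutely_integrable_on UNIV \<and>
    integral UNIV (\<lambda>x. exp (\<mu> * of_real x - of_real (1 * exp x))) = Gamma \<mu>"
    using has_absolute_integral_change_of_variables_real[of UNIV exp exp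
        "\<lambda>t. complex_of_real t powr (\<mu> - 1) / of_real (exp (1 * t))" "Gamma \<mu>"]
    unfolding eq by (simp add: DERIV_exp inj_on_def)
  hence "integral\<^sup>L lebesgue (\<lambda>x. exp (\<mu> * of_real x - of_real (1 * exp x))) = Gamma \<mu>"
    using set_lebesgue_integral_eq_integral(2)[OF conjunct1[OF *]] by (simp add: set_lebesgue_integral_def)
  thus "(\<integral>x. exp (\<mu> * of_real x - of_real (exp x)) \<partial>lborel) = Gamma \<mu>"
    using meas[of 1] by (simp add: integral_completion)
qed


lemma integrable_exp_one:
  fixes c a :: real
  assumes "c > 0" "a > 0"
  shows "integrable lborel (\<lambda>x. exp (c * x - a * exp x))"
  using integrable_norm[OF exp_integral_one(1)[of "of_real c" a]] assms by simp

text \<open>On each half-line one of the two double exponentials alone gives enough decay, so the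
  integrand lies below a sum of two one-sided kernels.\<close>

lemma integrable_exp_two:
  fixes c a b :: real
  assumes "a > 0" "b > 0"
  shows "integrable lborel (\<lambda>x. exp (c * \<bar>x\<bar> - a * exp x - b * exp (-x)))"
proof -
  \<comment> \<open>Positive even if \<open>c\<close> is not, as the integrability of the one-sided
    kernel demands.\<close>
  define d where "d = \<bar>c\<bar> + 1"
  have d: "d > 0" "c \<le> d" by (auto simp: d_def)
  have 1: "integrable lborel (\<lambda>x. exp (d * x - a * exp x))" by (intro integrable_exp_one d assms)
  have "integrable lborel (\<lambda>x. exp (d * x - b * exp x))" by (intro integrable_exp_one d assms)
  from lborel_integrable_real_affine[OF this, of "-1" 0]
  have 2: "integrable lborel (\<lambda>x. exp (d * (-x) - b * exp (-x)))" by simp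
  show ?thesis
  proof (rule Bochner_Integration.integrable_bound[OF Bochner_Integration.integrable_add[OF 1 2]])
    show "(\<lambda>x. exp (c * \<bar>x\<bar> - a * exp x - b * exp (-x))) \<in> borel_measurable lborel"
      unfolding measurable_lborel2 by (intro borel_measurable_continuous_onI continuous_intros)
    show "AE x in lborel. norm (exp (c * \<bar>x\<bar> - a * exp x - b * exp (-x)))
        \<le> norm (exp (d * x - a * exp x) + exp (d * (-x) - b * exp (-x)))"
    proof (rule AE_I2)
      fix x :: real
      have nn: "a * exp x \<ge> 0" "b * exp (-x) \<ge> 0" using assms by auto
      have "c * \<bar>x\<bar> \<le> d * \<bar>x\<bar>" using d by (intro mult_right_mono) auto
      hence "c * \<bar>x\<bar> - a * exp x - b * exp (-x) \<le> (if x \<ge> 0 then d * x - a * exp x else d * (-x) - b * exp (-x))"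
        using nn by (smt (verit, best))
      hence "exp (c * \<bar>x\<bar> - a * exp x - b * exp (-x)) \<le> (if x \<ge> 0 then exp (d * x - a * exp x) else exp (d * (-x) - b * exp (-x)))"
        by (auto split: if_splits)
      hence "exp (c * \<bar>x\<bar> - a * exp x - b * exp (-x)) \<le> exp (d * x - a * exp x) + exp (d * (-x) - b * exp (-x))"
        by (smt (verit) exp_ge_zero)
      thus "norm (exp (c * \<bar>x\<bar> - a * exp x - b * exp (-x)))
        \<le> norm (exp (d * x - a * exp x) + exp (d * (-x) - b * exp (-x)))" by simp
    qed
  qed
qed

text \<open>Bounds a whole range of exponents by its two endpoints, hence uniformly in a
  parameter.\<close>

lemma exp_convex_bound:
  fixes u v w x :: real
  assumes "u \<le> v" "v \<le> w"
  shows "exp (v * x) \<le> exp (u * x) + exp (w * x)"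
proof (cases "x \<ge> 0")
  case True
  hence "exp (v * x) \<le> exp (w * x)" using assms by (simp add: mult_right_mono)
  thus ?thesis by (intro order_trans[OF _ add_increasing]) auto
next
  case False
  hence "exp (v * x) \<le> exp (u * x)" using assms by (simp add: mult_right_mono_neg)
  thus ?thesis by (intro order_trans[OF _ add_increasing2]) auto
qed

text \<open>For real \<eta> > 0 a translation by ln \<eta> normalises \<eta> to 1 and leaves Euler's
  integral; the half-plane Re \<eta> > 0 follows by the identity theorem. This is the Laplace
  representation of a complex power in logarithmic form.\<close>

lemma
  fixes \<mu> \<eta> :: complex
  assumes "Re \<mu> > 0" "Re \<eta> > 0"
  shows integrable_exp_Gamma: "integrable lborel (\<lambda>x. exp (\<mu> * of_real x - \<eta> * of_real (exp x)))"
    and integral_exp_Gamma: "(\<integral>x. exp (\<mu> * of_real x - \<eta> * of_real (exp x)) \<partial>lborel) = Gamma \<mu> * \<eta> powr (-\<mu>)"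
proof -
  define f where "f \<eta> x = exp (\<mu> * of_real x - \<eta> * of_real (exp x))" for \<eta> :: complex and x :: real
  define U where "U = {\<eta>. Re \<eta> > 0}"
  have U: "open U" "connected U" unfolding U_def
    by (auto intro: open_halfspace_Re_gt convex_connected convex_halfspace_Re_gt)
  have meas: "f \<eta> \<in> borel_measurable lborel" for \<eta>
    unfolding measurable_lborel2 f_def by (intro borel_measurable_continuous_onI continuous_intros)
  have hol: "(\<lambda>\<eta>. f \<eta> x) holomorphic_on U" for x unfolding f_def by (intro holomorphic_intros)
  have dom: "\<exists>r>0. \<exists>g. integrable lborel g \<and> (\<forall>\<eta>\<in>ball \<eta>0 r \<inter> U. \<forall>x\<in>space lborel. norm (f \<eta> x) \<le> g x)"
    if "\<eta>0 \<in> U" for \<eta>0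
  proof (intro exI conjI ballI)
    have p: "Re \<eta>0 > 0" using that by (simp add: U_def)
    thus "Re \<eta>0 / 2 > 0" by simp
    show "integrable lborel (\<lambda>x. exp (Re \<mu> * x - Re \<eta>0 / 2 * exp x))"
      using p assms by (intro integrable_exp_one) auto
    fix \<eta> x assume "\<eta> \<in> ball \<eta>0 (Re \<eta>0 / 2) \<inter> U"
    hence "Re \<eta> \<ge> Re \<eta>0 / 2" using abs_Re_le_cmod[of "\<eta>0 - \<eta>"] by (auto simp: dist_norm)
    thus "norm (f \<eta> x) \<le> exp (Re \<mu> * x - Re \<eta>0 / 2 * exp x)"
      by (simp add: f_def)
  qed
  note H = U(1) meas hol dom
  show "integrable lborel (\<lambda>x. exp (\<mu> * of_real x - \<eta> * of_real (exp x)))"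
    using integrable_param_integral[OF H, of "\<eta>"] assms by (simp add: f_def U_def)
  have "(\<integral>x. f \<eta> x \<partial>lborel) = Gamma \<mu> * \<eta> powr (-\<mu>)"
  proof (rule holomorphic_eqI_on_reals[of "\<lambda>\<eta>. \<integral>x. f \<eta> x \<partial>lborel" U "\<lambda>\<eta>. Gamma \<mu> * \<eta> powr (-\<mu>)" 0 1 \<eta>])
    show "(\<lambda>\<eta>. \<integral>x. f \<eta> x \<partial>lborel) holomorphic_on U" by (rule holomorphic_param_integral[OF H])
    show "(\<lambda>\<eta>. Gamma \<mu> * \<eta> powr (-\<mu>)) holomorphic_on U"
      by (intro holomorphic_intros) (auto simp: U_def complex_nonpos_Reals_iff)
    fix y :: real assume y: "0 < y"
    have "(\<integral>x. f (of_real y) x \<partial>lborel) = (\<integral>x. f (of_real y) (- ln y + 1 * x) \<partial>lborel)"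
      by (subst lborel_integral_real_affine[of 1 _ "- ln y"]) auto
    also have "\<dots> = (\<integral>x. of_real y powr (-\<mu>) * exp (\<mu> * of_real x - of_real (exp x)) \<partial>lborel)"
    proof (rule Bochner_Integration.integral_cong)
      fix x :: real
      have "y * exp (x - ln y) = exp x" using y by (simp add: exp_diff)
      hence e: "of_real y * of_real (exp (x - ln y)) = complex_of_real (exp x)" by (metis of_real_mult)
      have "of_real y powr (-\<mu>) = exp (- \<mu> * of_real (ln y))" using y by (simp add: powr_def Ln_of_real)
      thus "f (of_real y) (- ln y + 1 * x) = of_real y powr (-\<mu>) * exp (\<mu> * of_real x - of_real (exp x))"
        using e by (simp add: f_def algebra_simps flip: exp_add)
    qed auto
    also have "\<dots> = of_real y powr (-\<mu>) * Gamma \<mu>"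
      using exp_integral_one[OF assms(1), of 1] by simp
    finally show "of_real y \<in> U \<and> (\<integral>x. f (of_real y) x \<partial>lborel) = Gamma \<mu> * of_real y powr (-\<mu>)"
      using y by (simp add: U_def)
  qed (use U assms in \<open>auto simp: U_def\<close>)
  thus "(\<integral>x. exp (\<mu> * of_real x - \<eta> * of_real (exp x)) \<partial>lborel) = Gamma \<mu> * \<eta> powr (-\<mu>)"
    by (simp add: f_def)
qed

subsection \<open>Bessel functions\<close>

text \<open>The substitution \<open>r = e\<^sup>x\<close> turns \<open>\<integral>\<^sub>0\<^sup>\<infinity> r\<^bsup>\<nu>-1\<^esup> e\<^bsup>-Ar-B/r\<^esup> dr\<close> into the integral below.\<close>

definition Kint :: "complex \<Rightarrow> complex \<Rightarrow> complex \<Rightarrow> complex" where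
  "Kint \<nu> A B = (\<integral>x. exp (\<nu> * of_real x - A * of_real (exp x) - B * of_real (exp (-x))) \<partial>lborel)"

lemma Kint_kernel_measurable:
  "(\<lambda>x. exp (\<nu> * of_real x - A * of_real (exp x) - B * of_real (exp (-x)))) \<in> borel_measurable lborel"
  for \<nu> A B :: complex
  unfolding measurable_lborel2 by (intro borel_measurable_continuous_onI continuous_intros)

lemma Kint_kernel_bound:
  assumes "\<bar>Re \<nu>\<bar> \<le> c" "a \<le> Re A" "b \<le> Re B"
  shows "norm (exp (\<nu> * of_real x - A * of_real (exp x) - B * of_real (exp (-x))))
    \<le> exp (c * \<bar>x\<bar> - a * exp x - b * exp (-x))"
proof -
  have "Re \<nu> * x \<le> \<bar>Re \<nu>\<bar> * \<bar>x\<bar>" by (metis abs_ge_self abs_mult)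
  also have "\<dots> \<le> c * \<bar>x\<bar>" using assms by (intro mult_right_mono) auto
  finally have "Re \<nu> * x \<le> c * \<bar>x\<bar>" .
  moreover have "a * exp x \<le> Re A * exp x" "b * exp (-x) \<le> Re B * exp (-x)" using assms by auto
  ultimately have "Re \<nu> * x - Re A * exp x - Re B * exp (-x) \<le> c * \<bar>x\<bar> - a * exp x - b * exp (-x)" by linarith
  thus ?thesis by (simp del: of_real_exp)
qed

lemma Kint_sym: "Kint \<nu> A B = Kint (-\<nu>) B A"
  unfolding Kint_def by (subst lborel_integral_real_affine[of "-1" _ 0]) (auto simp: algebra_simps)

context
  fixes A B :: complex
  assumes A: "Re A > 0" and B: "Re B > 0"
begin

lemma Kint_integrable:
  "integrable lborel (\<lambda>x. exp (\<nu> * of_real x - A * of_real (exp x) - B * of_real (exp (-x))))"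
  by (rule Bochner_Integration.integrable_bound[OF integrable_exp_two[OF A B, of "\<bar>Re \<nu>\<bar>"] Kint_kernel_measurable])
     (use Kint_kernel_bound[of \<nu> "\<bar>Re \<nu>\<bar>" "Re A" A "Re B" B] in auto)

lemma Kint_holomorphic: "(\<lambda>\<nu>. Kint \<nu> A B) holomorphic_on UNIV"
  unfolding Kint_def
proof (rule holomorphic_param_integral)
  fix \<nu>0 :: complex
  show "\<exists>r>0. \<exists>g. integrable lborel g \<and> (\<forall>\<nu>\<in>ball \<nu>0 r \<inter> UNIV. \<forall>x\<in>space lborel.
    norm (exp (\<nu> * of_real x - A * of_real (exp x) - B * of_real (exp (-x)))) \<le> g x)"
  proof (intro exI conjI ballI)
    show "integrable lborel (\<lambda>x. exp ((\<bar>Re \<nu>0\<bar> + 1) * \<bar>x\<bar> - Re A * exp x - Re B * exp (-x)))"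
      by (rule integrable_exp_two[OF A B])
    fix \<nu> x assume "\<nu> \<in> ball \<nu>0 1 \<inter> UNIV"
    hence "\<bar>Re \<nu>\<bar> \<le> \<bar>Re \<nu>0\<bar> + 1" using abs_Re_le_cmod[of "\<nu>0 - \<nu>"] by (auto simp: dist_norm)
    thus "norm (exp (\<nu> * of_real x - A * of_real (exp x) - B * of_real (exp (-x))))
      \<le> exp ((\<bar>Re \<nu>0\<bar> + 1) * \<bar>x\<bar> - Re A * exp x - Re B * exp (-x))"
      by (intro Kint_kernel_bound) auto
  qed auto
qed (auto intro!: holomorphic_intros Kint_kernel_measurable)

lemma Kint_deriv_A: "((\<lambda>A. Kint \<nu> A B) has_field_derivative - Kint (\<nu> + 1) A B) (at A)"
proof -
  define f where "f A x = exp (\<nu> * of_real x - A * of_real (exp x) - B * of_real (exp (-x)))" for A :: complex and x :: real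
  have dom: "\<exists>r>0. \<exists>g. integrable lborel g \<and> (\<forall>A\<in>ball A0 r \<inter> {A. Re A > 0}. \<forall>x\<in>space lborel. norm (f A x) \<le> g x)"
    if "A0 \<in> {A. Re A > 0}" for A0
  proof (intro exI conjI ballI)
    show p: "Re A0 / 2 > 0" using that by simp
    show "integrable lborel (\<lambda>x. exp (\<bar>Re \<nu>\<bar> * \<bar>x\<bar> - (Re A0 / 2) * exp x - Re B * exp (-x)))"
      by (rule integrable_exp_two[OF p B])
    fix A x assume "A \<in> ball A0 (Re A0 / 2) \<inter> {A. Re A > 0}"
    hence "Re A0 / 2 \<le> Re A" using abs_Re_le_cmod[of "A0 - A"] by (auto simp: dist_norm)
    thus "norm (f A x) \<le> exp (\<bar>Re \<nu>\<bar> * \<bar>x\<bar> - (Re A0 / 2) * exp x - Re B * exp (-x))"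
      unfolding f_def by (intro Kint_kernel_bound) auto
  qed
  have "((\<lambda>A. \<integral>x. f A x \<partial>lborel) has_field_derivative (\<integral>x. deriv (\<lambda>A. f A x) A \<partial>lborel)) (at A)"
    by (rule has_field_derivative_param_integral[OF open_halfspace_Re_gt _ _ dom])
       (use A in \<open>auto simp: f_def intro!: holomorphic_intros Kint_kernel_measurable\<close>)
  moreover have "deriv (\<lambda>A. f A x) A = - exp ((\<nu> + 1) * of_real x - A * of_real (exp x) - B * of_real (exp (-x)))" for x
  proof (rule DERIV_imp_deriv)
    have "exp ((\<nu> + 1) * of_real x - A * of_real (exp x) - B * of_real (exp (-x))) = of_real (exp x) * f A x"
      unfolding f_def of_real_exp by (simp add: algebra_simps flip: exp_add)
    thus "((\<lambda>A. f A x) has_field_derivative - exp ((\<nu> + 1) * of_real x - A * of_real (exp x) - B * of_real (exp (-x)))) (at A)"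
      unfolding f_def by (auto intro!: derivative_eq_intros)
  qed
  ultimately show ?thesis by (simp add: Kint_def f_def)
qed

end

lemma Kint_deriv_B:
  assumes "Re A > 0" "Re B > 0"
  shows "((\<lambda>B. Kint \<nu> A B) has_field_derivative - Kint (\<nu> - 1) A B) (at B)"
proof -
  have "(\<lambda>B. Kint \<nu> A B) = (\<lambda>B. Kint (-\<nu>) B A)" using Kint_sym by blast
  moreover have "Kint (\<nu> - 1) A B = Kint (-\<nu> + 1) B A" by (subst Kint_sym) simp
  ultimately show ?thesis using Kint_deriv_A[OF assms(2,1), of "-\<nu>"] by simp
qed

text \<open>The left side is the integral over the line of the derivative of the integrand of
  \<open>Kint \<nu> A B\<close>, which tends to 0 at both ends. It is the three-term recurrence of
  the modified Bessel function K.\<close>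

lemma Kint_rec:
  assumes A: "Re A > 0" and B: "Re B > 0"
  shows "\<nu> * Kint \<nu> A B - A * Kint (\<nu> + 1) A B + B * Kint (\<nu> - 1) A B = 0"
proof -
  define f where "f \<nu> x = exp (\<nu> * of_real x - A * of_real (exp x) - B * of_real (exp (-x)))" for \<nu> :: complex and x :: real
  define f' where "f' x = \<nu> * f \<nu> x - A * f (\<nu> + 1) x + B * f (\<nu> - 1) x" for x
  have i: "integrable lborel (f \<nu>)" for \<nu> unfolding f_def by (rule Kint_integrable[OF A B])
  have f1: "f (\<nu> + 1) x = exp (of_real x) * f \<nu> x" "f (\<nu> - 1) x = exp (- of_real x) * f \<nu> x" for x
    unfolding f_def by (simp_all add: algebra_simps flip: exp_add)
  have der: "(f \<nu> has_vector_derivative f' x) (at x)" for x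
  proof -
    have "((\<lambda>z. exp (\<nu> * z - A * exp z - B * exp (-z))) has_field_derivative
      (\<nu> - A * exp (of_real x) + B * exp (- of_real x)) * f \<nu> x) (at (of_real x))"
      unfolding f_def of_real_exp of_real_minus by (auto intro!: derivative_eq_intros simp: algebra_simps)
    from has_vector_derivative_real_field[OF this, of UNIV]
    have "((\<lambda>x. exp (\<nu> * of_real x - A * exp (of_real x) - B * exp (- of_real x))) has_vector_derivative
      (\<nu> - A * exp (of_real x) + B * exp (- of_real x)) * f \<nu> x) (at x)" .
    moreover have "(\<lambda>x. exp (\<nu> * of_real x - A * exp (of_real x) - B * exp (- of_real x))) = f \<nu>"
      by (simp add: f_def of_real_exp fun_eq_iff)
    moreover have "(\<nu> - A * exp (of_real x) + B * exp (- of_real x)) * f \<nu> x = f' x"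
      by (simp only: f'_def f1) (simp add: algebra_simps)
    ultimately show ?thesis by simp
  qed
  define c where "c = \<bar>Re \<nu>\<bar> + 1"
  have "c > 0" by (simp add: c_def)
  have lim_real: "((\<lambda>x. exp (c * x - a * exp x)) \<longlongrightarrow> 0) at_top" if "a > 0" for a :: real
    using \<open>c > 0\<close> that by real_asymp
  have bd: "norm (f \<nu> x) \<le> exp (c * x - Re A * exp x)" if "x \<ge> 0" for x
  proof -
    have "norm (f \<nu> x) \<le> exp (c * \<bar>x\<bar> - Re A * exp x - Re B * exp (-x))" unfolding f_def
      by (rule Kint_kernel_bound) (auto simp: c_def)
    also have "\<dots> \<le> exp (c * x - Re A * exp x)" using B that by simp
    finally show ?thesis .
  qed
  have bd': "norm (f \<nu> (-x)) \<le> exp (c * x - Re B * exp x)" if "x \<ge> 0" for x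
  proof -
    have "norm (f \<nu> (-x)) \<le> exp (c * \<bar>-x\<bar> - Re A * exp (-x) - Re B * exp (-(-x)))" unfolding f_def
      by (rule Kint_kernel_bound) (auto simp: c_def)
    also have "\<dots> \<le> exp (c * x - Re B * exp x)" using A that by simp
    finally show ?thesis .
  qed
  have lim_top: "(f \<nu> \<longlongrightarrow> 0) at_top"
    by (rule Lim_null_comparison[OF _ lim_real[OF A]]) (rule eventually_mono[OF eventually_ge_at_top[of 0] bd])
  have "((\<lambda>x. f \<nu> (-x)) \<longlongrightarrow> 0) at_top"
    by (rule Lim_null_comparison[OF _ lim_real[OF B]]) (rule eventually_mono[OF eventually_ge_at_top[of 0] bd'])
  hence lim_bot: "(f \<nu> \<longlongrightarrow> 0) at_bot" by (simp add: filterlim_at_bot_mirror)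
  have int: "integrable lborel f'" unfolding f'_def using i by auto
  have "(LBINT x=-\<infinity>..\<infinity>. f' x) = 0 - 0"
  proof (rule interval_integral_FTC_integrable)
    show "isCont f' x" for x unfolding f'_def f_def by (intro continuous_intros)
    show "set_integrable lborel (einterval (-\<infinity>) \<infinity>) f'" using int by (simp add: set_integrable_def)
    show "((f \<nu> \<circ> real_of_ereal) \<longlongrightarrow> 0) (at_right (-\<infinity>))" using lim_bot by (simp add: ereal_tendsto_simps)
    show "((f \<nu> \<circ> real_of_ereal) \<longlongrightarrow> 0) (at_left \<infinity>)" using lim_top by (simp add: ereal_tendsto_simps)
  qed (use der in auto)
  hence "(\<integral>x. f' x \<partial>lborel) = 0" by (simp add: interval_lebesgue_integral_def set_lebesgue_integral_def)
  hence "\<nu> * (\<integral>x. f \<nu> x \<partial>lborel) - A * (\<integral>x. f (\<nu> + 1) x \<partial>lborel) + B * (\<integral>x. f (\<nu> - 1) x \<partial>lborel) = 0"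
    unfolding f'_def using i by simp
  thus ?thesis unfolding Kint_def f_def .
qed

section \<open>The entire Bessel-Clifford series \<open>bser\<close> and its connection with
  \<open>Kint\<close>\<close>

definition bser :: "complex \<Rightarrow> complex \<Rightarrow> complex" where
  "bser \<nu> X = (\<Sum>n. rGamma (\<nu> + of_nat n + 1) / fact n * X ^ n)"

text \<open>The functional equation divides the bound by |\<nu> + n + 1| at each step. Once n >= 2R
  this is at least (n + 1)/2, which produces the factor 2^n / n!; the finitely many earlier n are
  absorbed into the constant by compactness.\<close>

lemma rGamma_shift_bound:
  assumes "compact S"
  obtains C where "C \<ge> 0" "\<And>\<nu> n. \<nu> \<in> S \<Longrightarrow> norm (rGamma (\<nu> + of_nat n + 1 :: complex)) \<le> C * 2 ^ n / fact n"
proof -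
  obtain R where R: "\<And>\<nu>. \<nu> \<in> S \<Longrightarrow> norm \<nu> \<le> R" using compact_imp_bounded[OF assms] by (auto simp: bounded_iff)
  obtain N :: nat where N: "real N \<ge> 2 * R" using real_arch_simple by blast
  have "\<exists>M\<ge>0. \<forall>\<nu>\<in>S. norm (rGamma (\<nu> + of_nat n + 1)) \<le> M" for n
  proof -
    have "compact ((\<lambda>\<nu>. rGamma (\<nu> + of_nat n + 1)) ` S)"
      by (intro compact_continuous_image assms holomorphic_on_imp_continuous_on holomorphic_intros)
    from compact_imp_bounded[OF this] obtain M where "\<forall>\<nu>\<in>S. norm (rGamma (\<nu> + of_nat n + 1)) \<le> M"
      unfolding bounded_iff by auto
    thus ?thesis by (intro exI[of _ "max M 0"]) auto
  qed
  then obtain M where M: "\<And>n. M n \<ge> 0" "\<And>n \<nu>. \<nu> \<in> S \<Longrightarrow> norm (rGamma (\<nu> + of_nat n + 1)) \<le> M n" by metis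
  define C where "C = (\<Sum>n\<le>N. M n * fact n)"
  have C: "C \<ge> 0" unfolding C_def using M by (intro sum_nonneg) auto
  have "norm (rGamma (\<nu> + of_nat n + 1)) \<le> C * 2 ^ n / fact n" if \<nu>: "\<nu> \<in> S" for \<nu> n
  proof (induction n)
    case 0
    have "M 0 * fact 0 \<le> C" unfolding C_def using M by (intro member_le_sum) auto
    thus ?case using M(2)[OF \<nu>, of 0] by simp
  next
    case (Suc n)
    show ?case
    proof (cases "Suc n \<le> N")
      case True
      have "M (Suc n) * fact (Suc n) \<le> C" unfolding C_def using M True by (intro member_le_sum) auto
      hence "M (Suc n) \<le> C / fact (Suc n)" by (simp add: pos_le_divide_eq del: fact_Suc)
      also have "\<dots> \<le> C * 2 ^ Suc n / fact (Suc n)"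
        using mult_left_mono[OF one_le_power[of 2 "Suc n"] C] by (intro divide_right_mono) auto
      finally show ?thesis using M(2)[OF \<nu>, of "Suc n"] by linarith
    next
      case False
      have "norm (\<nu> + of_nat n + 1) \<ge> real n + 1 - R"
        using norm_triangle_ineq4[of "\<nu> + of_nat n + 1" \<nu>] R[OF \<nu>] norm_of_nat[of "Suc n", where ?'a = complex]
        by (simp add: add_ac)
      hence ge: "norm (\<nu> + of_nat n + 1) \<ge> (real n + 1) / 2" using N False by simp
      hence nz: "\<nu> + of_nat n + 1 \<noteq> 0" by auto
      have "rGamma (\<nu> + of_nat n + 1) = (\<nu> + of_nat n + 1) * rGamma (\<nu> + of_nat (Suc n) + 1)"
        using rGamma_plus1[of "\<nu> + of_nat n + 1"] by (simp add: add_ac)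
      hence "norm (rGamma (\<nu> + of_nat (Suc n) + 1)) = norm (rGamma (\<nu> + of_nat n + 1)) / norm (\<nu> + of_nat n + 1)"
        using nz by (simp add: norm_mult)
      also have "\<dots> \<le> (C * 2 ^ n / fact n) / ((real n + 1) / 2)"
        using ge C Suc by (intro frac_le) auto
      also have "\<dots> = C * 2 ^ Suc n / fact (Suc n)" by (simp add: field_simps)
      finally show ?thesis .
    qed
  qed
  with C show ?thesis using that by blast
qed

lemma bser_term_bound:
  assumes "compact S"
  obtains C where "C \<ge> 0"
    "\<And>\<nu> X n. \<nu> \<in> S \<Longrightarrow> norm (rGamma (\<nu> + of_nat n + 1 :: complex) / fact n * X ^ n) \<le> C * ((2 * norm X) ^ n / fact n)"
proof -
  obtain C where C: "C \<ge> 0" "\<And>\<nu> n. \<nu> \<in> S \<Longrightarrow> norm (rGamma (\<nu> + of_nat n + 1 :: complex)) \<le> C * 2 ^ n / fact n"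
    using rGamma_shift_bound[OF assms] by blast
  have "norm (rGamma (\<nu> + of_nat n + 1 :: complex) / fact n * X ^ n) \<le> C * ((2 * norm X) ^ n / fact n)"
    if "\<nu> \<in> S" for \<nu> X n
  proof -
    have "norm (rGamma (\<nu> + of_nat n + 1 :: complex) / fact n * X ^ n)
      = norm (rGamma (\<nu> + of_nat n + 1)) / fact n * norm X ^ n"
      by (simp add: norm_mult norm_divide norm_power)
    also have "\<dots> \<le> norm (rGamma (\<nu> + of_nat n + 1)) / 1 * norm X ^ n"
      by (intro mult_right_mono divide_left_mono) auto
    also have "\<dots> \<le> (C * 2 ^ n / fact n) * norm X ^ n"
      using C(2)[OF that, of n] by (intro mult_right_mono) auto
    finally show ?thesis by (simp add: power_mult_distrib)
  qed
  with C(1) show ?thesis using that by blast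
qed

lemma summable_exp_series: "summable (\<lambda>n. (x::real) ^ n / fact n)"
  using summable_exp[of x] by (simp add: field_simps)

lemma bser_summable_norm: "summable (\<lambda>n. norm (rGamma (\<nu> + of_nat n + 1) / fact n * X ^ n))"
  for \<nu> X :: complex
proof -
  obtain C where C: "\<And>\<mu> X n. \<mu> \<in> {\<nu>} \<Longrightarrow> norm (rGamma (\<mu> + of_nat n + 1 :: complex) / fact n * X ^ n) \<le> C * ((2 * norm X) ^ n / fact n)"
    using bser_term_bound[of "{\<nu>}"] by (metis compact_sing)
  show ?thesis
    by (rule summable_comparison_test[OF _ summable_mult[OF summable_exp_series, of C "2 * norm X"]])
       (use C[of \<nu>] in auto)
qed

lemma bser_summable: "summable (\<lambda>n. rGamma (\<nu> + of_nat n + 1) / fact n * X ^ n)"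
  for \<nu> X :: complex
  by (rule summable_norm_cancel[OF bser_summable_norm])

lemma bser_bound:
  assumes "compact S"
  obtains C where "C \<ge> 0" "\<And>\<nu> X. \<nu> \<in> S \<Longrightarrow> norm (bser \<nu> X) \<le> C * exp (2 * norm X)"
proof -
  obtain C where C: "C \<ge> 0" "\<And>\<mu> X n. \<mu> \<in> S \<Longrightarrow> norm (rGamma (\<mu> + of_nat n + 1 :: complex) / fact n * X ^ n) \<le> C * ((2 * norm X) ^ n / fact n)"
    using bser_term_bound[OF assms] by metis
  have "norm (bser \<nu> X) \<le> C * exp (2 * norm X)" if "\<nu> \<in> S" for \<nu> X
  proof -
    have "norm (bser \<nu> X) \<le> (\<Sum>n. C * ((2 * norm X) ^ n / fact n))" unfolding bser_def
      by (intro norm_suminf_le summable_mult summable_exp_series C that)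
    also have "\<dots> = C * exp (2 * norm X)"
      unfolding exp_def by (subst suminf_mult[OF summable_exp_series]) (simp add: scaleR_conv_of_real field_simps)
    finally show ?thesis .
  qed
  with C(1) that show ?thesis by blast
qed

lemma bser_0 [simp]: "bser \<nu> 0 = rGamma (\<nu> + 1)"
  unfolding bser_def by (subst suminf_finite[of "{0}"]) auto

lemma bser_deriv: "(bser \<nu> has_field_derivative bser (\<nu> + 1) X) (at X)"
proof -
  define c where "c n = rGamma (\<nu> + of_nat n + 1) / fact n" for n
  have "((\<lambda>X. \<Sum>n. c n * X ^ n) has_field_derivative (\<Sum>n. diffs c n * X ^ n)) (at X)"
    by (rule termdiffs_strong_converges_everywhere) (use bser_summable[of \<nu>] in \<open>simp add: c_def\<close>)
  moreover have "diffs c n = rGamma (\<nu> + 1 + of_nat n + 1) / fact n" for n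
    unfolding diffs_def c_def by (simp add: add_ac divide_simps del: of_nat_Suc) (simp add: algebra_simps)
  ultimately show ?thesis by (simp add: bser_def[abs_def] c_def)
qed

lemma bser_holomorphic [holomorphic_intros]: "bser \<nu> holomorphic_on S"
  using bser_deriv by (meson holomorphic_onI field_differentiable_def field_differentiable_at_within)

lemma bser_holomorphic' [holomorphic_intros]:
  "f holomorphic_on S \<Longrightarrow> (\<lambda>z. bser \<nu> (f z)) holomorphic_on S"
  using holomorphic_on_compose[OF _ bser_holomorphic, of f S \<nu>] by (simp add: o_def)

lemma bser_continuous [continuous_intros]: "continuous_on S f \<Longrightarrow> continuous_on S (\<lambda>x. bser \<nu> (f x))"
  using continuous_on_compose2[OF holomorphic_on_imp_continuous_on[OF bser_holomorphic[of \<nu> UNIV]], of S f] by simp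

text \<open>Together with \<open>bser_deriv\<close> this is the Bessel equation: b =
  \<open>bser \<nu>\<close> satisfies X b'' + (\<nu> + 1) b' = b. It comes from comparing
  coefficients, since (\<nu> + n) / Gamma (\<nu> + n + 1) = 1 / Gamma (\<nu> + n).\<close>

lemma bser_rec: "bser (\<nu> - 1) X = \<nu> * bser \<nu> X + X * bser (\<nu> + 1) X"
proof -
  define c where "c n = rGamma (\<nu> + of_nat n + 1) / fact n" for n
  have s: "(\<lambda>n. c n * X ^ n) sums bser \<nu> X"
    using summable_sums[OF bser_summable[of \<nu> X]] by (simp add: c_def bser_def)
  have d: "diffs c n = rGamma (\<nu> + 1 + of_nat n + 1) / fact n" for n
    unfolding diffs_def c_def by (simp add: add_ac divide_simps del: of_nat_Suc) (simp add: algebra_simps)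
  have "(\<lambda>n. diffs c n * X ^ n) sums bser (\<nu> + 1) X"
    using summable_sums[OF bser_summable[of "\<nu> + 1" X]] by (simp add: d bser_def)
  hence "(\<lambda>n. X * (diffs c n * X ^ n)) sums (X * bser (\<nu> + 1) X)" by (rule sums_mult)
  hence "(\<lambda>n. of_nat (Suc n) * c (Suc n) * X ^ Suc n) sums (X * bser (\<nu> + 1) X)"
    by (simp add: diffs_def mult_ac)
  hence "(\<lambda>n. of_nat n * c n * X ^ n) sums (X * bser (\<nu> + 1) X)"
    by (subst (asm) sums_Suc_iff) simp
  from sums_add[OF sums_mult[OF s, of \<nu>] this]
  have "(\<lambda>n. (\<nu> + of_nat n) * c n * X ^ n) sums (\<nu> * bser \<nu> X + X * bser (\<nu> + 1) X)"
    by (simp add: algebra_simps)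
  moreover have "(\<nu> + of_nat n) * c n = rGamma (\<nu> - 1 + of_nat n + 1) / fact n" for n
    using rGamma_plus1[of "\<nu> + of_nat n"] by (simp add: c_def)
  ultimately show ?thesis by (simp add: bser_def sums_iff)
qed

text \<open>A series is an integral over the counting measure, so the holomorphy of parameter
  integrals applies; the domination is the locally uniform bound on the coefficients.\<close>

lemma bser_holomorphic_order: "(\<lambda>\<nu>. bser \<nu> X) holomorphic_on UNIV"
proof -
  define f where "f \<nu> n = rGamma (\<nu> + of_nat n + 1) / fact n * X ^ n" for \<nu> :: complex and n :: nat
  have "bser \<nu> X = (\<integral>n. f \<nu> n \<partial>count_space UNIV)" for \<nu>
    unfolding bser_def f_def using bser_summable_norm
    by (subst integral_count_space_nat) (auto simp: integrable_count_space_nat_iff)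
  moreover have "(\<lambda>\<nu>. \<integral>n. f \<nu> n \<partial>count_space UNIV) holomorphic_on UNIV"
  proof (rule holomorphic_param_integral)
    fix \<nu>0 :: complex
    obtain C where C: "C \<ge> 0" "\<And>\<mu> X n. \<mu> \<in> cball \<nu>0 1 \<Longrightarrow> norm (rGamma (\<mu> + of_nat n + 1 :: complex) / fact n * X ^ n) \<le> C * ((2 * norm X) ^ n / fact n)"
      using bser_term_bound[of "cball \<nu>0 1"] by (metis compact_cball)
    show "\<exists>r>0. \<exists>g. integrable (count_space UNIV) g \<and> (\<forall>\<nu>\<in>ball \<nu>0 r \<inter> UNIV. \<forall>n\<in>space (count_space UNIV). norm (f \<nu> n) \<le> g n)"
    proof (intro exI conjI ballI)
      show "integrable (count_space UNIV) (\<lambda>n. C * ((2 * norm X) ^ n / fact n))"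
        using C(1) summable_mult[OF summable_exp_series, of C "2 * norm X"] by (simp add: integrable_count_space_nat_iff abs_mult)
      show "(1::real) > 0" by simp
      fix \<nu> n assume "\<nu> \<in> ball \<nu>0 1 \<inter> UNIV"
      thus "norm (f \<nu> n) \<le> C * ((2 * norm X) ^ n / fact n)" using C(2)[of \<nu> n X] by (simp add: f_def)
    qed
  qed (auto simp: f_def intro!: holomorphic_intros)
  ultimately show ?thesis by simp
qed

text \<open>The recurrence makes the derivative in X vanish, and the reflection formula evaluates
  the constant at X = 0.\<close>

lemma bser_wronskian:
  "bser s X * bser (-s - 1) X - X * bser (s + 1) X * bser (-s) X = - sin (of_real pi * s) / of_real pi"
proof -
  define f where "f X = bser s X * bser (-s - 1) X - X * bser (s + 1) X * bser (-s) X" for X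
  have "(f has_field_derivative 0) (at X within UNIV)" for X
  proof -
    have "(f has_field_derivative (bser (s + 1) X * bser (-s - 1) X + bser s X * bser (-s - 1 + 1) X -
       ((1 * bser (s + 1) X + X * bser (s + 1 + 1) X) * bser (-s) X + X * bser (s + 1) X * bser (-s + 1) X))) (at X)"
      unfolding f_def by (rule derivative_eq_intros bser_deriv refl)+ (simp add: algebra_simps)
    moreover have "bser s X = (s + 1) * bser (s + 1) X + X * bser (s + 1 + 1) X" using bser_rec[of "s + 1" X] by simp
    moreover have "bser (-s - 1) X = (-s) * bser (-s) X + X * bser (-s + 1) X" using bser_rec[of "-s" X] by simp
    ultimately show ?thesis by (simp add: algebra_simps)
  qed
  hence "f X = f 0" using has_field_derivative_zero_constant[of UNIV f] by (metis UNIV_I convex_UNIV)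
  also have "f 0 = - sin (of_real pi * s) / of_real pi"
    using rGamma_reflection_complex[of "-s"] by (simp add: f_def mult.commute add.commute)
  finally show ?thesis by (simp add: f_def)
qed

lemma Re_pos_not_nonpos_Ints: "Re z > 0 \<Longrightarrow> z \<notin> \<int>\<^sub>\<le>\<^sub>0"
  by (auto elim!: nonpos_Ints_cases)

text \<open>Translation by ln y moves the factor y from one exponential to the other.\<close>

lemma Kint_scale:
  assumes "y > 0"
  shows "Kint \<nu> A (B * of_real y) = of_real y powr \<nu> * Kint \<nu> (A * of_real y) B"
proof -
  have "Kint \<nu> A (B * of_real y) = (\<integral>x. exp (\<nu> * of_real (ln y + 1 * x) - A * of_real (exp (ln y + 1 * x)) - (B * of_real y) * of_real (exp (-(ln y + 1 * x)))) \<partial>lborel)"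
    unfolding Kint_def by (subst lborel_integral_real_affine[of 1 _ "ln y"]) auto
  also have "\<dots> = (\<integral>x. of_real y powr \<nu> * exp (\<nu> * of_real x - (A * of_real y) * of_real (exp x) - B * of_real (exp (-x))) \<partial>lborel)"
  proof (rule Bochner_Integration.integral_cong)
    fix x :: real
    have 1: "exp (ln y + 1 * x) = y * exp x" using assms by (simp add: exp_add)
    have 2: "y * exp (-(ln y + 1 * x)) = exp (-x)" using assms by (simp add: exp_diff exp_minus field_simps)
    have 3: "(B * of_real y) * of_real (exp (-(ln y + 1 * x))) = B * of_real (exp (-x))" unfolding 2[symmetric] by simp
    have 4: "of_real y powr \<nu> = exp (\<nu> * of_real (ln y))" using assms by (simp add: powr_def Ln_of_real)
    show "exp (\<nu> * of_real (ln y + 1 * x) - A * of_real (exp (ln y + 1 * x)) - (B * of_real y) * of_real (exp (-(ln y + 1 * x))))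
      = of_real y powr \<nu> * exp (\<nu> * of_real x - (A * of_real y) * of_real (exp x) - B * of_real (exp (-x)))"
      unfolding 3 1 4 exp_add[symmetric] by (simp add: algebra_simps)
  qed auto
  finally show ?thesis unfolding Kint_def by simp
qed

text \<open>Supplies the constant in the Wronskian relation between \<open>Kint\<close> and
  \<open>bser\<close>: the second exponential disappears in the limit and Euler's integral
  remains.\<close>

lemma Kint_tendsto_Gamma:
  assumes "Re \<nu> > 0" "Re A \<ge> 0"
  shows "((\<lambda>y. Kint \<nu> 1 (A * of_real y)) \<longlongrightarrow> Gamma \<nu>) (at_right 0)"
proof -
  have "((\<lambda>y. \<integral>x. exp (\<nu> * of_real x - 1 * of_real (exp x) - A * of_real y * of_real (exp (-x))) \<partial>lborel)
    \<longlongrightarrow> (\<integral>x. exp (\<nu> * of_real x - 1 * of_real (exp x)) \<partial>lborel)) (at_right 0)"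
    unfolding tendsto_at_iff_sequentially o_def
  proof (intro allI impI, rule integral_dominated_convergence)
    fix Y assume Y: "\<forall>i. Y i \<in> {0::real<..} - {0}" "Y \<longlonglongrightarrow> 0"
    show "integrable lborel (\<lambda>x. exp (Re \<nu> * x - 1 * exp x))" using assms by (intro integrable_exp_one) auto
    show "AE x in lborel. (\<lambda>i. exp (\<nu> * of_real x - 1 * of_real (exp x) - A * of_real (Y i) * of_real (exp (-x))))
      \<longlonglongrightarrow> exp (\<nu> * of_real x - 1 * of_real (exp x))"
    proof (rule AE_I2)
      fix x :: real
      have "(\<lambda>i. exp (\<nu> * of_real x - 1 * of_real (exp x) - A * of_real (Y i) * of_real (exp (-x))))
        \<longlonglongrightarrow> exp (\<nu> * of_real x - 1 * of_real (exp x) - A * of_real 0 * of_real (exp (-x)))"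
        by (intro tendsto_intros Y)
      thus "(\<lambda>i. exp (\<nu> * of_real x - 1 * of_real (exp x) - A * of_real (Y i) * of_real (exp (-x))))
        \<longlonglongrightarrow> exp (\<nu> * of_real x - 1 * of_real (exp x))" by simp
    qed
    show "AE x in lborel. norm (exp (\<nu> * of_real x - 1 * of_real (exp x) - A * of_real (Y i) * of_real (exp (-x))))
      \<le> exp (Re \<nu> * x - 1 * exp x)" for i
    proof (rule AE_I2)
      fix x
      have "Re A * Y i * exp (-x) \<ge> 0" using Y(1) assms by (simp add: less_imp_le)
      thus "norm (exp (\<nu> * of_real x - 1 * of_real (exp x) - A * of_real (Y i) * of_real (exp (-x))))
      \<le> exp (Re \<nu> * x - 1 * exp x)" by (simp del: of_real_exp)
    qed
    show "(\<lambda>x. exp (\<nu> * of_real x - 1 * of_real (exp x) - A * of_real (Y i) * of_real (exp (-x)))) \<in> borel_measurable lborel" for i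
      by (rule Kint_kernel_measurable)
    show "(\<lambda>x. exp (\<nu> * of_real x - 1 * of_real (exp x))) \<in> borel_measurable lborel"
      unfolding measurable_lborel2 by (intro borel_measurable_continuous_onI continuous_intros)
  qed
  thus ?thesis using integral_exp_Gamma[OF assms(1), of 1] by (simp add: Kint_def)
qed

text \<open>The expression is the Wronskian of the solutions of type K and of type I. Its derivative
  in B vanishes, and for Re s > 0 its constant value is read off as B tends to 0 along the positive
  axis. All other orders are reached because the expression does not change when s is replaced by s
  + 1.\<close>

lemma Kint_bser_wronskian:
  assumes A: "Re A > 0" and B: "Re B > 0"
  shows "B powr s * (A * B * Kint (-s) A B * bser (s + 1) (A * B) + B * Kint (-s - 1) A B * bser s (A * B)) = 1"
proof -
  define c where "c s B = B powr s * (A * B * Kint (-s) A B * bser (s + 1) (A * B) + B * Kint (-s - 1) A B * bser s (A * B))" for s B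
  have step: "c (s - 1) B = c s B" for s
  proof -
    have B0: "B \<noteq> 0" using B by auto
    have 1: "B * Kint (-(s - 1) - 1 - 1) A B = s * Kint (-s) A B + A * Kint (-s + 1) A B"
      using Kint_rec[OF A B, of "-s"] by (simp add: algebra_simps)
    have 2: "B powr s = B powr (s - 1) * B" using B0 powr_add[of B "s - 1" 1] by simp
    have 3: "bser (s - 1) (A * B) = s * bser s (A * B) + A * B * bser (s + 1) (A * B)" by (rule bser_rec)
    have 4: "B * Kint (- s - 1) A B = s * Kint (-s) A B + A * Kint (-s + 1) A B"
      using Kint_rec[OF A B, of "-s"] by (simp add: algebra_simps)
    have "c (s - 1) B = B powr (s - 1) * (A * B * Kint (-s + 1) A B * bser s (A * B) + B * Kint (-s) A B * bser (s - 1) (A * B))"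
      by (simp add: c_def)
    also have "\<dots> = B powr (s - 1) * B * (A * Kint (-s + 1) A B * bser s (A * B) + Kint (-s) A B * (s * bser s (A * B) + A * B * bser (s + 1) (A * B)))"
      unfolding 3 by (simp add: algebra_simps)
    also have "\<dots> = B powr (s - 1) * B * (A * B * Kint (-s) A B * bser (s + 1) (A * B) + (s * Kint (-s) A B + A * Kint (-s + 1) A B) * bser s (A * B))"
      by (simp add: algebra_simps)
    also have "\<dots> = c s B" unfolding c_def 2 4 ..
    finally show ?thesis .
  qed
  have main: "c s B = 1" if s: "Re s > 0" for s
  proof -
    have "(c s has_field_derivative 0) (at B within {B. Re B > 0})" if B: "B \<in> {B. Re B > 0}" for B
    proof -
      have B: "Re B > 0" and Bn: "B \<notin> \<real>\<^sub>\<le>\<^sub>0" "B \<noteq> 0" using B by (auto simp: complex_nonpos_Reals_iff)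
      have b: "((\<lambda>B. bser \<nu> (A * B)) has_field_derivative A * bser (\<nu> + 1) (A * B)) (at B)" for \<nu>
        by (rule DERIV_chain2[OF bser_deriv, THEN DERIV_cong]) (auto intro!: derivative_eq_intros)
      have rec: "B * Kint (-s - 1 - 1) A B = (s + 1) * Kint (-s - 1) A B + A * Kint (-s) A B"
        using Kint_rec[OF A B, of "-s - 1"] by (simp add: algebra_simps)
      have rec2: "bser s (A * B) = (s + 1) * bser (s + 1) (A * B) + A * B * bser (s + 1 + 1) (A * B)"
        using bser_rec[of "s + 1"] by simp
      have pw: "((\<lambda>B. B powr s) has_field_derivative s * B powr (s - 1)) (at B)"
        using has_field_derivative_powr[OF Bn(1)] by simp
      have pw2: "B powr s = B powr (s - 1) * B" using Bn powr_add[of B "s - 1" 1] by simp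
      note Kint_deriv_B[OF A B, of "-s", THEN DERIV_cong, of "- Kint (-s - 1) A B", OF refl, derivative_intros]
         and Kint_deriv_B[OF A B, of "-s - 1", THEN DERIV_cong, of "- Kint (-s - 1 - 1) A B", OF refl, derivative_intros]
         and b[derivative_intros] and pw[derivative_intros]
      define K0 K1 K2 b0 b1 b2 where defs: "K0 = Kint (-s) A B" "K1 = Kint (-s - 1) A B" "K2 = Kint (-s - 1 - 1) A B"
        "b0 = bser s (A * B)" "b1 = bser (s + 1) (A * B)" "b2 = bser (s + 1 + 1) (A * B)"
      have "(c s has_field_derivative (s * B powr (s - 1) * (A * B * K0 * b1 + B * K1 * b0) +
         B powr s * ((A * K0 - A * B * K1) * b1 + A * B * K0 * (A * b2) + ((K1 - B * K2) * b0 + B * K1 * (A * b1))))) (at B)"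
        unfolding c_def defs by (rule derivative_eq_intros refl)+ (simp add: algebra_simps)
      moreover have "s * B powr (s - 1) * (A * B * K0 * b1 + B * K1 * b0) +
         B powr s * ((A * K0 - A * B * K1) * b1 + A * B * K0 * (A * b2) + ((K1 - B * K2) * b0 + B * K1 * (A * b1))) = 0"
        using rec rec2 unfolding pw2 defs[symmetric] by algebra
      ultimately show ?thesis by (metis has_field_derivative_at_within)
    qed
    hence const: "\<exists>k. \<forall>B\<in>{B. Re B > 0}. c s B = k"
      by (intro has_field_derivative_zero_constant convex_halfspace_Re_gt) auto
    then obtain k where k: "\<And>B. Re B > 0 \<Longrightarrow> c s B = k" by auto
    \<comment> \<open>For B = y the powers of y are moved into \<open>Kint\<close> by scaling. Then
      both integrals converge to Gamma values, the first term carries an extra factor y, and Gamma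
      (s + 1) times its reciprocal is left.\<close>
    have "((\<lambda>y. of_real y * A * Kint s 1 (A * of_real y) * bser (s + 1) (A * of_real y) + Kint (s + 1) 1 (A * of_real y) * bser s (A * of_real y)) \<longlongrightarrow>
       of_real 0 * A * Gamma s * bser (s + 1) (A * of_real 0) + Gamma (s + 1) * bser s (A * of_real 0)) (at_right 0)"
      using s A
      by (intro tendsto_intros Kint_tendsto_Gamma isCont_tendsto_compose[OF DERIV_isCont[OF bser_deriv]]) auto
    moreover have "\<forall>\<^sub>F y in at_right 0. of_real y * A * Kint s 1 (A * of_real y) * bser (s + 1) (A * of_real y) + Kint (s + 1) 1 (A * of_real y) * bser s (A * of_real y) = k"
      using eventually_at_right_less[of 0]
    proof eventually_elim
      case (elim y)
      have sc: "of_real y powr (-\<nu>) * Kint \<nu> 1 (A * of_real y) = Kint (-\<nu>) A (of_real y)" for \<nu>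
        using Kint_scale[OF elim, of "-\<nu>" A 1] Kint_sym[of \<nu> 1] by simp
      have y0: "complex_of_real y \<noteq> 0" using elim by simp
      have p1: "of_real y powr (-s - 1) = of_real y powr (-s) / complex_of_real y"
        using powr_diff[of "of_real y" "-s" 1] y0 by simp
      have e: "-1 - s = -s - 1" by simp
      hence "of_real y powr (-1 - s) = of_real y powr (-s) / complex_of_real y" using p1 by metis
      hence sc1: "Kint s 1 (A * of_real y) = of_real y powr s * Kint (-s) A (of_real y)"
        "Kint (s + 1) 1 (A * of_real y) = of_real y powr s * of_real y * Kint (-s - 1) A (of_real y)"
        unfolding sc[of s, symmetric] using sc[of "s + 1"] y0 arg_cong[OF e, of "\<lambda>\<nu>. Kint \<nu> A (of_real y)"]
        by (simp_all add: powr_minus field_simps)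
      show ?case
        using k[of "of_real y"] elim unfolding c_def sc1 by (simp add: algebra_simps)
    qed
    ultimately have "k = Gamma (s + 1) * rGamma (s + 1)"
      using tendsto_unique[OF _ _ tendsto_eventually] trivial_limit_at_right_real by fastforce
    moreover have "Gamma (s + 1) * rGamma (s + 1) = 1"
    proof -
      have "s + 1 \<notin> \<int>\<^sub>\<le>\<^sub>0" using s by (intro Re_pos_not_nonpos_Ints) simp
      thus ?thesis by (simp add: rGamma_inverse_Gamma Gamma_eq_zero_iff)
    qed
    ultimately show ?thesis using k[OF B] by simp
  qed
  have "c s B = c (s + of_nat n) B" for n
    by (induction n) (use step in \<open>simp_all add: add.assoc\<close>, metis add_diff_cancel_left' step add.commute add.assoc)
  moreover obtain n :: nat where "real n > - Re s" using reals_Archimedean2 by blast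
  ultimately have "c s B = 1" using main[of "s + of_nat n"] by simp
  thus ?thesis by (simp add: c_def)
qed

text \<open>The connection formula between K and the two solutions of type I. The Wronskian relation
  for s, and the one for -s - 1 with A and B exchanged, are two linear equations for
  \<open>Kint (-s) A B\<close> and \<open>Kint (-s - 1) A B\<close>; eliminating the latter leaves
  the determinant \<open>bser_wronskian\<close>.\<close>

lemma Kint_eq_bser:
  assumes A: "Re A > 0" and B: "Re B > 0"
  shows "sin (of_real pi * s) / of_real pi * Kint (-s) A B = B powr (-s) * bser (-s) (A * B) - A powr s * bser s (A * B)"
proof -
  have nz: "A \<noteq> 0" "B \<noteq> 0" using A B by auto
  have 1: "A * B * Kint (-s) A B * bser (s + 1) (A * B) + B * Kint (-s - 1) A B * bser s (A * B) = B powr (-s)"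
    using Kint_bser_wronskian[OF A B, of s] nz by (simp add: powr_minus field_simps)
  have "A powr (-s - 1) * (B * A * Kint (s + 1) B A * bser (-s) (B * A) + A * Kint s B A * bser (-s - 1) (B * A)) = 1"
    using Kint_bser_wronskian[OF B A, of "-s - 1"] by (simp add: add.commute)
  moreover have "Kint (s + 1) B A = Kint (-s - 1) A B" "Kint s B A = Kint (-s) A B"
    using Kint_sym[of "s + 1" B A] Kint_sym[of s B A] by simp_all
  moreover have "A powr (-s - 1) * A = A powr (-s)" using powr_add[of A "-s - 1" 1] nz by simp
  ultimately have "A powr (-s) * (B * Kint (-s - 1) A B * bser (-s) (A * B) + Kint (-s) A B * bser (-s - 1) (A * B)) = 1"
    by (simp only: flip: \<open>A powr (-s - 1) * A = A powr (-s)\<close>) (simp add: mult_ac ring_distribs)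
  hence 2: "B * Kint (-s - 1) A B * bser (-s) (A * B) + Kint (-s) A B * bser (-s - 1) (A * B) = A powr s"
    using nz by (simp add: powr_minus field_simps)
  have "- (sin (of_real pi * s) / of_real pi) * Kint (-s) A B =
     Kint (-s) A B * (bser s (A * B) * bser (-s - 1) (A * B) - A * B * bser (s + 1) (A * B) * bser (-s) (A * B))"
    unfolding bser_wronskian by simp
  also have "\<dots> = A powr s * bser s (A * B) - B powr (-s) * bser (-s) (A * B)"
    unfolding 1[symmetric] 2[symmetric] by (simp add: algebra_simps)
  finally show ?thesis by (simp add: algebra_simps)
qed

section \<open>The Bessel functions in terms of \<open>bser\<close> and \<open>Kint\<close>, and
  their integer orders\<close>

lemma Bessel_J_eq_bser: "Bessel_J s x = (x / 2) powr s * bser s (- (x / 2)\<^sup>2)"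
proof -
  have "(- (x / 2)\<^sup>2) ^ n = (-1) ^ n * (x / 2) ^ (2 * n)" for n
    by (simp only: power_minus[of "(x / 2)\<^sup>2"] power_mult)
  thus ?thesis unfolding Bessel_J_def bser_def by (simp add: mult_ac)
qed

lemma Bessel_I_eq_bser: "Bessel_I s x = (x / 2) powr s * bser s ((x / 2)\<^sup>2)"
  unfolding Bessel_I_def bser_def by (simp add: power_mult)

lemma Im_Ln_less: "Re z > 0 \<Longrightarrow> \<bar>Im (Ln z)\<bar> < pi / 2"
  using Re_Ln_pos_lt[of z] by (cases "z = 0") auto

lemma Ln_mult_Re_pos:
  assumes "Re a > 0" "Re b > 0"
  shows "Ln (a * b) = Ln a + Ln b"
proof (rule Ln_times_simple)
  show "a \<noteq> 0" "b \<noteq> 0" using assms by auto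
  show "- pi < Im (Ln a) + Im (Ln b)" "Im (Ln a) + Im (Ln b) \<le> pi"
    using Im_Ln_less[OF assms(1)] Im_Ln_less[OF assms(2)] by auto
qed

lemma powr_mult_Re_pos:
  assumes "Re a > 0" "Re b > 0"
  shows "(a * b) powr c = a powr c * b powr c"
proof -
  have "a \<noteq> 0" "b \<noteq> 0" using assms by auto
  thus ?thesis using Ln_mult_Re_pos[OF assms] by (simp add: powr_def exp_add[symmetric] algebra_simps)
qed

lemma cone_square:
  assumes "\<bar>Im z\<bar> < Re z"
  shows "Re z > 0" "Re (z\<^sup>2) > 0"
proof -
  show "Re z > 0" using assms by linarith
  have "\<bar>Im z\<bar>\<^sup>2 < (Re z)\<^sup>2" using assms by (intro power_strict_mono) auto
  thus "Re (z\<^sup>2) > 0" by (simp add: Re_power2)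
qed

lemma sin_pi_eq_0_iff: "sin (complex_of_real pi * \<nu>) = 0 \<longleftrightarrow> \<nu> \<in> \<int>"
proof -
  have "sin (complex_of_real pi * \<nu>) = 0 \<longleftrightarrow> (\<exists>n::int. complex_of_real pi * \<nu> = of_real (of_int n * pi))"
    using sin_eq_0[of "complex_of_real pi * \<nu>"] by auto
  also have "\<dots> \<longleftrightarrow> (\<exists>n::int. \<nu> = of_int n)"
    by (intro ex_cong1) (simp add: field_simps)
  finally show ?thesis by (auto elim!: Ints_cases)
qed

lemma Ints_complex_isolated:
  assumes "n \<in> \<int>" "\<nu> \<in> \<int>" "norm (\<nu> - n) < 1"
  shows "\<nu> = (n :: complex)"
proof -
  obtain a b :: int where "n = of_int a" "\<nu> = of_int b" using assms by (auto elim!: Ints_cases)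
  moreover from this have "norm (of_int (b - a) :: complex) < 1" using assms by simp
  hence "\<bar>b - a\<bar> < 1" unfolding norm_of_int by linarith
  ultimately show ?thesis by simp
qed

lemma eventually_not_Ints: "\<forall>\<^sub>F \<nu> in at n. \<nu> \<notin> \<int>" for n :: complex
proof (cases "n \<in> \<int>")
  case True
  thus ?thesis unfolding eventually_at
    by (intro exI[of _ 1]) (use Ints_complex_isolated[of n] in \<open>auto simp: dist_norm\<close>)
next
  case False
  hence "eventually (\<lambda>\<nu>. \<nu> \<in> - \<int>) (nhds n)"
    by (intro eventually_nhds_in_open) (auto simp: open_Compl)
  thus ?thesis by (auto simp: eventually_at_filter elim: eventually_mono)
qed

text \<open>Off the integers this is the connection formula; at the integers the limit in the
  definition is evaluated by continuity, \<open>Kint\<close> being entire in \<nu>. The condition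
  |Im| < Re on both factors puts both squares into the right half-plane. The freedom in splitting
  the argument as 2\<alpha>\<beta> serves to match rotated rays at the end.\<close>

lemma Bessel_K_eq_Kint:
  assumes \<alpha>: "\<bar>Im \<alpha>\<bar> < Re \<alpha>" and \<beta>: "\<bar>Im \<beta>\<bar> < Re \<beta>"
  shows "Bessel_K \<nu> (2 * \<alpha> * \<beta>) = \<alpha> powr \<nu> * \<beta> powr (-\<nu>) * Kint \<nu> (\<alpha>\<^sup>2) (\<beta>\<^sup>2) / 2"
proof -
  define x where "x = 2 * \<alpha> * \<beta>"
  define q where "q \<nu> = of_real pi / 2 * (Bessel_I (-\<nu>) x - Bessel_I \<nu> x) / sin (of_real pi * \<nu>)" for \<nu>
  define K where "K \<nu> = \<alpha> powr \<nu> * \<beta> powr (-\<nu>) * Kint \<nu> (\<alpha>\<^sup>2) (\<beta>\<^sup>2) / 2" for \<nu>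
  note a = cone_square[OF \<alpha>] and b = cone_square[OF \<beta>]
  have nz: "\<alpha> \<noteq> 0" "\<beta> \<noteq> 0" using a b by auto
  have q: "q \<nu> = K \<nu>" if "\<nu> \<notin> \<int>" for \<nu>
  proof -
    have s0: "sin (of_real pi * \<nu>) \<noteq> 0" using that by (simp add: sin_pi_eq_0_iff)
    have I: "Bessel_I \<mu> x = \<alpha> powr \<mu> * \<beta> powr \<mu> * bser \<mu> (\<alpha>\<^sup>2 * \<beta>\<^sup>2)" for \<mu>
      by (simp add: Bessel_I_eq_bser x_def powr_mult_Re_pos[OF a(1) b(1)] power_mult_distrib)
    have "Kint \<nu> (\<alpha>\<^sup>2) (\<beta>\<^sup>2) = Kint (-\<nu>) (\<beta>\<^sup>2) (\<alpha>\<^sup>2)" by (rule Kint_sym)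
    also have "\<dots> = of_real pi / sin (of_real pi * \<nu>) *
        ((\<alpha>\<^sup>2) powr (-\<nu>) * bser (-\<nu>) (\<beta>\<^sup>2 * \<alpha>\<^sup>2) - (\<beta>\<^sup>2) powr \<nu> * bser \<nu> (\<beta>\<^sup>2 * \<alpha>\<^sup>2))"
      using Kint_eq_bser[OF b(2) a(2), of \<nu>] s0 by (simp add: field_simps)
    finally have K: "Kint \<nu> (\<alpha>\<^sup>2) (\<beta>\<^sup>2) = of_real pi / sin (of_real pi * \<nu>) *
        ((\<alpha>\<^sup>2) powr (-\<nu>) * bser (-\<nu>) (\<beta>\<^sup>2 * \<alpha>\<^sup>2) - (\<beta>\<^sup>2) powr \<nu> * bser \<nu> (\<beta>\<^sup>2 * \<alpha>\<^sup>2))" .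
    have "(\<alpha>\<^sup>2) powr (-\<nu>) = \<alpha> powr (-\<nu>) * \<alpha> powr (-\<nu>)" "(\<beta>\<^sup>2) powr \<nu> = \<beta> powr \<nu> * \<beta> powr \<nu>"
      unfolding power2_eq_square using a b by (simp_all add: powr_mult_Re_pos)
    thus ?thesis using nz s0 unfolding q_def K_def I K mult.commute[of "\<beta>\<^sup>2" "\<alpha>\<^sup>2"]
      by (simp add: powr_minus field_simps)
  qed
  have "K holomorphic_on UNIV" unfolding K_def
    using nz Kint_holomorphic[OF a(2) b(2)] by (auto intro!: holomorphic_intros)
  hence cont: "(K \<longlongrightarrow> K \<nu>) (at \<nu>)"
    using holomorphic_on_imp_continuous_on continuous_on_def by blast
  have "(q \<longlongrightarrow> K \<nu>) (at \<nu>)"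
    by (rule Lim_transform_eventually[OF cont]) (use eventually_not_Ints[of \<nu>] q in \<open>auto elim!: eventually_mono\<close>)
  hence "Lim (at \<nu>) q = K \<nu>" by (intro tendsto_Lim) auto
  moreover have "Bessel_K \<nu> x = (if \<nu> \<in> \<int> then Lim (at \<nu>) q else q \<nu>)"
    unfolding Bessel_K_def Let_def q_def ..
  ultimately have "Bessel_K \<nu> x = K \<nu>" using q[of \<nu>] by simp
  thus ?thesis unfolding x_def K_def .
qed

lemma Bessel_K_holomorphic_order:
  assumes "t > 0"
  shows "(\<lambda>\<nu>. Bessel_K \<nu> (of_real t)) holomorphic_on UNIV"
proof -
  define \<alpha> where "\<alpha> = complex_of_real (sqrt (t / 2))"
  have \<alpha>: "\<bar>Im \<alpha>\<bar> < Re \<alpha>" using assms by (simp add: \<alpha>_def)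
  have "2 * (sqrt (t / 2) * sqrt (t / 2)) = t" using assms by simp
  hence "complex_of_real (2 * (sqrt (t / 2) * sqrt (t / 2))) = of_real t" by (rule arg_cong)
  hence "of_real t = 2 * \<alpha> * \<alpha>" unfolding \<alpha>_def of_real_mult by (simp add: mult.assoc)
  hence "Bessel_K \<nu> (of_real t) = \<alpha> powr \<nu> * \<alpha> powr (-\<nu>) * Kint \<nu> (\<alpha>\<^sup>2) (\<alpha>\<^sup>2) / 2" for \<nu>
    using Bessel_K_eq_Kint[OF \<alpha> \<alpha>] by simp
  moreover have "(\<lambda>\<nu>. \<alpha> powr \<nu> * \<alpha> powr (-\<nu>) * Kint \<nu> (\<alpha>\<^sup>2) (\<alpha>\<^sup>2) / 2) holomorphic_on UNIV"
    using cone_square[OF \<alpha>] by (intro holomorphic_intros Kint_holomorphic) auto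
  ultimately show ?thesis by presburger
qed

text \<open>The leading coefficients vanish at negative integer orders. The three-term recurrence
  carries the relation upwards from the orders 0 and 1.\<close>

lemma bser_neg_nat: "bser (- of_nat n) X = X ^ n * bser (of_nat n) X"
proof (induction n rule: less_induct)
  case (less n)
  consider "n = 0" | "n = 1" | m where "n = Suc (Suc m)" by (metis One_nat_def not0_implies_Suc)
  thus ?case
  proof cases
    case 2
    thus ?thesis using bser_rec[of 0 X] by simp
  next
    case 3
    have "bser (- of_nat n) X = (- of_nat (Suc m)) * bser (- of_nat (Suc m)) X + X * bser (- of_nat m) X"
      using bser_rec[of "- of_nat (Suc m)" X] 3 by (simp add: algebra_simps)
    also have "\<dots> = X ^ Suc m * (bser (of_nat (Suc m) - 1) X - of_nat (Suc m) * bser (of_nat (Suc m)) X)"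
      using less[of "Suc m"] less[of m] 3 by (simp add: algebra_simps)
    also have "\<dots> = X ^ Suc m * (X * bser (of_nat (Suc m) + 1) X)" by (subst bser_rec) simp
    finally show ?thesis using 3 by (simp add: algebra_simps)
  qed auto
qed

lemma Bessel_J_holomorphic_order:
  "x \<noteq> 0 \<Longrightarrow> (\<lambda>\<nu>. Bessel_J \<nu> x) holomorphic_on UNIV"
  unfolding Bessel_J_eq_bser by (intro holomorphic_intros bser_holomorphic_order)

lemma Bessel_J_holomorphic_neg_order:
  "x \<noteq> 0 \<Longrightarrow> (\<lambda>\<nu>. Bessel_J (-\<nu>) x) holomorphic_on UNIV"
  using holomorphic_on_compose_gen[OF holomorphic_on_minus[OF holomorphic_on_ident] Bessel_J_holomorphic_order[of x], of UNIV]
  by (simp add: o_def)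

lemma Bessel_J_neg_nat:
  assumes "x \<noteq> 0"
  shows "Bessel_J (- of_nat n) x = (-1) ^ n * Bessel_J (of_nat n) x"
proof -
  define y where "y = x / 2"
  have y: "y \<noteq> 0" using assms by (simp add: y_def)
  have "(- y\<^sup>2) ^ n = (-1) ^ n * y ^ n * y ^ n" 
    by (subst power_minus) (simp add: power2_eq_square power_mult_distrib)
  thus ?thesis using y
    by (simp add: Bessel_J_eq_bser bser_neg_nat powr_minus y_def[symmetric] powr_nat' field_simps)
qed

text \<open>Numerator and denominator of the defining quotient both vanish at n, the former by
  \<open>Bessel_J_neg_nat\<close>. Dividing both by \<nu> - n exhibits the limit as a quotient of
  derivatives; its existence makes it the value that \<open>Lim\<close> selects.\<close>

lemma Bessel_Y_tendsto:
  assumes "x \<noteq> 0"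
  shows "((\<lambda>\<nu>. Bessel_Y \<nu> x) \<longlongrightarrow> Bessel_Y (of_nat n) x) (at (of_nat n))"
proof -
  define num where "num \<nu> = Bessel_J \<nu> x * cos (of_real pi * \<nu>) - Bessel_J (-\<nu>) x" for \<nu>
  define q where "q \<nu> = num \<nu> / sin (of_real pi * \<nu>)" for \<nu>
  have "num holomorphic_on UNIV" unfolding num_def
    by (intro holomorphic_intros Bessel_J_holomorphic_order Bessel_J_holomorphic_neg_order assms)
  then obtain D where "(num has_field_derivative D) (at (of_nat n))"
    using holomorphic_on_open by blast
  moreover have c: "cos (of_real pi * of_nat n) = ((-1) ^ n :: complex)"
  proof -
    have "complex_of_real pi * of_nat n = of_real (pi * real n)" by simp
    hence "cos (of_real pi * of_nat n) = complex_of_real (cos (pi * real n))" by (simp only: cos_of_real)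
    thus ?thesis by (simp only: cos_npi2) simp
  qed
  moreover have n0: "num (of_nat n) = 0" by (simp add: num_def Bessel_J_neg_nat[OF assms] c)
  ultimately have 1: "((\<lambda>\<nu>. num \<nu> / (\<nu> - of_nat n)) \<longlongrightarrow> D) (at (of_nat n))"
    by (simp add: has_field_derivative_iff)
  have s0: "sin (of_real pi * of_nat n) = (0 :: complex)" by (simp add: sin_pi_eq_0_iff)
  have "((\<lambda>\<nu>. sin (of_real pi * \<nu>)) has_field_derivative cos (of_real pi * of_nat n) * of_real pi) (at (of_nat n :: complex))"
    by (auto intro!: derivative_eq_intros)
  hence 2: "((\<lambda>\<nu>. sin (of_real pi * \<nu>) / (\<nu> - of_nat n)) \<longlongrightarrow> (-1) ^ n * of_real pi) (at (of_nat n :: complex))"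
    by (simp add: has_field_derivative_iff s0 c)
  have "((\<lambda>\<nu>. (num \<nu> / (\<nu> - of_nat n)) / (sin (of_real pi * \<nu>) / (\<nu> - of_nat n))) \<longlongrightarrow> D / ((-1) ^ n * of_real pi)) (at (of_nat n))"
    by (intro tendsto_divide 1 2) auto
  hence q: "(q \<longlongrightarrow> D / ((-1) ^ n * of_real pi)) (at (of_nat n))"
  proof (rule Lim_transform_eventually)
    have quot: "d \<noteq> 0 \<Longrightarrow> (a / d) / (b / d) = a / b" for a b d :: complex by simp
    show "\<forall>\<^sub>F \<nu> in at (of_nat n). (num \<nu> / (\<nu> - of_nat n)) / (sin (of_real pi * \<nu>) / (\<nu> - of_nat n)) = q \<nu>"
      unfolding q_def using eventually_neq_at_within[of "of_nat n :: complex"]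
      by (rule eventually_mono) (rule quot, simp only: right_minus_eq not_False_eq_True)
  qed
  hence "Lim (at (of_nat n)) q = D / ((-1) ^ n * of_real pi)" by (intro tendsto_Lim) auto
  hence "Bessel_Y (of_nat n) x = D / ((-1) ^ n * of_real pi)"
    by (simp add: Bessel_Y_def Let_def q_def[abs_def] num_def[abs_def])
  moreover have "\<forall>\<^sub>F \<nu> in at (of_nat n). q \<nu> = Bessel_Y \<nu> x"
    using eventually_not_Ints[of "of_nat n"]
    by eventually_elim (simp add: Bessel_Y_def Let_def q_def num_def)
  ultimately show ?thesis using Lim_transform_eventually[OF q] by simp
qed

lemma cos_sin_half: "cos (2 * z) = 1 - 2 * sin z ^ 2" "sin (2 * z) = 2 * sin z * cos z" for z :: complex
  by (simp_all add: cos_double_sin sin_double)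

text \<open>The half-angle formulas cancel the factor cos (pi \<nu> / 2), so that only sin (pi \<nu>
  / 2) stays in the denominator.\<close>

lemma Koshliakov_F_nonint:
  assumes "\<nu> \<notin> \<int>"
  shows "Koshliakov_F \<nu> x = (Bessel_I (-\<nu>) x + Bessel_J (-\<nu>) x - Bessel_I \<nu> x - Bessel_J \<nu> x) / (2 * sin (of_real pi * \<nu> / 2))"
proof -
  define S C where "S = sin (of_real pi * \<nu> / 2)" and "C = cos (of_real pi * \<nu> / 2)"
  have d: "sin (of_real pi * \<nu>) = 2 * S * C" "cos (of_real pi * \<nu>) = 1 - 2 * S\<^sup>2"
    using cos_sin_half[of "of_real pi * \<nu> / 2"] by (simp_all add: S_def C_def)
  have "sin (of_real pi * \<nu>) \<noteq> 0" using assms by (simp add: sin_pi_eq_0_iff)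
  hence nz: "S \<noteq> 0" "C \<noteq> 0" using d by auto
  show ?thesis using assms nz
    by (simp add: Koshliakov_F_def Bessel_K_def Bessel_Y_def Let_def d S_def[symmetric] C_def[symmetric])
       (simp add: field_simps power2_eq_square)
qed

text \<open>The integers are isolated and the kernel is continuous at each of them, so they are
  removable singularities. In the half-plane Re \<nu> > -1 every integer is a natural number, the
  case covered by \<open>Bessel_Y_tendsto\<close>.\<close>

lemma Koshliakov_F_holomorphic_order:
  assumes t: "t > 0"
  shows "(\<lambda>\<nu>. Koshliakov_F \<nu> (of_real t)) holomorphic_on {\<nu>. Re \<nu> > -1}"
proof -
  define x where "x = complex_of_real t"
  have x: "x \<noteq> 0" using t by (simp add: x_def)
  define F where "F \<nu> = Koshliakov_F \<nu> x" for \<nu>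
  have U: "open {\<nu>. Re \<nu> > -1}" by (rule open_halfspace_Re_gt)
  have hY: "(\<lambda>\<nu>. Bessel_Y \<nu> x) holomorphic_on - \<int>"
  proof (rule holomorphic_transform)
    show "(\<lambda>\<nu>. (Bessel_J \<nu> x * cos (of_real pi * \<nu>) - Bessel_J (-\<nu>) x) / sin (of_real pi * \<nu>)) holomorphic_on - \<int>"
      by (intro holomorphic_intros holomorphic_on_subset[OF Bessel_J_holomorphic_order[OF x]]
          holomorphic_on_subset[OF Bessel_J_holomorphic_neg_order[OF x]]) (auto simp: sin_pi_eq_0_iff)
  qed (auto simp: Bessel_Y_def Let_def)
  have hK: "(\<lambda>\<nu>. Bessel_K \<nu> x) holomorphic_on UNIV" unfolding x_def by (rule Bessel_K_holomorphic_order[OF t])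
  have hF: "F holomorphic_on - \<int>" unfolding F_def Koshliakov_F_def
    by (intro holomorphic_intros hY holomorphic_on_subset[OF Bessel_J_holomorphic_order[OF x]]
        holomorphic_on_subset[OF hK]) auto
  have "F field_differentiable (at \<nu>)" if \<nu>: "Re \<nu> > -1" for \<nu>
  proof (cases "\<nu> \<in> \<int>")
    case False
    thus ?thesis using hF by (metis ComplI closed_Ints holomorphic_on_imp_differentiable_at open_Compl)
  next
    case True
    then obtain k :: int where k: "\<nu> = of_int k" by (auto elim: Ints_cases)
    hence "k \<ge> 0" using \<nu> by simp
    then obtain n :: nat where n: "\<nu> = of_nat n" using k by (metis nonneg_int_cases of_int_of_nat_eq)
    have K: "((\<lambda>\<nu>. Bessel_K \<nu> x) \<longlongrightarrow> Bessel_K \<nu> x) (at \<nu>)" "((\<lambda>\<nu>. Bessel_J \<nu> x) \<longlongrightarrow> Bessel_J \<nu> x) (at \<nu>)"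
      using holomorphic_on_imp_continuous_on[OF hK] holomorphic_on_imp_continuous_on[OF Bessel_J_holomorphic_order[OF x]]
      by (auto simp: continuous_on_def)
    have "(F \<longlongrightarrow> F \<nu>) (at \<nu>)" unfolding F_def Koshliakov_F_def
      using Bessel_Y_tendsto[OF x, of n] K unfolding n[symmetric] by (intro tendsto_intros) auto
    moreover have "F holomorphic_on (ball \<nu> 1 - {\<nu>})"
      by (rule holomorphic_on_subset[OF hF]) (use Ints_complex_isolated[OF True] in \<open>auto simp: dist_norm norm_minus_commute\<close>)
    ultimately have "F holomorphic_on ball \<nu> 1"
      using tendsto_within_subset[of F "nhds (F \<nu>)" \<nu> UNIV "ball \<nu> 1"]
      by (intro no_isolated_singularity'[of "{\<nu>}" F "ball \<nu> 1"]) simp_all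
    thus ?thesis by (rule holomorphic_on_imp_differentiable_at) auto
  qed
  thus ?thesis unfolding F_def x_def using U by (simp add: holomorphic_on_def field_differentiable_at_within)
qed

subsection \<open>A primitive of the Koshliakov kernel\<close>

text \<open>The density of the integral in the variable X: with t = 2 sqrt X,
  \<open>Koshliakov_g s X\<close> dX equals 2^(-s) t^(s+1) F_s(t) dt.\<close>

definition Koshliakov_g :: "complex \<Rightarrow> real \<Rightarrow> complex" where
  "Koshliakov_g s X = 2 * of_real X powr (s / 2) * Koshliakov_F s (of_real (2 * sqrt X))"

text \<open>For even \<open>s\<close> the denominator vanishes and the value is the junk value \<open>0\<close>.\<close>

definition Vker :: "complex \<Rightarrow> complex \<Rightarrow> complex" where
  "Vker s X = (bser (-s - 1) X - bser (-s - 1) (-X) - X powr (s + 1) * (bser (s + 1) X + bser (s + 1) (-X)))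
      / sin (of_real pi * s / 2)"

lemma Koshliakov_g_nonint:
  assumes s: "s \<notin> \<int>" and X: "X > 0"
  shows "Koshliakov_g s X = (bser (-s) (of_real X) + bser (-s) (- of_real X)
     - of_real X powr s * (bser s (of_real X) + bser s (- of_real X))) / sin (of_real pi * s / 2)"
proof -
  have l: "Ln (complex_of_real (sqrt X)) = of_real (ln X) / 2" using X by (simp add: Ln_of_real ln_sqrt)
  have p: "complex_of_real (sqrt X) powr \<nu> = exp (\<nu> * of_real (ln X) / 2)" for \<nu> using X by (simp add: powr_def l)
  have p': "complex_of_real X powr \<nu> = exp (\<nu> * of_real (ln X))" for \<nu> using X by (simp add: powr_def Ln_of_real)
  have h: "complex_of_real (2 * sqrt X) / 2 = of_real (sqrt X)" by simp
  have sq: "(complex_of_real (sqrt X))\<^sup>2 = of_real X" using X by (simp flip: of_real_power)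
  have e1: "exp (s / 2 * of_real (ln X)) * exp (-s * of_real (ln X) / 2) = (1::complex)" by (simp flip: exp_add)
  have e2: "exp (s / 2 * of_real (ln X)) * exp (s * of_real (ln X) / 2) = exp (s * complex_of_real (ln X))" by (simp flip: exp_add)
  define S where "S = sin (of_real pi * s / 2)"
  have "Koshliakov_g s X = (exp (s / 2 * of_real (ln X)) * exp (-s * of_real (ln X) / 2)) * (bser (-s) (of_real X) + bser (-s) (- of_real X)) / S
     - (exp (s / 2 * of_real (ln X)) * exp (s * of_real (ln X) / 2)) * (bser s (of_real X) + bser s (- of_real X)) / S"
    unfolding Koshliakov_g_def Koshliakov_F_nonint[OF s] Bessel_I_eq_bser Bessel_J_eq_bser h sq p p' S_def[symmetric]
    by (simp add: diff_divide_distrib add_divide_distrib ring_distribs mult.assoc)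
  thus ?thesis unfolding e1 e2 p' S_def by (simp add: diff_divide_distrib)
qed

text \<open>Write b_s for \<open>bser s\<close>. By the recurrence the derivative of X^(s+1)
  b_{s+1}(X) is X^s b_s(X), and likewise with -X in the argument of b; differentiating b_{-s-1}
  raises its order to -s. The result is the expression in
  \<open>Koshliakov_g_nonint\<close>.\<close>

lemma Vker_deriv:
  assumes X: "Re X > 0"
  shows "(Vker s has_field_derivative (bser (-s) X + bser (-s) (-X) - X powr s * (bser s X + bser s (-X))) / sin (of_real pi * s / 2)) (at X)"
proof -
  have X': "X \<notin> \<real>\<^sub>\<le>\<^sub>0" "X \<noteq> 0" using X by (auto simp: complex_nonpos_Reals_iff)
  have neg: "((\<lambda>X. bser \<nu> (-X)) has_field_derivative - bser (\<nu> + 1) (-X)) (at X)" for \<nu>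
    using DERIV_chain2[OF bser_deriv[of \<nu> "-X"] DERIV_minus[OF DERIV_ident]] by simp
  have pw: "((\<lambda>X. X powr (s + 1)) has_field_derivative (s + 1) * X powr s) (at X)"
    using has_field_derivative_powr[OF X'(1), of "s + 1"] by simp
  have pw2: "X powr (s + 1) = X powr s * X" using X' powr_add[of X s 1] by simp
  have rec: "bser s Y = (s + 1) * bser (s + 1) Y + Y * bser (s + 1 + 1) Y" for Y using bser_rec[of "s + 1" Y] by simp
  define S where "S = sin (of_real pi * s / 2)"
  have "((\<lambda>X. (bser (-s - 1) X - bser (-s - 1) (-X) - X powr (s + 1) * (bser (s + 1) X + bser (s + 1) (-X))) / S) has_field_derivative
     (bser (-s - 1 + 1) X - - bser (-s - 1 + 1) (-X) - ((s + 1) * X powr s * (bser (s + 1) X + bser (s + 1) (-X))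
        + (bser (s + 1 + 1) X + - bser (s + 1 + 1) (-X)) * X powr (s + 1))) / S) (at X)"
    by (intro DERIV_cdivide DERIV_diff DERIV_mult DERIV_add bser_deriv neg pw)
  moreover have eq: "(bser (-s - 1 + 1) X - - bser (-s - 1 + 1) (-X) - ((s + 1) * X powr s * (bser (s + 1) X + bser (s + 1) (-X))
        + (bser (s + 1 + 1) X + - bser (s + 1 + 1) (-X)) * X powr (s + 1)))
     = bser (-s) X + bser (-s) (-X) - X powr s * (bser s X + bser s (-X))"
    unfolding pw2 rec[of X] rec[of "-X"] by (simp add: algebra_simps)
  ultimately show ?thesis unfolding Vker_def[abs_def] S_def by (simp only:)
qed

section \<open>Growth of the primitive near 0 and at infinity\<close>

lemma bser_measurable [measurable (raw)]:
  assumes [measurable]: "f \<in> borel_measurable M" "g \<in> borel_measurable M"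
  shows "(\<lambda>x. bser (f x) (g x)) \<in> borel_measurable M"
proof -
  have [measurable]: "rGamma \<in> borel_measurable (borel :: complex measure)"
    by (intro borel_measurable_continuous_onI holomorphic_on_imp_continuous_on holomorphic_intros)
  show ?thesis unfolding bser_def by measurable
qed

text \<open>An energy estimate. The function y(t) = t^(\<nu>+1/2) b(-t^2/4) with b =
  \<open>bser \<nu>\<close>, a constant multiple of sqrt t times the Bessel function J of order
  \<nu>, solves y'' = (c/t^2 - 1) y with c = \<nu>^2 - 1/4. Hence |y|^2 + |y'|^2 grows at a relative
  rate of at most |c|/t^2, which is integrable at infinity, and it stays bounded uniformly for \<nu>
  in a compact set.\<close>

lemma bessel_energy_bound:
  assumes "compact S"
  obtains C where "C \<ge> 0" "\<And>\<nu> t. \<nu> \<in> S \<Longrightarrow> t \<ge> 1 \<Longrightarrow> norm (bser \<nu> (- (of_real t)\<^sup>2 / 4)) \<le> C * t powr (- Re \<nu> - 1 / 2)"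
proof -
  obtain R where R: "\<And>\<nu>. \<nu> \<in> S \<Longrightarrow> norm \<nu> \<le> R" using compact_imp_bounded[OF assms] by (auto simp: bounded_iff)
  obtain B where B: "B \<ge> 0" "\<And>\<nu> X. \<nu> \<in> cball 0 (R + 2) \<Longrightarrow> norm (bser \<nu> X) \<le> B * exp (2 * norm X)"
    using bser_bound[of "cball 0 (R + 2)"] by (metis compact_cball)
  \<comment> \<open>\<open>R1\<close> bounds the norm of q = \<nu> + 1/2, so that |c| <= R1^2 + R1,
    and \<open>E1\<close> bounds the energy at the starting point t = 1.\<close>
  define R1 where "R1 = \<bar>R\<bar> + 1"
  define E1 where "E1 = (B * exp 1)\<^sup>2 + (R1 * (B * exp 1) + B * exp 1)\<^sup>2"
  define C where "C = sqrt (E1 * exp (R1\<^sup>2 + R1))"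
  have "norm (bser \<nu> (- (of_real t)\<^sup>2 / 4)) \<le> C * t powr (- Re \<nu> - 1 / 2)" if \<nu>: "\<nu> \<in> S" and t: "t \<ge> 1" for \<nu> t
  proof -
    define q where "q = \<nu> + 1 / 2"
    define y where "y t = of_real t powr q * bser \<nu> (- (of_real t)\<^sup>2 / 4)" for t
    define y' where "y' t = q * of_real t powr (q - 1) * bser \<nu> (- (of_real t)\<^sup>2 / 4)
        - of_real t powr (q + 1) * bser (\<nu> + 1) (- (of_real t)\<^sup>2 / 4) / 2" for t
    define c where "c = q * (q - 1)"
    define e where "e t = (norm (y t))\<^sup>2 + (norm (y' t))\<^sup>2" for t
    have "norm \<nu> \<le> R" using R[OF \<nu>] .
    hence q: "norm q \<le> R1" unfolding q_def R1_def using norm_triangle_ineq[of \<nu> "1/2"] by simp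
    have c: "norm c \<le> R1\<^sup>2 + R1"
    proof -
      have "norm c \<le> norm q * (norm q + 1)" unfolding c_def norm_mult
        using norm_triangle_ineq4[of q 1] by (intro mult_left_mono) auto
      also have "\<dots> \<le> R1 * (R1 + 1)" using q by (intro mult_mono) (auto intro: order_trans[OF norm_ge_zero])
      finally show ?thesis by (simp add: power2_eq_square algebra_simps)
    qed
    have dy: "(y has_vector_derivative y' t) (at t)" and
         dy': "(y' has_vector_derivative (c / (of_real t)\<^sup>2 - 1) * y t) (at t)" if t: "t > 0" for t
    proof -
      have nz: "complex_of_real t \<notin> \<real>\<^sub>\<le>\<^sub>0" "complex_of_real t \<noteq> 0" using t by auto
      have pw: "((\<lambda>z. z powr a) has_field_derivative a * of_real t powr (a - 1)) (at (complex_of_real t))" for a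
        using has_field_derivative_powr[OF nz(1)] by simp
      have bd: "((\<lambda>z. bser \<mu> (- z\<^sup>2 / 4)) has_field_derivative (bser (\<mu> + 1) (- (of_real t)\<^sup>2 / 4) * (- of_real t / 2))) (at (complex_of_real t))" for \<mu>
        by (rule DERIV_chain2[OF bser_deriv]) (auto intro!: derivative_eq_intros)
      define b0 b1 b2 where "b0 = bser \<nu> (- (of_real t)\<^sup>2 / 4)" and "b1 = bser (\<nu> + 1) (- (of_real t)\<^sup>2 / 4)"
        and "b2 = bser (\<nu> + 1 + 1) (- (of_real t)\<^sup>2 / 4)"
      define p where "p = of_real t powr (q - 2)"
      have p: "of_real t powr (q - 1) = p * of_real t" "of_real t powr q = p * (of_real t)\<^sup>2" "of_real t powr (q + 1) = p * (of_real t) ^ 3"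
        "of_real t powr (q - 1 - 1) = p" "of_real t powr (q + 1 - 1) = p * (of_real t)\<^sup>2"
        using nz powr_add[of "of_real t" "q - 2" 1] powr_add[of "of_real t" "q - 2" 2] powr_add[of "of_real t" "q - 2" 3]
        by (simp_all add: p_def powr_numeral algebra_simps)
      have rec: "b0 = (\<nu> + 1) * b1 - (of_real t)\<^sup>2 / 4 * b2" unfolding b0_def b1_def b2_def
        using bser_rec[of "\<nu> + 1" "- (of_real t)\<^sup>2 / 4"] by simp
      have "((\<lambda>z. z powr q * bser \<nu> (- z\<^sup>2 / 4)) has_field_derivative
          q * of_real t powr (q - 1) * b0 + b1 * (- of_real t / 2) * of_real t powr q) (at (complex_of_real t))"
        unfolding b0_def b1_def by (intro DERIV_mult pw bd)
      moreover have "q * of_real t powr (q - 1) * b0 + b1 * (- of_real t / 2) * of_real t powr q = y' t"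
        unfolding y'_def b0_def[symmetric] b1_def[symmetric] p by (simp add: field_simps power2_eq_square power3_eq_cube)
      ultimately show "(y has_vector_derivative y' t) (at t)"
        using has_vector_derivative_real_field[of "\<lambda>z. z powr q * bser \<nu> (- z\<^sup>2 / 4)" "y' t" t UNIV] unfolding y_def by simp
      have "((\<lambda>z. q * z powr (q - 1) * bser \<nu> (- z\<^sup>2 / 4) - z powr (q + 1) * bser (\<nu> + 1) (- z\<^sup>2 / 4) / 2) has_field_derivative
          (q * ((q - 1) * of_real t powr (q - 1 - 1))) * b0 + b1 * (- of_real t / 2) * (q * of_real t powr (q - 1))
          - ((q + 1) * of_real t powr (q + 1 - 1) * b1 + b2 * (- of_real t / 2) * of_real t powr (q + 1)) / 2) (at (complex_of_real t))"
        unfolding b0_def b1_def b2_def by (intro DERIV_diff DERIV_cdivide DERIV_mult DERIV_cmult pw bd)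
      moreover have "(q * ((q - 1) * of_real t powr (q - 1 - 1))) * b0 + b1 * (- of_real t / 2) * (q * of_real t powr (q - 1))
          - ((q + 1) * of_real t powr (q + 1 - 1) * b1 + b2 * (- of_real t / 2) * of_real t powr (q + 1)) / 2 = (c / (of_real t)\<^sup>2 - 1) * y t"
        unfolding y_def b0_def[symmetric] p c_def rec using nz by (simp add: q_def field_simps power2_eq_square power3_eq_cube)
      ultimately show "(y' has_vector_derivative (c / (of_real t)\<^sup>2 - 1) * y t) (at t)"
        using has_vector_derivative_real_field[of "\<lambda>z. q * z powr (q - 1) * bser \<nu> (- z\<^sup>2 / 4) - z powr (q + 1) * bser (\<nu> + 1) (- z\<^sup>2 / 4) / 2"
          "(c / (of_real t)\<^sup>2 - 1) * y t" t UNIV] unfolding y'_def by simp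
    qed
    have de: "(e has_real_derivative 2 * Re (cnj (y' t) * (c / (of_real t)\<^sup>2 * y t))) (at t)" if t: "t > 0" for t
    proof -
      have n: "((\<lambda>t. (norm (f t))\<^sup>2) has_real_derivative 2 * Re (cnj (f t) * f')) (at t)" if "(f has_vector_derivative f') (at t)" for f f'
      proof -
        have "((\<lambda>t. Re (f t)) has_real_derivative Re f') (at t)" "((\<lambda>t. Im (f t)) has_real_derivative Im f') (at t)"
          using that by (simp_all add: has_vector_derivative_complex_iff)
        from DERIV_add[OF DERIV_power[OF this(1), of 2] DERIV_power[OF this(2), of 2]]
        have "((\<lambda>t. (Re (f t))\<^sup>2 + (Im (f t))\<^sup>2) has_real_derivative 2 * Re f' * Re (f t) + 2 * Im f' * Im (f t)) (at t)"
          by (simp add: algebra_simps)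
        thus ?thesis by (simp add: cmod_power2 algebra_simps)
      qed
      have "(e has_real_derivative 2 * Re (cnj (y t) * y' t) + 2 * Re (cnj (y' t) * ((c / (of_real t)\<^sup>2 - 1) * y t))) (at t)"
        unfolding e_def by (intro DERIV_add n dy dy' t)
      moreover have "2 * Re (cnj (y t) * y' t) + 2 * Re (cnj (y' t) * ((c / (of_real t)\<^sup>2 - 1) * y t)) = 2 * Re (cnj (y' t) * (c / (of_real t)\<^sup>2 * y t))"
        by (simp add: algebra_simps)
      ultimately show ?thesis by simp
    qed
    \<comment> \<open>exp (|c|/t) is the integrating factor for e' <= (|c|/t^2) e: the product does
      not increase.\<close>
    have "e t * exp (norm c * (1 / t)) \<le> e 1 * exp (norm c * (1 / 1))"
    proof (rule DERIV_nonpos_imp_nonincreasing[OF t])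
      fix x :: real assume x: "1 \<le> x" "x \<le> t"
      define d where "d = 2 * Re (cnj (y' x) * (c / (of_real x)\<^sup>2 * y x))"
      have "((\<lambda>t. e t * exp (norm c * (1 / t))) has_real_derivative d * exp (norm c * (1 / x)) + exp (norm c * (1 / x)) * (norm c * (- 1 / x\<^sup>2)) * e x) (at x)"
        using x unfolding d_def by (intro DERIV_mult de DERIV_fun_exp DERIV_cmult) (auto intro!: derivative_eq_intros simp: power2_eq_square)
      moreover have "d \<le> norm c / x\<^sup>2 * e x"
      proof -
        have "d \<le> 2 * norm (cnj (y' x) * (c / (of_real x)\<^sup>2 * y x))" unfolding d_def
          by (rule mult_left_mono[OF complex_Re_le_cmod]) simp
        also have "\<dots> = norm c / x\<^sup>2 * (2 * norm (y x) * norm (y' x))" by (simp add: norm_mult norm_divide norm_power)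
        also have "\<dots> \<le> norm c / x\<^sup>2 * e x" unfolding e_def
          using sum_squares_bound[of "norm (y x)" "norm (y' x)"] by (intro mult_left_mono) auto
        finally show ?thesis .
      qed
      hence "exp (norm c * (1 / x)) * d \<le> exp (norm c * (1 / x)) * (norm c / x\<^sup>2 * e x)" by (intro mult_left_mono) auto
      hence "d * exp (norm c * (1 / x)) + exp (norm c * (1 / x)) * (norm c * (- 1 / x\<^sup>2)) * e x \<le> 0" by (simp add: algebra_simps)
      ultimately show "\<exists>z. ((\<lambda>t. e t * exp (norm c * (1 / t))) has_real_derivative z) (at x) \<and> z \<le> 0" by blast
    qed
    moreover have "1 \<le> exp (norm c * (1 / t))" using t by simp
    moreover have "e t \<ge> 0" "e 1 \<ge> 0" by (auto simp: e_def)
    ultimately have "e t \<le> e 1 * exp (norm c)" using mult_left_mono[of 1 "exp (norm c * (1 / t))" "e t"] by simp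
    also have "\<dots> \<le> e 1 * exp (R1\<^sup>2 + R1)" using c \<open>e 1 \<ge> 0\<close> by (intro mult_left_mono) auto
    also have "e 1 \<le> E1"
    proof -
      have b: "norm (bser \<mu> (- (of_real 1)\<^sup>2 / 4)) \<le> B * exp 1" if "\<mu> \<in> cball 0 (R + 2)" for \<mu>
      proof -
        have "norm (bser \<mu> (- (of_real 1)\<^sup>2 / 4)) \<le> B * exp (2 * norm (- (of_real 1)\<^sup>2 / 4 :: complex))" by (rule B(2)[OF that])
        also have "\<dots> \<le> B * exp 1" using B(1) by (intro mult_left_mono) auto
        finally show ?thesis .
      qed
      have in1: "\<nu> \<in> cball 0 (R + 2)" "\<nu> + 1 \<in> cball 0 (R + 2)"
        using \<open>norm \<nu> \<le> R\<close> norm_triangle_ineq[of \<nu> 1] by auto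
      have "norm (y 1) \<le> B * exp 1" unfolding y_def using b[OF in1(1)] by simp
      moreover have "norm (y' 1) \<le> R1 * (B * exp 1) + B * exp 1"
      proof -
        have "norm (y' 1) \<le> norm q * norm (bser \<nu> (- (of_real 1)\<^sup>2 / 4)) + norm (bser (\<nu> + 1) (- (of_real 1)\<^sup>2 / 4)) / 2"
          unfolding y'_def using norm_triangle_ineq4[of "q * bser \<nu> (- (of_real 1)\<^sup>2 / 4)" "bser (\<nu> + 1) (- (of_real 1)\<^sup>2 / 4) / 2"]
          by (simp add: norm_mult norm_divide)
        also have "\<dots> \<le> R1 * (B * exp 1) + B * exp 1"
          using b[OF in1(1)] b[OF in1(2)] q B(1) by (intro add_mono mult_mono) (auto simp: R1_def intro: order_trans[of _ "B * exp 1 / 1"])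
        finally show ?thesis .
      qed
      ultimately show ?thesis unfolding e_def E1_def by (intro add_mono power_mono) auto
    qed
    finally have "e t \<le> E1 * exp (R1\<^sup>2 + R1)" by simp
    hence "(norm (y t))\<^sup>2 \<le> E1 * exp (R1\<^sup>2 + R1)" by (auto simp: e_def intro: order_trans[rotated])
    hence "norm (y t) \<le> C" unfolding C_def by (rule real_le_rsqrt)
    moreover have "norm (y t) = t powr (Re \<nu> + 1 / 2) * norm (bser \<nu> (- (of_real t)\<^sup>2 / 4))"
      using t by (simp add: y_def q_def norm_mult norm_powr_real_powr)
    ultimately have "t powr (Re \<nu> + 1 / 2) * norm (bser \<nu> (- (of_real t)\<^sup>2 / 4)) \<le> C" by simp
    hence "t powr (- Re \<nu> - 1 / 2) * (t powr (Re \<nu> + 1 / 2) * norm (bser \<nu> (- (of_real t)\<^sup>2 / 4))) \<le> t powr (- Re \<nu> - 1 / 2) * C"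
      by (intro mult_left_mono) auto
    thus ?thesis using t by (simp add: mult.assoc[symmetric] powr_add[symmetric] mult.commute)
  qed
  moreover have "C \<ge> 0" unfolding C_def E1_def by simp
  ultimately show ?thesis using that by blast
qed

lemma power_div_fact_le_exp: "(u::real) ^ k / fact k \<le> exp u" if "u \<ge> 0"
proof -
  have "sum (\<lambda>n. u ^ n / fact n) {k} \<le> (\<Sum>n. u ^ n / fact n)"
    by (rule sum_le_suminf[OF summable_exp_series]) (use that in auto)
  thus ?thesis by (simp add: exp_def scaleR_conv_of_real field_simps)
qed

lemma integral_exp_Gamma_real:
  fixes c a :: real
  assumes "c > 0" "a > 0"
  shows "(\<integral>x. exp (c * x - a * exp x) \<partial>lborel) = Gamma c * a powr (-c)"
proof -
  have "complex_of_real (\<integral>x. exp (c * x - a * exp x) \<partial>lborel) = (\<integral>x. complex_of_real (exp (c * x - a * exp x)) \<partial>lborel)"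
    by simp
  also have "\<dots> = (\<integral>x. exp (of_real c * of_real x - of_real a * of_real (exp x)) \<partial>lborel)"
    by (intro Bochner_Integration.integral_cong) (simp_all add: exp_of_real flip: of_real_mult of_real_diff)
  also have "\<dots> = Gamma (of_real c) * of_real a powr (- of_real c)"
    using assms by (intro integral_exp_Gamma) auto
  also have "\<dots> = complex_of_real (Gamma c * a powr (-c))"
    using assms by (simp add: Gamma_complex_of_real powr_of_real flip: of_real_minus)
  finally show ?thesis by (simp only: of_real_eq_iff)
qed

text \<open>The true decay is exponential in sqrt X; a power suffices here. With u = X e^(-y), the
  bound e^(-u) <= k!/u^k extracts X^(-k) at the price of e^(ky), and the resulting exponent k - Re s
  - 1 lies between 1 and \<open>c2\<close>, uniformly in s.\<close>

lemma Kint_decay: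
  assumes "k \<ge> R + 2"
  obtains C where "C \<ge> 0" "\<And>s X. norm s \<le> R \<Longrightarrow> X > 0 \<Longrightarrow> norm (Kint (-s - 1) 1 (of_real X)) \<le> C * X powr (- real k)"
proof -
  define c2 where "c2 = real k + \<bar>R\<bar>"
  define I where "I = (\<integral>y. exp (1 * y - 1 * exp y) + exp (c2 * y - 1 * exp y) \<partial>lborel)"
  have c2: "c2 \<ge> 1" using assms unfolding c2_def by linarith
  have int: "integrable lborel (\<lambda>y. exp (1 * y - 1 * exp y) + exp (c2 * y - 1 * exp y))"
    using c2 by (intro Bochner_Integration.integrable_add integrable_exp_one) auto
  have I: "I \<ge> 0" unfolding I_def by (rule Bochner_Integration.integral_nonneg) auto
  have "norm (Kint (-s - 1) 1 (of_real X)) \<le> fact k * I * X powr (- real k)" if s: "norm s \<le> R" and X: "X > 0" for s X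
  proof -
    have "norm (Kint (-s - 1) 1 (of_real X)) \<le> (\<integral>y. fact k * X powr (- real k) * (exp (1 * y - 1 * exp y) + exp (c2 * y - 1 * exp y)) \<partial>lborel)"
      unfolding Kint_def
    proof (rule Bochner_Integration.integral_norm_bound_integral)
      show "integrable lborel (\<lambda>x. exp ((-s - 1) * of_real x - 1 * of_real (exp x) - of_real X * of_real (exp (- x))))"
        by (rule Kint_integrable) (use X in auto)
      show "integrable lborel (\<lambda>y. fact k * X powr (- real k) * (exp (1 * y - 1 * exp y) + exp (c2 * y - 1 * exp y)))"
        using int by (intro integrable_mult_right) auto
      fix y :: real
      define u where "u = X * exp (-y)"
      have u: "u > 0" using X by (simp add: u_def)
      have "u ^ k / fact k \<le> exp u" using u by (intro power_div_fact_le_exp) auto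
      hence "exp (-u) \<le> fact k / u ^ k" using u by (simp add: exp_minus field_simps)
      also have "u ^ k = X powr real k * exp (- real k * y)"
        using X by (simp add: u_def power_mult_distrib powr_realpow exp_of_nat_mult[symmetric])
      finally have e: "exp (-u) \<le> fact k * X powr (- real k) * exp (real k * y)"
        by (simp add: powr_minus exp_minus field_simps)
      have "norm (exp ((-s - 1) * of_real y - 1 * of_real (exp y) - of_real X * of_real (exp (- y))))
         = exp (((- Re s - 1) * y - exp y) + (-u))"
        by (simp add: u_def del: of_real_exp)
      also have "\<dots> = exp ((- Re s - 1) * y - exp y) * exp (-u)" by (rule exp_add)
      also have "\<dots> \<le> exp ((- Re s - 1) * y - exp y) * (fact k * X powr (- real k) * exp (real k * y))"
        using e by (intro mult_left_mono) auto
      also have "\<dots> = fact k * X powr (- real k) * (exp ((real k - Re s - 1) * y) * exp (- exp y))"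
        by (simp add: exp_add[symmetric] exp_diff[symmetric] algebra_simps)
      also have "\<dots> \<le> fact k * X powr (- real k) * ((exp (1 * y) + exp (c2 * y)) * exp (- exp y))"
        using assms s abs_Re_le_cmod[of s] unfolding c2_def
        by (intro mult_left_mono mult_right_mono exp_convex_bound) auto
      also have "(exp (1 * y) + exp (c2 * y)) * exp (- exp y) = exp (1 * y - 1 * exp y) + exp (c2 * y - 1 * exp y)"
        by (simp add: exp_diff exp_minus field_simps)
      finally show "norm (exp ((-s - 1) * of_real y - 1 * of_real (exp y) - of_real X * of_real (exp (- y))))
        \<le> fact k * X powr (- real k) * (exp (1 * y - 1 * exp y) + exp (c2 * y - 1 * exp y))" .
    qed
    also have "\<dots> = fact k * X powr (- real k) * I" unfolding I_def by (rule integral_mult_right_zero)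
    finally show ?thesis by (simp add: mult_ac)
  qed
  thus ?thesis using that[of "fact k * I"] I by simp
qed

lemma sin_half_pi_bound:
  assumes "compact S" "S \<inter> \<int> = {}"
  obtains C where "C \<ge> 0" "\<And>s. s \<in> S \<Longrightarrow> norm (1 / sin (complex_of_real pi * s / 2)) \<le> C"
proof -
  have nz: "sin (complex_of_real pi * s / 2) \<noteq> 0" if "s \<in> S" for s
  proof
    assume "sin (complex_of_real pi * s / 2) = 0"
    hence "sin (complex_of_real pi * s) = 0" using cos_sin_half(2)[of "of_real pi * s / 2"] by simp
    thus False using assms(2) that by (auto simp: sin_pi_eq_0_iff)
  qed
  have "compact ((\<lambda>s. 1 / sin (complex_of_real pi * s / 2)) ` S)"
    by (intro compact_continuous_image assms continuous_intros) (use nz in auto)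
  from compact_imp_bounded[OF this] obtain C where "\<And>s. s \<in> S \<Longrightarrow> norm (1 / sin (complex_of_real pi * s / 2)) \<le> C"
    unfolding bounded_iff by auto
  thus ?thesis using that[of "max C 0"] by (meson max.cobounded2 max.coboundedI1)
qed

text \<open>The two series of order -s - 1 agree at X = 0, so their difference is O(X) by a mean
  value estimate; the other term is of size X^(Re s + 1). On (0, 1] both are dominated by the power
  with exponent \<delta>.\<close>

lemma Vker_bound_small:
  assumes S: "compact S" "S \<inter> \<int> = {}" and Re: "\<And>s. s \<in> S \<Longrightarrow> Re s \<ge> \<delta> - 1" and \<delta>: "0 < \<delta>" "\<delta> \<le> 1"
  obtains C where "C \<ge> 0" "\<And>s X. s \<in> S \<Longrightarrow> 0 < X \<Longrightarrow> X \<le> 1 \<Longrightarrow> norm (Vker s (of_real X)) \<le> C * X powr \<delta>"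
proof -
  obtain R where R: "\<And>\<nu>. \<nu> \<in> S \<Longrightarrow> norm \<nu> \<le> R" using compact_imp_bounded[OF S(1)] by (auto simp: bounded_iff)
  obtain B where B: "B \<ge> 0" "\<And>\<nu> X. \<nu> \<in> cball 0 (R + 1) \<Longrightarrow> norm (bser \<nu> X) \<le> B * exp (2 * norm X)"
    using bser_bound[of "cball 0 (R + 1)"] by (metis compact_cball)
  obtain D where D: "D \<ge> 0" "\<And>s. s \<in> S \<Longrightarrow> norm (1 / sin (complex_of_real pi * s / 2)) \<le> D"
    using sin_half_pi_bound[OF S] by blast
  define M where "M = B * exp 2"
  have M: "M \<ge> 0" using B by (simp add: M_def)
  have "norm (Vker s (of_real X)) \<le> 4 * M * D * X powr \<delta>" if s: "s \<in> S" and X: "0 < X" "X \<le> 1" for s X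
  proof -
    have b: "norm (bser \<nu> Y) \<le> M" if "\<nu> \<in> cball 0 (R + 1)" "norm Y \<le> 1" for \<nu> Y
      using B(2)[OF that(1), of Y] that(2) B(1) unfolding M_def
      by (intro order_trans[OF _ mult_left_mono[of "exp (2 * norm Y)" "exp 2" B]]) auto
    have in1: "- s \<in> cball 0 (R + 1)" "s + 1 \<in> cball 0 (R + 1)" using R[OF s] norm_triangle_ineq[of s 1] by auto
    have "norm (bser (-s - 1) (of_real X) - bser (-s - 1) (- of_real X)) \<le> M * norm (of_real X - (- of_real X) :: complex)"
    proof (rule field_differentiable_bound[of "cball 0 1" _ "bser (-s - 1 + 1)"])
      show "(bser (-s - 1) has_field_derivative bser (-s - 1 + 1) z) (at z within cball 0 1)" for z
        by (rule has_field_derivative_at_within[OF bser_deriv])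
    qed (use X b in1 in auto)
    also have "norm (of_real X - (- of_real X) :: complex) = 2 * X"
      using X by (simp flip: of_real_add)
    finally have 1: "norm (bser (-s - 1) (of_real X) - bser (-s - 1) (- of_real X)) \<le> M * (2 * X)" .
    have "X = X powr 1" using X by simp
    also have "\<dots> \<le> X powr \<delta>" using X \<delta> by (intro powr_mono') auto
    finally have X1: "X \<le> X powr \<delta>" .
    have X2: "X powr (Re s + 1) \<le> X powr \<delta>" using X Re[OF s] by (intro powr_mono') auto
    have 2: "norm (of_real X powr (s + 1) * (bser (s + 1) (of_real X) + bser (s + 1) (- of_real X))) \<le> X powr (Re s + 1) * (M + M)"
      unfolding norm_mult using X b[OF in1(2)]
      by (intro mult_mono norm_triangle_le add_mono) (auto simp: norm_powr_real_powr)
    have "norm (bser (-s - 1) (of_real X) - bser (-s - 1) (- of_real X) - of_real X powr (s + 1) * (bser (s + 1) (of_real X) + bser (s + 1) (- of_real X)))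
      \<le> M * (2 * X) + X powr (Re s + 1) * (M + M)" by (rule order_trans[OF norm_triangle_ineq4 add_mono[OF 1 2]])
    also have "\<dots> \<le> M * (2 * X powr \<delta>) + X powr \<delta> * (M + M)"
      using X1 X2 M by (intro add_mono mult_left_mono mult_right_mono) auto
    also have "\<dots> = 4 * M * X powr \<delta>" by (simp add: algebra_simps)
    finally have "norm (bser (-s - 1) (of_real X) - bser (-s - 1) (- of_real X) - of_real X powr (s + 1) * (bser (s + 1) (of_real X) + bser (s + 1) (- of_real X)))
       * norm (1 / sin (complex_of_real pi * s / 2)) \<le> (4 * M * X powr \<delta>) * D"
      using D(2)[OF s] M by (intro mult_mono) auto
    thus ?thesis by (simp add: Vker_def norm_divide mult_ac)
  qed
  thus ?thesis using that[of "4 * M * D"] M D by simp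
qed

text \<open>The two terms with positive argument grow exponentially one by one, but the connection
  formula combines them into a multiple of \<open>Kint\<close>, which decays. The terms with
  argument -X are of type J, and the energy estimate at t = 2 sqrt X gives X^(Re s/2 + 1/4) for each
  of them.\<close>

lemma Vker_bound_large:
  assumes S: "compact S" "S \<inter> \<int> = {}" and Re: "\<And>s. s \<in> S \<Longrightarrow> Re s > - 1"
  obtains C where "C \<ge> 0" "\<And>s X. s \<in> S \<Longrightarrow> 1 \<le> X \<Longrightarrow> norm (Vker s (of_real X)) \<le> C * X powr (Re s / 2 + 1 / 4)"
proof -
  obtain R where R: "\<And>\<nu>. \<nu> \<in> S \<Longrightarrow> norm \<nu> \<le> R" using compact_imp_bounded[OF S(1)] by (auto simp: bounded_iff)
  obtain E where E: "E \<ge> 0" "\<And>\<nu> t. \<nu> \<in> cball 0 (R + 1) \<Longrightarrow> t \<ge> 1 \<Longrightarrow> norm (bser \<nu> (- (of_real t)\<^sup>2 / 4)) \<le> E * t powr (- Re \<nu> - 1 / 2)"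
    using bessel_energy_bound[of "cball 0 (R + 1)"] by (metis compact_cball)
  obtain D where D: "D \<ge> 0" "\<And>s. s \<in> S \<Longrightarrow> norm (1 / sin (complex_of_real pi * s / 2)) \<le> D"
    using sin_half_pi_bound[OF S] by blast
  obtain k :: nat where k: "real k \<ge> R + 2" using real_arch_simple by blast
  obtain K where K: "K \<ge> 0" "\<And>s X. norm s \<le> R \<Longrightarrow> X > 0 \<Longrightarrow> norm (Kint (-s - 1) 1 (of_real X)) \<le> K * X powr (- real k)"
    using Kint_decay[OF k] by blast
  obtain N where N: "\<And>s. s \<in> S \<Longrightarrow> norm (sin (complex_of_real pi * s)) \<le> N"
  proof -
    have "compact ((\<lambda>s. sin (complex_of_real pi * s)) ` S)" by (intro compact_continuous_image S continuous_intros)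
    from compact_imp_bounded[OF this] show ?thesis using that unfolding bounded_iff by auto
  qed
  define T where "T = 2 powr (R + 1)"
  define C where "C = (\<bar>N\<bar> * K + 2 * (E * T)) * D"
  have "norm (Vker s (of_real X)) \<le> C * X powr (Re s / 2 + 1 / 4)" if s: "s \<in> S" and X: "1 \<le> X" for s X
  proof -
    define m where "m = Re s / 2 + 1 / 4"
    define t where "t = 2 * sqrt X"
    have "sqrt X \<ge> 1" using X by simp
    hence t1: "t \<ge> 1" unfolding t_def by linarith
    have t2: "- (of_real t)\<^sup>2 / 4 = - complex_of_real X"
      using X by (simp add: t_def power_mult_distrib flip: of_real_power)
    note t = t1 t2
    have tp: "t powr a = 2 powr a * X powr (a / 2)" for a
      using X by (simp add: t_def powr_mult powr_half_sqrt[symmetric] powr_powr)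
    have rs: "norm s \<le> R" "Re s \<le> R" "Re s > -1" using R[OF s] complex_Re_le_cmod[of s] Re[OF s] by auto
    have R0: "R \<ge> 0" using rs norm_ge_zero order_trans by blast
    have in1: "-s - 1 \<in> cball 0 (R + 1)" "s + 1 \<in> cball 0 (R + 1)"
      using rs(1) norm_triangle_ineq[of s 1] norm_triangle_ineq4[of "-s" 1] by auto
    have 1: "norm (bser (-s - 1) (- of_real X)) \<le> E * T * X powr m"
    proof -
      have "norm (bser (-s - 1) (- of_real X)) \<le> E * t powr (Re s + 1 / 2)"
        using E(2)[OF in1(1) t(1)] unfolding t(2) by (simp add: add.commute)
      also have "t powr (Re s + 1 / 2) = 2 powr (Re s + 1 / 2) * X powr m" unfolding tp m_def by (simp add: field_simps)
      also have "E * \<dots> \<le> E * (T * X powr m)" unfolding T_def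
        using E(1) rs by (intro mult_left_mono mult_right_mono powr_mono) auto
      finally show ?thesis by (simp add: mult_ac)
    qed
    have 2: "norm (of_real X powr (s + 1) * bser (s + 1) (- of_real X)) \<le> E * T * X powr m"
    proof -
      have "norm (bser (s + 1) (- of_real X)) \<le> E * t powr (- Re s - 3 / 2)"
        using E(2)[OF in1(2) t(1)] unfolding t(2) by (simp add: algebra_simps)
      also have "t powr (- Re s - 3 / 2) = 2 powr (- Re s - 3 / 2) * X powr ((- Re s - 3 / 2) / 2)" by (rule tp)
      also have "E * \<dots> \<le> E * (T * X powr ((- Re s - 3 / 2) / 2))" unfolding T_def
        using E(1) rs R0 by (intro mult_left_mono mult_right_mono powr_mono) auto
      finally have "norm (of_real X powr (s + 1) * bser (s + 1) (- of_real X)) \<le> X powr (Re s + 1) * (E * (T * X powr ((- Re s - 3 / 2) / 2)))"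
        unfolding norm_mult using X by (intro mult_mono) (auto simp: norm_powr_real_powr)
      also have "\<dots> = E * T * (X powr (Re s + 1) * X powr ((- Re s - 3 / 2) / 2))" by (simp add: mult_ac)
      also have "X powr (Re s + 1) * X powr ((- Re s - 3 / 2) / 2) = X powr m"
        unfolding m_def powr_add[symmetric] by (simp add: field_simps)
      finally show ?thesis .
    qed
    have 3: "norm (bser (-s - 1) (of_real X) - of_real X powr (s + 1) * bser (s + 1) (of_real X)) \<le> \<bar>N\<bar> * K * X powr m"
    proof -
      have X0: "complex_of_real X \<noteq> 0" using X by simp
      have sn: "sin (of_real pi * (s + 1)) = - sin (of_real pi * s)" by (simp add: sin_add ring_distribs)
      have "- sin (of_real pi * s) / of_real pi * Kint (-s - 1) 1 (of_real X) = of_real X powr (- (s + 1)) * bser (-s - 1) (of_real X) - bser (s + 1) (of_real X)"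
        using Kint_eq_bser[of 1 "of_real X" "s + 1"] X unfolding sn by simp
      hence "of_real X powr (s + 1) * (- sin (of_real pi * s) / of_real pi * Kint (-s - 1) 1 (of_real X)) =
         of_real X powr (s + 1) * of_real X powr (- (s + 1)) * bser (-s - 1) (of_real X) - of_real X powr (s + 1) * bser (s + 1) (of_real X)"
        by (simp only: right_diff_distrib mult.assoc)
      also have "of_real X powr (s + 1) * of_real X powr (- (s + 1)) = 1" using X0 by (subst powr_minus) simp
      finally have e: "bser (-s - 1) (of_real X) - of_real X powr (s + 1) * bser (s + 1) (of_real X) =
        of_real X powr (s + 1) * (- sin (of_real pi * s) / of_real pi * Kint (-s - 1) 1 (of_real X))" by simp
      have "norm (bser (-s - 1) (of_real X) - of_real X powr (s + 1) * bser (s + 1) (of_real X)) =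
        X powr (Re s + 1) * (norm (sin (complex_of_real pi * s)) / pi * norm (Kint (-s - 1) 1 (of_real X)))"
        unfolding e norm_mult norm_divide norm_minus_cancel using X by (simp add: norm_powr_real_powr)
      also have "\<dots> \<le> X powr (Re s + 1) * (\<bar>N\<bar> / 1 * (K * X powr (- real k)))"
        using N[OF s] K(2)[OF rs(1), of X] X pi_ge_two by (intro mult_left_mono mult_mono frac_le) auto
      also have "\<dots> = \<bar>N\<bar> * K * X powr (Re s + 1 - real k)" by (simp add: powr_add[symmetric] powr_diff powr_minus field_simps)
      also have "\<dots> \<le> \<bar>N\<bar> * K * X powr m" using k rs R0 X K(1) unfolding m_def by (intro mult_left_mono powr_mono) auto
      finally show ?thesis .
    qed
    have "norm (bser (-s - 1) (of_real X) - bser (-s - 1) (- of_real X) - of_real X powr (s + 1) * (bser (s + 1) (of_real X) + bser (s + 1) (- of_real X)))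
       = norm ((bser (-s - 1) (of_real X) - of_real X powr (s + 1) * bser (s + 1) (of_real X)) - bser (-s - 1) (- of_real X) - of_real X powr (s + 1) * bser (s + 1) (- of_real X))"
      by (simp add: algebra_simps)
    also have "\<dots> \<le> (\<bar>N\<bar> * K * X powr m + E * T * X powr m) + E * T * X powr m"
      by (rule order_trans[OF norm_triangle_ineq4 add_mono[OF order_trans[OF norm_triangle_ineq4 add_mono[OF 3 1]] 2]])
    finally have "norm (bser (-s - 1) (of_real X) - bser (-s - 1) (- of_real X) - of_real X powr (s + 1) * (bser (s + 1) (of_real X) + bser (s + 1) (- of_real X)))
       * norm (1 / sin (complex_of_real pi * s / 2)) \<le> ((\<bar>N\<bar> * K * X powr m + E * T * X powr m) + E * T * X powr m) * D"
      using D(2)[OF s] by (rule mult_mono) (use K E D in \<open>auto simp: T_def\<close>)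
    thus ?thesis by (simp add: Vker_def norm_divide C_def m_def algebra_simps)
  qed
  moreover have "C \<ge> 0" unfolding C_def T_def using K E D by auto
  ultimately show ?thesis using that by blast
qed

section \<open>Laplace transforms of the Bessel series and of the primitive\<close>

lemma
  assumes P: "Re P > 0" and \<alpha>: "Re \<alpha> > -1" and e: "norm e = 1"
  shows integrable_laplace_bser: "integrable lborel (\<lambda>y. exp ((\<alpha> + 1) * of_real y - P * of_real (exp y)) * bser \<nu> (e * of_real (exp y)))"
    and laplace_bser: "(\<lambda>n. rGamma (\<nu> + of_nat n + 1) / fact n * e ^ n * (Gamma (\<alpha> + of_nat n + 1) * P powr (- (\<alpha> + of_nat n + 1))))
       sums (\<integral>y. exp ((\<alpha> + 1) * of_real y - P * of_real (exp y)) * bser \<nu> (e * of_real (exp y)) \<partial>lborel)"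
proof -
  define c where "c n = rGamma (\<nu> + of_nat n + 1) / fact n * e ^ n" for n
  define f where "f n y = c n * exp ((\<alpha> + of_nat n + 1) * of_real y - P * of_real (exp y))" for n and y :: real
  define a p where "a = Re \<alpha>" and "p = Re P"
  have ap: "a > -1" "p > 0" using P \<alpha> by (auto simp: a_def p_def)
  have int: "integrable lborel (f n)" for n
    unfolding f_def by (intro integrable_mult_right integrable_exp_Gamma) (use ap in \<open>auto simp: a_def p_def\<close>)
  have If: "(\<integral>y. f n y \<partial>lborel) = c n * (Gamma (\<alpha> + of_nat n + 1) * P powr (- (\<alpha> + of_nat n + 1)))" for n
    unfolding f_def by (subst integral_mult_right_zero, subst integral_exp_Gamma) (use ap in \<open>auto simp: a_def p_def\<close>)
  have nf: "norm (f n y) = norm (c n) * exp ((a + real n + 1) * y - p * exp y)" for n y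
    by (simp add: f_def norm_mult a_def p_def del: of_real_exp)
  have Inf: "(\<integral>y. norm (f n y) \<partial>lborel) = norm (c n) * (Gamma (a + real n + 1) * p powr (- (a + real n + 1)))" for n
    unfolding nf using ap by (subst integral_mult_right_zero, subst integral_exp_Gamma_real) auto
  have sumf: "(\<lambda>n. f n y) sums (exp ((\<alpha> + 1) * of_real y - P * of_real (exp y)) * bser \<nu> (e * of_real (exp y)))"
    and sumn: "summable (\<lambda>n. norm (f n y))" for y
  proof -
    have eq: "exp ((\<alpha> + 1) * of_real y - P * of_real (exp y)) * (rGamma (\<nu> + of_nat n + 1) / fact n * (e * of_real (exp y)) ^ n) = f n y" for n
    proof -
      have "complex_of_real (exp y) ^ n = exp (of_nat n * of_real y)" unfolding of_real_exp exp_of_nat_mult ..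
      thus ?thesis unfolding f_def c_def power_mult_distrib by (simp add: ring_distribs exp_add exp_diff mult_ac)
    qed
    show "(\<lambda>n. f n y) sums (exp ((\<alpha> + 1) * of_real y - P * of_real (exp y)) * bser \<nu> (e * of_real (exp y)))"
      unfolding eq[symmetric] bser_def by (intro sums_mult summable_sums bser_summable)
    show "summable (\<lambda>n. norm (f n y))"
      unfolding eq[symmetric] norm_mult[of "exp _"] by (intro summable_mult bser_summable_norm)
  qed
  \<comment> \<open>Termwise integration is justified by summing the integrals of the norms. The
    majorant \<open>u\<close> has the explicit ratio 2(a + n + 1) / ((n + 1)^2 p), which eventually
    falls below 1/2.\<close>
  have summ: "summable (\<lambda>n. \<integral>y. norm (f n y) \<partial>lborel)"
  proof -
    obtain C where C: "C \<ge> 0" "\<And>\<mu> n. \<mu> \<in> {\<nu>} \<Longrightarrow> norm (rGamma (\<mu> + of_nat n + 1)) \<le> C * 2 ^ n / fact n"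
      using rGamma_shift_bound[of "{\<nu>}"] by (metis compact_sing)
    define u where "u n = C * 2 ^ n / fact n / fact n * (Gamma (a + real n + 1) * p powr (- (a + real n + 1)))" for n
    have Gpos: "Gamma (a + real n + 1) > 0" for n using ap by (intro Gamma_real_pos) auto
    have u0: "u n \<ge> 0" for n unfolding u_def using C Gpos[of n] by (intro mult_nonneg_nonneg divide_nonneg_nonneg) (auto intro: less_imp_le)
    have uS: "u (Suc n) = u n * (2 * (a + real n + 1) / ((real n + 1)\<^sup>2 * p))" for n
    proof -
      have 1: "Gamma (a + real (Suc n) + 1) = (a + real n + 1) * Gamma (a + real n + 1)"
      proof -
        have "a + real n + 1 \<notin> \<int>\<^sub>\<le>\<^sub>0" using ap by (auto elim!: nonpos_Ints_cases)
        from Gamma_plus1[OF this] show ?thesis by (simp add: add_ac)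
      qed
      have 2: "p powr (- (a + real (Suc n) + 1)) = p powr (- (a + real n + 1)) / p"
        using ap powr_diff[of p "- (a + real n + 1)" 1] by (simp add: algebra_simps)
      show ?thesis unfolding u_def 1 2 using ap by (simp add: field_simps power2_eq_square)
    qed
    obtain N :: nat where N: "real N \<ge> 4 * (\<bar>a\<bar> + 1) / p" using real_arch_simple by blast
    have "summable u"
    proof (rule summable_ratio_test[of "1/2" N])
      fix n assume n: "n \<ge> N"
      have "4 * (\<bar>a\<bar> + 1) / p \<le> real n + 1" using N n by linarith
      hence "4 * (\<bar>a\<bar> + 1) \<le> p * (real n + 1)" using ap by (simp add: field_simps)
      hence "4 * (\<bar>a\<bar> + 1) * (real n + 1) \<le> p * (real n + 1) * (real n + 1)" by (intro mult_right_mono) auto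
      moreover have h2: "a + real n + 1 \<le> (\<bar>a\<bar> + 1) * (real n + 1)"
      proof -
        have "(\<bar>a\<bar> + 1) * (real n + 1) = \<bar>a\<bar> * real n + \<bar>a\<bar> + real n + 1" by (simp add: algebra_simps)
        moreover have "\<bar>a\<bar> * real n \<ge> 0" by simp
        ultimately show ?thesis by linarith
      qed
      moreover have "4 * (a + real n + 1) \<le> 4 * (\<bar>a\<bar> + 1) * (real n + 1)"
        using mult_left_mono[OF h2, of 4] by (simp only: mult.assoc)
      ultimately have "4 * (a + real n + 1) \<le> p * (real n + 1) * (real n + 1)" by linarith
      hence "4 * (a + real n + 1) \<le> (real n + 1)\<^sup>2 * p" by (simp add: power2_eq_square mult_ac)
      hence "2 * (a + real n + 1) / ((real n + 1)\<^sup>2 * p) \<le> 1 / 2" using ap by (simp add: divide_simps)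
      hence "u n * (2 * (a + real n + 1) / ((real n + 1)\<^sup>2 * p)) \<le> u n * (1 / 2)" by (rule mult_left_mono[OF _ u0])
      thus "norm (u (Suc n)) \<le> 1 / 2 * norm (u n)" using u0[of n] u0[of "Suc n"] uS[of n] by simp
    qed auto
    thus ?thesis
    proof (rule summable_comparison_test'[where N = 0])
      fix n :: nat
      have "norm (c n) \<le> C * 2 ^ n / fact n / fact n"
        unfolding c_def norm_mult norm_divide norm_power e
        using divide_right_mono[OF C(2)[of \<nu> n], of "fact n"] by simp
      hence "(\<integral>y. norm (f n y) \<partial>lborel) \<le> u n" unfolding Inf u_def
        using Gpos[of n] by (intro mult_right_mono) (auto intro: less_imp_le)
      thus "norm (\<integral>y. norm (f n y) \<partial>lborel) \<le> u n" by simp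
    qed
  qed
  note H = int AE_I2[OF sumn] summ
  have eqS: "(\<Sum>n. f n y) = exp ((\<alpha> + 1) * of_real y - P * of_real (exp y)) * bser \<nu> (e * of_real (exp y))" for y
    using sumf sums_iff by blast
  show "integrable lborel (\<lambda>y. exp ((\<alpha> + 1) * of_real y - P * of_real (exp y)) * bser \<nu> (e * of_real (exp y)))"
    using integrable_suminf[OF H] unfolding eqS .
  show "(\<lambda>n. rGamma (\<nu> + of_nat n + 1) / fact n * e ^ n * (Gamma (\<alpha> + of_nat n + 1) * P powr (- (\<alpha> + of_nat n + 1))))
       sums (\<integral>y. exp ((\<alpha> + 1) * of_real y - P * of_real (exp y)) * bser \<nu> (e * of_real (exp y)) \<partial>lborel)"
    using sums_integral[OF H] unfolding eqS If c_def .
qed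

text \<open>The Mittag-Leffler function E_{1,-s}. In the Laplace transform of
  \<open>bser (-s - 1)\<close> the n! from Euler's integral cancels the one in the coefficient, and
  this series remains.\<close>

definition Sser :: "complex \<Rightarrow> complex \<Rightarrow> complex" where
  "Sser s w = (\<Sum>n. rGamma (of_nat n - s) * w ^ n)"

lemma Sser_summable: "summable (\<lambda>n. rGamma (of_nat n - s) * w ^ n)" for s w :: complex
proof -
  obtain C where C: "C \<ge> 0" "\<And>\<mu> n. \<mu> \<in> {-s - 1} \<Longrightarrow> norm (rGamma (\<mu> + of_nat n + 1)) \<le> C * 2 ^ n / fact n"
    using rGamma_shift_bound[of "{-s - 1}"] by (metis compact_sing)
  show ?thesis
  proof (rule summable_comparison_test'[OF summable_mult[OF summable_exp_series, of C "2 * norm w"], of 0])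
    fix n
    have "norm (rGamma (of_nat n - s) * w ^ n) \<le> (C * 2 ^ n / fact n) * norm w ^ n"
      unfolding norm_mult norm_power using C(2)[of "-s - 1" n] by (intro mult_right_mono) (auto simp: algebra_simps)
    thus "norm (rGamma (of_nat n - s) * w ^ n) \<le> C * ((2 * norm w) ^ n / fact n)" by (simp add: power_mult_distrib)
  qed
qed

lemma Sser_holomorphic: "Sser s holomorphic_on A"
proof -
  have "(Sser s has_field_derivative (\<Sum>n. diffs (\<lambda>n. rGamma (of_nat n - s)) n * w ^ n)) (at w)" for w
    unfolding Sser_def[abs_def] by (rule termdiffs_strong_converges_everywhere) (rule Sser_summable)
  thus ?thesis by (meson holomorphic_onI field_differentiable_def field_differentiable_at_within)
qed

text \<open>In the variable r = e^x this is the integral of e^(-r) (1 + Pr)^(-s-2) dr over (0,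
  infinity). For P > 0 it equals P^(-s-2) e^(1/P) times the upper incomplete gamma function
  Gamma(-s-1, 1/P).\<close>

definition Nint :: "complex \<Rightarrow> complex \<Rightarrow> complex" where
  "Nint s P = (\<integral>x. exp (of_real x - of_real (exp x)) * (P * of_real (exp x) + 1) powr (-s - 2) \<partial>lborel)"

lemma norm_powr_le:
  assumes "c > 0" "c \<le> norm z" "Re w \<le> 0"
  shows "norm (z powr w) \<le> c powr Re w * exp (pi * \<bar>Im w\<bar>)"
proof -
  have z: "z \<noteq> 0" using assms by auto
  have "norm (z powr w) = exp (Re w * ln (norm z)) * exp (- (Im w * Im (Ln z)))"
    using z by (simp add: powr_def exp_diff exp_minus divide_inverse)
  also have "exp (Re w * ln (norm z)) = norm z powr Re w" using z by (simp add: powr_def)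
  also have "\<dots> \<le> c powr Re w" using assms by (intro powr_mono2') auto
  also have "- (Im w * Im (Ln z)) \<le> pi * \<bar>Im w\<bar>"
  proof -
    have "- (Im w * Im (Ln z)) \<le> \<bar>Im w\<bar> * \<bar>Im (Ln z)\<bar>" by (metis abs_ge_minus_self abs_mult)
    also have "\<dots> \<le> \<bar>Im w\<bar> * pi" using Im_Ln_le_pi[OF z] mpi_less_Im_Ln[OF z] by (intro mult_left_mono) auto
    finally show ?thesis by (simp add: mult.commute)
  qed
  finally show ?thesis by (simp add: mult_left_mono)
qed

lemma slit_shift_not_nonpos:
  fixes P :: complex
  assumes "P \<notin> \<real>\<^sub>\<le>\<^sub>0" "r \<ge> 0"
  shows "P * of_real r + 1 \<notin> \<real>\<^sub>\<le>\<^sub>0"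
proof
  assume "P * of_real r + 1 \<in> \<real>\<^sub>\<le>\<^sub>0"
  hence h: "Re P * r + 1 \<le> 0" "Im P * r = 0" by (auto simp: complex_nonpos_Reals_iff)
  hence "r \<noteq> 0" by auto
  hence "Im P = 0" "r > 0" using h assms by auto
  moreover have "Re P \<le> 0" using h \<open>r > 0\<close> by (smt (verit) mult_nonneg_nonneg)
  ultimately show False using assms by (auto simp: complex_nonpos_Reals_iff)
qed

text \<open>The lower bound is the distance of 0 from the line through 1 in direction P, hence
  uniform in r.\<close>

lemma slit_shift_lower:
  assumes "Im P \<noteq> 0"
  shows "norm (P * of_real r + 1) \<ge> \<bar>Im P\<bar> / norm P"
proof -
  have P: "P \<noteq> 0" using assms by auto
  have "\<bar>Im ((P * of_real r + 1) * cnj P)\<bar> \<le> norm ((P * of_real r + 1) * cnj P)" by (rule abs_Im_le_cmod)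
  moreover have "Im ((P * of_real r + 1) * cnj P) = - Im P" by (simp add: algebra_simps)
  ultimately have "\<bar>Im P\<bar> \<le> norm (P * of_real r + 1) * norm P" by (simp only: norm_mult complex_mod_cnj abs_minus_cancel)
  thus ?thesis using P by (simp add: divide_le_eq)
qed

lemma slit_shift_lower_Re:
  assumes "Re P \<ge> 0" "r \<ge> 0"
  shows "norm (P * of_real r + 1) \<ge> 1"
proof -
  have "Re (P * of_real r + 1) = Re P * r + 1" by simp
  moreover have "Re P * r \<ge> 0" using assms by simp
  ultimately show ?thesis using complex_Re_le_cmod[of "P * of_real r + 1"] by linarith
qed

lemma Nint_kernel_bound:
  assumes "Re s > -2" "c > 0" "c \<le> norm (P * of_real (exp x) + 1)"
  shows "norm (exp (of_real x - of_real (exp x)) * (P * of_real (exp x) + 1) powr (-s - 2))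
     \<le> (c powr (- Re s - 2) * exp (pi * \<bar>Im s\<bar>)) * exp (1 * x - 1 * exp x)"
proof -
  have "norm ((P * of_real (exp x) + 1) powr (-s - 2)) \<le> c powr Re (-s - 2) * exp (pi * \<bar>Im (-s - 2)\<bar>)"
    using assms by (intro norm_powr_le) auto
  hence "exp (x - exp x) * norm ((P * of_real (exp x) + 1) powr (-s - 2)) \<le> exp (x - exp x) * (c powr (- Re s - 2) * exp (pi * \<bar>Im s\<bar>))"
    by (intro mult_left_mono) auto
  thus ?thesis by (simp add: norm_mult mult_ac del: of_real_exp)
qed

lemma Nint_measurable: "(\<lambda>x. exp (of_real x - of_real (exp x)) * (P * of_real (exp x) + 1) powr (-s - 2)) \<in> borel_measurable lborel"
  for P s :: complex
  unfolding powr_def by measurable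

text \<open>For P near P0 the values Pr + 1 must stay away from 0 uniformly in r > 0. If P0 lies on
  the positive axis the real part ensures this, otherwise the distance of 0 from a line
  does.\<close>

lemma Nint_holomorphic:
  assumes s: "Re s > -2"
  shows "Nint s holomorphic_on (- \<real>\<^sub>\<le>\<^sub>0)"
  unfolding Nint_def[abs_def]
proof (rule holomorphic_param_integral)
  show "open (- \<real>\<^sub>\<le>\<^sub>0 :: complex set)" by (simp add: open_Compl)
  show "(\<lambda>P. exp (of_real x - of_real (exp x)) * (P * of_real (exp x) + 1) powr (-s - 2)) holomorphic_on - \<real>\<^sub>\<le>\<^sub>0" for x
    using slit_shift_not_nonpos[of _ "exp x"] by (intro holomorphic_intros) auto
  fix P0 :: complex assume P0: "P0 \<in> - \<real>\<^sub>\<le>\<^sub>0"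
  have "\<exists>r>0. \<exists>c>0. \<forall>P\<in>ball P0 r. \<forall>x. norm (P * of_real (exp x) + 1) \<ge> c"
  proof (cases "Im P0 = 0")
    case True
    hence p: "Re P0 > 0" using P0 by (auto simp: complex_nonpos_Reals_iff)
    have "\<forall>P\<in>ball P0 (Re P0). \<forall>x. norm (P * of_real (exp x) + 1) \<ge> 1"
    proof (intro ballI allI)
      fix P x assume "P \<in> ball P0 (Re P0)"
      hence "Re P \<ge> 0" using abs_Re_le_cmod[of "P0 - P"] by (auto simp: dist_norm)
      thus "1 \<le> norm (P * of_real (exp x) + 1)" by (intro slit_shift_lower_Re) auto
    qed
    thus ?thesis using p zero_less_one by blast
  next
    case False
    define d where "d = \<bar>Im P0\<bar> / 2"
    have "\<forall>P\<in>ball P0 d. \<forall>x. norm (P * of_real (exp x) + 1) \<ge> d / (norm P0 + d)"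
    proof (intro ballI allI)
      fix P x assume P: "P \<in> ball P0 d"
      have 1: "\<bar>Im P\<bar> \<ge> d" using abs_Im_le_cmod[of "P0 - P"] P by (auto simp: dist_norm d_def)
      have 2: "norm P \<le> norm P0 + d" using norm_triangle_sub[of P P0] P by (auto simp: dist_norm norm_minus_commute)
      have d: "d > 0" using False by (simp add: d_def)
      have "d / (norm P0 + d) \<le> \<bar>Im P\<bar> / norm P" using 1 2 d by (intro frac_le) auto
      also have "\<dots> \<le> norm (P * of_real (exp x) + 1)" using 1 d by (intro slit_shift_lower) auto
      finally show "d / (norm P0 + d) \<le> norm (P * of_real (exp x) + 1)" .
    qed
    moreover have "d > 0" "d / (norm P0 + d) > 0"
      using False by (auto simp: d_def intro!: divide_pos_pos add_nonneg_pos)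
    ultimately show ?thesis by blast
  qed
  then obtain r c where rc: "r > 0" "c > 0" "\<And>P x. P \<in> ball P0 r \<Longrightarrow> norm (P * of_real (exp x) + 1) \<ge> c" by blast
  show "\<exists>r>0. \<exists>g. integrable lborel g \<and> (\<forall>P\<in>ball P0 r \<inter> - \<real>\<^sub>\<le>\<^sub>0. \<forall>x\<in>space lborel.
     norm (exp (of_real x - of_real (exp x)) * (P * of_real (exp x) + 1) powr (-s - 2)) \<le> g x)"
  proof (intro exI[of _ r] conjI exI ballI)
    show "integrable lborel (\<lambda>x. (c powr (- Re s - 2) * exp (pi * \<bar>Im s\<bar>)) * exp (1 * x - 1 * exp x))"
      by (intro integrable_mult_right integrable_exp_one) auto
    show "norm (exp (of_real x - of_real (exp x)) * (P * of_real (exp x) + 1) powr (-s - 2))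
     \<le> (c powr (- Re s - 2) * exp (pi * \<bar>Im s\<bar>)) * exp (1 * x - 1 * exp x)" if "P \<in> ball P0 r \<inter> - \<real>\<^sub>\<le>\<^sub>0" for P x
      by (rule Nint_kernel_bound[OF s rc(2)]) (use that rc(3) in auto)
  qed (rule rc)
qed (rule Nint_measurable)

text \<open>The bound depends on P only through |Im P|/|P|, so it is constant along each ray from 0.
  This is what controls the integrals over rotated rays.\<close>

lemma Nint_bound:
  assumes s: "Re s > -2" and P: "Im P \<noteq> 0"
  shows "norm (Nint s P) \<le> (\<bar>Im P\<bar> / norm P) powr (- Re s - 2) * exp (pi * \<bar>Im s\<bar>)"
proof -
  define c where "c = \<bar>Im P\<bar> / norm P"
  have c: "c > 0" using P by (auto simp: c_def intro!: divide_pos_pos)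
  have b: "norm (exp (of_real x - of_real (exp x)) * (P * of_real (exp x) + 1) powr (-s - 2))
     \<le> (c powr (- Re s - 2) * exp (pi * \<bar>Im s\<bar>)) * exp (1 * x - 1 * exp x)" for x
    by (rule Nint_kernel_bound[OF s c]) (use slit_shift_lower[OF P] in \<open>auto simp: c_def\<close>)
  have i: "integrable lborel (\<lambda>x. (c powr (- Re s - 2) * exp (pi * \<bar>Im s\<bar>)) * exp (1 * x - 1 * exp x))"
    by (intro integrable_mult_right integrable_exp_one) auto
  have "norm (Nint s P) \<le> (\<integral>x. (c powr (- Re s - 2) * exp (pi * \<bar>Im s\<bar>)) * exp (1 * x - 1 * exp x) \<partial>lborel)"
    unfolding Nint_def
  proof (rule Bochner_Integration.integral_norm_bound_integral[OF _ i])
    show "integrable lborel (\<lambda>x. exp (of_real x - of_real (exp x)) * (P * of_real (exp x) + 1) powr (-s - 2))"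
      by (rule Bochner_Integration.integrable_bound[OF i Nint_measurable]) (use b in \<open>auto intro!: AE_I2 order_trans[OF b] simp del: of_real_exp\<close>)
  qed (rule b)
  also have "\<dots> = (c powr (- Re s - 2) * exp (pi * \<bar>Im s\<bar>)) * (Gamma 1 * 1 powr (-1))"
    by (subst integral_mult_right_zero, subst integral_exp_Gamma_real) auto
  finally show ?thesis by (simp add: c_def)
qed

lemma
  assumes P: "Re P > 0" and e: "norm e = 1"
  shows integrable_laplace_bser_neg: "integrable lborel (\<lambda>y. exp (of_real y - P * of_real (exp y)) * bser (-s - 1) (e * of_real (exp y)))"
    and laplace_bser_neg: "(\<integral>y. exp (of_real y - P * of_real (exp y)) * bser (-s - 1) (e * of_real (exp y)) \<partial>lborel) = Sser s (e / P) / P"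
proof -
  have nz: "P \<noteq> 0" using P by auto
  have 0: "Re 0 > -1" by simp
  show "integrable lborel (\<lambda>y. exp (of_real y - P * of_real (exp y)) * bser (-s - 1) (e * of_real (exp y)))"
    using integrable_laplace_bser[OF P 0 e, of "-s - 1"] by simp
  have "rGamma (-s - 1 + of_nat n + 1) / fact n * e ^ n * (Gamma (0 + of_nat n + 1) * P powr (- (0 + of_nat n + 1)))
     = rGamma (of_nat n - s) * (e / P) ^ n / P" for n
  proof -
    have 1: "P powr (- (0 + of_nat n + 1)) = 1 / P ^ Suc n"
      using nz powr_nat[of P "Suc n"] unfolding powr_minus by (simp add: add.commute divide_inverse)
    have 2: "Gamma (0 + of_nat n + 1) = (fact n :: complex)" using Gamma_fact[of n, where ?'a = complex] by (simp add: add.commute)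
    have 3: "-s - 1 + of_nat n + 1 = of_nat n - s" by simp
    show ?thesis unfolding 1 2 3 by (simp add: power_divide)
  qed
  hence "(\<lambda>n. rGamma (of_nat n - s) * (e / P) ^ n / P) sums (\<integral>y. exp (of_real y - P * of_real (exp y)) * bser (-s - 1) (e * of_real (exp y)) \<partial>lborel)"
    using laplace_bser[OF P 0 e, of "-s - 1"] by simp
  moreover have "(\<lambda>n. rGamma (of_nat n - s) * (e / P) ^ n / P) sums (Sser s (e / P) / P)"
    unfolding Sser_def by (intro sums_divide summable_sums Sser_summable)
  ultimately show "(\<integral>y. exp (of_real y - P * of_real (exp y)) * bser (-s - 1) (e * of_real (exp y)) \<partial>lborel) = Sser s (e / P) / P"
    by (rule sums_unique2)
qed

text \<open>Here the Gamma value of Euler's integral cancels the coefficient 1/Gamma (s + n + 2),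
  and the exponential series at e/P is left.\<close>

lemma
  assumes P: "Re P > 0" and e: "norm e = 1" and s: "Re s > -2"
  shows integrable_laplace_bser_pos: "integrable lborel (\<lambda>y. exp ((s + 2) * of_real y - P * of_real (exp y)) * bser (s + 1) (e * of_real (exp y)))"
    and laplace_bser_pos: "(\<integral>y. exp ((s + 2) * of_real y - P * of_real (exp y)) * bser (s + 1) (e * of_real (exp y)) \<partial>lborel) = P powr (-s - 2) * exp (e / P)"
proof -
  have nz: "P \<noteq> 0" using P by auto
  have s1: "Re (s + 1) > -1" using s by simp
  have s2: "s + 1 + 1 = s + 2" by simp
  show "integrable lborel (\<lambda>y. exp ((s + 2) * of_real y - P * of_real (exp y)) * bser (s + 1) (e * of_real (exp y)))"
    using integrable_laplace_bser[OF P s1 e, of "s + 1"] unfolding s2 .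
  have "rGamma (s + 1 + of_nat n + 1) / fact n * e ^ n * (Gamma (s + 1 + of_nat n + 1) * P powr (- (s + 1 + of_nat n + 1)))
     = P powr (-s - 2) * ((e / P) ^ n /\<^sub>R fact n)" for n
  proof -
    have "s + 1 + of_nat n + 1 \<notin> \<int>\<^sub>\<le>\<^sub>0" using s by (intro Re_pos_not_nonpos_Ints) simp
    hence 1: "rGamma (s + 1 + of_nat n + 1) * Gamma (s + 1 + of_nat n + 1) = 1"
      by (simp add: rGamma_inverse_Gamma Gamma_eq_zero_iff)
    have "- (s + 1 + of_nat n + 1) = (-s - 2) - of_nat n" by simp
    hence 2: "P powr (- (s + 1 + of_nat n + 1)) = P powr (-s - 2) / P ^ n"
      using nz powr_diff[of P "-s - 2" "of_nat n"] by (simp only: powr_nat if_False simp_thms)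
    have "rGamma (s + 1 + of_nat n + 1) / fact n * e ^ n * (Gamma (s + 1 + of_nat n + 1) * P powr (- (s + 1 + of_nat n + 1)))
      = (rGamma (s + 1 + of_nat n + 1) * Gamma (s + 1 + of_nat n + 1)) * (e ^ n / fact n * P powr (- (s + 1 + of_nat n + 1)))" by simp
    also have "\<dots> = P powr (-s - 2) * ((e / P) ^ n /\<^sub>R fact n)" unfolding 1 2 by (simp add: power_divide scaleR_conv_of_real field_simps)
    finally show ?thesis .
  qed
  hence "(\<lambda>n. P powr (-s - 2) * ((e / P) ^ n /\<^sub>R fact n)) sums (\<integral>y. exp ((s + 2) * of_real y - P * of_real (exp y)) * bser (s + 1) (e * of_real (exp y)) \<partial>lborel)"
    using laplace_bser[OF P s1 e, of "s + 1"] unfolding s2 by simp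
  moreover have "(\<lambda>n. P powr (-s - 2) * ((e / P) ^ n /\<^sub>R fact n)) sums (P powr (-s - 2) * exp (e / P))"
    by (intro sums_mult exp_converges)
  ultimately show "(\<integral>y. exp ((s + 2) * of_real y - P * of_real (exp y)) * bser (s + 1) (e * of_real (exp y)) \<partial>lborel) = P powr (-s - 2) * exp (e / P)"
    by (rule sums_unique2)
qed

text \<open>The double integral of \<open>F\<close> is evaluated in both orders. Integrating over y
  gives an Euler integral and then \<open>Nint\<close>; integrating over x gives
  \<open>Kint (-s - 1)\<close>, which the connection formula splits into two series with known
  Laplace transforms.\<close>

lemma Sser_eq_Nint_real:
  assumes s: "Re s > -1" and p: "p > 0"
  shows "Sser s (1 / of_real p) / of_real p = of_real p powr (-s - 2) * exp (1 / of_real p)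
    - sin (of_real pi * s) / of_real pi * Gamma (s + 2) * Nint s (of_real p)"
proof -
  define F where "F x y = exp ((s + 2) * of_real y - of_real p * of_real (exp y)) *
     exp ((-s - 1) * of_real x - 1 * of_real (exp x) - of_real (exp y) * of_real (exp (-x)))" for x y :: real
  define c where "c = sin (of_real pi * s) / of_real pi"
  have norm: "norm (F x y) = exp ((- Re s - 1) * x - exp x) * exp ((Re s + 2) * y - (p + exp (-x)) * exp y)" for x y
    by (simp add: F_def norm_mult del: of_real_exp flip: exp_add) (simp add: algebra_simps exp_diff exp_minus divide_inverse)
  have px: "p + exp (-x) > 0" for x using p by (simp add: add_pos_pos)
  have Fy: "(\<lambda>y. F x y) = (\<lambda>y. exp ((-s - 1) * of_real x - of_real (exp x)) * exp ((s + 2) * of_real y - of_real (p + exp (-x)) * of_real (exp y)))" for x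
    by (rule ext) (simp add: F_def flip: exp_add, simp add: algebra_simps)
  have inty: "integrable lborel (\<lambda>y. F x y)" for x
    unfolding Fy by (intro integrable_mult_right integrable_exp_Gamma) (use px s in auto)
  have Inty: "(\<integral>y. F x y \<partial>lborel) = Gamma (s + 2) * (exp (of_real x - of_real (exp x)) * (of_real p * of_real (exp x) + 1) powr (-s - 2))" for x
  proof -
    have "(\<integral>y. F x y \<partial>lborel) = exp ((-s - 1) * of_real x - of_real (exp x)) * (Gamma (s + 2) * of_real (p + exp (-x)) powr (- (s + 2)))"
      unfolding Fy by (subst integral_mult_right_zero, subst integral_exp_Gamma) (use px[of x] s in auto)
    \<comment> \<open>Pulling out e^(-x) creates the base p e^x + 1 of \<open>Nint\<close>; the
      power e^((s+2)x) that it leaves combines with e^((-s-1)x) to the e^x of that kernel.\<close>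
    also have "p + exp (-x) = (p * exp x + 1) * exp (-x)" by (simp add: exp_minus field_simps)
    also have "complex_of_real \<dots> powr (- (s + 2)) = of_real (p * exp x + 1) powr (- (s + 2)) * of_real (exp (-x)) powr (- (s + 2))"
      unfolding of_real_mult by (rule powr_mult_Re_pos) (use p in \<open>auto intro: add_pos_pos\<close>)
    also have "complex_of_real (exp (-x)) powr (- (s + 2)) = exp ((s + 2) * of_real x)"
      unfolding powr_def Ln_of_real[OF exp_gt_zero] by (simp add: algebra_simps)
    also have "exp ((-s - 1) * of_real x - of_real (exp x)) * (Gamma (s + 2) * (of_real (p * exp x + 1) powr (- (s + 2)) * exp ((s + 2) * of_real x)))
      = Gamma (s + 2) * ((exp ((-s - 1) * of_real x - of_real (exp x)) * exp ((s + 2) * of_real x)) * of_real (p * exp x + 1) powr (- (s + 2)))"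
      by (simp only: mult_ac)
    also have "exp ((-s - 1) * of_real x - of_real (exp x)) * exp ((s + 2) * of_real x) = exp (of_real x - of_real (exp x))"
      unfolding exp_add[symmetric] by (simp add: algebra_simps)
    finally show ?thesis by simp
  qed
  have meas: "case_prod F \<in> borel_measurable (lborel \<Otimes>\<^sub>M lborel)" unfolding F_def by measurable
  have "integrable (lborel \<Otimes>\<^sub>M lborel) (case_prod F)"
  proof (rule lborel_pair.Fubini_integrable[OF meas])
    have eq: "(\<integral>y. norm (F x y) \<partial>lborel) = exp ((- Re s - 1) * x - exp x) * (Gamma (Re s + 2) * (p + exp (-x)) powr (- (Re s + 2)))" for x
      unfolding norm by (subst integral_mult_right_zero, subst integral_exp_Gamma_real) (use px s in auto)
    have "integrable lborel (\<lambda>x. \<integral>y. norm (F x y) \<partial>lborel)"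
    proof (rule Bochner_Integration.integrable_bound)
      show "integrable lborel (\<lambda>x. Gamma (Re s + 2) * exp (1 * x - 1 * exp x))"
        by (intro integrable_mult_right integrable_exp_one) auto
      show "(\<lambda>x. \<integral>y. norm (F x y) \<partial>lborel) \<in> borel_measurable lborel" unfolding eq by measurable
      show "AE x in lborel. norm (\<integral>y. norm (F x y) \<partial>lborel) \<le> norm (Gamma (Re s + 2) * exp (1 * x - 1 * exp x))"
      proof (rule AE_I2)
        fix x :: real
        have G: "Gamma (Re s + 2) \<ge> 0" using s by (intro less_imp_le Gamma_real_pos) auto
        have "(p + exp (-x)) powr (- (Re s + 2)) \<le> exp (-x) powr (- (Re s + 2))" using s p by (intro powr_mono2') auto
        also have "\<dots> = exp ((Re s + 2) * x)" by (simp add: powr_def algebra_simps)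
        finally have "exp ((- Re s - 1) * x - exp x) * (Gamma (Re s + 2) * (p + exp (-x)) powr (- (Re s + 2))) \<le>
          exp ((- Re s - 1) * x - exp x) * (Gamma (Re s + 2) * exp ((Re s + 2) * x))" using G by (intro mult_left_mono) auto
        also have "\<dots> = Gamma (Re s + 2) * exp (1 * x - 1 * exp x)" by (simp add: exp_add[symmetric]) (simp add: algebra_simps)
        finally show "norm (\<integral>y. norm (F x y) \<partial>lborel) \<le> norm (Gamma (Re s + 2) * exp (1 * x - 1 * exp x))"
          unfolding eq using G by simp
      qed
    qed
    thus "integrable lborel (\<lambda>x. \<integral>y. norm (case (x, y) of (x, y) \<Rightarrow> F x y) \<partial>lborel)" by simp
    show "AE x in lborel. integrable lborel (\<lambda>y. case (x, y) of (x, y) \<Rightarrow> F x y)" using inty by simp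
  qed
  from lborel_pair.Fubini_integral[OF this]
  have fub: "(\<integral>y. \<integral>x. F x y \<partial>lborel \<partial>lborel) = Gamma (s + 2) * Nint s (of_real p)"
    unfolding Inty Nint_def by simp
  have Fx: "(\<integral>x. F x y \<partial>lborel) = exp ((s + 2) * of_real y - of_real p * of_real (exp y)) * Kint (-s - 1) 1 (of_real (exp y))" for y
    unfolding F_def Kint_def by simp
  have P: "Re (of_real p) > 0" using p by simp
  note i1 = integrable_laplace_bser_neg[OF P, of 1 s] laplace_bser_neg[OF P, of 1 s]
  note i3 = integrable_laplace_bser_pos[OF P, of 1 s] laplace_bser_pos[OF P, of 1 s]
  have pt: "- c * (\<integral>x. F x y \<partial>lborel) = exp (of_real y - of_real p * of_real (exp y)) * bser (-s - 1) (1 * of_real (exp y))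
    - exp ((s + 2) * of_real y - of_real p * of_real (exp y)) * bser (s + 1) (1 * of_real (exp y))" for y
  proof -
    have sn: "sin (of_real pi * (s + 1)) = - sin (of_real pi * s)" by (simp add: sin_add ring_distribs)
    have pw: "complex_of_real (exp y) powr (- (s + 1)) = exp (- (s + 1) * of_real y)"
      unfolding powr_def Ln_of_real[OF exp_gt_zero] by simp
    have "- c * Kint (-s - 1) 1 (of_real (exp y)) = exp (- (s + 1) * of_real y) * bser (-s - 1) (of_real (exp y)) - bser (s + 1) (of_real (exp y))"
      using Kint_eq_bser[of 1 "of_real (exp y)" "s + 1"] unfolding sn pw c_def by (simp del: of_real_exp)
    hence "- c * (\<integral>x. F x y \<partial>lborel) = exp ((s + 2) * of_real y - of_real p * of_real (exp y)) *
       (exp (- (s + 1) * of_real y) * bser (-s - 1) (of_real (exp y)) - bser (s + 1) (of_real (exp y)))"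
      unfolding Fx by (metis mult.left_commute)
    also have "\<dots> = (exp ((s + 2) * of_real y - of_real p * of_real (exp y)) * exp (- (s + 1) * of_real y)) * bser (-s - 1) (of_real (exp y))
      - exp ((s + 2) * of_real y - of_real p * of_real (exp y)) * bser (s + 1) (of_real (exp y))" by (simp add: algebra_simps)
    also have "exp ((s + 2) * of_real y - of_real p * of_real (exp y)) * exp (- (s + 1) * of_real y) = exp (of_real y - of_real p * of_real (exp y))"
      unfolding exp_add[symmetric] by (simp add: algebra_simps)
    finally show ?thesis by simp
  qed
  have "- c * (Gamma (s + 2) * Nint s (of_real p)) = (\<integral>y. - c * (\<integral>x. F x y \<partial>lborel) \<partial>lborel)"
    unfolding fub[symmetric] by (rule integral_mult_right_zero[symmetric])
  also have "\<dots> = Sser s (1 / of_real p) / of_real p - of_real p powr (-s - 2) * exp (1 / of_real p)"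
    unfolding pt using i1 i3 s by (subst Bochner_Integration.integral_diff) auto
  finally show ?thesis unfolding c_def by (simp add: algebra_simps)
qed

text \<open>Both sides are holomorphic in the plane slit along the negative axis, which for nonreal
  P contains -P as well; the transform of the primitive uses the formula at both points.\<close>

lemma Sser_eq_Nint:
  assumes s: "Re s > -1" and P: "P \<notin> \<real>\<^sub>\<le>\<^sub>0"
  shows "Sser s (1 / P) / P = P powr (-s - 2) * exp (1 / P) - sin (of_real pi * s) / of_real pi * Gamma (s + 2) * Nint s P"
proof (rule holomorphic_eqI_on_reals[of "\<lambda>P. Sser s (1 / P) / P" "- \<real>\<^sub>\<le>\<^sub>0"
     "\<lambda>P. P powr (-s - 2) * exp (1 / P) - sin (of_real pi * s) / of_real pi * Gamma (s + 2) * Nint s P" 0 1 P])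
  have nz: "P \<noteq> 0" if "P \<in> - \<real>\<^sub>\<le>\<^sub>0" for P :: complex using that by auto
  have "(\<lambda>P. Sser s (1 / P)) holomorphic_on - \<real>\<^sub>\<le>\<^sub>0"
  proof -
    have "(\<lambda>P::complex. 1 / P) holomorphic_on - \<real>\<^sub>\<le>\<^sub>0" using nz by (intro holomorphic_intros) auto
    from holomorphic_on_compose[OF this Sser_holomorphic, of s] show ?thesis by (simp add: o_def)
  qed
  thus "(\<lambda>P. Sser s (1 / P) / P) holomorphic_on - \<real>\<^sub>\<le>\<^sub>0" using nz by (intro holomorphic_intros) auto
  show "(\<lambda>P. P powr (-s - 2) * exp (1 / P) - sin (of_real pi * s) / of_real pi * Gamma (s + 2) * Nint s P) holomorphic_on - \<real>\<^sub>\<le>\<^sub>0"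
    using nz s by (intro holomorphic_intros Nint_holomorphic) auto
  show "connected (- \<real>\<^sub>\<le>\<^sub>0 :: complex set)"
  proof -
    have "(\<real>\<^sub>\<le>\<^sub>0 :: complex set) = complex_of_real ` {..0}" by (auto simp: nonpos_Reals_def)
    thus ?thesis using starlike_imp_connected[OF starlike_slotted_complex_plane_left[of 0]]
      by (simp add: Compl_eq_Diff_UNIV)
  qed
qed (use P s Sser_eq_Nint_real in \<open>auto simp: open_Compl\<close>)

text \<open>The identity for \<open>Sser\<close> is applied at P and at -P, and the terms with
  e^(1/P) cancel. The principal power at -P differs from the one at P by e^(j pi s), and e^(j pi s)
  - 1 = 2j sin (pi s/2) e^(j pi s/2) removes the denominator of \<open>Vker\<close>. In the
  \<open>Nint\<close> terms the factor sin (pi s) does the same and leaves cos (pi s/2) times a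
  function that is even in P.\<close>

lemma laplace_Vker:
  assumes nz: "sin (of_real pi * s / 2) \<noteq> 0" and s: "Re s > -1" and P: "Re P > 0" "Im P \<noteq> 0"
    and j: "j = (if Im P > 0 then \<i> else - \<i>)"
  shows "(\<integral>y. exp (of_real y - P * of_real (exp y)) * Vker s (of_real (exp y)) \<partial>lborel) =
      2 * j * exp (j * of_real pi * s / 2) * P powr (-s - 2) * exp (- 1 / P)
      - 2 * cos (of_real pi * s / 2) * Gamma (s + 2) / of_real pi * (Nint s P + Nint s (-P))"
proof -
  define S C where "S = sin (of_real pi * s / 2)" and "C = cos (of_real pi * s / 2)"
  define A where "A e y = exp (of_real y - P * of_real (exp y)) * bser (-s - 1) (e * of_real (exp y))" for e :: complex and y :: real
  define B where "B e y = exp ((s + 2) * of_real y - P * of_real (exp y)) * bser (s + 1) (e * of_real (exp y))" for e :: complex and y :: real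
  have s2: "Re s > -2" using s by simp
  have iA: "integrable lborel (A e)" "(\<integral>y. A e y \<partial>lborel) = Sser s (e / P) / P"
   and iB: "integrable lborel (B e)" "(\<integral>y. B e y \<partial>lborel) = P powr (-s - 2) * exp (e / P)" if "norm e = 1" for e
    unfolding A_def B_def using integrable_laplace_bser_neg[OF P(1) that, of s] laplace_bser_neg[OF P(1) that, of s]
      integrable_laplace_bser_pos[OF P(1) that s2] laplace_bser_pos[OF P(1) that s2] by auto
  have eq: "exp (of_real y - P * of_real (exp y)) * Vker s (of_real (exp y)) = (A 1 y - A (-1) y - (B 1 y + B (-1) y)) / S" for y
  proof -
    have pw: "complex_of_real (exp y) powr (s + 1) = exp ((s + 1) * of_real y)"
      unfolding powr_def Ln_of_real[OF exp_gt_zero] by simp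
    have "exp ((s + 2) * of_real y - P * of_real (exp y)) = exp (of_real y - P * of_real (exp y)) * exp ((s + 1) * of_real y)"
      unfolding exp_add[symmetric] by (simp add: algebra_simps)
    thus ?thesis unfolding A_def B_def Vker_def S_def pw by (simp add: algebra_simps diff_divide_distrib add_divide_distrib)
  qed
  have "(\<integral>y. exp (of_real y - P * of_real (exp y)) * Vker s (of_real (exp y)) \<partial>lborel) =
    (Sser s (1 / P) / P - Sser s (-1 / P) / P - (P powr (-s - 2) * exp (1 / P) + P powr (-s - 2) * exp (-1 / P))) / S"
    unfolding eq using iA[of 1] iA[of "-1"] iB[of 1] iB[of "-1"] by simp
  also have "Sser s (1 / P) / P = P powr (-s - 2) * exp (1 / P) - sin (of_real pi * s) / of_real pi * Gamma (s + 2) * Nint s P"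
    using P by (intro Sser_eq_Nint s) (auto simp: complex_nonpos_Reals_iff)
  also have "Sser s (-1 / P) / P = - (Sser s (1 / (-P)) / (-P))" by simp
  also have "Sser s (1 / (-P)) / (-P) = (-P) powr (-s - 2) * exp (1 / (-P)) - sin (of_real pi * s) / of_real pi * Gamma (s + 2) * Nint s (-P)"
    using P by (intro Sser_eq_Nint s) (auto simp: complex_nonpos_Reals_iff)
  \<comment> \<open>The principal logarithm satisfies Ln (-P) = Ln P - j pi, with j carrying the
    sign of Im P; the summand -2 in the exponent contributes only e^(2 pi j) = 1.\<close>
  also have "(-P) powr (-s - 2) = P powr (-s - 2) * exp (j * of_real pi * s)"
  proof -
    have "P \<noteq> 0" using P by auto
    moreover from this have "Ln (-P) = Ln P - j * of_real pi" using P unfolding j by (subst Ln_minus) auto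
    moreover have "exp ((-s - 2) * (Ln P - j * of_real pi)) = exp ((-s - 2) * Ln P) * exp (j * of_real pi * s) * exp (j * (2 * of_real pi))"
      by (simp add: algebra_simps flip: exp_add)
    moreover have "exp (j * (2 * of_real pi)) = 1" unfolding j using exp_two_pi_i exp_two_pi_i'
      by (simp add: exp_minus mult_ac)
    ultimately show ?thesis by (simp add: powr_def)
  qed
  also have "exp (j * of_real pi * s) = 1 + 2 * j * S * exp (j * of_real pi * s / 2)"
  proof -
    have j2: "j * j = -1" unfolding j by simp
    have E: "exp (j * of_real pi * s / 2) = C + j * S"
    proof (cases "Im P > 0")
      case True
      thus ?thesis using exp_Euler[of "of_real pi * s / 2"] by (simp add: j C_def S_def mult_ac)
    next
      case False
      thus ?thesis using exp_Euler[of "- (of_real pi * s / 2)"] by (simp add: j C_def S_def mult_ac)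
    qed
    have "exp (j * of_real pi * s) = exp (j * of_real pi * s / 2 + j * of_real pi * s / 2)" by (simp add: mult_ac)
    also have "\<dots> = exp (j * of_real pi * s / 2) * exp (j * of_real pi * s / 2)" by (rule exp_add)
    finally have "exp (j * of_real pi * s) = exp (j * of_real pi * s / 2) * exp (j * of_real pi * s / 2)" .
    also have "\<dots> = (C + j * S) * (C + j * S)" unfolding E ..
    also have "\<dots> = (C\<^sup>2 + S\<^sup>2) + 2 * j * S * (C + j * S)" using j2 by algebra
    also have "C\<^sup>2 + S\<^sup>2 = 1" unfolding C_def S_def by (simp add: add.commute)
    finally show ?thesis unfolding E .
  qed
  also have "sin (of_real pi * s) = 2 * S * C" using cos_sin_half(2)[of "of_real pi * s / 2"] by (simp add: S_def C_def)
  also have "(P powr (-s - 2) * exp (1 / P) - 2 * S * C / of_real pi * Gamma (s + 2) * Nint s P -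
       - (P powr (-s - 2) * (1 + 2 * j * S * exp (j * of_real pi * s / 2)) * exp (1 / (-P)) - 2 * S * C / of_real pi * Gamma (s + 2) * Nint s (-P)) -
       (P powr (-s - 2) * exp (1 / P) + P powr (-s - 2) * exp (-1 / P))) / S
     = 2 * j * exp (j * of_real pi * s / 2) * P powr (-s - 2) * exp (- 1 / P)
      - 2 * C * Gamma (s + 2) / of_real pi * (Nint s P + Nint s (-P))"
    using nz unfolding S_def[symmetric] by (simp add: field_simps)
  finally show "(\<integral>y. exp (of_real y - P * of_real (exp y)) * Vker s (of_real (exp y)) \<partial>lborel) =
      2 * j * exp (j * of_real pi * s / 2) * P powr (-s - 2) * exp (- 1 / P)
      - 2 * cos (of_real pi * s / 2) * Gamma (s + 2) / of_real pi * (Nint s P + Nint s (-P))" unfolding C_def .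
qed

section \<open>Averages over a circle of orders\<close>

abbreviation unit_interval :: "real measure" where
  "unit_interval \<equiv> restrict_space lborel {0..1}"

lemma finite_measure_unit_interval: "finite_measure unit_interval"
  by (rule finite_measureI) (simp add: emeasure_restrict_space)

lemma integral_unit_interval_const [simp]: "(\<integral>\<theta>. (c::real) \<partial>unit_interval) = c"
  by (simp add: measure_restrict_space)

text \<open>Cauchy's integral formula for the centre: in the parametrisation over [0, 1] the factor
  1/(u - s) cancels against the derivative of the path up to 2 pi i.\<close>

lemma circle_mean_value:
  assumes f: "f holomorphic_on U" and U: "open U" and sub: "cball s r \<subseteq> U" and r: "r > 0"
  shows "integrable unit_interval (\<lambda>\<theta>. f (circlepath s r \<theta>))"
    and "(\<integral>\<theta>. f (circlepath s r \<theta>) \<partial>unit_interval) = f s"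
proof -
  have "((\<lambda>u. f u / (u - s)) has_contour_integral (2 * of_real pi * \<i> * f s)) (circlepath s r)"
  proof (rule Cauchy_integral_circlepath)
    show "continuous_on (cball s r) f" using f sub holomorphic_on_imp_continuous_on continuous_on_subset by blast
    show "f holomorphic_on ball s r" using f sub ball_subset_cball holomorphic_on_subset by blast
  qed (use r in auto)
  hence "((\<lambda>\<theta>. f (circlepath s r \<theta>) / (circlepath s r \<theta> - s) * vector_derivative (circlepath s r) (at \<theta> within {0..1}))
     has_integral (2 * of_real pi * \<i> * f s)) {0..1}" by (simp add: has_contour_integral_def)
  hence "((\<lambda>\<theta>. 2 * of_real pi * \<i> * f (circlepath s r \<theta>)) has_integral (2 * of_real pi * \<i> * f s)) {0..1}"
  proof (rule has_integral_eq[rotated])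
    fix \<theta> :: real assume "\<theta> \<in> {0..1}"
    hence v: "vector_derivative (circlepath s r) (at \<theta> within {0..1}) = 2 * of_real pi * \<i> * of_real r * exp (2 * of_real pi * \<i> * of_real \<theta>)"
      using vector_derivative_circlepath01[of \<theta> s r] by auto
    have c: "circlepath s r \<theta> - s = of_real r * exp (2 * of_real pi * \<i> * of_real \<theta>)" by (simp add: circlepath)
    show "f (circlepath s r \<theta>) / (circlepath s r \<theta> - s) * vector_derivative (circlepath s r) (at \<theta> within {0..1})
      = 2 * of_real pi * \<i> * f (circlepath s r \<theta>)"
      unfolding v c using r by simp
  qed
  from has_integral_mult_right[OF this, of "1 / (2 * of_real pi * \<i>)"]
  have I: "((\<lambda>\<theta>. f (circlepath s r \<theta>)) has_integral f s) {0..1}" by simp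
  have "circlepath s r \<theta> \<in> cball s r" for \<theta>
    using r by (simp add: circlepath dist_norm norm_mult)
  hence "continuous_on {0..1} (\<lambda>\<theta>. f (circlepath s r \<theta>))"
    using sub by (intro continuous_on_compose2[OF holomorphic_on_imp_continuous_on[OF f]])
       (auto simp: circlepath intro!: continuous_intros)
  hence si: "set_integrable lborel {0..1} (\<lambda>\<theta>. f (circlepath s r \<theta>))"
    using borel_integrable_compact[of "{0..1}" "\<lambda>\<theta>. f (circlepath s r \<theta>)"]
    by (simp add: set_integrable_def indicator_def[abs_def] if_distrib cong: if_cong)
  thus "integrable unit_interval (\<lambda>\<theta>. f (circlepath s r \<theta>))"
    by (simp add: integrable_restrict_space set_integrable_def)
  have "(\<integral>\<theta>. f (circlepath s r \<theta>) \<partial>unit_interval) = (LINT \<theta>:{0..1}|lborel. f (circlepath s r \<theta>))"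
    by (simp add: integral_restrict_space set_lebesgue_integral_def)
  also have "\<dots> = f s" using set_borel_integral_eq_integral(2)[OF si] I by (simp add: integral_unique)
  finally show "(\<integral>\<theta>. f (circlepath s r \<theta>) \<partial>unit_interval) = f s" .
qed

lemma Nint_holomorphic_order:
  assumes P: "Im P \<noteq> 0"
  shows "(\<lambda>s. Nint s P) holomorphic_on {s. Re s > -1}"
  unfolding Nint_def
proof (rule holomorphic_param_integral)
  define c where "c = \<bar>Im P\<bar> / norm P"
  have P0: "norm P > 0" "P \<notin> \<real>\<^sub>\<le>\<^sub>0" using P by (auto simp: complex_nonpos_Reals_iff)
  have c: "c > 0" "c \<le> 1" using P P0 abs_Im_le_cmod[of P] by (auto simp: c_def)
  fix s0 :: complex assume s0: "s0 \<in> {s. Re s > -1}"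
  show "\<exists>r>0. \<exists>g. integrable lborel g \<and> (\<forall>s\<in>ball s0 r \<inter> {s. Re s > -1}. \<forall>x\<in>space lborel.
     norm (exp (of_real x - of_real (exp x)) * (P * of_real (exp x) + 1) powr (-s - 2)) \<le> g x)"
  proof (intro exI[of _ 1] conjI exI ballI)
    show "integrable lborel (\<lambda>x. (c powr (- Re s0 - 3) * exp (pi * (\<bar>Im s0\<bar> + 1))) * exp (1 * x - 1 * exp x))"
      by (intro integrable_mult_right integrable_exp_one) auto
    fix s x assume s: "s \<in> ball s0 1 \<inter> {s. Re s > -1}"
    have d: "\<bar>Re s - Re s0\<bar> < 1" "\<bar>Im s - Im s0\<bar> < 1"
      using s abs_Re_le_cmod[of "s0 - s"] abs_Im_le_cmod[of "s0 - s"] by (auto simp: dist_norm)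
    have "norm (exp (of_real x - of_real (exp x)) * (P * of_real (exp x) + 1) powr (-s - 2))
      \<le> (c powr (- Re s - 2) * exp (pi * \<bar>Im s\<bar>)) * exp (1 * x - 1 * exp x)"
      by (rule Nint_kernel_bound) (use s c slit_shift_lower[OF P] in \<open>auto simp: c_def\<close>)
    also have "c powr (- Re s - 2) \<le> c powr (- Re s0 - 3)" using c d by (intro powr_mono') auto
    also have "exp (pi * \<bar>Im s\<bar>) \<le> exp (pi * (\<bar>Im s0\<bar> + 1))" using d by simp
    finally show "norm (exp (of_real x - of_real (exp x)) * (P * of_real (exp x) + 1) powr (-s - 2))
      \<le> (c powr (- Re s0 - 3) * exp (pi * (\<bar>Im s0\<bar> + 1))) * exp (1 * x - 1 * exp x)"
      by (simp add: mult_right_mono mult_left_mono)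
  qed auto
next
  have P0: "P \<notin> \<real>\<^sub>\<le>\<^sub>0" using P by (auto simp: complex_nonpos_Reals_iff)
  show "(\<lambda>s. exp (of_real x - of_real (exp x)) * (P * of_real (exp x) + 1) powr (-s - 2)) holomorphic_on {s. Re s > -1}" for x
    using slit_shift_not_nonpos[OF P0, of "exp x"] by (intro holomorphic_intros) auto
qed (rule open_halfspace_Re_gt Nint_measurable)+

lemma Vker_measurable [measurable (raw)]:
  assumes [measurable]: "f \<in> borel_measurable M" "g \<in> borel_measurable M"
  shows "(\<lambda>x. Vker (f x) (g x)) \<in> borel_measurable M"
proof -
  have [measurable]: "sin \<in> borel_measurable (borel :: complex measure)"
    by (intro borel_measurable_continuous_onI continuous_intros)
  show ?thesis unfolding Vker_def powr_def by measurable
qed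

lemma circlepath_measurable [measurable]: "circlepath s r \<in> borel_measurable borel"
  unfolding circlepath by (intro borel_measurable_continuous_onI continuous_intros)

text \<open>A crude bound at complex X, whose purpose is the domination when the average over the
  orders is differentiated in X.\<close>

lemma Vker_local_bound:
  assumes S: "compact S" "S \<inter> \<int> = {}" and Re: "\<And>s. s \<in> S \<Longrightarrow> Re s > -1"
  obtains C where "\<And>s X. s \<in> S \<Longrightarrow> Re X > 0 \<Longrightarrow> norm X \<le> M \<Longrightarrow> norm (Vker s X) \<le> C"
proof -
  obtain R where R: "\<And>\<nu>. \<nu> \<in> S \<Longrightarrow> norm \<nu> \<le> R" using compact_imp_bounded[OF S(1)] by (auto simp: bounded_iff)
  obtain B where B: "B \<ge> 0" "\<And>\<nu> X. \<nu> \<in> cball 0 (R + 1) \<Longrightarrow> norm (bser \<nu> X) \<le> B * exp (2 * norm X)"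
    using bser_bound[of "cball 0 (R + 1)"] by (metis compact_cball)
  obtain D where D: "D \<ge> 0" "\<And>s. s \<in> S \<Longrightarrow> norm (1 / sin (complex_of_real pi * s / 2)) \<le> D"
    using sin_half_pi_bound[OF S] by blast
  define b where "b = B * exp (2 * M)"
  define p where "p = (1 + \<bar>M\<bar>) powr (R + 1) * exp (pi * R)"
  have "norm (Vker s X) \<le> (b + b + p * (b + b)) * D" if s: "s \<in> S" and X: "Re X > 0" "norm X \<le> M" for s X
  proof -
    have bb: "norm (bser \<nu> Y) \<le> b" if "\<nu> \<in> cball 0 (R + 1)" "norm Y \<le> M" for \<nu> Y
      using B(2)[OF that(1), of Y] that(2) B(1) unfolding b_def
      by (intro order_trans[OF _ mult_left_mono[of "exp (2 * norm Y)" "exp (2 * M)" B]]) auto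
    have in1: "-s - 1 \<in> cball 0 (R + 1)" "s + 1 \<in> cball 0 (R + 1)"
      using R[OF s] norm_triangle_ineq[of s 1] norm_triangle_ineq4[of "-s" 1] by auto
    have X0: "X \<noteq> 0" using X by auto
    have b0: "b \<ge> 0" unfolding b_def using B by simp
    have "norm (X powr (s + 1)) = norm X powr (Re s + 1) * exp (- (Im s * Im (Ln X)))"
      using X0 by (simp add: powr_def exp_diff exp_minus divide_inverse)
    also have "norm X powr (Re s + 1) \<le> (1 + \<bar>M\<bar>) powr (Re s + 1)"
      using X Re[OF s] by (intro powr_mono2) auto
    also have "\<dots> \<le> (1 + \<bar>M\<bar>) powr (R + 1)" using R[OF s] complex_Re_le_cmod[of s] by (intro powr_mono) auto
    also have "- (Im s * Im (Ln X)) \<le> pi * R"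
    proof -
      have "- (Im s * Im (Ln X)) \<le> \<bar>Im s\<bar> * \<bar>Im (Ln X)\<bar>" by (metis abs_ge_minus_self abs_mult)
      also have "\<dots> \<le> R * pi" using Im_Ln_le_pi[OF X0] mpi_less_Im_Ln[OF X0] R[OF s] abs_Im_le_cmod[of s]
        by (intro mult_mono) (auto intro: order_trans[of 0 "norm s"])
      finally show ?thesis by (simp add: mult.commute)
    qed
    finally have p: "norm (X powr (s + 1)) \<le> p" unfolding p_def by (simp add: mult_left_mono mult_right_mono)
    have p0: "p \<ge> 0" unfolding p_def by simp
    have 2: "norm (X powr (s + 1) * (bser (s + 1) X + bser (s + 1) (-X))) \<le> p * (b + b)"
      unfolding norm_mult using p p0 X bb[OF in1(2)] by (intro mult_mono norm_triangle_le add_mono) auto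
    have 1: "norm (bser (-s - 1) X - bser (-s - 1) (-X)) \<le> b + b"
      using X bb[OF in1(1), of X] bb[OF in1(1), of "-X"] by (intro order_trans[OF norm_triangle_ineq4] add_mono) auto
    have "norm (bser (-s - 1) X - bser (-s - 1) (-X) - X powr (s + 1) * (bser (s + 1) X + bser (s + 1) (-X))) \<le> b + b + p * (b + b)"
      by (rule order_trans[OF norm_triangle_ineq4 add_mono[OF 1 2]])
    hence "norm (bser (-s - 1) X - bser (-s - 1) (-X) - X powr (s + 1) * (bser (s + 1) X + bser (s + 1) (-X)))
       * norm (1 / sin (complex_of_real pi * s / 2)) \<le> (b + b + p * (b + b)) * D"
      using D(2)[OF s] b0 p0 by (intro mult_mono) auto
    thus ?thesis by (simp add: Vker_def norm_divide)
  qed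
  thus ?thesis using that by blast
qed

lemma sin_half_pi_nz: "s \<notin> \<int> \<Longrightarrow> sin (complex_of_real pi * s / 2) \<noteq> 0"
proof
  assume "s \<notin> \<int>" "sin (complex_of_real pi * s / 2) = 0"
  hence "sin (complex_of_real pi * s) = 0" using cos_sin_half(2)[of "of_real pi * s / 2"] by simp
  thus False using \<open>s \<notin> \<int>\<close> by (auto simp: sin_pi_eq_0_iff)
qed

text \<open>At even \<open>s\<close> the function \<open>Vker s\<close> has to be read as a removable limit. Averaging over a small
  circle of orders around \<open>s\<close> treats all orders uniformly, by the mean value property.\<close>

lemma Koshliakov_primitive:
  assumes s: "Re s > -1" and \<epsilon>: "\<epsilon> > 0"
  obtains V C \<delta> where "C \<ge> 0" "\<delta> > 0"
    "\<And>X. X > 0 \<Longrightarrow> (V has_vector_derivative Koshliakov_g s X) (at X)"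
    "\<And>X. 0 < X \<Longrightarrow> X \<le> 1 \<Longrightarrow> norm (V X) \<le> C * X powr \<delta>"
    "\<And>X. 1 \<le> X \<Longrightarrow> norm (V X) \<le> C * X powr (Re s / 2 + 1 / 4 + \<epsilon>)"
    "\<And>P j. Re P > 0 \<Longrightarrow> Im P \<noteq> 0 \<Longrightarrow> j = (if Im P > 0 then \<i> else - \<i>) \<Longrightarrow>
      (\<integral>y. exp (of_real y - P * of_real (exp y)) * V (exp y) \<partial>lborel) =
      2 * j * exp (j * of_real pi * s / 2) * P powr (-s - 2) * exp (- 1 / P)
      - 2 * cos (of_real pi * s / 2) * Gamma (s + 2) / of_real pi * (Nint s P + Nint s (-P))"
proof -
  obtain r0 where r0: "r0 > 0" "\<And>\<nu>. \<nu> \<noteq> s \<Longrightarrow> dist \<nu> s < r0 \<Longrightarrow> \<nu> \<notin> \<int>"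
    using eventually_not_Ints[of s] unfolding eventually_at by auto
  \<comment> \<open>The circle has to avoid all integers, the growth exponent may rise by at most
    \<epsilon>, and Re \<nu> has to stay above -1 by a fixed margin.\<close>
  define r where "r = min (r0 / 2) (min \<epsilon> ((Re s + 1) / 2))"
  have "r \<le> (Re s + 1) / 2" unfolding r_def by (meson min.cobounded2 order_trans)
  hence r: "r > 0" "r < r0" "r \<le> \<epsilon>" "r \<le> (Re s + 1) / 2"
    using r0(1) \<epsilon> s by (auto simp: r_def)
  define S where "S = sphere s r"
  define \<nu> where "\<nu> = circlepath s r"
  have [measurable]: "\<nu> \<in> borel_measurable borel" unfolding \<nu>_def by measurable
  have [measurable]: "\<nu> \<in> borel_measurable unit_interval"
    by (rule measurable_restrict_space1) simp
  have \<nu>S: "\<nu> \<theta> \<in> S" for \<theta> using r by (simp add: \<nu>_def S_def circlepath dist_norm norm_mult)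
  have cS: "compact S" by (simp add: S_def)
  have SI: "S \<inter> \<int> = {}" using r0(2) r by (auto simp: S_def dist_commute)
  have Re_diff: "\<bar>Re x - Re s\<bar> \<le> r" if "x \<in> cball s r" for x
    using that abs_Re_le_cmod[of "s - x"] by (auto simp: dist_norm)
  have cb: "cball s r \<subseteq> {s. Re s > -1}"
  proof
    fix x assume "x \<in> cball s r"
    from Re_diff[OF this] r s show "x \<in> {s. Re s > -1}" by auto
  qed
  have SR: "Re x > -1" if "x \<in> S" for x using that cb by (auto simp: S_def)
  \<comment> \<open>On the circle Re \<nu> + 1 >= (Re s + 1)/2, while the 1 is the order of
    vanishing granted by the difference of the two series in \<open>Vker\<close>.\<close>
  define \<delta> where "\<delta> = min 1 ((Re s + 1) / 2)"
  have \<delta>: "0 < \<delta>" "\<delta> \<le> 1" using s by (auto simp: \<delta>_def)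
  have S\<delta>: "Re x \<ge> \<delta> - 1" if "x \<in> S" for x
    using Re_diff[of x] r that by (auto simp: S_def \<delta>_def min_def)
  obtain C1 where C1: "C1 \<ge> 0" "\<And>s X. s \<in> S \<Longrightarrow> 0 < X \<Longrightarrow> X \<le> 1 \<Longrightarrow> norm (Vker s (of_real X)) \<le> C1 * X powr \<delta>"
    using Vker_bound_small[OF cS SI S\<delta> \<delta>] by blast
  obtain C2 where C2: "C2 \<ge> 0" "\<And>s X. s \<in> S \<Longrightarrow> 1 \<le> X \<Longrightarrow> norm (Vker s (of_real X)) \<le> C2 * X powr (Re s / 2 + 1 / 4)"
    using Vker_bound_large[OF cS SI SR] by blast
  define C where "C = max C1 C2"
  define m where "m = Re s / 2 + 1 / 4 + \<epsilon>"
  have C: "C \<ge> 0" "C1 \<le> C" "C2 \<le> C" using C1 by (auto simp: C_def)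
  have b1: "norm (Vker (\<nu> \<theta>) (of_real X)) \<le> C * X powr \<delta>" if "0 < X" "X \<le> 1" for \<theta> X
    using C1(2)[OF \<nu>S that, of \<theta>] C by (meson mult_right_mono order_trans powr_ge_zero)
  have b2: "norm (Vker (\<nu> \<theta>) (of_real X)) \<le> C * X powr m" if "1 \<le> X" for \<theta> X
  proof -
    have "norm (Vker (\<nu> \<theta>) (of_real X)) \<le> C2 * X powr (Re (\<nu> \<theta>) / 2 + 1 / 4)" by (rule C2(2)[OF \<nu>S that])
    also have "\<dots> \<le> C * X powr m" unfolding m_def
      using C C2 that Re_diff[of "\<nu> \<theta>"] \<nu>S[of \<theta>] r by (intro mult_mono powr_mono) (auto simp: S_def)
    finally show ?thesis .
  qed
  interpret U: finite_measure unit_interval by (rule finite_measure_unit_interval)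
  define V where "V X = (\<integral>\<theta>. Vker (\<nu> \<theta>) X \<partial>unit_interval)" for X :: complex
  have int: "integrable unit_interval (\<lambda>\<theta>. Vker (\<nu> \<theta>) (of_real X))" if "X > 0" for X
  proof (rule U.integrable_const_bound[of _ "C * X powr \<delta> + C * X powr m"])
    have "C * X powr \<delta> \<ge> 0" "C * X powr m \<ge> 0" using C by auto
    thus "AE \<theta> in unit_interval. norm (Vker (\<nu> \<theta>) (of_real X)) \<le> C * X powr \<delta> + C * X powr m"
      using b1[of X] b2[of X] that by (intro AE_I2) (smt (verit, best))
  qed measurable
  have Vle: "norm (V (of_real X)) \<le> K" if "X > 0" "\<And>\<theta>. norm (Vker (\<nu> \<theta>) (of_real X)) \<le> K" for X K
  proof -
    have "norm (V (of_real X)) \<le> (\<integral>\<theta>. K \<partial>unit_interval)" unfolding V_def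
      by (rule Bochner_Integration.integral_norm_bound_integral[OF int[OF that(1)]]) (use that(2) in auto)
    also have "\<dots> = K" by (rule integral_unit_interval_const)
    finally show ?thesis .
  qed
  have derV: "((\<lambda>X. V (of_real X)) has_vector_derivative Koshliakov_g s X) (at X)" if X: "X > 0" for X
  proof -
    have H: "((\<lambda>X. \<integral>\<theta>. Vker (\<nu> \<theta>) X \<partial>unit_interval) has_field_derivative
       (\<integral>\<theta>. deriv (\<lambda>X. Vker (\<nu> \<theta>) X) (of_real X) \<partial>unit_interval)) (at (complex_of_real X))"
    proof (rule has_field_derivative_param_integral)
      show "open {X. Re X > 0}" by (rule open_halfspace_Re_gt)
      show "(\<lambda>X. Vker (\<nu> \<theta>) X) holomorphic_on {X. Re X > 0}" for \<theta>
        using Vker_deriv by (auto simp: holomorphic_on_def field_differentiable_def intro: has_field_derivative_at_within)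
      fix X0 :: complex assume "X0 \<in> {X. Re X > 0}"
      obtain K where K: "\<And>s X. s \<in> S \<Longrightarrow> Re X > 0 \<Longrightarrow> norm X \<le> norm X0 + 1 \<Longrightarrow> norm (Vker s X) \<le> K"
        using Vker_local_bound[OF cS SI SR] by blast
      have "norm X \<le> norm X0 + 1" if "X \<in> ball X0 1" for X
        using that norm_triangle_sub[of X X0] by (auto simp: dist_norm norm_minus_commute)
      thus "\<exists>r>0. \<exists>g. integrable unit_interval g \<and> (\<forall>X\<in>ball X0 r \<inter> {X. 0 < Re X}. \<forall>\<theta>\<in>space unit_interval. norm (Vker (\<nu> \<theta>) X) \<le> g \<theta>)"
        using K[OF \<nu>S] by (intro exI[of _ 1] conjI exI[of _ "\<lambda>_. K"]) auto
    qed (use X in auto)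
    have nn: "\<nu> \<theta> \<notin> \<int>" for \<theta> using \<nu>S[of \<theta>] SI by auto
    have "deriv (\<lambda>X. Vker (\<nu> \<theta>) X) (of_real X) = Koshliakov_g (\<nu> \<theta>) X" for \<theta>
      unfolding Koshliakov_g_nonint[OF nn X] by (rule DERIV_imp_deriv, rule Vker_deriv) (use X in simp)
    hence "(\<integral>\<theta>. deriv (\<lambda>X. Vker (\<nu> \<theta>) X) (of_real X) \<partial>unit_interval) = (\<integral>\<theta>. Koshliakov_g (\<nu> \<theta>) X \<partial>unit_interval)" by simp
    \<comment> \<open>Since the Koshliakov kernel is holomorphic in the order, integers included,
      the mean value property returns its value at s itself.\<close>
    also have "\<dots> = Koshliakov_g s X" unfolding \<nu>_def
    proof (rule circle_mean_value(2)[OF _ open_halfspace_Re_gt cb r(1)])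
      show "(\<lambda>s. Koshliakov_g s X) holomorphic_on {s. - 1 < Re s}" unfolding Koshliakov_g_def
        using X by (intro holomorphic_intros Koshliakov_F_holomorphic_order) auto
    qed
    finally show ?thesis using has_vector_derivative_real_field[OF H, of UNIV] by (simp add: V_def)
  qed
  have lap: "(\<integral>y. exp (of_real y - P * of_real (exp y)) * V (of_real (exp y)) \<partial>lborel) =
      2 * j * exp (j * of_real pi * s / 2) * P powr (-s - 2) * exp (- 1 / P)
      - 2 * cos (of_real pi * s / 2) * Gamma (s + 2) / of_real pi * (Nint s P + Nint s (-P))"
    if P: "Re P > 0" "Im P \<noteq> 0" and j: "j = (if Im P > 0 then \<i> else - \<i>)" for P j
  proof -
    define G where "G y \<theta> = exp (of_real y - P * of_real (exp y)) * Vker (\<nu> \<theta>) (of_real (exp y))" for y \<theta> :: real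
    interpret LU: pair_sigma_finite lborel unit_interval ..
    have meas: "case_prod G \<in> borel_measurable (lborel \<Otimes>\<^sub>M unit_interval)" unfolding G_def by measurable
    define g where "g y = C * (exp ((1 + \<delta>) * y - Re P * exp y) + exp ((1 + m) * y - Re P * exp y))" for y
    have m1: "1 + m > 0" using s \<epsilon> by (simp add: m_def)
    have ig: "integrable lborel g" unfolding g_def
      using m1 \<delta> P by (intro integrable_mult_right Bochner_Integration.integrable_add integrable_exp_one) auto
    have G: "norm (G y \<theta>) \<le> g y" for y \<theta>
    proof -
      have "norm (Vker (\<nu> \<theta>) (of_real (exp y))) \<le> C * (exp (\<delta> * y) + exp (m * y))"
      proof (cases "y \<le> 0")
        case True
        hence "norm (Vker (\<nu> \<theta>) (of_real (exp y))) \<le> C * exp (\<delta> * y)" using b1[of "exp y" \<theta>] by (simp add: powr_def)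
        also have "\<dots> \<le> C * (exp (\<delta> * y) + exp (m * y))" using C by (intro mult_left_mono) auto
        finally show ?thesis .
      next
        case False
        hence "norm (Vker (\<nu> \<theta>) (of_real (exp y))) \<le> C * exp (m * y)" using b2[of "exp y" \<theta>] by (simp add: powr_def)
        also have "\<dots> \<le> C * (exp (\<delta> * y) + exp (m * y))" using C by (intro mult_left_mono) auto
        finally show ?thesis .
      qed
      hence "exp (y - Re P * exp y) * norm (Vker (\<nu> \<theta>) (of_real (exp y))) \<le> exp (y - Re P * exp y) * (C * (exp (\<delta> * y) + exp (m * y)))"
        by (intro mult_left_mono) auto
      also have "\<dots> = g y" unfolding g_def by (simp add: ring_distribs exp_add exp_diff field_simps)
      finally show ?thesis by (simp add: G_def norm_mult del: of_real_exp)
    qed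
    have mG: "G y \<in> borel_measurable unit_interval" for y unfolding G_def by measurable
    have iG: "integrable unit_interval (G y)" for y
      by (rule U.integrable_const_bound[OF AE_I2[OF G] mG])
    have "integrable (lborel \<Otimes>\<^sub>M unit_interval) (case_prod G)"
    proof (rule LU.Fubini_integrable[OF meas])
      show "integrable lborel (\<lambda>y. \<integral>\<theta>. norm (case (y, \<theta>) of (y, \<theta>) \<Rightarrow> G y \<theta>) \<partial>unit_interval)"
      proof (rule Bochner_Integration.integrable_bound[OF ig])
        show "(\<lambda>y. \<integral>\<theta>. norm (case (y, \<theta>) of (y, \<theta>) \<Rightarrow> G y \<theta>) \<partial>unit_interval) \<in> borel_measurable lborel"
          using meas by measurable
        show "AE y in lborel. norm (\<integral>\<theta>. norm (case (y, \<theta>) of (y, \<theta>) \<Rightarrow> G y \<theta>) \<partial>unit_interval) \<le> norm (g y)"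
        proof (rule AE_I2)
          fix y
          have "(\<integral>\<theta>. norm (G y \<theta>) \<partial>unit_interval) \<le> (\<integral>\<theta>. g y \<partial>unit_interval)"
            by (intro integral_mono integrable_norm iG G) auto
          also have "\<dots> = g y" by (rule integral_unit_interval_const)
          finally have "(\<integral>\<theta>. norm (G y \<theta>) \<partial>unit_interval) \<le> g y" .
          moreover have "(\<integral>\<theta>. norm (G y \<theta>) \<partial>unit_interval) \<ge> 0" by (intro Bochner_Integration.integral_nonneg) auto
          ultimately show "norm (\<integral>\<theta>. norm (case (y, \<theta>) of (y, \<theta>) \<Rightarrow> G y \<theta>) \<partial>unit_interval) \<le> norm (g y)" by simp
        qed
      qed
    qed (use iG in simp)
    from LU.Fubini_integral[OF this]
    have fub: "(\<integral>\<theta>. \<integral>y. G y \<theta> \<partial>lborel \<partial>unit_interval) = (\<integral>y. \<integral>\<theta>. G y \<theta> \<partial>unit_interval \<partial>lborel)" .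
    have nn: "\<nu> \<theta> \<notin> \<int>" for \<theta> using \<nu>S[of \<theta>] SI by auto
    define L where "L s = 2 * j * exp (j * of_real pi * s / 2) * P powr (-s - 2) * exp (- 1 / P)
      - 2 * cos (of_real pi * s / 2) * Gamma (s + 2) / of_real pi * (Nint s P + Nint s (-P))" for s
    have "(\<integral>y. exp (of_real y - P * of_real (exp y)) * V (of_real (exp y)) \<partial>lborel) = (\<integral>y. \<integral>\<theta>. G y \<theta> \<partial>unit_interval \<partial>lborel)"
      unfolding G_def V_def by (simp only: integral_mult_right_zero)
    also have "\<dots> = (\<integral>\<theta>. \<integral>y. G y \<theta> \<partial>lborel \<partial>unit_interval)" by (rule fub[symmetric])
    also have "\<dots> = (\<integral>\<theta>. L (\<nu> \<theta>) \<partial>unit_interval)"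
      unfolding G_def L_def
      by (intro Bochner_Integration.integral_cong refl laplace_Vker sin_half_pi_nz nn SR \<nu>S P j)
    \<comment> \<open>The transform \<open>L\<close> is holomorphic in the order, because the
      denominator sin (pi s/2) has already cancelled in it.\<close>
    also have "\<dots> = L s" unfolding \<nu>_def
    proof (rule circle_mean_value(2)[OF _ open_halfspace_Re_gt cb r(1)])
      have "s + 2 \<notin> \<int>\<^sub>\<le>\<^sub>0" if "Re s > -1" for s using that by (intro Re_pos_not_nonpos_Ints) simp
      moreover have "P \<noteq> 0" using P by auto
      ultimately show "L holomorphic_on {s. -1 < Re s}" unfolding L_def
        using P by (intro holomorphic_intros Nint_holomorphic_order) auto
    qed
    finally show ?thesis unfolding L_def .
  qed
  show ?thesis
  proof (rule that[of C \<delta> "\<lambda>X. V (of_real X)"])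
    show "norm (V (of_real X)) \<le> C * X powr \<delta>" if "0 < X" "X \<le> 1" for X
      by (rule Vle[OF that(1)]) (use b1 that in auto)
    show "norm (V (of_real X)) \<le> C * X powr (Re s / 2 + 1 / 4 + \<epsilon>)" if "1 \<le> X" for X
      by (rule Vle) (use b2 that in \<open>auto simp: m_def\<close>)
  qed (use C \<delta> derV lap in auto)
qed

lemma integrable_exp_abs:
  assumes "c > 0"
  shows "integrable lborel (\<lambda>y. exp (- c * \<bar>y\<bar>) :: real)"
proof -
  have 1: "integrable lborel (\<lambda>y. exp (c * y - 1 * exp y))" using assms by (intro integrable_exp_one) auto
  have 2: "integrable lborel (\<lambda>y. exp (c * (-y) - 1 * exp (-y)))"
    using lborel_integrable_real_affine[OF 1, of "-1" 0] by simp
  show ?thesis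
  proof (rule Bochner_Integration.integrable_bound)
    show "integrable lborel (\<lambda>y. exp 1 * (exp (c * y - 1 * exp y) + exp (c * (-y) - 1 * exp (-y))))"
      using 1 2 by (intro integrable_mult_right Bochner_Integration.integrable_add)
    show "AE y in lborel. norm (exp (- c * \<bar>y\<bar>)) \<le> norm (exp 1 * (exp (c * y - 1 * exp y) + exp (c * (-y) - 1 * exp (-y))))"
    proof (rule AE_I2)
      fix y :: real
      have *: "exp (c * z) \<le> exp 1 * exp (c * z - 1 * exp z)" if "z \<le> 0" for z
        using that by (simp flip: exp_add)
      have "exp (- c * \<bar>y\<bar>) \<le> exp 1 * (exp (c * y - 1 * exp y) + exp (c * (-y) - 1 * exp (-y)))"
      proof (cases "y \<le> 0")
        case True
        hence "exp (- c * \<bar>y\<bar>) \<le> exp 1 * exp (c * y - 1 * exp y)" using *[of y] by simp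
        thus ?thesis by (simp add: ring_distribs add_increasing2)
      next
        case False
        hence "exp (- c * \<bar>y\<bar>) \<le> exp 1 * exp (c * (-y) - 1 * exp (-y))" using *[of "-y"] by simp
        thus ?thesis by (simp add: ring_distribs add_increasing)
      qed
      thus "norm (exp (- c * \<bar>y\<bar>)) \<le> norm (exp 1 * (exp (c * y - 1 * exp y) + exp (c * (-y) - 1 * exp (-y))))" by simp
    qed
  qed measurable
qed

lemma strip_open_connected:
  "open {\<omega>. \<bar>Im \<omega>\<bar> < \<theta>}" "connected {\<omega>. \<bar>Im \<omega>\<bar> < \<theta>}"
proof -
  have eq: "{\<omega>. \<bar>Im \<omega>\<bar> < \<theta>} = {\<omega>. Im \<omega> < \<theta>} \<inter> {\<omega>. Im \<omega> > - \<theta>}" by auto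
  show "open {\<omega>. \<bar>Im \<omega>\<bar> < \<theta>}" unfolding eq by (intro open_Int open_halfspace_Im_lt open_halfspace_Im_gt)
  show "connected {\<omega>. \<bar>Im \<omega>\<bar> < \<theta>}" unfolding eq
    by (intro convex_connected convex_Int convex_halfspace_Im_lt convex_halfspace_Im_gt)
qed

subsection \<open>Rotation of rays\<close>

text \<open>Cauchy's theorem for the rotation of the ray \<open>(0, \<infinity>)\<close>, in logarithmic coordinates.\<close>

lemma integral_strip_shift:
  assumes f: "f holomorphic_on {\<omega>. \<bar>Im \<omega>\<bar> < \<theta>}" and \<omega>: "\<bar>Im \<omega>\<bar> < \<theta>"
    and dom: "\<And>\<omega>. \<bar>Im \<omega>\<bar> < \<theta> \<Longrightarrow> \<exists>r>0. \<exists>g. integrable lborel g \<and>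
      (\<forall>\<omega>'\<in>ball \<omega> r. \<bar>Im \<omega>'\<bar> < \<theta> \<longrightarrow> (\<forall>x. norm (f (of_real x + \<omega>')) \<le> g x))"
  shows "(\<integral>x. f (of_real x + \<omega>) \<partial>lborel) = (\<integral>x. f (of_real x) \<partial>lborel)"
\<comment> \<open>The integral is holomorphic in the shift and, by translation invariance, constant
  for real shifts; hence it is constant on the strip.\<close>
proof (rule holomorphic_eqI_on_reals[of "\<lambda>\<omega>. \<integral>x. f (of_real x + \<omega>) \<partial>lborel" "{\<omega>. \<bar>Im \<omega>\<bar> < \<theta>}" "\<lambda>_. \<integral>x. f (of_real x) \<partial>lborel" 0 1])
  show "(\<lambda>\<omega>. \<integral>x. f (of_real x + \<omega>) \<partial>lborel) holomorphic_on {\<omega>. \<bar>Im \<omega>\<bar> < \<theta>}"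
  proof (rule holomorphic_param_integral)
    fix \<omega> assume "\<omega> \<in> {\<omega>. \<bar>Im \<omega>\<bar> < \<theta>}"
    hence w: "\<bar>Im \<omega>\<bar> < \<theta>" by simp
    have "continuous_on UNIV (\<lambda>x. f (of_real x + \<omega>))"
      by (rule continuous_on_compose2[OF holomorphic_on_imp_continuous_on[OF f]])
         (use w in \<open>auto intro!: continuous_intros\<close>)
    thus "(\<lambda>x. f (of_real x + \<omega>)) \<in> borel_measurable lborel"
      unfolding measurable_lborel2 by (rule borel_measurable_continuous_onI)
    obtain r g where "r > 0" "integrable lborel g" "\<forall>\<omega>'\<in>ball \<omega> r. \<bar>Im \<omega>'\<bar> < \<theta> \<longrightarrow> (\<forall>x. norm (f (of_real x + \<omega>')) \<le> g x)"
      using dom[OF w] by blast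
    thus "\<exists>r>0. \<exists>g. integrable lborel g \<and> (\<forall>z\<in>ball \<omega> r \<inter> {\<omega>. \<bar>Im \<omega>\<bar> < \<theta>}. \<forall>x\<in>space lborel. norm (f (of_real x + z)) \<le> g x)"
      by (intro exI[of _ r] conjI exI[of _ g]) auto
  next
    fix x :: real
    show "(\<lambda>z. f (of_real x + z)) holomorphic_on {\<omega>. \<bar>Im \<omega>\<bar> < \<theta>}"
      by (rule holomorphic_on_compose_gen[OF _ f, unfolded o_def]) (auto intro!: holomorphic_intros)
  qed (rule strip_open_connected)
  fix x :: real
  have "(\<integral>y. f (of_real y) \<partial>lborel) = (\<integral>y. f (of_real (x + 1 * y)) \<partial>lborel)"
    by (subst lborel_integral_real_affine[of 1 _ x]) auto
  thus "of_real x \<in> {\<omega>. \<bar>Im \<omega>\<bar> < \<theta>} \<and> (\<integral>y. f (of_real y + of_real x) \<partial>lborel) = (\<integral>x. f (of_real x) \<partial>lborel)"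
    using \<omega> by (simp add: add.commute)
qed (use \<omega> strip_open_connected in auto)

text \<open>After a rotation by at most q the argument of \<zeta> e^v stays within |Arg \<zeta>| +
  q; as long as this is below pi/2, the bound forces exponential decay along the ray.\<close>

lemma Re_mult_exp_ge:
  assumes \<zeta>: "\<zeta> \<noteq> 0" and q: "\<bar>Im v\<bar> \<le> q" and le: "\<bar>Arg \<zeta>\<bar> + q \<le> pi"
  shows "Re (\<zeta> * exp v) \<ge> norm \<zeta> * cos (\<bar>Arg \<zeta>\<bar> + q) * exp (Re v)"
proof -
  have "\<zeta> = of_real (norm \<zeta>) * exp (\<i> * of_real (Arg \<zeta>))" by (rule Arg_eq[OF \<zeta>, folded mult.commute[of \<i>]]) 
  hence "\<zeta> * exp v = of_real (norm \<zeta>) * (exp (\<i> * of_real (Arg \<zeta>)) * exp v)" by (metis mult.assoc)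
  also have "exp (\<i> * of_real (Arg \<zeta>)) * exp v = exp (\<i> * of_real (Arg \<zeta>) + v)" by (simp add: exp_add)
  finally have "Re (\<zeta> * exp v) = norm \<zeta> * (exp (Re v) * cos (Arg \<zeta> + Im v))" by (simp add: Re_exp)
  moreover have "cos (Arg \<zeta> + Im v) \<ge> cos (\<bar>Arg \<zeta>\<bar> + q)"
  proof -
    have "cos (Arg \<zeta> + Im v) = cos \<bar>Arg \<zeta> + Im v\<bar>" by simp
    also have "\<dots> \<ge> cos (\<bar>Arg \<zeta>\<bar> + q)" using q le by (intro cos_monotone_0_pi_le) auto
    finally show ?thesis .
  qed
  ultimately show ?thesis by (simp add: mult_left_mono mult_ac)
qed

text \<open>The contribution of the \<open>Nint\<close> terms in the Laplace transform of \<open>V\<close>; it is the part that cancels between the two rays.\<close>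

definition ray_fun :: "complex \<Rightarrow> complex \<Rightarrow> complex \<Rightarrow> complex \<Rightarrow> complex" where
  "ray_fun s \<mu> \<zeta> v = exp ((\<mu> + 1) * v - \<zeta> * exp v) * (Nint s (4 * \<i> * exp v) + Nint s (-(4 * \<i> * exp v)))"

context
  fixes s \<mu> :: complex
  assumes s: "Re s > -1" and \<mu>: "Re \<mu> > 0"
begin

lemma ray_fun_bound:
  assumes \<zeta>: "\<zeta> \<noteq> 0" and q: "\<bar>Im v\<bar> \<le> q" "q < pi / 2" and le: "\<bar>Arg \<zeta>\<bar> + q \<le> pi"
  shows "norm (ray_fun s \<mu> \<zeta> v) \<le> exp ((Re \<mu> + 1) * Re v + \<bar>Im \<mu>\<bar> * q - norm \<zeta> * cos (\<bar>Arg \<zeta>\<bar> + q) * exp (Re v))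
     * (2 * (cos q powr (- Re s - 2) * exp (pi * \<bar>Im s\<bar>)))"
proof -
  have cq: "cos q > 0" using q by (intro cos_gt_zero_pi) auto
  have cv: "cos (Im v) \<ge> cos q"
    using q cos_monotone_0_pi_le[of "\<bar>Im v\<bar>" q] by auto
  have s2: "Re s > -2" using s by simp
  have N: "norm (Nint s P) \<le> cos q powr (- Re s - 2) * exp (pi * \<bar>Im s\<bar>)" if "P = 4 * \<i> * exp v \<or> P = -(4 * \<i> * exp v)" for P
  proof -
    \<comment> \<open>Both arguments 4i e^v and -4i e^v are imaginary multiples of e^v, so the ratio
      is the cosine of the rotation angle, independently of Re v.\<close>
    have r: "\<bar>Im P\<bar> / norm P = cos (Im v)"
      using that cq cv by (auto simp: norm_mult Re_exp abs_mult)
    have "Im P \<noteq> 0" using r cq cv by auto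
    from Nint_bound[OF s2 this] have "norm (Nint s P) \<le> cos (Im v) powr (- Re s - 2) * exp (pi * \<bar>Im s\<bar>)" unfolding r .
    also have "\<dots> \<le> cos q powr (- Re s - 2) * exp (pi * \<bar>Im s\<bar>)"
      using cv cq s by (intro mult_right_mono powr_mono2') auto
    finally show ?thesis .
  qed
  have "norm (exp ((\<mu> + 1) * v - \<zeta> * exp v)) \<le> exp ((Re \<mu> + 1) * Re v + \<bar>Im \<mu>\<bar> * q - norm \<zeta> * cos (\<bar>Arg \<zeta>\<bar> + q) * exp (Re v))"
  proof -
    have "- (Im \<mu> * Im v) \<le> \<bar>Im \<mu>\<bar> * \<bar>Im v\<bar>" by (metis abs_ge_minus_self abs_mult)
    also have "\<dots> \<le> \<bar>Im \<mu>\<bar> * q" using q by (intro mult_left_mono) auto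
    finally have "- (Im \<mu> * Im v) \<le> \<bar>Im \<mu>\<bar> * q" .
    moreover have "Re ((\<mu> + 1) * v - \<zeta> * exp v) = (Re \<mu> + 1) * Re v - Im \<mu> * Im v - Re (\<zeta> * exp v)" by simp
    ultimately have "Re ((\<mu> + 1) * v - \<zeta> * exp v) \<le> (Re \<mu> + 1) * Re v + \<bar>Im \<mu>\<bar> * q - norm \<zeta> * cos (\<bar>Arg \<zeta>\<bar> + q) * exp (Re v)"
      using Re_mult_exp_ge[OF \<zeta> q(1) le] by linarith
    thus ?thesis by (subst norm_exp_eq_Re) simp
  qed
  moreover have "norm (Nint s (4 * \<i> * exp v) + Nint s (-(4 * \<i> * exp v))) \<le> 2 * (cos q powr (- Re s - 2) * exp (pi * \<bar>Im s\<bar>))"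
    using norm_triangle_ineq[of "Nint s (4 * \<i> * exp v)" "Nint s (-(4 * \<i> * exp v))"] N[of "4 * \<i> * exp v"] N[of "-(4 * \<i> * exp v)"] by simp
  ultimately show ?thesis unfolding ray_fun_def norm_mult by (intro mult_mono) auto
qed

text \<open>As long as |Arg \<zeta>| + |Im \<omega>| < pi/2, the exponential decays and the
  arguments of \<open>Nint\<close> stay off the negative axis. Two rays turned in opposite
  directions thus share the value of the unshifted integral.\<close>

lemma ray_fun_integral_shift:
  assumes \<zeta>: "\<zeta> \<noteq> 0" and \<omega>: "\<bar>Arg \<zeta>\<bar> + \<bar>Im \<omega>\<bar> < pi / 2"
  shows "(\<integral>x. ray_fun s \<mu> \<zeta> (of_real x + \<omega>) \<partial>lborel) = (\<integral>x. ray_fun s \<mu> \<zeta> (of_real x) \<partial>lborel)"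
proof (rule integral_strip_shift[where \<theta> = "pi / 2 - \<bar>Arg \<zeta>\<bar>"])
  define \<theta> where "\<theta> = pi / 2 - \<bar>Arg \<zeta>\<bar>"
  have Im: "Im (4 * \<i> * exp v) > 0" if "\<bar>Im v\<bar> < pi / 2 - \<bar>Arg \<zeta>\<bar>" for v
    using that by (auto simp: Re_exp intro!: cos_gt_zero_pi mult_pos_pos)
  have 1: "(\<lambda>v. 4 * \<i> * exp v) holomorphic_on {\<omega>. \<bar>Im \<omega>\<bar> < pi / 2 - \<bar>Arg \<zeta>\<bar>}"
          "(\<lambda>v. -(4 * \<i> * exp v)) holomorphic_on {\<omega>. \<bar>Im \<omega>\<bar> < pi / 2 - \<bar>Arg \<zeta>\<bar>}" by (intro holomorphic_intros)+
  have s2: "Re s > -2" using s by simp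
  have "(\<lambda>v. Nint s (4 * \<i> * exp v)) holomorphic_on {\<omega>. \<bar>Im \<omega>\<bar> < pi / 2 - \<bar>Arg \<zeta>\<bar>}"
    by (rule holomorphic_on_compose_gen[OF 1(1) Nint_holomorphic[OF s2], unfolded o_def])
       (use Im in \<open>fastforce simp: complex_nonpos_Reals_iff\<close>)
  moreover have "(\<lambda>v. Nint s (-(4 * \<i> * exp v))) holomorphic_on {\<omega>. \<bar>Im \<omega>\<bar> < pi / 2 - \<bar>Arg \<zeta>\<bar>}"
    by (rule holomorphic_on_compose_gen[OF 1(2) Nint_holomorphic[OF s2], unfolded o_def])
       (use Im in \<open>fastforce simp: complex_nonpos_Reals_iff\<close>)
  ultimately show "ray_fun s \<mu> \<zeta> holomorphic_on {\<omega>. \<bar>Im \<omega>\<bar> < pi / 2 - \<bar>Arg \<zeta>\<bar>}"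
    unfolding ray_fun_def by (intro holomorphic_intros)
  show "\<bar>Im \<omega>\<bar> < pi / 2 - \<bar>Arg \<zeta>\<bar>" using \<omega> by simp
  fix \<omega>0 assume w0: "\<bar>Im \<omega>0\<bar> < pi / 2 - \<bar>Arg \<zeta>\<bar>"
  \<comment> \<open>Half of the distance to the boundary of the strip: the angles near \<omega>0 are
    at most q, and |Arg \<zeta>| + q < pi/2 still holds.\<close>
  define r where "r = (pi / 2 - \<bar>Arg \<zeta>\<bar> - \<bar>Im \<omega>0\<bar>) / 2"
  define q where "q = \<bar>Im \<omega>0\<bar> + r"
  have r: "r > 0" using w0 by (simp add: r_def)
  have q: "q < pi / 2" "\<bar>Arg \<zeta>\<bar> + q < pi / 2" "q \<ge> 0" using w0 by (auto simp: q_def r_def field_simps)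
  define p where "p = \<bar>Re \<omega>0\<bar> + r"
  define c where "c = norm \<zeta> * cos (\<bar>Arg \<zeta>\<bar> + q) * exp (- p)"
  have c0: "norm \<zeta> * cos (\<bar>Arg \<zeta>\<bar> + q) > 0" using \<zeta> q by (intro mult_pos_pos cos_gt_zero_pi) auto
  hence c: "c > 0" by (simp add: c_def)
  define K where "K = exp ((Re \<mu> + 1) * p + \<bar>Im \<mu>\<bar> * q) * (2 * (cos q powr (- Re s - 2) * exp (pi * \<bar>Im s\<bar>)))"
  show "\<exists>r>0. \<exists>g. integrable lborel g \<and> (\<forall>\<omega>'\<in>ball \<omega>0 r. \<bar>Im \<omega>'\<bar> < pi / 2 - \<bar>Arg \<zeta>\<bar> \<longrightarrow> (\<forall>x. norm (ray_fun s \<mu> \<zeta> (of_real x + \<omega>')) \<le> g x))"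
  proof (intro exI[of _ r] conjI exI ballI impI allI)
    show "integrable lborel (\<lambda>x. K * exp ((Re \<mu> + 1) * x - c * exp x))"
      using c \<mu> by (intro integrable_mult_right integrable_exp_one) auto
    fix \<omega>' x assume w': "\<omega>' \<in> ball \<omega>0 r"
    have "\<bar>Im \<omega>' - Im \<omega>0\<bar> < r" "\<bar>Re \<omega>' - Re \<omega>0\<bar> < r"
      using w' abs_Im_le_cmod[of "\<omega>0 - \<omega>'"] abs_Re_le_cmod[of "\<omega>0 - \<omega>'"] by (auto simp: dist_norm)
    hence d: "\<bar>Im (of_real x + \<omega>')\<bar> \<le> q" "Re \<omega>' \<le> p" "- p \<le> Re \<omega>'" by (auto simp: q_def p_def)
    have "norm (ray_fun s \<mu> \<zeta> (of_real x + \<omega>')) \<le> exp ((Re \<mu> + 1) * Re (of_real x + \<omega>') + \<bar>Im \<mu>\<bar> * q - norm \<zeta> * cos (\<bar>Arg \<zeta>\<bar> + q) * exp (Re (of_real x + \<omega>')))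
     * (2 * (cos q powr (- Re s - 2) * exp (pi * \<bar>Im s\<bar>)))"
      by (rule ray_fun_bound[OF \<zeta> d(1) q(1)]) (use q in auto)
    also have "\<dots> \<le> exp ((Re \<mu> + 1) * p + \<bar>Im \<mu>\<bar> * q + ((Re \<mu> + 1) * x - c * exp x))
     * (2 * (cos q powr (- Re s - 2) * exp (pi * \<bar>Im s\<bar>)))"
    proof -
      have "(Re \<mu> + 1) * Re \<omega>' \<le> (Re \<mu> + 1) * p" using d \<mu> by (intro mult_left_mono) auto
      moreover have "c * exp x \<le> norm \<zeta> * cos (\<bar>Arg \<zeta>\<bar> + q) * exp (Re (of_real x + \<omega>'))"
      proof -
        have "c * exp x = norm \<zeta> * cos (\<bar>Arg \<zeta>\<bar> + q) * exp (- p + x)" by (simp add: c_def exp_diff exp_minus field_simps)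
        also have "\<dots> \<le> norm \<zeta> * cos (\<bar>Arg \<zeta>\<bar> + q) * exp (Re (of_real x + \<omega>'))"
          using c0 d by (intro mult_left_mono) auto
        finally show ?thesis .
      qed
      ultimately have "(Re \<mu> + 1) * Re (of_real x + \<omega>') + \<bar>Im \<mu>\<bar> * q - norm \<zeta> * cos (\<bar>Arg \<zeta>\<bar> + q) * exp (Re (of_real x + \<omega>'))
         \<le> (Re \<mu> + 1) * p + \<bar>Im \<mu>\<bar> * q + ((Re \<mu> + 1) * x - c * exp x)" by (simp add: ring_distribs)
      thus ?thesis by (intro mult_right_mono) auto
    qed
    also have "\<dots> = K * exp ((Re \<mu> + 1) * x - c * exp x)" unfolding K_def exp_add by (simp add: mult_ac)
    finally show "norm (ray_fun s \<mu> \<zeta> (of_real x + \<omega>')) \<le> K * exp ((Re \<mu> + 1) * x - c * exp x)" .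
  qed (rule r)
qed

lemma ray_fun_integrable:
  assumes \<zeta>: "\<zeta> \<noteq> 0" and \<omega>: "\<bar>Arg \<zeta>\<bar> + \<bar>Im \<omega>\<bar> < pi / 2" and re: "Re \<omega> = 0"
  shows "integrable lborel (\<lambda>x. ray_fun s \<mu> \<zeta> (of_real x + \<omega>))"
proof -
  define q where "q = \<bar>Im \<omega>\<bar>"
  define c where "c = norm \<zeta> * cos (\<bar>Arg \<zeta>\<bar> + q)"
  have c: "c > 0" unfolding c_def using \<zeta> \<omega> by (intro mult_pos_pos cos_gt_zero_pi) (auto simp: q_def)
  define K where "K = exp (\<bar>Im \<mu>\<bar> * q) * (2 * (cos q powr (- Re s - 2) * exp (pi * \<bar>Im s\<bar>)))"
  have Im: "Im (4 * \<i> * exp (of_real x + \<omega>)) > 0" for x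
    using \<omega> by (auto simp: Re_exp intro!: cos_gt_zero_pi mult_pos_pos)
  have s2: "Re s > -2" using s by simp
  have cN: "continuous_on (- \<real>\<^sub>\<le>\<^sub>0) (Nint s)" by (rule holomorphic_on_imp_continuous_on[OF Nint_holomorphic[OF s2]])
  have nn: "z \<notin> \<real>\<^sub>\<le>\<^sub>0" "- z \<notin> \<real>\<^sub>\<le>\<^sub>0" if "Im z > 0" for z
    using that by (auto simp: complex_nonpos_Reals_iff)
  have "continuous_on UNIV (\<lambda>x. Nint s (4 * \<i> * exp (of_real x + \<omega>)))"
  proof (rule continuous_on_compose2[OF cN])
    show "continuous_on UNIV (\<lambda>x. 4 * \<i> * exp (of_real x + \<omega>))" by (intro continuous_intros)
  qed (rule image_subsetI, use nn[OF Im] in blast)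
  moreover have "continuous_on UNIV (\<lambda>x. Nint s (-(4 * \<i> * exp (of_real x + \<omega>))))"
  proof (rule continuous_on_compose2[OF cN])
    show "continuous_on UNIV (\<lambda>x. -(4 * \<i> * exp (of_real x + \<omega>)))" by (intro continuous_intros)
  qed (rule image_subsetI, use nn[OF Im] in blast)
  ultimately have "continuous_on UNIV (\<lambda>x. ray_fun s \<mu> \<zeta> (of_real x + \<omega>))" unfolding ray_fun_def by (intro continuous_intros)
  hence m: "(\<lambda>x. ray_fun s \<mu> \<zeta> (of_real x + \<omega>)) \<in> borel_measurable lborel" unfolding measurable_lborel2 by (rule borel_measurable_continuous_onI)
  have "norm (ray_fun s \<mu> \<zeta> (of_real x + \<omega>)) \<le> K * exp ((Re \<mu> + 1) * x - c * exp x)" for x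
  proof -
    have "norm (ray_fun s \<mu> \<zeta> (of_real x + \<omega>)) \<le> exp ((Re \<mu> + 1) * Re (of_real x + \<omega>) + \<bar>Im \<mu>\<bar> * q - norm \<zeta> * cos (\<bar>Arg \<zeta>\<bar> + q) * exp (Re (of_real x + \<omega>)))
     * (2 * (cos q powr (- Re s - 2) * exp (pi * \<bar>Im s\<bar>)))"
      by (rule ray_fun_bound[OF \<zeta>]) (use \<omega> in \<open>auto simp: q_def\<close>)
    also have "\<dots> = exp (\<bar>Im \<mu>\<bar> * q + ((Re \<mu> + 1) * x - c * exp x)) * (2 * (cos q powr (- Re s - 2) * exp (pi * \<bar>Im s\<bar>)))"
      by (simp add: re c_def algebra_simps)
    also have "\<dots> = K * exp ((Re \<mu> + 1) * x - c * exp x)" unfolding K_def exp_add by (simp add: mult_ac)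
    finally show ?thesis .
  qed
  moreover have "K \<ge> 0" by (simp add: K_def)
  ultimately show ?thesis
    by (intro Bochner_Integration.integrable_bound[OF integrable_mult_right[OF integrable_exp_one[of "Re \<mu> + 1" c], of K] m] AE_I2)
       (use c \<mu> in auto)
qed

end

section \<open>Pairing the primitive with a single complex power\<close>

lemma Arg_less_imp_Re_pos:
  assumes "\<zeta> \<noteq> 0" "\<bar>Arg \<zeta>\<bar> < pi / 2"
  shows "Re \<zeta> > 0"
  using assms Arg_Re_pos[of \<zeta>] by auto

context
  fixes s lam \<mu> :: complex and V :: "real \<Rightarrow> complex" and C m :: real
  assumes s: "Re s > -1" and \<mu>: "Re \<mu> > 0" and \<mu>_eq: "\<mu> = s + lam + 1"
    and V_cont: "continuous_on {0<..} V"
    and C: "C \<ge> 0"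
    and V_small: "\<And>X. 0 < X \<Longrightarrow> X \<le> 1 \<Longrightarrow> norm (V X) \<le> C"
    and V_large: "\<And>X. 1 \<le> X \<Longrightarrow> norm (V X) \<le> C * X powr m"
    and m: "m < Re \<mu>"
    and lap: "\<And>P j. Re P > 0 \<Longrightarrow> Im P \<noteq> 0 \<Longrightarrow> j = (if Im P > 0 then \<i> else - \<i>) \<Longrightarrow>
      (\<integral>y. exp (of_real y - P * of_real (exp y)) * V (exp y) \<partial>lborel) =
      2 * j * exp (j * of_real pi * s / 2) * P powr (-s - 2) * exp (- 1 / P)
      - 2 * cos (of_real pi * s / 2) * Gamma (s + 2) / of_real pi * (Nint s P + Nint s (-P))"
begin

lemma V_exp_measurable: "(\<lambda>y. V (exp y)) \<in> borel_measurable borel"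
  by (intro borel_measurable_continuous_onI continuous_on_compose2[OF V_cont]) (auto intro!: continuous_intros)

text \<open>In logarithmic coordinates: for negative y the primitive is bounded and e^y decays; for
  positive y the exponents add up to m + 1 - Re \<mu> - 1, which is negative.\<close>

lemma V_weight_bound:
  assumes a: "a > 0" and b: "b > 0"
  obtains K c where "K \<ge> 0" "c > 0"
    "\<And>y. norm (V (exp y)) * exp y * (a + b * exp y) powr (- Re \<mu> - 1) \<le> K * exp (- c * \<bar>y\<bar>)"
proof -
  define c where "c = min 1 (Re \<mu> - m)"
  define K where "K = C * (a powr (- Re \<mu> - 1) + b powr (- Re \<mu> - 1))"
  have c: "c > 0" "c \<le> 1" "c \<le> Re \<mu> - m" using m by (auto simp: c_def)
  have "norm (V (exp y)) * exp y * (a + b * exp y) powr (- Re \<mu> - 1) \<le> K * exp (- c * \<bar>y\<bar>)" for y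
  proof (cases "y \<le> 0")
    case True
    have 1: "(a + b * exp y) powr (- Re \<mu> - 1) \<le> a powr (- Re \<mu> - 1)" using a b \<mu> by (intro powr_mono2') auto
    have "y \<le> - c * \<bar>y\<bar>" using c True by (simp add: mult_le_cancel_right1)
    hence 2: "exp y \<le> exp (- c * \<bar>y\<bar>)" by simp
    have "norm (V (exp y)) * exp y * (a + b * exp y) powr (- Re \<mu> - 1) \<le> C * exp (- c * \<bar>y\<bar>) * a powr (- Re \<mu> - 1)"
      using True V_small[of "exp y"] C 1 2 by (intro mult_mono) auto
    also have "\<dots> \<le> K * exp (- c * \<bar>y\<bar>)" unfolding K_def using C by (simp add: ring_distribs)
    finally show ?thesis .
  next
    case False
    have "(a + b * exp y) powr (- Re \<mu> - 1) \<le> (b * exp y) powr (- Re \<mu> - 1)" using a b \<mu> by (intro powr_mono2') auto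
    also have "\<dots> = b powr (- Re \<mu> - 1) * exp ((- Re \<mu> - 1) * y)" using b by (simp add: powr_mult) (simp add: powr_def)
    finally have 1: "(a + b * exp y) powr (- Re \<mu> - 1) \<le> b powr (- Re \<mu> - 1) * exp ((- Re \<mu> - 1) * y)" .
    have 2: "norm (V (exp y)) \<le> C * exp (m * y)" using False V_large[of "exp y"] by (simp add: powr_def)
    have "norm (V (exp y)) * exp y * (a + b * exp y) powr (- Re \<mu> - 1) \<le> (C * exp (m * y)) * exp y * (b powr (- Re \<mu> - 1) * exp ((- Re \<mu> - 1) * y))"
      using C 1 2 by (intro mult_mono) auto
    also have "\<dots> = C * b powr (- Re \<mu> - 1) * exp ((m - Re \<mu>) * y)" by (simp add: algebra_simps flip: exp_add)
    also have "\<dots> \<le> C * b powr (- Re \<mu> - 1) * exp (- c * \<bar>y\<bar>)"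
      using C c False mult_right_mono[of "m - Re \<mu>" "- c" y] by (intro mult_left_mono) auto
    also have "\<dots> \<le> K * exp (- c * \<bar>y\<bar>)" unfolding K_def using C by (simp add: ring_distribs)
    finally show ?thesis .
  qed
  moreover have "K \<ge> 0" unfolding K_def using C by simp
  ultimately show ?thesis using that c by blast
qed

text \<open>The power is written as a Laplace integral along the ray of direction \<omega> =
  e^(-j\<phi>). After the integrals are exchanged, \<open>V\<close> is transformed at P =
  4j\<omega>e^x, where Re P = 4 sin \<phi> e^x > 0, while the bound on |Arg \<zeta>| + \<phi> keeps
  Re (\<omega>\<zeta>) > 0. The elementary part of the transform integrates to \<open>Kint\<close>;
  the rest is \<open>ray_fun\<close> on a shifted line.\<close>

lemma ray_evaluation:
  assumes j: "j = \<i> \<or> j = - \<i>" and \<zeta>: "\<zeta> \<noteq> 0" and \<phi>: "\<phi> > 0" "\<bar>Arg \<zeta>\<bar> + \<phi> < pi / 2"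
  defines "a \<equiv> - j * of_real \<phi>"
  shows "j * (\<integral>y. V (exp y) * of_real (exp y) * (\<zeta> + 4 * j * of_real (exp y)) powr (- \<mu> - 1) \<partial>lborel) =
    (2 * exp ((-s - 2) * of_real (ln 4)) * exp (lam * a) * Kint lam (exp a * \<zeta>) (1 / (4 * j * exp a))
      - j * (2 * cos (of_real pi * s / 2) * Gamma (s + 2) / of_real pi) * (\<integral>x. ray_fun s \<mu> \<zeta> (of_real x) \<partial>lborel)) / Gamma (\<mu> + 1)"
proof -
  define \<omega> where "\<omega> = exp a"
  define \<kappa> where "\<kappa> = 2 * cos (of_real pi * s / 2) * Gamma (s + 2) / of_real pi"
  define \<eta> where "\<eta> y = \<zeta> + 4 * j * of_real (exp y)" for y :: real
  have Rea: "Re a = 0" and Ima: "\<bar>Im a\<bar> = \<phi>" using j \<phi> by (auto simp: a_def)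
  have \<phi>2: "\<phi> < pi / 2" using \<phi> by linarith
  have sn: "sin \<phi> > 0" "cos \<phi> > 0" using \<phi> \<phi>2 by (auto intro!: sin_gt_zero cos_gt_zero_pi)
  have j2: "j * j = -1" using j by auto
  have j0: "Re j = 0" using j by auto
  have j\<omega>: "Re (j * \<omega>) = sin \<phi>" "Im (j * \<omega>) = Im j * cos \<phi>"
    using j by (auto simp: \<omega>_def a_def Re_exp Im_exp)
  have Re\<omega>: "Re \<omega> > 0" using sn j by (auto simp: \<omega>_def a_def Re_exp)
  have Im_lt: "\<bar>Im a\<bar> < pi" using Ima \<phi>2 by simp
  have Ln\<omega>: "Ln \<omega> = a" unfolding \<omega>_def using Im_lt by (intro Ln_exp) auto
  have \<omega>0: "\<omega> \<noteq> 0" by (simp add: \<omega>_def)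
  define A where "A = Re (\<omega> * \<zeta>)"
  define B where "B = 4 * sin \<phi>"
  have A: "A > 0"
  proof -
    have "norm \<zeta> * cos (\<bar>Arg \<zeta>\<bar> + \<phi>) * exp (Re a) > 0" using \<zeta> \<phi> by (intro mult_pos_pos cos_gt_zero_pi) auto
    also have "norm \<zeta> * cos (\<bar>Arg \<zeta>\<bar> + \<phi>) * exp (Re a) \<le> Re (\<zeta> * exp a)"
      by (rule Re_mult_exp_ge[OF \<zeta>]) (use Ima \<phi> in auto)
    finally show ?thesis by (simp add: A_def \<omega>_def mult.commute)
  qed
  have B: "B > 0" using sn by (simp add: B_def)
  have Re\<zeta>: "Re \<zeta> > 0" by (rule Arg_less_imp_Re_pos) (use \<zeta> \<phi> in auto)
  have Re\<eta>: "Re (\<eta> y) > 0" for y using Re\<zeta> j0 by (simp add: \<eta>_def)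
  have \<omega>\<eta>: "\<omega> * \<eta> y = \<omega> * \<zeta> + 4 * (j * \<omega>) * of_real (exp y)" for y by (simp add: \<eta>_def algebra_simps)
  have Re\<omega>\<eta>: "Re (\<omega> * \<eta> y) = A + B * exp y" for y
    unfolding \<omega>\<eta> using j\<omega> by (simp add: A_def B_def del: of_real_exp)
  have Re\<omega>\<eta>_pos: "Re (\<omega> * \<eta> y) > 0" for y unfolding Re\<omega>\<eta> using A B by (simp add: add_pos_pos)
  have \<mu>1: "Re (\<mu> + 1) > 0" using \<mu> by simp
  have G0: "Gamma (\<mu> + 1) \<noteq> 0" using Re_pos_not_nonpos_Ints[OF \<mu>1] by (simp add: Gamma_eq_zero_iff)
  have rep: "\<eta> y powr (- \<mu> - 1) = exp ((\<mu> + 1) * a) / Gamma (\<mu> + 1) * (\<integral>x. exp ((\<mu> + 1) * of_real x - \<omega> * \<eta> y * of_real (exp x)) \<partial>lborel)" for y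
  proof -
    have "(\<integral>x. exp ((\<mu> + 1) * of_real x - \<omega> * \<eta> y * of_real (exp x)) \<partial>lborel) = Gamma (\<mu> + 1) * (\<omega> * \<eta> y) powr (- (\<mu> + 1))"
      by (rule integral_exp_Gamma[OF \<mu>1 Re\<omega>\<eta>_pos])
    also have "(\<omega> * \<eta> y) powr (- (\<mu> + 1)) = \<omega> powr (- (\<mu> + 1)) * \<eta> y powr (- (\<mu> + 1))"
      by (rule powr_mult_Re_pos[OF Re\<omega> Re\<eta>])
    also have "\<omega> powr (- (\<mu> + 1)) = exp (- ((\<mu> + 1) * a))" using \<omega>0 Ln\<omega> by (simp add: powr_def algebra_simps)
    finally have I: "(\<integral>x. exp ((\<mu> + 1) * of_real x - \<omega> * \<eta> y * of_real (exp x)) \<partial>lborel)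
      = Gamma (\<mu> + 1) * (exp (- ((\<mu> + 1) * a)) * \<eta> y powr (- (\<mu> + 1)))" .
    have e: "exp ((\<mu> + 1) * a) * exp (- ((\<mu> + 1) * a)) = 1" by (simp flip: exp_add)
    have "- (\<mu> + 1) = - \<mu> - 1" by simp
    moreover have "exp ((\<mu> + 1) * a) / Gamma (\<mu> + 1) * (Gamma (\<mu> + 1) * (exp (- ((\<mu> + 1) * a)) * \<eta> y powr (- (\<mu> + 1))))
      = (exp ((\<mu> + 1) * a) * exp (- ((\<mu> + 1) * a))) * \<eta> y powr (- (\<mu> + 1))" using G0 by simp
    ultimately show ?thesis unfolding I e by simp
  qed
  define F where "F y x = V (exp y) * of_real (exp y) * exp ((\<mu> + 1) * of_real x - \<omega> * \<eta> y * of_real (exp x))" for y x :: real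
  have [measurable]: "(\<lambda>y. V (exp y)) \<in> borel_measurable borel" by (rule V_exp_measurable)
  have meas: "case_prod F \<in> borel_measurable (lborel \<Otimes>\<^sub>M lborel)" unfolding F_def \<eta>_def by measurable
  have Fn: "norm (F y x) = norm (V (exp y)) * exp y * exp ((Re \<mu> + 1) * x - (A + B * exp y) * exp x)" for y x
    using Re\<omega>\<eta>[of y] by (simp add: F_def norm_mult del: of_real_exp)
  have pos: "A + B * exp y > 0" for y using A B by (simp add: add_pos_pos)
  have int_x: "integrable lborel (F y)" for y
    unfolding F_def by (intro integrable_mult_right integrable_exp_Gamma \<mu>1 Re\<omega>\<eta>_pos)
  have eq: "(\<integral>x. norm (F y x) \<partial>lborel) = Gamma (Re \<mu> + 1) * (norm (V (exp y)) * exp y * (A + B * exp y) powr (- Re \<mu> - 1))" for y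
    unfolding Fn using \<mu> pos[of y] by (subst integral_mult_right_zero, subst integral_exp_Gamma_real) auto
  have Gp: "Gamma (Re \<mu> + 1) \<ge> 0" using \<mu> by (intro less_imp_le Gamma_real_pos) auto
  obtain K c where K: "K \<ge> 0" "c > 0" "\<And>y. norm (V (exp y)) * exp y * (A + B * exp y) powr (- Re \<mu> - 1) \<le> K * exp (- c * \<bar>y\<bar>)"
    using V_weight_bound[OF A B] by blast
  have "integrable (lborel \<Otimes>\<^sub>M lborel) (case_prod F)"
  proof (rule lborel_pair.Fubini_integrable[OF meas])
    show "integrable lborel (\<lambda>y. \<integral>x. norm (case (y, x) of (y, x) \<Rightarrow> F y x) \<partial>lborel)"
    proof (rule Bochner_Integration.integrable_bound)
      show "integrable lborel (\<lambda>y. Gamma (Re \<mu> + 1) * (K * exp (- c * \<bar>y\<bar>)))"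
        by (intro integrable_mult_right integrable_exp_abs K)
      show "(\<lambda>y. \<integral>x. norm (case (y, x) of (y, x) \<Rightarrow> F y x) \<partial>lborel) \<in> borel_measurable lborel"
        using meas by measurable
      show "AE y in lborel. norm (\<integral>x. norm (case (y, x) of (y, x) \<Rightarrow> F y x) \<partial>lborel) \<le> norm (Gamma (Re \<mu> + 1) * (K * exp (- c * \<bar>y\<bar>)))"
      proof (rule AE_I2)
        fix y
        have "(\<integral>x. norm (F y x) \<partial>lborel) \<le> Gamma (Re \<mu> + 1) * (K * exp (- c * \<bar>y\<bar>))" unfolding eq using Gp K by (intro mult_left_mono)
        moreover have "(\<integral>x. norm (F y x) \<partial>lborel) \<ge> 0" by (intro Bochner_Integration.integral_nonneg) auto
        ultimately show "norm (\<integral>x. norm (case (y, x) of (y, x) \<Rightarrow> F y x) \<partial>lborel) \<le> norm (Gamma (Re \<mu> + 1) * (K * exp (- c * \<bar>y\<bar>)))" by simp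
      qed
    qed
  qed (use int_x in simp)
  from lborel_pair.Fubini_integral[OF this]
  have fub: "(\<integral>x. \<integral>y. F y x \<partial>lborel \<partial>lborel) = (\<integral>y. \<integral>x. F y x \<partial>lborel \<partial>lborel)" .
  define k where "k x = exp (lam * of_real x - \<omega> * \<zeta> * of_real (exp x) - 1 / (4 * j * \<omega>) * of_real (exp (-x)))" for x :: real
  define D where "D = 2 * exp ((-s - 2) * of_real (ln 4)) * exp (lam * a)"
  have inner: "j * (exp ((\<mu> + 1) * a) * (\<integral>y. F y x \<partial>lborel)) = D * k x - j * \<kappa> * ray_fun s \<mu> \<zeta> (of_real x + a)" for x
  proof -
    define P where "P = 4 * (j * \<omega>) * of_real (exp x)"
    have "Re P = 4 * Re (j * \<omega>) * exp x" "Im P = 4 * Im (j * \<omega>) * exp x"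
      unfolding P_def by (simp_all add: algebra_simps del: of_real_exp)
    hence "Re P = 4 * sin \<phi> * exp x" "Im P = 4 * (Im j * cos \<phi>) * exp x" unfolding j\<omega> .
    hence P: "Re P > 0" "Im P \<noteq> 0" "j = (if Im P > 0 then \<i> else - \<i>)"
      using j sn by (auto simp: zero_less_mult_iff mult_less_0_iff)
    have xa: "exp (of_real x + a) = \<omega> * of_real (exp x)" by (simp add: exp_add \<omega>_def mult.commute exp_of_real)
    have F: "F y x = exp ((\<mu> + 1) * of_real x - \<omega> * \<zeta> * of_real (exp x)) * (exp (of_real y - P * of_real (exp y)) * V (exp y))" for y
    proof -
      have "(\<mu> + 1) * of_real x - \<omega> * \<eta> y * of_real (exp x) = ((\<mu> + 1) * of_real x - \<omega> * \<zeta> * of_real (exp x)) + (- (P * of_real (exp y)))"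
        unfolding \<omega>\<eta> P_def by (simp add: algebra_simps)
      thus ?thesis unfolding F_def by (simp only: exp_add exp_diff exp_minus of_real_exp) (simp add: field_simps)
    qed
    have I: "(\<integral>y. F y x \<partial>lborel) = exp ((\<mu> + 1) * of_real x - \<omega> * \<zeta> * of_real (exp x)) *
      (2 * j * exp (j * of_real pi * s / 2) * P powr (-s - 2) * exp (- 1 / P) - \<kappa> * (Nint s P + Nint s (-P)))"
      unfolding F integral_mult_right_zero lap[OF P] \<kappa>_def ..
    have 1: "j * (exp ((\<mu> + 1) * a) * (\<integral>y. F y x \<partial>lborel)) =
      j * (2 * j * exp (j * of_real pi * s / 2) * P powr (-s - 2) * exp (- 1 / P)) * (exp ((\<mu> + 1) * a) * exp ((\<mu> + 1) * of_real x - \<omega> * \<zeta> * of_real (exp x)))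
      - j * \<kappa> * ((exp ((\<mu> + 1) * a) * exp ((\<mu> + 1) * of_real x - \<omega> * \<zeta> * of_real (exp x))) * (Nint s P + Nint s (-P)))"
      unfolding I by (simp only: right_diff_distrib mult_ac)
    have E: "exp ((\<mu> + 1) * a) * exp ((\<mu> + 1) * of_real x - \<omega> * \<zeta> * of_real (exp x)) = exp ((\<mu> + 1) * (of_real x + a) - \<zeta> * exp (of_real x + a))"
      unfolding xa by (simp add: algebra_simps flip: exp_add)
    have N: "Nint s P + Nint s (-P) = Nint s (4 * \<i> * exp (of_real x + a)) + Nint s (-(4 * \<i> * exp (of_real x + a)))"
      using j unfolding xa P_def by (auto simp: mult.assoc)
    have 2: "j * \<kappa> * ((exp ((\<mu> + 1) * a) * exp ((\<mu> + 1) * of_real x - \<omega> * \<zeta> * of_real (exp x))) * (Nint s P + Nint s (-P)))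
       = j * \<kappa> * ray_fun s \<mu> \<zeta> (of_real x + a)" unfolding ray_fun_def E N ..
    \<comment> \<open>The imaginary part of the exponent is pi/2 - \<phi> in absolute value, hence
      the exponent is the principal logarithm of P.\<close>
    have LnP: "P powr (-s - 2) = exp ((-s - 2) * (of_real (ln 4) + j * of_real pi / 2 + a + of_real x))"
    proof -
      have "exp (j * of_real pi / 2) = j" using j exp_Euler[of "of_real pi / 2"] exp_Euler[of "- (of_real pi / 2)"]
        by (auto simp: sin_of_real[symmetric] cos_of_real[symmetric] mult_ac)
      moreover have "exp (complex_of_real (ln 4)) = 4" by (simp add: exp_of_real)
      ultimately have "exp (of_real (ln 4) + j * of_real pi / 2 + a + of_real x) = P"
        by (simp add: exp_add P_def \<omega>_def exp_of_real)
      moreover have "\<bar>Im (of_real (ln 4) + j * of_real pi / 2 + a + of_real x)\<bar> < pi"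
        using j \<phi> \<phi>2 by (auto simp: a_def)
      ultimately have "Ln P = of_real (ln 4) + j * of_real pi / 2 + a + of_real x"
        by (metis Ln_exp abs_less_iff less_imp_le minus_less_iff)
      moreover have "P \<noteq> 0" using P by auto
      ultimately show ?thesis by (simp add: powr_def)
    qed
    have invP: "- 1 / P = - (1 / (4 * j * \<omega>) * of_real (exp (-x)))" by (simp add: P_def exp_minus field_simps)
    \<comment> \<open>The phases e^(j pi s/2) and e^((-s-2) j pi/2) combine to e^(-j pi) = -1, which
      is going to meet j^2 = -1; both rays therefore contribute with the same sign. The powers of
      e^x collect to e^(\<lambda>x) because \<mu> + 1 = s + \<lambda> + 2.\<close>
    have "exp (j * of_real pi * s / 2) * P powr (-s - 2) * exp (- 1 / P) * (exp ((\<mu> + 1) * a) * exp ((\<mu> + 1) * of_real x - \<omega> * \<zeta> * of_real (exp x)))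
       = exp (- j * of_real pi) * (exp ((-s - 2) * of_real (ln 4)) * exp (lam * a) * k x)"
      unfolding LnP invP k_def exp_add[symmetric] \<mu>_eq by (simp add: algebra_simps) (simp add: field_simps)
    moreover have "exp (- j * of_real pi) = -1" using j by (auto simp: exp_minus exp_pi_i')
    ultimately have "j * (2 * j * exp (j * of_real pi * s / 2) * P powr (-s - 2) * exp (- 1 / P)) * (exp ((\<mu> + 1) * a) * exp ((\<mu> + 1) * of_real x - \<omega> * \<zeta> * of_real (exp x)))
       = (j * j) * 2 * (- 1 * (exp ((-s - 2) * of_real (ln 4)) * exp (lam * a) * k x))"
      by (simp only: mult_ac)
    also have "\<dots> = D * k x" unfolding j2 D_def by simp
    finally show ?thesis unfolding 1 2 by simp
  qed
  have ik: "integrable lborel k" and Ik: "(\<integral>x. k x \<partial>lborel) = Kint lam (\<omega> * \<zeta>) (1 / (4 * j * \<omega>))"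
  proof -
    have "Re (1 / (4 * j * \<omega>)) > 0"
    proof -
      have "Re (4 * (j * \<omega>)) > 0" using j\<omega>(1) sn by simp
      hence "Re (inverse (4 * (j * \<omega>))) > 0"
        unfolding inverse_complex.sel by (intro divide_pos_pos add_pos_nonneg) auto
      thus ?thesis by (simp add: inverse_eq_divide mult.assoc)
    qed
    thus "integrable lborel k" unfolding k_def using A by (intro Kint_integrable) (auto simp: A_def)
  qed (simp add: k_def Kint_def)
  have Arga: "\<bar>Arg \<zeta>\<bar> + \<bar>Im a\<bar> < pi / 2" using Ima \<phi> by simp
  have "j * (\<integral>y. V (exp y) * of_real (exp y) * \<eta> y powr (- \<mu> - 1) \<partial>lborel) =
    j * (exp ((\<mu> + 1) * a) * (\<integral>y. \<integral>x. F y x \<partial>lborel \<partial>lborel)) / Gamma (\<mu> + 1)"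
  proof -
    have "V (exp y) * of_real (exp y) * \<eta> y powr (- \<mu> - 1) = exp ((\<mu> + 1) * a) / Gamma (\<mu> + 1) * (\<integral>x. F y x \<partial>lborel)" for y
      unfolding rep F_def integral_mult_right_zero by simp
    thus ?thesis by simp
  qed
  also have "j * (exp ((\<mu> + 1) * a) * (\<integral>y. \<integral>x. F y x \<partial>lborel \<partial>lborel)) = (\<integral>x. j * (exp ((\<mu> + 1) * a) * (\<integral>y. F y x \<partial>lborel)) \<partial>lborel)"
    unfolding fub[symmetric] by (simp only: integral_mult_right_zero)
  also have "\<dots> = D * Kint lam (\<omega> * \<zeta>) (1 / (4 * j * \<omega>)) - j * \<kappa> * (\<integral>x. ray_fun s \<mu> \<zeta> (of_real x + a) \<partial>lborel)"
    unfolding inner Ik[symmetric] using ik ray_fun_integrable[OF s \<mu> \<zeta> Arga Rea]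
    by (subst Bochner_Integration.integral_diff) auto
  also have "(\<integral>x. ray_fun s \<mu> \<zeta> (of_real x + a) \<partial>lborel) = (\<integral>x. ray_fun s \<mu> \<zeta> (of_real x) \<partial>lborel)"
    by (rule ray_fun_integral_shift[OF s \<mu> \<zeta> Arga])
  finally show ?thesis unfolding \<eta>_def D_def \<kappa>_def \<omega>_def .
qed

text \<open>The integral of \<open>ray_fun\<close> is the same for j = i and j = -i, and its
  coefficient is a multiple of j. The two terms cancel and only the \<open>Kint\<close> values
  survive.\<close>

lemma sum_ray_evaluation:
  assumes \<zeta>: "\<zeta> \<noteq> 0" and \<phi>: "\<phi> > 0" "\<bar>Arg \<zeta>\<bar> + \<phi> < pi / 2"
  shows "(\<Sum>j\<in>{\<i>, - \<i>}. j * (\<integral>y. V (exp y) * of_real (exp y) * (\<zeta> + 4 * j * of_real (exp y)) powr (- \<mu> - 1) \<partial>lborel)) =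
    2 * exp ((-s - 2) * of_real (ln 4)) / Gamma (\<mu> + 1) *
    (\<Sum>j\<in>{\<i>, - \<i>}. exp (lam * (- j * of_real \<phi>)) * Kint lam (exp (- j * of_real \<phi>) * \<zeta>) (1 / (4 * j * exp (- j * of_real \<phi>))))"
proof -
  have ne: "\<i> \<noteq> - \<i>" by (simp add: complex_eq_iff)
  show ?thesis
    using ray_evaluation[OF _ \<zeta> \<phi>, of "\<i>"] ray_evaluation[OF _ \<zeta> \<phi>, of "- \<i>"] ne
    by (simp only: sum.insert finite.insertI finite.emptyI insert_iff empty_iff sum.empty simp_thms)
       (simp add: algebra_simps add_divide_distrib diff_divide_distrib)
qed

end

section \<open>The hypergeometric series inside the unit disc\<close>

lemma hyp2F1_summable:
  fixes a b c x :: complex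
  assumes c: "c \<notin> \<int>\<^sub>\<le>\<^sub>0" and x: "norm x < 1"
  shows "summable (\<lambda>n. pochhammer a n * pochhammer b n / (pochhammer c n * fact n) * x ^ n)"
proof -
  define f where "f n = pochhammer a n * pochhammer b n / (pochhammer c n * fact n) * x ^ n" for n
  \<comment> \<open>A quotient of factors rather than of terms, so that terminating series obey the
    same recursion.\<close>
  define q where "q n = (a + of_nat n) * (b + of_nat n) / ((c + of_nat n) * (1 + of_nat n)) * x" for n
  have fS: "f (Suc n) = f n * q n" for n
    unfolding f_def q_def pochhammer_Suc fact_Suc by (simp add: field_simps)
  have lim: "(\<lambda>n. (d + of_nat n) / of_nat n :: complex) \<longlonglongrightarrow> 1" for d
  proof -
    have "(\<lambda>n. d / of_nat n + 1) \<longlonglongrightarrow> 0 + 1" by (intro tendsto_intros lim_const_over_n)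
    moreover have "\<forall>\<^sub>F n in sequentially. d / of_nat n + 1 = (d + of_nat n) / of_nat n"
      using eventually_gt_at_top[of 0] by eventually_elim (simp add: field_simps)
    ultimately show ?thesis using Lim_transform_eventually by fastforce
  qed
  have "(\<lambda>n. ((a + of_nat n) / of_nat n) * ((b + of_nat n) / of_nat n) / (((c + of_nat n) / of_nat n) * ((1 + of_nat n) / of_nat n)) * x) \<longlonglongrightarrow> 1 * 1 / (1 * 1) * x"
    by (intro tendsto_intros lim) auto
  moreover have "\<forall>\<^sub>F n in sequentially. ((a + of_nat n) / of_nat n) * ((b + of_nat n) / of_nat n) / (((c + of_nat n) / of_nat n) * ((1 + of_nat n) / of_nat n)) * x = q n"
  proof -
    have "N \<noteq> 0 \<Longrightarrow> (A / N) * (B / N) / ((D / N) * (E / N)) = A * B / (D * E)" for N A B D E :: complex by simp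
    thus ?thesis by (intro eventually_mono[OF eventually_gt_at_top[of 0]]) (simp add: q_def)
  qed
  ultimately have "q \<longlonglongrightarrow> x" using Lim_transform_eventually by fastforce
  hence "(\<lambda>n. norm (q n)) \<longlonglongrightarrow> norm x" by (rule tendsto_norm)
  moreover define r where "r = (norm x + 1) / 2"
  have r: "norm x < r" "r < 1" using x by (auto simp: r_def)
  ultimately have "\<forall>\<^sub>F n in sequentially. norm (q n) < r" by (intro order_tendstoD(2)) auto
  then obtain N where N: "\<And>n. n \<ge> N \<Longrightarrow> norm (q n) < r" by (auto simp: eventually_sequentially)
  have "summable f"
  proof (rule summable_ratio_test[OF r(2), of N])
    fix n assume "n \<ge> N"
    thus "norm (f (Suc n)) \<le> r * norm (f n)" unfolding fS norm_mult using N[of n]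
      by (subst mult.commute) (intro mult_right_mono, auto)
  qed
  thus ?thesis unfolding f_def[abs_def] .
qed

subsection \<open>Euler's transformation\<close>

definition hyp_fps :: "complex \<Rightarrow> complex \<Rightarrow> complex \<Rightarrow> complex fps" where
  "hyp_fps a b c = Abs_fps (\<lambda>n. pochhammer a n * pochhammer b n / (pochhammer c n * fact n))"

lemma hyp2F1_holomorphic:
  assumes c: "c \<notin> \<int>\<^sub>\<le>\<^sub>0"
  shows "hyp2F1 a b c holomorphic_on ball 0 1"
proof -
  define u where "u n = pochhammer a n * pochhammer b n / (pochhammer c n * fact n)" for n
  have "(hyp2F1 a b c has_field_derivative (\<Sum>n. diffs u n * x ^ n)) (at x)" if x: "x \<in> ball 0 1" for x
  proof -
    obtain K where K: "norm x < K" "K < 1" using x dense by auto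
    have "summable (\<lambda>n. u n * of_real K ^ n)" unfolding u_def
    proof (rule hyp2F1_summable[OF c])
      have "K \<ge> 0" using K norm_ge_zero[of x] by linarith
      thus "norm (complex_of_real K) < 1" using K by simp
    qed
    from termdiffs_strong[OF this, of x] K norm_ge_zero[of x] show ?thesis
      by (simp add: hyp2F1_def[abs_def] u_def[abs_def])
  qed
  thus ?thesis using holomorphic_on_open[OF open_ball] by blast
qed

lemma hyp2F1_has_fps:
  assumes c: "c \<notin> \<int>\<^sub>\<le>\<^sub>0"
  shows "hyp2F1 a b c has_fps_expansion hyp_fps a b c"
proof -
  have "summable (\<lambda>n. fps_nth (hyp_fps a b c) n * (1/2) ^ n)" unfolding hyp_fps_def
    using hyp2F1_summable[OF c, of "1/2" a b] by simp
  from conv_radius_geI[OF this] have "fps_conv_radius (hyp_fps a b c) \<ge> ereal (norm (1/2 :: complex))" unfolding fps_conv_radius_def .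
  hence "fps_conv_radius (hyp_fps a b c) > 0" by (rule less_le_trans[rotated]) simp
  thus ?thesis unfolding has_fps_expansion_def by (simp add: eval_fps_def hyp_fps_def hyp2F1_def)
qed

text \<open>On coefficients the hypergeometric operator is a two-term recursion. Where c + n never
  vanishes, a formal solution is determined by its constant term.\<close>

lemma hyp_ode_nth:
  fixes f :: "complex fps"
  shows "fps_nth (fps_X * (1 - fps_X) * fps_deriv (fps_deriv f) + (fps_const c - fps_const (a + b + 1) * fps_X) * fps_deriv f - fps_const (a * b) * f) n
    = of_nat (Suc n) * (c + of_nat n) * fps_nth f (Suc n) - (a + of_nat n) * (b + of_nat n) * fps_nth f n"
proof -
  have "fps_X * (1 - fps_X) * fps_deriv (fps_deriv f) + (fps_const c - fps_const (a + b + 1) * fps_X) * fps_deriv f - fps_const (a * b) * f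
    = fps_X * fps_deriv (fps_deriv f) - fps_X * (fps_X * fps_deriv (fps_deriv f)) + fps_const c * fps_deriv f - fps_const (a + b + 1) * (fps_X * fps_deriv f) - fps_const (a * b) * f"
    by (simp add: algebra_simps)
  thus ?thesis
    by (cases n; cases "n - 1") (simp_all add: algebra_simps)
qed

lemma
  assumes c: "c \<notin> \<int>\<^sub>\<le>\<^sub>0"
  shows hyp_fps_ode: "fps_X * (1 - fps_X) * fps_deriv (fps_deriv (hyp_fps a b c)) + (fps_const c - fps_const (a + b + 1) * fps_X) * fps_deriv (hyp_fps a b c)
     - fps_const (a * b) * hyp_fps a b c = 0"
    and hyp_fps_unique: "\<And>g. fps_nth g 0 = 1 \<Longrightarrow>
      fps_X * (1 - fps_X) * fps_deriv (fps_deriv g) + (fps_const c - fps_const (a + b + 1) * fps_X) * fps_deriv g - fps_const (a * b) * g = 0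
      \<Longrightarrow> g = hyp_fps a b c"
proof -
  have cn: "c + of_nat n \<noteq> 0" for n using c plus_of_nat_eq_0_imp by blast
  have uS: "of_nat (Suc n) * (c + of_nat n) * fps_nth (hyp_fps a b c) (Suc n) = (a + of_nat n) * (b + of_nat n) * fps_nth (hyp_fps a b c) n" for n
  proof -
    have "pochhammer c n \<noteq> 0" using c pochhammer_eq_0_imp_nonpos_Int by blast
    thus ?thesis using cn[of n] unfolding hyp_fps_def fps_nth_Abs_fps pochhammer_Suc fact_Suc
      by (simp add: divide_simps del: of_nat_Suc) 
  qed
  thus "fps_X * (1 - fps_X) * fps_deriv (fps_deriv (hyp_fps a b c)) + (fps_const c - fps_const (a + b + 1) * fps_X) * fps_deriv (hyp_fps a b c)
     - fps_const (a * b) * hyp_fps a b c = 0"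
    by (intro fps_ext) (simp only: hyp_ode_nth, simp)
  fix g :: "complex fps"
  assume g: "fps_nth g 0 = 1"
    "fps_X * (1 - fps_X) * fps_deriv (fps_deriv g) + (fps_const c - fps_const (a + b + 1) * fps_X) * fps_deriv g - fps_const (a * b) * g = 0"
  have gS: "of_nat (Suc n) * (c + of_nat n) * fps_nth g (Suc n) = (a + of_nat n) * (b + of_nat n) * fps_nth g n" for n
    using arg_cong[OF g(2), of "\<lambda>f. fps_nth f n"] unfolding hyp_ode_nth by simp
  have "fps_nth g n = fps_nth (hyp_fps a b c) n" for n
  proof (induction n)
    case 0
    thus ?case using g by (simp add: hyp_fps_def)
  next
    case (Suc n)
    have "of_nat (Suc n) * (c + of_nat n) * fps_nth g (Suc n) = of_nat (Suc n) * (c + of_nat n) * fps_nth (hyp_fps a b c) (Suc n)"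
      unfolding gS uS Suc ..
    thus ?case using cn[of n] by (simp del: of_nat_Suc)
  qed
  thus "g = hyp_fps a b c" by (rule fps_ext)
qed

text \<open>\<open>E\<close> is the formal power (1 - X)^(a+b-c), characterised by its differential
  equation. The product solves the hypergeometric equation with parameters c - a and c - b, whose
  formal solution with constant term 1 is unique.\<close>

lemma hyp_fps_euler:
  assumes c: "c \<notin> \<int>\<^sub>\<le>\<^sub>0" and E: "(1 - fps_X) * fps_deriv E = - fps_const (a + b - c) * E" "fps_nth E 0 = 1"
  shows "E * hyp_fps a b c = hyp_fps (c - a) (c - b) c"
proof (rule hyp_fps_unique[OF c])
  define f u d where "f = hyp_fps a b c" and "u = (1 - fps_X :: complex fps)" and "d = fps_const (a + b - c)"
  define A B K X where "A = fps_const a" "B = fps_const b" "K = fps_const c" "X = (fps_X :: complex fps)"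
  have d: "d = A + B - K" by (simp add: d_def A_B_K_X_def)
  have u: "u = 1 - X" by (simp add: u_def A_B_K_X_def)
  define E1 E2 f1 f2 where "E1 = fps_deriv E" "E2 = fps_deriv E1" "f1 = fps_deriv f" "f2 = fps_deriv f1"
  have e1: "u * E1 = - d * E" using E by (simp add: u_def d_def E1_E2_f1_f2_def)
  have "fps_deriv (u * E1) = fps_deriv (- d * E)" unfolding e1 ..
  moreover have "fps_deriv (u * E1) = u * E2 - E1" by (simp add: u_def E1_E2_f1_f2_def algebra_simps)
  moreover have "fps_deriv (- d * E) = - d * E1" by (simp add: d_def E1_E2_f1_f2_def)
  ultimately have "u * E2 - E1 = - d * E1" by simp
  hence e2: "u * E2 = (1 - d) * E1" by (simp add: algebra_simps)
  have f: "X * u * f2 + (K - (A + B + 1) * X) * f1 - A * B * f = 0"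
    using hyp_fps_ode[OF c, of a b] by (simp add: f_def u_def A_B_K_X_def E1_E2_f1_f2_def fps_const_mult flip: fps_const_add)
  have g1: "fps_deriv (E * f) = E1 * f + E * f1" by (simp add: E1_E2_f1_f2_def algebra_simps)
  have g2: "fps_deriv (fps_deriv (E * f)) = E2 * f + 2 * E1 * f1 + E * f2" by (simp add: E1_E2_f1_f2_def algebra_simps)
  \<comment> \<open>The relations for the derivatives of \<open>E\<close> carry a factor u = 1 - X,
    hence the multiplication by u; formal power series form an integral domain, so it can be
    cancelled afterwards.\<close>
  have "u * (X * u * (E2 * f + 2 * E1 * f1 + E * f2) + (K - (2 * K - A - B + 1) * X) * (E1 * f + E * f1) - (K - A) * (K - B) * (E * f)) = 0"
    using e1 e2 f unfolding d u by algebra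
  moreover have "u \<noteq> 0" unfolding u_def by (metis fps_one_nth fps_sub_nth fps_X_nth fps_zero_nth zero_neq_one diff_zero)
  ultimately have z: "X * u * (E2 * f + 2 * E1 * f1 + E * f2) + (K - (2 * K - A - B + 1) * X) * (E1 * f + E * f1) - (K - A) * (K - B) * (E * f) = 0"
    using mult_eq_0_iff by blast
  have c12: "fps_const (c - a + (c - b) + 1) = 2 * K - A - B + 1" "fps_const ((c - a) * (c - b)) = (K - A) * (K - B)"
    by (simp_all add: A_B_K_X_def algebra_simps flip: fps_const_add fps_const_mult fps_const_sub)
  have fold: "fps_X = X" "1 - X = u" "fps_const c = K" "hyp_fps a b c = f"
    by (simp_all add: A_B_K_X_def u_def f_def)
  show "fps_X * (1 - fps_X) * fps_deriv (fps_deriv (E * hyp_fps a b c)) + (fps_const c - fps_const (c - a + (c - b) + 1) * fps_X) * fps_deriv (E * hyp_fps a b c)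
     - fps_const ((c - a) * (c - b)) * (E * hyp_fps a b c) = 0"
    by (simp only: fold g1 g2[unfolded g1] c12 z)
  show "fps_nth (E * hyp_fps a b c) 0 = 1" using E by (simp add: hyp_fps_def)
qed

text \<open>The formal identity gives equality near 0, and analytic continuation carries it to the
  whole disc.\<close>

lemma hyp2F1_euler:
  assumes c: "c \<notin> \<int>\<^sub>\<le>\<^sub>0" and x: "norm x < 1"
  shows "hyp2F1 (c - a) (c - b) c x = (1 - x) powr (a + b - c) * hyp2F1 a b c x"
proof -
  define e where "e x = (1 - x) powr (a + b - c)" for x :: complex
  have e_der: "(e has_field_derivative - (a + b - c) * (1 - x) powr (a + b - c - 1)) (at x)" if "x \<in> ball 0 1" for x
  proof -
    have "1 - x \<notin> \<real>\<^sub>\<le>\<^sub>0" using that complex_Re_le_cmod[of x] by (auto simp: complex_nonpos_Reals_iff)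
    from DERIV_chain2[OF has_field_derivative_powr[OF this] DERIV_diff[OF DERIV_const DERIV_ident], of "a + b - c"]
    show ?thesis unfolding e_def by (rule DERIV_cong) (simp add: algebra_simps)
  qed
  have e_hol: "e holomorphic_on ball 0 1"
    using e_der holomorphic_on_open[OF open_ball] by blast
  define E where "E = fps_expansion e 0"
  have Ee: "e has_fps_expansion E" unfolding E_def
    by (rule has_fps_expansion_fps_expansion[OF _ _ e_hol]) auto
  have "(\<lambda>x. (1 - x) * deriv e x) has_fps_expansion (1 - fps_X) * fps_deriv E"
    by (intro fps_expansion_intros Ee)
  moreover have "\<forall>\<^sub>F x in nhds 0. (1 - x) * deriv e x = - (a + b - c) * e x"
  proof -
    have "(1 - x) * deriv e x = - (a + b - c) * e x" if "x \<in> ball 0 1" for x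
    proof -
      have "1 - x \<noteq> 0" using that by auto
      hence "(1 - x) * (1 - x) powr (a + b - c - 1) = e x"
        using powr_add[of "1 - x" 1 "a + b - c - 1"] by (simp add: e_def add_diff_eq)
      thus ?thesis using DERIV_imp_deriv[OF e_der[OF that]] by (metis mult.left_commute)
    qed
    thus ?thesis using eventually_nhds_in_open[of "ball 0 1" "0::complex"] by (auto elim!: eventually_mono)
  qed
  ultimately have "(\<lambda>x. - (a + b - c) * e x) has_fps_expansion (1 - fps_X) * fps_deriv E"
    using has_fps_expansion_cong[of "\<lambda>x. (1 - x) * deriv e x" "\<lambda>x. - (a + b - c) * e x", OF _ refl] by simp
  moreover have "(\<lambda>x. - (a + b - c) * e x) has_fps_expansion fps_const (- (a + b - c)) * E"
    by (intro fps_expansion_intros Ee)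
  ultimately have E1: "(1 - fps_X) * fps_deriv E = - fps_const (a + b - c) * E"
    using fps_expansion_unique_complex by fastforce
  have "fps_nth E 0 = 1" using has_fps_expansion_imp_0_eq_fps_nth_0[OF Ee] by (simp add: e_def)
  from hyp_fps_euler[OF c E1 this] have fps: "E * hyp_fps a b c = hyp_fps (c - a) (c - b) c" .
  have "(\<lambda>x. e x * hyp2F1 a b c x) has_fps_expansion E * hyp_fps a b c"
    by (intro fps_expansion_intros Ee hyp2F1_has_fps c)
  with hyp2F1_has_fps[OF c, of "c - a" "c - b"]
  have "\<forall>\<^sub>F x in nhds 0. e x * hyp2F1 a b c x = hyp2F1 (c - a) (c - b) c x"
    unfolding fps has_fps_expansion_def by (auto elim: eventually_elim2)
  then obtain S where S: "open S" "0 \<in> S" "\<And>x. x \<in> S \<Longrightarrow> e x * hyp2F1 a b c x = hyp2F1 (c - a) (c - b) c x"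
    by (auto simp: eventually_nhds)
  have "e x * hyp2F1 a b c x = hyp2F1 (c - a) (c - b) c x"
  proof (rule analytic_continuation_open[of "S \<inter> ball 0 1" "ball 0 1" "\<lambda>x. e x * hyp2F1 a b c x" "hyp2F1 (c - a) (c - b) c"])
    show "(\<lambda>x. e x * hyp2F1 a b c x) holomorphic_on ball 0 1"
      by (intro holomorphic_intros e_hol hyp2F1_holomorphic c)
    show "hyp2F1 (c - a) (c - b) c holomorphic_on ball 0 1" by (rule hyp2F1_holomorphic[OF c])
    show "S \<inter> ball 0 1 \<noteq> {}" using S by auto
  qed (use S x in auto)
  thus ?thesis by (simp add: e_def)
qed

subsection \<open>Gegenbauer means\<close>

abbreviation gegen_interval :: "real measure" where
  "gegen_interval \<equiv> restrict_space lborel {-1<..<1}"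

definition gegen_weight :: "complex \<Rightarrow> real \<Rightarrow> complex" where
  "gegen_weight lam x = of_real (1 - x\<^sup>2) powr (lam - 1 / 2)"

lemma gegen_weight_measurable [measurable]: "gegen_weight lam \<in> borel_measurable borel"
  unfolding gegen_weight_def[abs_def] powr_def by measurable

lemma norm_gegen_weight: "x \<in> {-1<..<1} \<Longrightarrow> norm (gegen_weight lam x) = (1 - x\<^sup>2) powr (Re lam - 1 / 2)"
  unfolding gegen_weight_def
  by (subst norm_powr_real_powr) (auto simp: abs_square_less_1[of x, unfolded power2_eq_square] power2_eq_square intro: less_imp_le)

text \<open>The substitution x = 2t - 1, for which 1 - x^2 = 4t(1 - t), produces a Beta
  integral.\<close>

lemma
  fixes c :: real
  assumes c: "c > 0"
  shows gegen_real_integrable: "integrable gegen_interval (\<lambda>x. (1 - x\<^sup>2) powr (c - 1))"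
    and gegen_real_integral: "(\<integral>x. (1 - x\<^sup>2) powr (c - 1) \<partial>gegen_interval) = 2 * 4 powr (c - 1) * Beta c c"
proof -
  define f where "f t = t powr (c - 1) * (1 - t) powr (c - 1)" for t :: real
  define F where "F t = indicator {0..1} t *\<^sub>R f t" for t :: real
  have F: "integrable lborel F" using integrable_Beta[OF c c] by (simp add: set_integrable_def F_def[abs_def] f_def)
  have IF: "(\<integral>t. F t \<partial>lborel) = Beta c c"
    using set_borel_integral_eq_integral[OF integrable_Beta[OF c c]] has_integral_Beta_real[OF c c]
    by (simp add: set_lebesgue_integral_def F_def f_def integral_unique)
  have eq: "4 powr (c - 1) * F (1/2 + 1/2 * x) = indicator {-1<..<1} x *\<^sub>R ((1 - x\<^sup>2) powr (c - 1))" for x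
  proof (cases "x \<in> {-1<..<1}")
    case True
    have "1 - x\<^sup>2 = 4 * ((1/2 + 1/2 * x) * (1 - (1/2 + 1/2 * x)))" by (simp add: power2_eq_square algebra_simps)
    hence "(1 - x\<^sup>2) powr (c - 1) = 4 powr (c - 1) * ((1/2 + 1/2 * x) powr (c - 1) * (1 - (1/2 + 1/2 * x)) powr (c - 1))"
      using True by (simp only: powr_mult)
    thus ?thesis using True by (simp add: F_def f_def)
  next
    case False
    show ?thesis
    proof (cases "1/2 + 1/2 * x \<in> {0..1}")
      case True
      \<comment> \<open>At the endpoints of the closed interval the integrand is 0 by the convention
        \<open>0 powr a = 0\<close>.\<close>
      with False have "x = 1 \<or> x = -1" by auto
      thus ?thesis using False by (auto simp: F_def f_def)
    next
      case f: False
      thus ?thesis using False by (simp add: F_def)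
    qed
  qed
  have 1: "integrable lborel (\<lambda>x. 4 powr (c - 1) * F (1/2 + 1/2 * x))"
    by (intro integrable_mult_right lborel_integrable_real_affine[OF F]) auto
  thus "integrable gegen_interval (\<lambda>x. (1 - x\<^sup>2) powr (c - 1))"
    unfolding eq by (simp add: integrable_restrict_space set_integrable_def)
  have "(\<integral>x. (1 - x\<^sup>2) powr (c - 1) \<partial>gegen_interval) = (\<integral>x. 4 powr (c - 1) * F (1/2 + 1/2 * x) \<partial>lborel)"
    unfolding eq by (simp add: integral_restrict_space set_lebesgue_integral_def)
  also have "\<dots> = 4 powr (c - 1) * (\<integral>x. F (1/2 + 1/2 * x) \<partial>lborel)" by (rule integral_mult_right_zero)
  also have "(\<integral>x. F (1/2 + 1/2 * x) \<partial>lborel) = 2 * Beta c c"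
    using lborel_integral_real_affine[of "1/2" F "1/2"] IF by simp
  finally show "(\<integral>x. (1 - x\<^sup>2) powr (c - 1) \<partial>gegen_interval) = 2 * 4 powr (c - 1) * Beta c c" by simp
qed

definition gegen_mass :: "complex \<Rightarrow> complex" where
  "gegen_mass lam = (\<integral>x. gegen_weight lam x \<partial>gegen_interval)"

lemma gegen_weight_measurable' [measurable]: "gegen_weight lam \<in> borel_measurable gegen_interval"
  by (rule measurable_restrict_space1) simp

lemma gegen_weight_integrable:
  assumes "Re lam > -1/2"
  shows "integrable gegen_interval (gegen_weight lam)"
proof (rule Bochner_Integration.integrable_bound)
  show "integrable gegen_interval (\<lambda>x. (1 - x\<^sup>2) powr ((Re lam + 1/2) - 1))"
    by (rule gegen_real_integrable) (use assms in simp)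
  show "AE x in gegen_interval. norm (gegen_weight lam x) \<le> norm ((1 - x\<^sup>2) powr ((Re lam + 1/2) - 1))"
    by (rule AE_I2) (simp add: norm_gegen_weight)
qed measurable

text \<open>For complex \<lambda> the weight is not positive, so the mass might vanish a priori. Its
  closed form, a Beta value continued from real \<lambda>, is a product of factors without zeros in
  this half-plane.\<close>

lemma gegen_mass_nonzero:
  assumes lam: "Re lam > -1/2"
  shows "gegen_mass lam \<noteq> 0"
proof -
  define U where "U = {l. Re l > -1/2}"
  define B where "B l = 2 * 4 powr (l - 1/2) * (Gamma (l + 1/2) ^ 2 * rGamma (2 * l + 1))" for l :: complex
  have U: "open U" "connected U" unfolding U_def
    by (auto intro: open_halfspace_Re_gt convex_connected convex_halfspace_Re_gt)
  have nn: "l + 1/2 \<notin> \<int>\<^sub>\<le>\<^sub>0" "2 * l + 1 \<notin> \<int>\<^sub>\<le>\<^sub>0" if "l \<in> U" for l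
    using that by (auto simp: U_def intro!: Re_pos_not_nonpos_Ints)
  have "gegen_mass lam = B lam"
  proof (rule holomorphic_eqI_on_reals[of gegen_mass U B 0 1])
    show "B holomorphic_on U" unfolding B_def using nn by (intro holomorphic_intros) auto
    show "gegen_mass holomorphic_on U" unfolding gegen_mass_def[abs_def]
    proof (rule holomorphic_param_integral[OF U(1)])
      fix l0 assume l0: "l0 \<in> U"
      define r where "r = (Re l0 + 1/2) / 2"
      have r: "r > 0" using l0 by (simp add: r_def U_def)
      show "\<exists>r>0. \<exists>g. integrable gegen_interval g \<and> (\<forall>l\<in>ball l0 r \<inter> U. \<forall>x\<in>space gegen_interval. norm (gegen_weight l x) \<le> g x)"
      proof (intro exI[of _ r] conjI exI ballI)
        show "integrable gegen_interval (\<lambda>x. (1 - x\<^sup>2) powr (r - 1))" by (rule gegen_real_integrable[OF r])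
        fix l x assume l: "l \<in> ball l0 r \<inter> U" and x: "x \<in> space gegen_interval"
        have "Re l - 1/2 \<ge> r - 1" using l abs_Re_le_cmod[of "l0 - l"] by (auto simp: dist_norm r_def field_simps)
        moreover have "1 - x\<^sup>2 \<le> 1" "1 - x\<^sup>2 \<ge> 0" using x by (auto simp: abs_square_le_1[of x] abs_le_iff)
        ultimately have "(1 - x\<^sup>2) powr (Re l - 1/2) \<le> (1 - x\<^sup>2) powr (r - 1)" by (intro powr_mono')
        thus "norm (gegen_weight l x) \<le> (1 - x\<^sup>2) powr (r - 1)" using x by (simp add: norm_gegen_weight)
      qed (rule r)
    next
      show "(\<lambda>l. gegen_weight l x) holomorphic_on U" if "x \<in> space gegen_interval" for x
      proof -
        have "x\<^sup>2 < 1" using that by (auto simp: abs_square_less_1)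
        hence "complex_of_real (1 - x\<^sup>2) \<noteq> 0" by (subst of_real_eq_0_iff) simp
        thus ?thesis unfolding gegen_weight_def by (intro holomorphic_intros) auto
      qed
    qed measurable
    fix l :: real assume l: "0 < l"
    have "gegen_mass (of_real l) = (\<integral>x. complex_of_real ((1 - x\<^sup>2) powr (l - 1/2)) \<partial>gegen_interval)"
      unfolding gegen_mass_def
    proof (rule Bochner_Integration.integral_cong[OF refl])
      fix x assume "x \<in> space gegen_interval"
      hence "1 - x\<^sup>2 \<ge> 0" by (auto simp: abs_square_le_1[of x] abs_le_iff)
      hence "complex_of_real (1 - x\<^sup>2) powr complex_of_real (l - 1/2) = complex_of_real ((1 - x\<^sup>2) powr (l - 1/2))"
        by (rule powr_of_real)
      thus "gegen_weight (of_real l) x = complex_of_real ((1 - x\<^sup>2) powr (l - 1/2))" by (simp add: gegen_weight_def)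
    qed
    also have "\<dots> = complex_of_real (2 * 4 powr ((l + 1/2) - 1) * Beta (l + 1/2) (l + 1/2))"
      using gegen_real_integral[of "l + 1/2"] l by simp
    also have "\<dots> = B (of_real l)"
    proof -
      have "Beta (l + 1/2) (l + 1/2) = Gamma (l + 1/2) ^ 2 * rGamma (2 * l + 1)"
        by (simp add: Beta_altdef power2_eq_square)
      moreover have "complex_of_real (4 powr (l - 1/2)) = 4 powr (of_real l - 1/2)"
        using powr_of_real[of 4 "l - 1/2"] by simp
      moreover have "complex_of_real (Gamma (l + 1/2)) = Gamma (of_real l + 1/2)" "complex_of_real (rGamma (2 * l + 1)) = rGamma (2 * of_real l + 1)"
        using Gamma_complex_of_real[of "l + 1/2"] rGamma_complex_of_real[of "2 * l + 1"] by simp_all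
      ultimately show ?thesis by (simp add: B_def)
    qed
    finally show "of_real l \<in> U \<and> gegen_mass (of_real l) = B (of_real l)" using l by (simp add: U_def)
  qed (use U lam in \<open>auto simp: U_def\<close>)
  moreover have "B lam \<noteq> 0"
    using nn[of lam] lam by (simp add: B_def U_def Gamma_eq_zero_iff rGamma_eq_zero_iff)
  ultimately show ?thesis by simp
qed

text \<open>On a closed disc times the compact interval [-1, 1] the continuous \<open>h\<close> is
  bounded, so a multiple of the integrable weight dominates.\<close>

lemma
  fixes h :: "complex \<Rightarrow> real \<Rightarrow> complex"
  assumes lam: "Re lam > -1/2" and U: "open U"
    and cont: "continuous_on (U \<times> {-1..1}) (\<lambda>(Z, x). h Z x)"
    and der: "\<And>Z x. Z \<in> U \<Longrightarrow> x \<in> {-1..1} \<Longrightarrow> ((\<lambda>Z. h Z x) has_field_derivative h' Z x) (at Z)"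
    and Z: "Z \<in> U"
  shows gegen_param_integrable: "integrable gegen_interval (\<lambda>x. gegen_weight lam x * h Z x)"
    and gegen_param_integrable_deriv: "integrable gegen_interval (\<lambda>x. gegen_weight lam x * h' Z x)"
    and gegen_param_deriv: "((\<lambda>Z. \<integral>x. gegen_weight lam x * h Z x \<partial>gegen_interval) has_field_derivative
       (\<integral>x. gegen_weight lam x * h' Z x \<partial>gegen_interval)) (at Z)"
proof -
  have sub: "x \<in> {-1..1}" if "x \<in> space gegen_interval" for x using that by auto
  have meas: "(\<lambda>x. gegen_weight lam x * h Z x) \<in> borel_measurable gegen_interval" if "Z \<in> U" for Z
  proof -
    have "continuous_on {-1<..<1} (\<lambda>x. (\<lambda>(Z, x). h Z x) (Z, x))"
      by (rule continuous_on_compose2[OF cont]) (use that in \<open>auto intro!: continuous_intros\<close>)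
    hence "h Z \<in> borel_measurable gegen_interval"
      using borel_measurable_continuous_on_restrict[of "{-1<..<1}" "h Z"]
      by (simp cong: measurable_cong_sets add: sets_restrict_space)
    thus ?thesis by measurable
  qed
  have hol: "(\<lambda>Z. gegen_weight lam x * h Z x) holomorphic_on U" if "x \<in> space gegen_interval" for x
  proof -
    have "(\<lambda>Z. h Z x) holomorphic_on U" using der[OF _ sub[OF that]] holomorphic_on_open[OF U] by blast
    thus ?thesis by (intro holomorphic_intros)
  qed
  have dom: "\<exists>r>0. \<exists>g. integrable gegen_interval g \<and> (\<forall>Z\<in>ball Z0 r \<inter> U. \<forall>x\<in>space gegen_interval. norm (gegen_weight lam x * h Z x) \<le> g x)"
    if Z0: "Z0 \<in> U" for Z0
  proof -
    obtain r where r: "r > 0" "cball Z0 r \<subseteq> U" using U Z0 unfolding open_contains_cball by auto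
    have cpt: "compact ((\<lambda>(Z, x). h Z x) ` (cball Z0 r \<times> {-1..1}))"
      using r by (intro compact_continuous_image continuous_on_subset[OF cont] compact_Times) auto
    obtain B where B: "\<And>Z x. Z \<in> cball Z0 r \<Longrightarrow> x \<in> {-1..1} \<Longrightarrow> norm (h Z x) \<le> B"
    proof -
      obtain B where B: "\<forall>y\<in>(\<lambda>(Z, x). h Z x) ` (cball Z0 r \<times> {-1..1}). norm y \<le> B"
        using compact_imp_bounded[OF cpt] unfolding bounded_iff by blast
      have "norm (h Z x) \<le> B" if "Z \<in> cball Z0 r" "x \<in> {-1..1}" for Z x
      proof -
        have "h Z x \<in> (\<lambda>(Z, x). h Z x) ` (cball Z0 r \<times> {-1..1})" using that by (intro image_eqI[of _ _ "(Z, x)"]) auto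
        thus ?thesis using B by blast
      qed
      thus ?thesis using that by blast
    qed
    show ?thesis
    proof (intro exI[of _ r] conjI exI ballI)
      show "integrable gegen_interval (\<lambda>x. norm (gegen_weight lam x) * B)"
        by (intro integrable_mult_left integrable_norm gegen_weight_integrable lam)
      show "norm (gegen_weight lam x * h Z x) \<le> norm (gegen_weight lam x) * B"
        if "Z \<in> ball Z0 r \<inter> U" "x \<in> space gegen_interval" for Z x
        unfolding norm_mult using B[of Z x] that sub by (intro mult_left_mono) auto
    qed (rule r)
  qed
  have d: "deriv (\<lambda>Z. gegen_weight lam x * h Z x) Z = gegen_weight lam x * h' Z x" if "x \<in> space gegen_interval" for x
    by (rule DERIV_imp_deriv, rule DERIV_cmult, rule der[OF Z sub[OF that]])
  note H = U meas hol dom Z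
  show "integrable gegen_interval (\<lambda>x. gegen_weight lam x * h Z x)" by (rule integrable_param_integral[OF H])
  have "integrable gegen_interval (\<lambda>x. deriv (\<lambda>Z. gegen_weight lam x * h Z x) Z)" by (rule integrable_param_deriv[OF H])
  thus "integrable gegen_interval (\<lambda>x. gegen_weight lam x * h' Z x)"
    by (subst (asm) Bochner_Integration.integrable_cong[OF refl d]) 
  have "((\<lambda>Z. \<integral>x. gegen_weight lam x * h Z x \<partial>gegen_interval) has_field_derivative
       (\<integral>x. deriv (\<lambda>Z. gegen_weight lam x * h Z x) Z \<partial>gegen_interval)) (at Z)"
    by (rule has_field_derivative_param_integral[OF H])
  thus "((\<lambda>Z. \<integral>x. gegen_weight lam x * h Z x \<partial>gegen_interval) has_field_derivative
       (\<integral>x. gegen_weight lam x * h' Z x \<partial>gegen_interval)) (at Z)"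
    by (subst (asm) Bochner_Integration.integral_cong[OF refl d])
qed

section \<open>Spherical means along segments in the right half-plane\<close>

definition cone_nbhd :: "complex \<Rightarrow> complex set" where
  "cone_nbhd W = {Z. \<bar>Im (W + Z)\<bar> < Re (W + Z) \<and> \<bar>Im (W - Z)\<bar> < Re (W - Z)}"

lemma cone_nbhd_open_connected: "open (cone_nbhd W)" "connected (cone_nbhd W)"
proof -
  define H where "H a b k = {Z :: complex. inner (Complex a b) Z < k}" for a b k
  have eq: "cone_nbhd W = H (-1) 1 (Re W - Im W) \<inter> H (-1) (-1) (Re W + Im W) \<inter> H 1 (-1) (Re W - Im W) \<inter> H 1 1 (Re W + Im W)"
    unfolding cone_nbhd_def H_def by (auto simp: inner_complex_def abs_less_iff)
  show "open (cone_nbhd W)" unfolding eq H_def by (intro open_Int open_halfspace_lt)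
  show "connected (cone_nbhd W)" unfolding eq H_def by (intro convex_connected convex_Int convex_halfspace_lt)
qed

definition chord :: "complex \<Rightarrow> complex \<Rightarrow> real \<Rightarrow> complex" where
  "chord W Z x = Z\<^sup>2 + W\<^sup>2 - 2 * of_real x * Z * W"

text \<open>As x runs from -1 to 1 the chord runs linearly from (W + Z)^2 to (W - Z)^2. Membership
  in \<open>cone_nbhd W\<close> keeps W + Z and W - Z within an angle pi/4 of the positive axis, so
  both squares, and with them the segment, have positive real part.\<close>

lemma Re_chord_pos:
  assumes "Z \<in> cone_nbhd W" "x \<in> {-1..1}"
  shows "Re (chord W Z x) > 0"
proof -
  have eq: "chord W Z x = of_real ((1 - x) / 2) * (W + Z)\<^sup>2 + of_real ((1 + x) / 2) * (W - Z)\<^sup>2"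
    by (simp add: chord_def power2_eq_square field_simps)
  have p: "Re ((W + Z)\<^sup>2) > 0" "Re ((W - Z)\<^sup>2) > 0" using assms cone_square[of "W + Z"] cone_square[of "W - Z"] by (auto simp: cone_nbhd_def)
  have "Re (chord W Z x) = (1 - x) / 2 * Re ((W + Z)\<^sup>2) + (1 + x) / 2 * Re ((W - Z)\<^sup>2)"
    unfolding eq by (simp only: plus_complex.sel Re_complex_of_real times_complex.sel Im_complex_of_real mult_zero_left diff_zero)
  moreover have "(1 - x) / 2 * Re ((W + Z)\<^sup>2) \<ge> 0" "(1 + x) / 2 * Re ((W - Z)\<^sup>2) \<ge> 0" using assms p by auto
  moreover have "(1 - x) / 2 * Re ((W + Z)\<^sup>2) > 0 \<or> (1 + x) / 2 * Re ((W - Z)\<^sup>2) > 0"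
    using assms p by (cases "x < 1") auto
  ultimately show ?thesis by linarith
qed

text \<open>The integrand is the derivative in x of (1 - x^2)^(\<lambda>+1/2) p(chord), which is
  continuous up to the endpoints because Re \<lambda> > -1/2, and vanishes there.\<close>

lemma integral_gegen_total_derivative:
  fixes W Z :: complex
  assumes lam: "Re lam > -1/2" and Z: "Z \<in> cone_nbhd W"
    and p: "\<And>\<zeta>. Re \<zeta> > 0 \<Longrightarrow> (p has_field_derivative p' \<zeta>) (at \<zeta>)"
    and int: "integrable gegen_interval (\<lambda>x. gegen_weight lam x *
       (- (2 * lam + 1) * of_real x * p (chord W Z x) - 2 * Z * W * (1 - of_real x ^ 2) * p' (chord W Z x)))"
  shows "(\<integral>x. gegen_weight lam x *
       (- (2 * lam + 1) * of_real x * p (chord W Z x) - 2 * Z * W * (1 - of_real x ^ 2) * p' (chord W Z x)) \<partial>gegen_interval) = 0"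
proof -
  define D where "D x = gegen_weight lam x * (- (2 * lam + 1) * of_real x * p (chord W Z x) - 2 * Z * W * (1 - of_real x ^ 2) * p' (chord W Z x))" for x
  define Q where "Q x = of_real (1 - x\<^sup>2) powr (lam + 1/2) * p (chord W Z x)" for x
  have pc: "continuous_on {\<zeta>. Re \<zeta> > 0} p" using p DERIV_isCont by (intro continuous_at_imp_continuous_on) blast
  have "(D has_integral (Q 1 - Q (-1))) {-1..1}"
  proof (rule fundamental_theorem_of_calculus_interior)
    have sq: "x\<^sup>2 \<le> 1" if "-1 \<le> x" "x \<le> 1" for x :: real using that by (simp add: abs_square_le_1 abs_le_iff)
    have "continuous_on {-1..1} (\<lambda>x. complex_of_real (1 - x\<^sup>2) powr (lam + 1/2))"
      using lam by (intro continuous_on_powr_complex continuous_intros) (auto simp: sq)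
    moreover have "continuous_on {-1..1} (\<lambda>x. p (chord W Z x))"
      by (rule continuous_on_compose2[OF pc])
         (use Re_chord_pos[OF Z] in \<open>auto simp: chord_def[abs_def] intro!: continuous_intros\<close>)
    ultimately show "continuous_on {-1..1} Q" unfolding Q_def by (rule continuous_on_mult)
  next
    fix x :: real assume x: "x \<in> {-1<..<1}"
    have x2: "1 - x\<^sup>2 > 0" using x by (auto simp: abs_square_less_1)
    define c where "c z = Z\<^sup>2 + W\<^sup>2 - 2 * z * Z * W" for z :: complex
    have cx: "c (of_real x) = chord W Z x" by (simp add: c_def chord_def)
    have "1 - (complex_of_real x)\<^sup>2 = of_real (1 - x\<^sup>2)" by simp
    hence nn: "1 - (complex_of_real x)\<^sup>2 \<notin> \<real>\<^sub>\<le>\<^sub>0" using x2 by (metis nonpos_Reals_of_real_iff not_le)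
    have d1: "((\<lambda>z. (1 - z\<^sup>2) powr (lam + 1/2)) has_field_derivative (lam + 1/2) * (1 - (of_real x)\<^sup>2) powr (lam - 1/2) * (- 2 * of_real x)) (at (complex_of_real x))"
    proof (rule DERIV_cong)
      show "((\<lambda>z. (1 - z\<^sup>2) powr (lam + 1/2)) has_field_derivative (lam + 1/2) * (1 - (of_real x)\<^sup>2) powr (lam + 1/2 - 1) * (- 2 * of_real x)) (at (complex_of_real x))"
      proof (rule DERIV_chain2[where f = "\<lambda>z. z powr (lam + 1/2)" and g = "\<lambda>z. 1 - z\<^sup>2"])
        show "((\<lambda>z. z powr (lam + 1/2)) has_field_derivative (lam + 1/2) * (1 - (of_real x)\<^sup>2) powr (lam + 1/2 - 1)) (at (1 - (complex_of_real x)\<^sup>2))"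
          by (rule has_field_derivative_powr[OF nn])
        show "((\<lambda>z. 1 - z\<^sup>2) has_field_derivative (- 2 * of_real x)) (at (complex_of_real x))"
          by (auto intro!: derivative_eq_intros)
      qed
    qed (simp add: algebra_simps)
    have d2: "((\<lambda>z. p (c z)) has_field_derivative p' (chord W Z x) * (- 2 * Z * W)) (at (complex_of_real x))"
    proof (rule DERIV_chain2[where f = p and g = c])
      show "(p has_field_derivative p' (chord W Z x)) (at (c (of_real x)))"
        unfolding cx using x by (intro p Re_chord_pos[OF Z]) auto
      show "(c has_field_derivative (- 2 * Z * W)) (at (of_real x))" unfolding c_def by (auto intro!: derivative_eq_intros)
    qed
    have pw: "(1 - (complex_of_real x)\<^sup>2) powr (lam + 1/2) = (1 - (of_real x)\<^sup>2) powr (lam - 1/2) * (1 - (of_real x)\<^sup>2)"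
      using powr_add[of "1 - (complex_of_real x)\<^sup>2" "lam - 1/2" 1] nn by (auto simp: add.commute)
    have gw: "(1 - (complex_of_real x)\<^sup>2) powr (lam - 1/2) = gegen_weight lam x" by (simp add: gegen_weight_def)
    have "((\<lambda>z. (1 - z\<^sup>2) powr (lam + 1/2) * p (c z)) has_field_derivative
       (lam + 1/2) * (1 - (of_real x)\<^sup>2) powr (lam - 1/2) * (- 2 * of_real x) * p (c (of_real x))
       + p' (chord W Z x) * (- 2 * Z * W) * (1 - (of_real x)\<^sup>2) powr (lam + 1/2)) (at (complex_of_real x))"
      by (rule DERIV_mult[OF d1 d2])
    also have "(lam + 1/2) * (1 - (of_real x)\<^sup>2) powr (lam - 1/2) * (- 2 * of_real x) * p (c (of_real x))
       + p' (chord W Z x) * (- 2 * Z * W) * (1 - (of_real x)\<^sup>2) powr (lam + 1/2) = D x"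
      unfolding pw gw cx D_def by (simp add: algebra_simps)
    finally have "((\<lambda>x. (1 - (of_real x)\<^sup>2) powr (lam + 1/2) * p (c (of_real x))) has_vector_derivative D x) (at x)"
      using has_vector_derivative_real_field[of "\<lambda>z. (1 - z\<^sup>2) powr (lam + 1/2) * p (c z)" "D x" x UNIV] by simp
    moreover have "(\<lambda>x. (1 - (complex_of_real x)\<^sup>2) powr (lam + 1/2) * p (c (of_real x))) = Q"
      by (simp add: Q_def fun_eq_iff c_def chord_def)
    ultimately show "(Q has_vector_derivative D x) (at x)" by simp
  qed simp
  moreover have "Q 1 = 0" "Q (-1) = 0" by (simp_all add: Q_def)
  ultimately have "(D has_integral 0) {-1<..<1}" by (simp add: has_integral_Icc_iff_Ioo)
  hence I0: "integral {-1<..<1} D = 0" by (simp add: integral_unique)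
  have "set_integrable lborel {-1<..<1} D" using int unfolding D_def[symmetric] by (simp add: integrable_restrict_space set_integrable_def)
  from set_borel_integral_eq_integral(2)[OF this] have "(LINT x:{-1<..<1}|lborel. D x) = 0" using I0 by simp
  thus ?thesis unfolding D_def[symmetric] by (simp add: integral_restrict_space set_lebesgue_integral_def)
qed

text \<open>Pizzetti's formula for the radial Laplacian in dimension \<open>2\<lambda> + 2\<close>: written in the squared radius
  \<open>\<zeta>\<close> the operator is \<open>4 \<zeta> g'' + 4 (\<lambda> + 1) g'\<close>, and \<open>chord W Z x\<close> is the squared length of
  the third side of a triangle with sides \<open>Z\<close>, \<open>W\<close> enclosing an angle of cosine \<open>x\<close>.\<close>

lemma pizzetti:
  assumes lam: "Re lam > -1/2" and W: "\<bar>Im W\<bar> < Re W" and Z: "Z \<in> cone_nbhd W"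
    and g: "\<And>n \<zeta>. Re \<zeta> > 0 \<Longrightarrow> (g n has_field_derivative g' n \<zeta>) (at \<zeta>)"
    and g': "\<And>n \<zeta>. Re \<zeta> > 0 \<Longrightarrow> (g' n has_field_derivative g'' n \<zeta>) (at \<zeta>)"
    and laplace: "\<And>n \<zeta>. Re \<zeta> > 0 \<Longrightarrow> 4 * \<zeta> * g'' n \<zeta> + 4 * (lam + 1) * g' n \<zeta> = g (Suc n) \<zeta>"
    and G: "G holomorphic_on cone_nbhd W"
    and sums: "\<And>Z. Z \<in> cone_nbhd W \<Longrightarrow> (\<lambda>k. g k (W\<^sup>2) / (4 ^ k * fact k * pochhammer (lam + 1) k) * Z ^ (2 * k)) sums G Z"
  shows "(\<integral>x. gegen_weight lam x * g 0 (chord W Z x) \<partial>gegen_interval) = gegen_mass lam * G Z"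
proof -
  define U where "U = cone_nbhd W"
  have U: "open U" "connected U" unfolding U_def by (rule cone_nbhd_open_connected)+
  have 0: "0 \<in> U" using W by (simp add: U_def cone_nbhd_def)
  define M where "M n Z = (\<integral>x. gegen_weight lam x * g n (chord W Z x) \<partial>gegen_interval)" for n Z
  define h1 where "h1 n Z x = g' n (chord W Z x) * (2 * Z - 2 * of_real x * W)" for n Z and x :: real
  define h2 where "h2 n Z x = g'' n (chord W Z x) * (2 * Z - 2 * of_real x * W) ^ 2 + 2 * g' n (chord W Z x)" for n Z and x :: real
  define M1 where "M1 n Z = (\<integral>x. gegen_weight lam x * h1 n Z x \<partial>gegen_interval)" for n Z
  define M2 where "M2 n Z = (\<integral>x. gegen_weight lam x * h2 n Z x \<partial>gegen_interval)" for n Z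
  have gc: "continuous_on {\<zeta>. Re \<zeta> > 0} (g n)" "continuous_on {\<zeta>. Re \<zeta> > 0} (g' n)" for n
    using g g' DERIV_isCont by (intro continuous_at_imp_continuous_on; blast)+
  have ch: "continuous_on (U \<times> {-1..1}) (\<lambda>(Z, x). chord W Z x)"
    unfolding chord_def split_beta by (intro continuous_intros)
  have ch': "(\<lambda>(Z, x). chord W Z x) ` (U \<times> {-1..1}) \<subseteq> {\<zeta>. Re \<zeta> > 0}" using Re_chord_pos by (auto simp: U_def)
  have c0: "continuous_on (U \<times> {-1..1}) (\<lambda>(Z, x). g n (chord W Z x))"
   and c0': "continuous_on (U \<times> {-1..1}) (\<lambda>(Z, x). g' n (chord W Z x))" for n
    using continuous_on_compose2[OF gc(1) ch ch'] continuous_on_compose2[OF gc(2) ch ch'] by (simp_all add: split_beta)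
  have c1: "continuous_on (U \<times> {-1..1}) (\<lambda>(Z, x). h1 n Z x)" for n
    using c0'[of n] unfolding h1_def split_beta by (intro continuous_intros)
  have dchord: "((\<lambda>Z. chord W Z x) has_field_derivative (2 * Z - 2 * of_real x * W)) (at Z)" for Z x
    unfolding chord_def by (auto intro!: derivative_eq_intros)
  have d0: "((\<lambda>Z. g n (chord W Z x)) has_field_derivative h1 n Z x) (at Z)" if "Z \<in> U" "x \<in> {-1..1}" for n Z x
    unfolding h1_def by (rule DERIV_chain2[OF g dchord]) (use that Re_chord_pos in \<open>auto simp: U_def\<close>)
  have d1: "((\<lambda>Z. h1 n Z x) has_field_derivative h2 n Z x) (at Z)" if "Z \<in> U" "x \<in> {-1..1}" for n Z x
  proof -
    have "((\<lambda>Z. g' n (chord W Z x)) has_field_derivative g'' n (chord W Z x) * (2 * Z - 2 * of_real x * W)) (at Z)"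
      by (rule DERIV_chain2[OF g' dchord]) (use that Re_chord_pos in \<open>auto simp: U_def\<close>)
    moreover have "((\<lambda>Z. 2 * Z - 2 * of_real x * W) has_field_derivative 2) (at Z)" by (auto intro!: derivative_eq_intros)
    ultimately show ?thesis unfolding h1_def h2_def
      by (rule DERIV_cong[OF DERIV_mult]) (simp add: power2_eq_square algebra_simps)
  qed
  note P0 = lam U(1) c0 d0 and P1 = lam U(1) c1 d1
  have i0: "integrable gegen_interval (\<lambda>x. gegen_weight lam x * g n (chord W Z x))" if "Z \<in> U" for n Z
    by (rule gegen_param_integrable[OF P0 that])
  have i1: "integrable gegen_interval (\<lambda>x. gegen_weight lam x * h1 n Z x)" if "Z \<in> U" for n Z
    by (rule gegen_param_integrable[OF P1 that])
  have i2: "integrable gegen_interval (\<lambda>x. gegen_weight lam x * h2 n Z x)" if "Z \<in> U" for n Z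
    by (rule gegen_param_integrable_deriv[OF P1 that])
  have dM: "(M n has_field_derivative M1 n Z) (at Z)" if "Z \<in> U" for n Z
    unfolding M_def[abs_def] M1_def by (rule gegen_param_deriv[OF P0 that])
  have dM1: "(M1 n has_field_derivative M2 n Z) (at Z)" if "Z \<in> U" for n Z
    unfolding M1_def[abs_def] M2_def by (rule gegen_param_deriv[OF P1 that])
  \<comment> \<open>Darboux's equation for spherical means: the radial Laplacian in Z of a mean is
    the mean of the Laplacian. The difference of the two sides is a total derivative in x, with p =
    2W g'.\<close>
  have ode: "Z * M2 n Z + (2 * lam + 1) * M1 n Z = Z * M (Suc n) Z" if Z: "Z \<in> U" for n Z
  proof -
    have eq: "Z * (gegen_weight lam x * h2 n Z x) + (2 * lam + 1) * (gegen_weight lam x * h1 n Z x) - Z * (gegen_weight lam x * g (Suc n) (chord W Z x))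
      = gegen_weight lam x * (- (2 * lam + 1) * of_real x * (2 * W * g' n (chord W Z x)) - 2 * Z * W * (1 - of_real x ^ 2) * (2 * W * g'' n (chord W Z x)))"
      if "x \<in> {-1..1}" for x
    proof -
      have eqg: "g (Suc n) (chord W Z x) = 4 * (Z\<^sup>2 + W\<^sup>2 - 2 * of_real x * Z * W) * g'' n (chord W Z x) + 4 * (lam + 1) * g' n (chord W Z x)"
        using laplace[of "chord W Z x" n] Re_chord_pos[of Z W x] that Z by (simp add: U_def chord_def)
      show ?thesis unfolding h1_def h2_def eqg by (simp add: power2_eq_square algebra_simps)
    qed
    have int: "integrable gegen_interval (\<lambda>x. Z * (gegen_weight lam x * h2 n Z x) + (2 * lam + 1) * (gegen_weight lam x * h1 n Z x) - Z * (gegen_weight lam x * g (Suc n) (chord W Z x)))"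
      by (intro Bochner_Integration.integrable_diff Bochner_Integration.integrable_add integrable_mult_right i0 i1 i2 Z)
    have "Z * M2 n Z + (2 * lam + 1) * M1 n Z - Z * M (Suc n) Z =
      (\<integral>x. Z * (gegen_weight lam x * h2 n Z x) + (2 * lam + 1) * (gegen_weight lam x * h1 n Z x) - Z * (gegen_weight lam x * g (Suc n) (chord W Z x)) \<partial>gegen_interval)"
      unfolding M_def M1_def M2_def using i0[OF Z] i1[OF Z] i2[OF Z] by simp
    also have "\<dots> = (\<integral>x. gegen_weight lam x * (- (2 * lam + 1) * of_real x * (2 * W * g' n (chord W Z x)) - 2 * Z * W * (1 - of_real x ^ 2) * (2 * W * g'' n (chord W Z x))) \<partial>gegen_interval)"
      by (intro Bochner_Integration.integral_cong refl eq) auto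
    also have "\<dots> = 0"
    proof (rule integral_gegen_total_derivative[OF lam, of Z W "\<lambda>\<zeta>. 2 * W * g' n \<zeta>" "\<lambda>\<zeta>. 2 * W * g'' n \<zeta>"])
      show "((\<lambda>\<zeta>. 2 * W * g' n \<zeta>) has_field_derivative 2 * W * g'' n \<zeta>) (at \<zeta>)" if "Re \<zeta> > 0" for \<zeta>
        by (rule DERIV_cmult[OF g'[OF that]])
      show "integrable gegen_interval (\<lambda>x. gegen_weight lam x * (- (2 * lam + 1) * of_real x * (2 * W * g' n (chord W Z x)) - 2 * Z * W * (1 - of_real x ^ 2) * (2 * W * g'' n (chord W Z x))))"
        by (rule Bochner_Integration.integrable_cong[THEN iffD1, OF refl _ int], rule eq) auto
    qed (use Z in \<open>simp add: U_def\<close>)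
    finally show ?thesis by simp
  qed
  have Mh: "M n holomorphic_on U" for n using dM holomorphic_on_open[OF U(1)] by blast
  define F where "F n = fps_expansion (M n) 0" for n
  have F: "M n has_fps_expansion F n" for n unfolding F_def by (rule has_fps_expansion_fps_expansion[OF U(1) 0 Mh])
  have dd: "deriv (M n) Z = M1 n Z" if "Z \<in> U" for n Z by (rule DERIV_imp_deriv[OF dM[OF that]])
  have ddd: "deriv (deriv (M n)) Z = M2 n Z" if "Z \<in> U" for n Z
    by (rule DERIV_imp_deriv, rule has_field_derivative_transform_within_open[OF dM1[OF that] U(1) that]) (simp add: dd)
  have exp1: "(\<lambda>Z. Z * deriv (deriv (M n)) Z + (2 * lam + 1) * deriv (M n) Z) has_fps_expansion fps_X * fps_deriv (fps_deriv (F n)) + fps_const (2 * lam + 1) * fps_deriv (F n)" for n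
    by (intro fps_expansion_intros F)
  have exp2: "\<forall>\<^sub>F Z in nhds 0. Z * deriv (deriv (M n)) Z + (2 * lam + 1) * deriv (M n) Z = Z * M (Suc n) Z" for n
    using eventually_nhds_in_open[OF U(1) 0] by eventually_elim (simp add: dd ddd ode)
  have "(\<lambda>Z. Z * M (Suc n) Z) has_fps_expansion fps_X * fps_deriv (fps_deriv (F n)) + fps_const (2 * lam + 1) * fps_deriv (F n)" for n
    by (rule has_fps_expansion_cong[THEN iffD1, OF exp2 refl exp1])
  moreover have "(\<lambda>Z. Z * M (Suc n) Z) has_fps_expansion fps_X * F (Suc n)" for n by (intro fps_expansion_intros F)
  ultimately have fps: "fps_X * fps_deriv (fps_deriv (F n)) + fps_const (2 * lam + 1) * fps_deriv (F n) = fps_X * F (Suc n)" for n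
    using fps_expansion_unique_complex by blast
  \<comment> \<open>Darboux's equation on coefficients. At k = 0 it kills the coefficient of Z, and
    through the recursion all odd ones.\<close>
  have rec: "of_nat (Suc k) * (of_nat k + 2 * lam + 1) * fps_nth (F n) (Suc k) = (if k = 0 then 0 else fps_nth (F (Suc n)) (k - 1))" for n k
    using arg_cong[OF fps[of n], of "\<lambda>f. fps_nth f k"] by (cases k) (simp_all add: algebra_simps)
  have nz: "of_nat k + 2 * lam + 1 \<noteq> 0" for k
  proof
    assume "of_nat k + 2 * lam + 1 = 0"
    hence "Re (of_nat k + 2 * lam + 1) = 0" by simp
    thus False using lam by simp
  qed
  have nz': "lam + 1 + of_nat k \<noteq> 0" for k
  proof
    assume "lam + 1 + of_nat k = 0"
    hence "Re (lam + 1 + of_nat k) = 0" by simp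
    thus False using lam by simp
  qed
  have coeff: "fps_nth (F n) (2 * k) = gegen_mass lam * g (n + k) (W\<^sup>2) / (4 ^ k * fact k * pochhammer (lam + 1) k) \<and> fps_nth (F n) (2 * k + 1) = 0" for n k
  proof (induction k arbitrary: n)
    case 0
    have "fps_nth (F n) 0 = M n 0" using has_fps_expansion_imp_0_eq_fps_nth_0[OF F] by simp
    also have "M n 0 = gegen_mass lam * g n (W\<^sup>2)" unfolding M_def gegen_mass_def chord_def by simp
    finally show ?case using rec[of 0 n] nz[of 0] by simp
  next
    case (Suc k)
    have a: "of_nat (2 * k + 2) * (of_nat (2 * k + 1) + 2 * lam + 1) = 4 * (of_nat (Suc k)) * (lam + 1 + of_nat k)" by (simp add: algebra_simps)
    have "of_nat (Suc (2 * k + 1)) * (of_nat (2 * k + 1) + 2 * lam + 1) * fps_nth (F n) (Suc (2 * k + 1)) = fps_nth (F (Suc n)) (2 * k)"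
      using rec[of "2 * k + 1" n] by simp
    hence "4 * (of_nat (Suc k)) * (lam + 1 + of_nat k) * fps_nth (F n) (2 * Suc k) = gegen_mass lam * g (n + Suc k) (W\<^sup>2) / (4 ^ k * fact k * pochhammer (lam + 1) k)"
      using Suc[of "Suc n"] a by (simp del: of_nat_Suc)
    hence "fps_nth (F n) (2 * Suc k) = gegen_mass lam * g (n + Suc k) (W\<^sup>2) / (4 ^ k * fact k * pochhammer (lam + 1) k) / (4 * (of_nat (Suc k)) * (lam + 1 + of_nat k))"
      using eq_divide_imp[of "4 * of_nat (Suc k) * (lam + 1 + of_nat k)" "fps_nth (F n) (2 * Suc k)"] nz'[of k]
      by (simp add: mult.commute del: of_nat_Suc mult_Suc_right)
    also have "\<dots> = gegen_mass lam * g (n + Suc k) (W\<^sup>2) / (4 ^ Suc k * fact (Suc k) * pochhammer (lam + 1) (Suc k))"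
      by (simp add: pochhammer_Suc mult_ac)
    finally have 1: "fps_nth (F n) (2 * Suc k) = gegen_mass lam * g (n + Suc k) (W\<^sup>2) / (4 ^ Suc k * fact (Suc k) * pochhammer (lam + 1) (Suc k))" .
    have "of_nat (Suc (2 * k + 2)) * (of_nat (2 * k + 2) + 2 * lam + 1) * fps_nth (F n) (Suc (2 * k + 2)) = 0"
      using rec[of "2 * k + 2" n] Suc[of "Suc n"] by simp
    hence "fps_nth (F n) (2 * Suc k + 1) = 0" using nz[of "2 * k + 2"] by (simp del: of_nat_Suc of_nat_add)
    with 1 show ?case by blast
  qed
  \<comment> \<open>The power series at 0 gives the equality on a small disc; as
    \<open>cone_nbhd W\<close> is connected, it extends to the whole set.\<close>
  obtain r where r: "r > 0" "ball 0 r \<subseteq> U" using U(1) 0 openE by blast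
  have near: "M 0 Z = gegen_mass lam * G Z" if Zr: "Z \<in> ball 0 r" for Z
  proof -
    have "(\<lambda>n. fps_nth (F 0) n * Z ^ n) sums M 0 Z"
    proof (rule has_fps_expansion_imp_sums_complex[OF F, of 0 "ereal r"])
      show "M 0 holomorphic_on eball 0 (ereal r)" using holomorphic_on_subset[OF Mh r(2)] by simp
    qed (use Zr in simp)
    moreover have "strict_mono (\<lambda>k::nat. 2 * k)" by (simp add: strict_mono_def)
    moreover have "fps_nth (F 0) n * Z ^ n = 0" if "n \<notin> range (\<lambda>k::nat. 2 * k)" for n
    proof -
      have "odd n" using that by (auto elim!: evenE)
      then obtain k where "n = 2 * k + 1" by (auto elim!: oddE)
      thus ?thesis using coeff[of 0 k] by simp
    qed
    ultimately have "(\<lambda>k. fps_nth (F 0) (2 * k) * Z ^ (2 * k)) sums M 0 Z"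
      using sums_mono_reindex[of "\<lambda>k. 2 * k" "\<lambda>n. fps_nth (F 0) n * Z ^ n" "M 0 Z"] by simp
    moreover have "(\<lambda>k. gegen_mass lam * (g k (W\<^sup>2) / (4 ^ k * fact k * pochhammer (lam + 1) k) * Z ^ (2 * k))) sums (gegen_mass lam * G Z)"
      using r Zr by (intro sums_mult sums) (auto simp: U_def)
    ultimately show ?thesis using sums_unique2 coeff[of 0] by (simp add: mult_ac)
  qed
  have "M 0 Z = gegen_mass lam * G Z"
  proof (rule analytic_continuation_open[of "ball 0 r" U "M 0" "\<lambda>Z. gegen_mass lam * G Z"])
    show "(\<lambda>Z. gegen_mass lam * G Z) holomorphic_on U" using G by (intro holomorphic_intros) (simp add: U_def)
  qed (use r U Mh near Z in \<open>auto simp: U_def\<close>)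
  thus ?thesis by (simp add: M_def)
qed

text \<open>With a = W + Z and b = W - Z, the difference |W|^2 - |Z|^2 is the real part of a times
  the conjugate of b, which is positive for arguments below pi/4. This puts Z/W inside the disc of
  convergence of the hypergeometric series.\<close>

lemma cone_nbhd_norm_less:
  assumes "Z \<in> cone_nbhd W"
  shows "norm Z < norm W" "Re W > 0" "\<bar>Im W\<bar> < Re W"
proof -
  define a b where "a = W + Z" and "b = W - Z"
  have ab: "\<bar>Im a\<bar> < Re a" "\<bar>Im b\<bar> < Re b" using assms by (auto simp: cone_nbhd_def a_def b_def)
  have W: "Re W = (Re a + Re b) / 2" "Im W = (Im a + Im b) / 2" by (simp_all add: a_def b_def)
  show "\<bar>Im W\<bar> < Re W" unfolding W using ab by (auto simp: abs_less_iff)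
  thus "Re W > 0" by linarith
  have "\<bar>Im a\<bar> * \<bar>Im b\<bar> < Re a * Re b" using ab by (intro mult_strict_mono) auto
  hence "Re a * Re b + Im a * Im b > 0" using abs_ge_minus_self[of "Im a * Im b"] by (simp add: abs_mult)
  hence "(norm W)\<^sup>2 - (norm Z)\<^sup>2 > 0" unfolding a_def b_def cmod_power2 by (simp add: power2_eq_square algebra_simps)
  thus "norm Z < norm W" by (simp add: power2_less_imp_less)
qed

text \<open>The radial operator maps \<zeta>^(-\<mu>-n) to 4(\<mu> + n)(\<mu> - \<lambda> + n)
  \<zeta>^(-\<mu>-n-1). The iterated Laplacians are again powers, and the Pizzetti series is
  hypergeometric in (Z/W)^2.\<close>

lemma pizzetti_powr:
  assumes lam: "Re lam > -1/2" and Z: "Z \<in> cone_nbhd W"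
  shows "(\<integral>x. gegen_weight lam x * chord W Z x powr (-\<mu>) \<partial>gegen_interval)
     = gegen_mass lam * (W\<^sup>2 powr (-\<mu>) * hyp2F1 \<mu> (\<mu> - lam) (lam + 1) ((Z / W)\<^sup>2))"
proof -
  define c where "c n = 4 ^ n * pochhammer \<mu> n * pochhammer (\<mu> - lam) n" for n
  define g where "g n \<zeta> = c n * \<zeta> powr (-\<mu> - of_nat n)" for n \<zeta>
  define g' where "g' n \<zeta> = c n * ((-\<mu> - of_nat n) * \<zeta> powr (-\<mu> - of_nat n - 1))" for n \<zeta>
  define g'' where "g'' n \<zeta> = c n * ((-\<mu> - of_nat n) * ((-\<mu> - of_nat n - 1) * \<zeta> powr (-\<mu> - of_nat n - 1 - 1)))" for n \<zeta>
  note W = cone_nbhd_norm_less(2,3)[OF Z]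
  have W0: "W \<noteq> 0" using W by auto
  have lam1: "lam + 1 \<notin> \<int>\<^sub>\<le>\<^sub>0" using lam by (intro Re_pos_not_nonpos_Ints) simp
  have nn: "\<zeta> \<notin> \<real>\<^sub>\<le>\<^sub>0" "\<zeta> \<noteq> 0" if "Re \<zeta> > 0" for \<zeta> using that by (auto simp: complex_nonpos_Reals_iff)
  have "(\<integral>x. gegen_weight lam x * g 0 (chord W Z x) \<partial>gegen_interval) = gegen_mass lam * (W\<^sup>2 powr (-\<mu>) * hyp2F1 \<mu> (\<mu> - lam) (lam + 1) ((Z / W)\<^sup>2))"
  proof (rule pizzetti[OF lam W(2) Z, of g g' g'' "\<lambda>Z. W\<^sup>2 powr (-\<mu>) * hyp2F1 \<mu> (\<mu> - lam) (lam + 1) ((Z / W)\<^sup>2)"])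
    show "(g n has_field_derivative g' n \<zeta>) (at \<zeta>)" if "Re \<zeta> > 0" for n \<zeta>
      unfolding g_def[abs_def] g'_def by (intro DERIV_cmult has_field_derivative_powr nn that)
    show "(g' n has_field_derivative g'' n \<zeta>) (at \<zeta>)" if "Re \<zeta> > 0" for n \<zeta>
      unfolding g'_def[abs_def] g''_def by (intro DERIV_cmult has_field_derivative_powr nn that)
    show "4 * \<zeta> * g'' n \<zeta> + 4 * (lam + 1) * g' n \<zeta> = g (Suc n) \<zeta>" if "Re \<zeta> > 0" for n \<zeta>
    proof -
      have 1: "\<zeta> powr (-\<mu> - of_nat n - 1) = \<zeta> powr (-\<mu> - of_nat n - 1 - 1) * \<zeta>"
        using powr_add[of \<zeta> "-\<mu> - of_nat n - 1 - 1" 1] nn[OF that] by simp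
      have 2: "-\<mu> - of_nat (Suc n) = -\<mu> - of_nat n - 1" by simp
      have 3: "c (Suc n) = 4 * c n * (\<mu> + of_nat n) * (\<mu> - lam + of_nat n)" by (simp add: c_def pochhammer_Suc)
      show ?thesis unfolding g''_def g'_def g_def 2 3 1 by (simp add: algebra_simps)
    qed
    have nl: "norm ((Y / W)\<^sup>2) < 1" if "Y \<in> cone_nbhd W" for Y
      using cone_nbhd_norm_less[OF that] W0 by (simp add: norm_power norm_divide power_less_one_iff abs_square_less_1)
    show "(\<lambda>Z. W\<^sup>2 powr (-\<mu>) * hyp2F1 \<mu> (\<mu> - lam) (lam + 1) ((Z / W)\<^sup>2)) holomorphic_on cone_nbhd W"
      using W0 nl by (intro holomorphic_intros holomorphic_on_compose_gen[OF _ hyp2F1_holomorphic[OF lam1], unfolded o_def]) auto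
    show "(\<lambda>k. g k (W\<^sup>2) / (4 ^ k * fact k * pochhammer (lam + 1) k) * Y ^ (2 * k)) sums (W\<^sup>2 powr (-\<mu>) * hyp2F1 \<mu> (\<mu> - lam) (lam + 1) ((Y / W)\<^sup>2))"
      if "Y \<in> cone_nbhd W" for Y
    proof -
      have "g k (W\<^sup>2) / (4 ^ k * fact k * pochhammer (lam + 1) k) * Y ^ (2 * k) =
        W\<^sup>2 powr (-\<mu>) * (pochhammer \<mu> k * pochhammer (\<mu> - lam) k / (pochhammer (lam + 1) k * fact k) * ((Y / W)\<^sup>2) ^ k)" for k
      proof -
        have "W\<^sup>2 powr (-\<mu> - of_nat k) = W\<^sup>2 powr (-\<mu>) / (W\<^sup>2) ^ k"
          using W0 powr_diff[of "W\<^sup>2" "-\<mu>" "of_nat k"] by (simp add: powr_nat)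
        moreover have "Y ^ (2 * k) = (Y\<^sup>2) ^ k" by (rule power_mult)
        ultimately show ?thesis by (simp add: g_def c_def power_divide divide_simps)
      qed
      moreover have "(\<lambda>k. W\<^sup>2 powr (-\<mu>) * (pochhammer \<mu> k * pochhammer (\<mu> - lam) k / (pochhammer (lam + 1) k * fact k) * ((Y / W)\<^sup>2) ^ k))
        sums (W\<^sup>2 powr (-\<mu>) * hyp2F1 \<mu> (\<mu> - lam) (lam + 1) ((Y / W)\<^sup>2))"
        unfolding hyp2F1_def by (intro sums_mult summable_sums hyp2F1_summable lam1 nl that)
      ultimately show ?thesis by simp
    qed
  qed
  thus ?thesis by (simp add: g_def c_def)
qed

text \<open>As a function of \<zeta>, \<open>Kint lam \<zeta> B\<close> is an eigenfunction of the
  radial operator with eigenvalue 4B, by \<open>Kint_rec\<close>. The Pizzetti series therefore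
  separates into the value at W^2 and the series of \<open>bser lam\<close> at B Z^2.\<close>

lemma pizzetti_Kint:
  assumes lam: "Re lam > -1/2" and Z: "Z \<in> cone_nbhd W" and B: "Re B > 0"
  shows "(\<integral>x. gegen_weight lam x * Kint lam (chord W Z x) B \<partial>gegen_interval)
     = gegen_mass lam * (Gamma (lam + 1) * bser lam (B * Z\<^sup>2) * Kint lam (W\<^sup>2) B)"
proof -
  define g where "g n \<zeta> = (4 * B) ^ n * Kint lam \<zeta> B" for n \<zeta>
  define g' where "g' n \<zeta> = (4 * B) ^ n * (- Kint (lam + 1) \<zeta> B)" for n \<zeta>
  define g'' where "g'' n \<zeta> = (4 * B) ^ n * (- (- Kint (lam + 1 + 1) \<zeta> B))" for n \<zeta>
  note W = cone_nbhd_norm_less(2,3)[OF Z]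
  have lam1: "lam + 1 \<notin> \<int>\<^sub>\<le>\<^sub>0" using lam by (intro Re_pos_not_nonpos_Ints) simp
  have "(\<integral>x. gegen_weight lam x * g 0 (chord W Z x) \<partial>gegen_interval) = gegen_mass lam * (Gamma (lam + 1) * bser lam (B * Z\<^sup>2) * Kint lam (W\<^sup>2) B)"
  proof (rule pizzetti[OF lam W(2) Z, of g g' g'' "\<lambda>Z. Gamma (lam + 1) * bser lam (B * Z\<^sup>2) * Kint lam (W\<^sup>2) B"])
    show "(g n has_field_derivative g' n \<zeta>) (at \<zeta>)" if "Re \<zeta> > 0" for n \<zeta>
      unfolding g_def[abs_def] g'_def by (intro DERIV_cmult Kint_deriv_A that B)
    show "(g' n has_field_derivative g'' n \<zeta>) (at \<zeta>)" if "Re \<zeta> > 0" for n \<zeta>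
      unfolding g'_def[abs_def] g''_def by (intro DERIV_cmult DERIV_minus Kint_deriv_A that B)
    show "4 * \<zeta> * g'' n \<zeta> + 4 * (lam + 1) * g' n \<zeta> = g (Suc n) \<zeta>" if "Re \<zeta> > 0" for n \<zeta>
    proof -
      have "B * Kint lam \<zeta> B = \<zeta> * Kint (lam + 1 + 1) \<zeta> B - (lam + 1) * Kint (lam + 1) \<zeta> B"
        using Kint_rec[OF that B, of "lam + 1"] by (simp add: algebra_simps)
      hence "g (Suc n) \<zeta> = 4 * (4 * B) ^ n * (\<zeta> * Kint (lam + 1 + 1) \<zeta> B - (lam + 1) * Kint (lam + 1) \<zeta> B)"
        by (simp add: g_def mult_ac)
      thus ?thesis unfolding g''_def g'_def by (simp add: algebra_simps)
    qed
    show "(\<lambda>Z. Gamma (lam + 1) * bser lam (B * Z\<^sup>2) * Kint lam (W\<^sup>2) B) holomorphic_on cone_nbhd W"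
      by (intro holomorphic_intros)
    show "(\<lambda>k. g k (W\<^sup>2) / (4 ^ k * fact k * pochhammer (lam + 1) k) * Y ^ (2 * k)) sums (Gamma (lam + 1) * bser lam (B * Y\<^sup>2) * Kint lam (W\<^sup>2) B)" for Y
    proof -
      have "g k (W\<^sup>2) / (4 ^ k * fact k * pochhammer (lam + 1) k) * Y ^ (2 * k) =
         Gamma (lam + 1) * (rGamma (lam + of_nat k + 1) / fact k * (B * Y\<^sup>2) ^ k) * Kint lam (W\<^sup>2) B" for k
      proof -
        have "pochhammer (lam + 1) k * rGamma (lam + 1 + of_nat k) = rGamma (lam + 1)" by (rule pochhammer_rGamma[symmetric])
        moreover have "Gamma (lam + 1) * rGamma (lam + 1) = 1" using lam1 by (simp add: rGamma_inverse_Gamma Gamma_eq_zero_iff)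
        ultimately have "Gamma (lam + 1) * rGamma (lam + of_nat k + 1) * pochhammer (lam + 1) k = 1" by (simp add: mult_ac add_ac)
        moreover from this have "pochhammer (lam + 1) k \<noteq> 0" by auto
        ultimately have "Gamma (lam + 1) * rGamma (lam + of_nat k + 1) = 1 / pochhammer (lam + 1) k" by (simp add: field_simps)
        moreover have "Gamma (lam + 1) * (rGamma (lam + of_nat k + 1) / fact k * (B * Y\<^sup>2) ^ k) * Kint lam (W\<^sup>2) B
           = (Gamma (lam + 1) * rGamma (lam + of_nat k + 1)) * ((B * Y\<^sup>2) ^ k / fact k * Kint lam (W\<^sup>2) B)" by simp
        moreover have "Y ^ (2 * k) = (Y\<^sup>2) ^ k" by (rule power_mult)
        ultimately show ?thesis by (simp add: g_def power_mult_distrib mult_ac)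
      qed
      moreover have "(\<lambda>k. Gamma (lam + 1) * (rGamma (lam + of_nat k + 1) / fact k * (B * Y\<^sup>2) ^ k) * Kint lam (W\<^sup>2) B) sums
        (Gamma (lam + 1) * bser lam (B * Y\<^sup>2) * Kint lam (W\<^sup>2) B)"
        unfolding bser_def by (intro sums_mult sums_mult2 summable_sums bser_summable)
      ultimately show ?thesis by simp
    qed
  qed
  thus ?thesis by (simp add: g_def)
qed

subsection \<open>The kernel as a Gegenbauer mean\<close>

text \<open>The linear form of the sector condition is closed under addition and positive scaling,
  and it cuts out an intersection of half-planes, whence convexity.\<close>

lemma abs_Arg_less_iff_cone:
  assumes "z \<noteq> 0"
  shows "\<bar>Arg z\<bar> < pi / 4 \<longleftrightarrow> \<bar>Im z\<bar> < Re z"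
proof (cases "Re z > 0")
  case True
  have "\<bar>Arg z\<bar> < pi / 4 \<longleftrightarrow> arctan (-1) < arctan (Im z / Re z) \<and> arctan (Im z / Re z) < arctan 1"
    using True by (auto simp: arg_conv_arctan arctan_one arctan_minus)
  also have "\<dots> \<longleftrightarrow> \<bar>Im z\<bar> < Re z"
    unfolding arctan_less_iff using True by (auto simp: field_simps)
  finally show ?thesis .
next
  case False
  hence "\<not> \<bar>Arg z\<bar> < pi / 2" using Re_Ln_pos_lt[OF assms] assms by (simp add: Arg_eq_Im_Ln)
  thus ?thesis using False pi_gt_zero by linarith
qed

lemma Im_Ln_cone: "\<bar>Im z\<bar> < Re z \<Longrightarrow> \<bar>Im (Ln z)\<bar> < pi / 4"
  using abs_Arg_less_iff_cone[of z] by (cases "z = 0") (auto simp: Arg_eq_Im_Ln)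

lemma cone_add: "\<bar>Im a\<bar> < Re a \<Longrightarrow> \<bar>Im b\<bar> < Re b \<Longrightarrow> \<bar>Im (a + b)\<bar> < Re (a + b)"
  by (auto simp: abs_less_iff)

lemma cone_of_real_mult: "\<bar>Im a\<bar> < Re a \<Longrightarrow> r > 0 \<Longrightarrow> \<bar>Im (of_real r * a)\<bar> < Re (of_real r * a)"
  by (simp add: abs_mult)

lemma csqrt_cone:
  assumes "Re c > 0"
  shows "\<bar>Im (csqrt c)\<bar> < Re (csqrt c)"
proof -
  have "Re ((csqrt c)\<^sup>2) > 0" using assms by simp
  hence "(Im (csqrt c))\<^sup>2 < (Re (csqrt c))\<^sup>2" by (simp add: power2_eq_square)
  moreover have "Re (csqrt c) \<ge> 0" using csqrt_principal[of c] by (auto simp del: csqrt.sel)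
  ultimately show ?thesis using abs_le_square_iff[of "Re (csqrt c)" "Im (csqrt c)"] by linarith
qed

lemma csqrt_holomorphic_right_half_plane: "csqrt holomorphic_on {c. Re c > 0}"
  unfolding holomorphic_on_def
  by (auto intro!: field_differentiable_within_csqrt simp: complex_nonpos_Reals_iff)

lemma zw_region_eq: "zw_region = {(z, w). \<bar>Im z\<bar> < Re z \<and> \<bar>Im w\<bar> < Re w \<and> Re z > Re w}"
proof -
  have "z \<noteq> 0 \<and> \<bar>Arg z\<bar> < pi / 4 \<longleftrightarrow> \<bar>Im z\<bar> < Re z" for z
    using abs_Arg_less_iff_cone[of z] by (cases "z = 0") auto
  thus ?thesis unfolding zw_region_def by blast
qed

lemma csqrt_shift_cone: "\<bar>Im z\<bar> < Re z \<Longrightarrow> \<bar>Im (csqrt (z\<^sup>2 + \<i> * of_real t))\<bar> < Re (csqrt (z\<^sup>2 + \<i> * of_real t))"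
  using cone_square(2)[of z] by (intro csqrt_cone) simp

lemma cone_slices:
  shows "open {z. (z, w) \<in> zw_region}" "connected {z. (z, w) \<in> zw_region}"
    "open {w. (z, w) \<in> zw_region}" "connected {w. (z, w) \<in> zw_region}"
proof -
  define H where "H a b k = {Z :: complex. inner (Complex a b) Z < k}" for a b k
  have 1: "{z. (z, w) \<in> zw_region} = (if \<bar>Im w\<bar> < Re w then H (-1) 1 0 \<inter> H (-1) (-1) 0 \<inter> H (-1) 0 (- Re w) else {})"
    by (auto simp: zw_region_eq H_def inner_complex_def abs_less_iff)
  have 2: "{w. (z, w) \<in> zw_region} = (if \<bar>Im z\<bar> < Re z then H (-1) 1 0 \<inter> H (-1) (-1) 0 \<inter> H 1 0 (Re z) else {})"
    by (auto simp: zw_region_eq H_def inner_complex_def abs_less_iff)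
  show "open {z. (z, w) \<in> zw_region}" "connected {z. (z, w) \<in> zw_region}"
    "open {w. (z, w) \<in> zw_region}" "connected {w. (z, w) \<in> zw_region}"
    unfolding 1 2 H_def
    by (auto intro!: open_Int open_halfspace_lt convex_connected convex_Int convex_halfspace_lt)
qed

text \<open>With a and b the two square roots, a^2 - b^2 = z^2 - w^2, so the quotient is (z - w)(z +
  w)/(a + b)^2. Each of z - w, z + w and a + b has positive real part, so the product of their
  principal powers is holomorphic on the region and is the required continuation; uniqueness then
  resolves the definite description.\<close>

lemma root_quot_power_eq:
  assumes zw: "\<bar>Im z\<bar> < Re z" "\<bar>Im w\<bar> < Re w" "Re z > Re w"
  shows "root_quot_power lam t z w = (z - w) powr lam * (z + w) powr lam *
     (csqrt (z\<^sup>2 + \<i> * of_real t) + csqrt (w\<^sup>2 + \<i> * of_real t)) powr (- 2 * lam)"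
proof -
  define r where "r z = csqrt (z\<^sup>2 + \<i> * of_real t)" for z
  define g where "g z w = (z - w) powr lam * (z + w) powr lam * (r z + r w) powr (- 2 * lam)" for z w
  have r: "\<bar>Im (r z)\<bar> < Re (r z)" if "\<bar>Im z\<bar> < Re z" for z unfolding r_def by (rule csqrt_shift_cone[OF that])
  have nn: "z - w \<notin> \<real>\<^sub>\<le>\<^sub>0" "z + w \<notin> \<real>\<^sub>\<le>\<^sub>0" "r z + r w \<notin> \<real>\<^sub>\<le>\<^sub>0" if "(z, w) \<in> zw_region" for z w
    using that cone_add[OF r[of z] r[of w]] by (auto simp: zw_region_eq complex_nonpos_Reals_iff)
  have rh: "r holomorphic_on {z. \<bar>Im z\<bar> < Re z}" unfolding r_def
    by (rule holomorphic_on_compose_gen[OF _ csqrt_holomorphic_right_half_plane, unfolded o_def])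
       (auto intro!: holomorphic_intros cone_square(2))
  have rc: "continuous_on {z. \<bar>Im z\<bar> < Re z} r" by (rule holomorphic_on_imp_continuous_on[OF rh])
  have g: "is_root_quot_power lam t g" unfolding is_root_quot_power_def
  proof (intro conjI allI impI)
    have rc1: "continuous_on zw_region (\<lambda>p. r (fst p))" and rc2: "continuous_on zw_region (\<lambda>p. r (snd p))"
      by (rule continuous_on_compose2[OF rc]; auto intro!: continuous_intros simp: zw_region_eq)+
    have pos: "Re (fst p - snd p) > 0" "Re (fst p + snd p) > 0" "Re (r (fst p) + r (snd p)) > 0" if "p \<in> zw_region" for p
      using that r[of "fst p"] r[of "snd p"] unfolding zw_region_eq by auto
    have nn': "0 \<le> Re (fst p - snd p)" "0 \<le> Re (fst p + snd p)" "0 \<le> Re (r (fst p) + r (snd p))"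
       "fst p - snd p \<noteq> 0" "fst p + snd p \<noteq> 0" "r (fst p) + r (snd p) \<noteq> 0" if "p \<in> zw_region" for p
      using pos[OF that] by (auto simp del: minus_complex.sel plus_complex.sel)
    show "continuous_on zw_region (\<lambda>(z, w). g z w)" unfolding g_def split_beta
      by (intro continuous_on_mult continuous_on_powr_complex continuous_on_add continuous_on_diff continuous_on_const
            continuous_on_fst continuous_on_snd continuous_on_id rc1 rc2) (use nn' in blast)+
    show "(\<lambda>z. g z w) holomorphic_on {z. (z, w) \<in> zw_region}" for w
      unfolding g_def using nn by (intro holomorphic_intros holomorphic_on_subset[OF rh]) (auto simp: zw_region_eq)
    show "(\<lambda>w. g z w) holomorphic_on {w. (z, w) \<in> zw_region}" for z
      unfolding g_def using nn by (intro holomorphic_intros holomorphic_on_subset[OF rh]) (auto simp: zw_region_eq)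
  next
    fix x y :: real assume xy: "x > y \<and> y > 0"
    define R where "R = r (of_real x) + r (of_real y)"
    have R: "\<bar>Im R\<bar> < Re R" unfolding R_def by (intro cone_add r) (use xy in auto)
    hence R0: "R \<noteq> 0" by auto
    have x0: "complex_of_real x - of_real y \<noteq> 0" "complex_of_real x + of_real y \<noteq> 0"
      using xy by (simp_all flip: of_real_diff of_real_add)
    have "root_quot t (of_real x) (of_real y) = (r (of_real x) - r (of_real y)) / R" by (simp add: root_quot_def r_def R_def)
    also have "\<dots> = (r (of_real x) - r (of_real y)) * R / R\<^sup>2" using R0 by (simp add: power2_eq_square)
    also have "(r (of_real x) - r (of_real y)) * R = (r (of_real x))\<^sup>2 - (r (of_real y))\<^sup>2" by (simp add: R_def power2_eq_square algebra_simps)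
    also have "\<dots> = (of_real x - of_real y) * (of_real x + of_real y)" unfolding r_def power2_csqrt by (simp add: power2_eq_square algebra_simps)
    finally have q: "root_quot t (of_real x) (of_real y) = (of_real x - of_real y) * (of_real x + of_real y) / R\<^sup>2" .
    have i: "Im (Ln (complex_of_real x - of_real y)) = 0" "Im (Ln (complex_of_real x + of_real y)) = 0"
      using xy by (simp_all add: Ln_of_real flip: of_real_diff of_real_add)
    \<comment> \<open>At real points Ln (x - y) and Ln (x + y) are real and |Im (Ln R)| < pi/4, so
      the right side is the principal logarithm of the quotient.\<close>
    have L: "Ln (root_quot t (of_real x) (of_real y)) = Ln (of_real x - of_real y) + Ln (of_real x + of_real y) - 2 * Ln R"
      unfolding q using Im_Ln_cone[OF R] i x0 R0
      by (intro Ln_unique) (auto simp: exp_add exp_diff exp_double)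
    have q0: "root_quot t (of_real x) (of_real y) \<noteq> 0" unfolding q using x0 R0 by simp
    show "g (of_real x) (of_real y) = root_quot t (of_real x) (of_real y) powr lam"
      unfolding g_def R_def[symmetric] using q0 x0 R0
      by (simp add: powr_def L algebra_simps flip: exp_add)
  qed
  have uniq: "h z w = g z w" if h: "is_root_quot_power lam t h" for h
  proof -
    have real_eq: "h (of_real x) (of_real y) = g (of_real x) (of_real y)" if "x > y" "y > 0" for x y
      using h g that unfolding is_root_quot_power_def by simp
    have hol: "(\<lambda>z. h z w) holomorphic_on {z. (z, w) \<in> zw_region}" "(\<lambda>w. h z w) holomorphic_on {w. (z, w) \<in> zw_region}"
       "(\<lambda>z. g z w) holomorphic_on {z. (z, w) \<in> zw_region}" "(\<lambda>w. g z w) holomorphic_on {w. (z, w) \<in> zw_region}" for z w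
      using h g unfolding is_root_quot_power_def by auto
    \<comment> \<open>Here z leaves the real axis while w = y is kept real; afterwards w does so
      with z fixed, starting from the interval 0 < y < Re z.\<close>
    have step: "h z (of_real y) = g z (of_real y)" if "y > 0" "y < Re z" for y
    proof (rule holomorphic_eqI_on_reals[OF hol(1) hol(3) cone_slices(1,2), of y "y + 1"])
      show "z \<in> {z. (z, of_real y) \<in> zw_region}" using zw that by (simp add: zw_region_eq)
    qed (use that real_eq in \<open>auto simp: zw_region_eq\<close>)
    show ?thesis
    proof (rule holomorphic_eqI_on_reals[OF hol(2) hol(4) cone_slices(3,4), of 0 "Re z"])
      show "w \<in> {w. (z, w) \<in> zw_region}" using zw by (simp add: zw_region_eq)
    qed (use zw step in \<open>auto simp: zw_region_eq\<close>)
  qed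
  have "root_quot_power lam t z w = g z w"
    unfolding root_quot_power_def using g uniq by (intro the_equality) blast+
  thus ?thesis by (simp add: g_def r_def)
qed

text \<open>Let a, b be the square roots of z^2 + it and w^2 + it, and W = (a + b)/2, Z = (a - b)/2.
  Then the quotient in the kernel is Z/W, and the chord runs from a^2 to b^2. Pizzetti's formula for
  the exponent \<mu> = s + \<lambda> + 1 gives a series with upper parameters \<mu> and \<mu> -
  \<lambda>, which Euler's transformation changes into the one with \<lambda> - s and -s. Since a, b
  and W have arguments below pi/4, their three logarithms express the principal powers that have to
  be compared.\<close>

lemma kernel_A_eq:
  assumes zw: "\<bar>Im z\<bar> < Re z" "\<bar>Im w\<bar> < Re w" "Re z > Re w" and lam: "Re lam > -1/2"
  shows "kernel_A s lam z w t = exp ((s - lam) * of_real (ln 4)) * ((z - w) powr lam * (z + w) powr lam) / gegen_mass lam *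
     (\<integral>x. gegen_weight lam x * (chord ((z + w) / 2) ((z - w) / 2) x + \<i> * of_real t) powr (- (s + lam + 1)) \<partial>gegen_interval)"
proof -
  define a where "a = csqrt (z\<^sup>2 + \<i> * of_real t)"
  define b where "b = csqrt (w\<^sup>2 + \<i> * of_real t)"
  define W where "W = (a + b) / 2"
  define Z where "Z = (a - b) / 2"
  define \<Lambda> where "\<Lambda> = (z - w) powr lam * (z + w) powr lam"
  define \<mu> where "\<mu> = s + lam + 1"
  define q where "q = root_quot t z w"
  have ab: "\<bar>Im a\<bar> < Re a" "\<bar>Im b\<bar> < Re b" unfolding a_def b_def using zw by (simp_all only: csqrt_shift_cone)
  have ab2: "a\<^sup>2 = z\<^sup>2 + \<i> * of_real t" "b\<^sup>2 = w\<^sup>2 + \<i> * of_real t" by (simp_all add: a_def b_def)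
  have WZ: "W + Z = a" "W - Z = b" by (simp_all add: W_def Z_def field_simps)
  have Z: "Z \<in> cone_nbhd W" using ab unfolding cone_nbhd_def mem_Collect_eq WZ by blast
  have Wc: "\<bar>Im W\<bar> < Re W" by (rule cone_nbhd_norm_less[OF Z])
  have nz: "a \<noteq> 0" "b \<noteq> 0" "W \<noteq> 0" using ab Wc by auto
  have q: "q = Z / W" 
  proof -
    have "u / v = (u / 2) / (v / 2)" for u v :: complex by simp
    thus ?thesis unfolding q_def root_quot_def Z_def W_def a_def[symmetric] b_def[symmetric] .
  qed
  have nq: "norm (q\<^sup>2) < 1" unfolding q using cone_nbhd_norm_less[OF Z] nz by (simp add: norm_power norm_divide power_less_one_iff abs_square_less_1)
  have lam1: "lam + 1 \<notin> \<int>\<^sub>\<le>\<^sub>0" using lam by (intro Re_pos_not_nonpos_Ints) simp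
  define La Lb LW where "La = Ln a" and "Lb = Ln b" and "LW = Ln W"
  have Im_L: "\<bar>Im La\<bar> < pi / 4" "\<bar>Im Lb\<bar> < pi / 4" "\<bar>Im LW\<bar> < pi / 4"
    unfolding La_def Lb_def LW_def using ab Wc by (simp_all only: Im_Ln_cone)
  have ex: "exp La = a" "exp Lb = b" "exp LW = W" using nz by (simp_all add: La_def Lb_def LW_def)
  have e2: "exp (of_real (ln 2)) = (2 :: complex)" by (simp add: exp_of_real)
  define l where "l = complex_of_real (ln 2)"
  have l4: "of_real (ln 4) = 2 * l" using ln_realpow[of 2 2] by (simp add: l_def)
  have L1: "Ln (1 / a + 1 / b) = l + LW - La - Lb" "1 / a + 1 / b \<noteq> 0"
  proof -
    have eq: "1 / a + 1 / b = 2 * W / (a * b)" using nz by (simp add: W_def field_simps)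
    show "1 / a + 1 / b \<noteq> 0" unfolding eq using nz by simp
    show "Ln (1 / a + 1 / b) = l + LW - La - Lb"
      unfolding eq using Im_L by (intro Ln_unique) (auto simp: exp_add exp_diff ex e2 l_def abs_less_iff)
  qed
  \<comment> \<open>The base of Euler's prefactor factors as ab/W^2, which ties it to the elementary
    factors of the kernel.\<close>
  have L2: "Ln (1 - q\<^sup>2) = La + Lb - 2 * LW" "1 - q\<^sup>2 \<noteq> 0"
  proof -
    have eq: "1 - q\<^sup>2 = a * b / W\<^sup>2" using nz unfolding q WZ[symmetric] by (simp add: power2_eq_square field_simps)
    show "1 - q\<^sup>2 \<noteq> 0" unfolding eq using nz by simp
    show "Ln (1 - q\<^sup>2) = La + Lb - 2 * LW"
      unfolding eq using Im_L by (intro Ln_unique) (auto simp: exp_add exp_diff exp_double ex abs_less_iff)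
  qed
  have L3: "Ln (W\<^sup>2) = 2 * LW" using Im_L ex nz by (intro Ln_unique) (auto simp: exp_double abs_less_iff)
  have L4: "Ln (a + b) = l + LW" "a + b \<noteq> 0"
  proof -
    have eq: "a + b = 2 * W" by (simp add: W_def)
    show "a + b \<noteq> 0" unfolding eq using nz by simp
    show "Ln (a + b) = l + LW" unfolding eq using Im_L by (intro Ln_unique) (auto simp: exp_add ex e2 l_def abs_less_iff)
  qed
  define H where "H = hyp2F1 (lam - s) (- s) (lam + 1) (q\<^sup>2)"
  have comm: "hyp2F1 x y c v = hyp2F1 y x c v" for x y c v by (simp add: hyp2F1_def mult.commute)
  have "hyp2F1 \<mu> (\<mu> - lam) (lam + 1) (q\<^sup>2) = (1 - q\<^sup>2) powr (- 2 * s - 1) * H"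
  proof -
    have e: "- s + (lam - s) - (lam + 1) = - 2 * s - 1" "lam + 1 - - s = \<mu>" "lam + 1 - (lam - s) = \<mu> - lam"
      by (simp_all add: \<mu>_def algebra_simps)
    show ?thesis using hyp2F1_euler[OF lam1 nq, of "- s" "lam - s"] unfolding e comm[of "- s"] H_def .
  qed
  hence mean: "(\<integral>x. gegen_weight lam x * chord W Z x powr (-\<mu>) \<partial>gegen_interval)
     = gegen_mass lam * (exp (- \<mu> * (2 * LW)) * (exp ((- 2 * s - 1) * (La + Lb - 2 * LW)) * H))"
    unfolding pizzetti_powr[OF lam Z] q[symmetric] using nz L2 L3 by (simp add: powr_def)
  \<comment> \<open>The chord depends on a and b only through their squares and linearly, so t
    enters as the additive constant it.\<close>
  have chord: "chord W Z x = chord ((z + w) / 2) ((z - w) / 2) x + \<i> * of_real t" for x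
  proof -
    have "chord W Z x = (a\<^sup>2 + b\<^sup>2) / 2 - of_real x * (a\<^sup>2 - b\<^sup>2) / 2" by (simp add: chord_def W_def Z_def power2_eq_square field_simps)
    also have "\<dots> = chord ((z + w) / 2) ((z - w) / 2) x + \<i> * of_real t" unfolding ab2 by (simp add: chord_def power2_eq_square field_simps)
    finally show ?thesis .
  qed
  have "kernel_A s lam z w t = 1 / (a * b) * (1 / a + 1 / b) powr (2 * s) * (\<Lambda> * (a + b) powr (- 2 * lam)) * H"
    unfolding kernel_A_def Let_def a_def[symmetric] b_def[symmetric] q_def[symmetric] H_def[symmetric]
    by (simp add: root_quot_power_eq[OF zw] \<Lambda>_def a_def b_def)
  also have "\<dots> = \<Lambda> * H * (exp (- La - Lb) * exp (2 * s * (l + LW - La - Lb)) * exp (- 2 * lam * (l + LW)))"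
  proof -
    have "(1 / a + 1 / b) powr (2 * s) = exp (2 * s * (l + LW - La - Lb))" unfolding powr_def L1(1) using L1(2) by simp
    moreover have "(a + b) powr (- 2 * lam) = exp (- 2 * lam * (l + LW))" unfolding powr_def L4(1) using L4(2) by simp
    moreover have "1 / (a * b) = exp (- La - Lb)" by (simp add: exp_diff exp_minus ex divide_inverse)
    ultimately show ?thesis by (simp only: mult_ac)
  qed
  also have "exp (- La - Lb) * exp (2 * s * (l + LW - La - Lb)) * exp (- 2 * lam * (l + LW)) =
     exp ((s - lam) * of_real (ln 4)) * (exp (- \<mu> * (2 * LW)) * exp ((- 2 * s - 1) * (La + Lb - 2 * LW)))"
    unfolding l4 exp_add[symmetric] by (rule arg_cong[of _ _ exp]) (simp add: \<mu>_def algebra_simps)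
  also have "\<Lambda> * H * (exp ((s - lam) * of_real (ln 4)) * (exp (- \<mu> * (2 * LW)) * exp ((- 2 * s - 1) * (La + Lb - 2 * LW)))) =
     exp ((s - lam) * of_real (ln 4)) * \<Lambda> / gegen_mass lam * (\<integral>x. gegen_weight lam x * chord W Z x powr (-\<mu>) \<partial>gegen_interval)"
    unfolding mean using gegen_mass_nonzero[OF lam] by simp
  finally show ?thesis unfolding chord \<mu>_def \<Lambda>_def .
qed

subsection \<open>The integral formula\<close>

text \<open>An explicit primitive of f is c times V A minus the integral of V A' up to X = k t^2,
  the latter taken in logarithmic coordinates. Its limits at both ends exist separately, because V A
  tends to 0 there and V A' is integrable; the integral of f may converge only
  conditionally.\<close>

lemma has_improper_integral_by_parts:
  fixes V V' A A' :: "real \<Rightarrow> complex"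
  assumes V: "\<And>X. X > 0 \<Longrightarrow> (V has_vector_derivative V' X) (at X)"
    and A: "\<And>X. X > 0 \<Longrightarrow> (A has_vector_derivative A' X) (at X)"
    and A'c: "continuous_on {0<..} A'"
    and int: "integrable lborel (\<lambda>y. V (exp y) * of_real (exp y) * A' (exp y))"
    and lim0: "((\<lambda>X. V X * A X) \<longlongrightarrow> 0) (at_right 0)" and lim1: "((\<lambda>X. V X * A X) \<longlongrightarrow> 0) at_top"
    and k: "k > 0" and f: "\<And>t. t > 0 \<Longrightarrow> f t = c * (V' (k * t\<^sup>2) * A (k * t\<^sup>2) * of_real (2 * k * t))"
  shows "has_improper_integral f (- c * (\<integral>y. V (exp y) * of_real (exp y) * A' (exp y) \<partial>lborel))"
proof -
  define h where "h y = V (exp y) * of_real (exp y) * A' (exp y)" for y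
  define X where "X t = k * t\<^sup>2" for t
  define \<Phi> where "\<Phi> y = (\<integral>u. indicator {..y} u *\<^sub>R h u \<partial>lborel)" for y
  have int: "integrable lborel h" using int by (simp add: h_def[abs_def])
  have Vc: "continuous_on {0<..} V"
    using V by (intro continuous_at_imp_continuous_on) (auto dest: has_vector_derivative_continuous)
  have hc: "continuous_on S h" for S unfolding h_def
    by (intro continuous_intros continuous_on_compose2[OF Vc] continuous_on_compose2[OF A'c]) auto
  have \<Phi>': "(\<Phi> has_vector_derivative h y) (at y)" for y
  proof -
    define c0 where "c0 = (\<integral>u. indicator {..<y - 1} u *\<^sub>R h u \<partial>lborel)"
    have eq: "c0 + integral {y - 1..u} h = \<Phi> u" if u: "u \<in> {y - 1<..<y + 1}" for u
    proof -
      have si: "set_integrable lborel S h" if "S \<in> sets lborel" for S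
        using integrable_mult_indicator[OF that int] by (simp add: set_integrable_def)
      have "\<Phi> u = (\<integral>v. indicator {..<y - 1} v *\<^sub>R h v + indicator {y - 1..u} v *\<^sub>R h v \<partial>lborel)"
        unfolding \<Phi>_def using u by (intro Bochner_Integration.integral_cong) (auto simp: indicator_def)
      also have "\<dots> = c0 + (\<integral>v. indicator {y - 1..u} v *\<^sub>R h v \<partial>lborel)"
        unfolding c0_def using si[of "{..<y - 1}"] si[of "{y - 1..u}"]
        by (intro Bochner_Integration.integral_add) (auto simp: set_integrable_def)
      also have "(\<integral>v. indicator {y - 1..u} v *\<^sub>R h v \<partial>lborel) = integral {y - 1..u} h"
        using set_borel_integral_eq_integral(2)[OF si[of "{y - 1..u}"]] by (simp add: set_lebesgue_integral_def)
      finally show ?thesis by simp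
    qed
    have "((\<lambda>u. c0 + integral {y - 1..u} h) has_vector_derivative (0 + h y)) (at y within {y - 1..y + 1})"
      by (intro has_vector_derivative_add has_vector_derivative_const integral_has_vector_derivative hc) auto
    also have "at y within {y - 1..y + 1} = at y" by (rule at_within_Icc_at) auto
    finally show ?thesis
      by (intro has_vector_derivative_transform_within_open[of "\<lambda>u. c0 + integral {y - 1..u} h" _ y "{y - 1<..<y + 1}" \<Phi>])
         (auto simp: eq)
  qed
  have \<Phi>_top: "(\<Phi> \<longlongrightarrow> (\<integral>y. h y \<partial>lborel)) at_top"
    unfolding \<Phi>_def by (rule tendsto_integral_at_top) (use int in auto)
  have \<Phi>_bot: "(\<Phi> \<longlongrightarrow> 0) at_bot"
  proof -
    have "((\<lambda>t. \<integral>u. indicator {..- t} u *\<^sub>R h u \<partial>lborel) \<longlongrightarrow> (\<integral>u. 0 \<partial>(lborel :: real measure))) at_top"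
    proof (rule integral_dominated_convergence_at_top[where w = "\<lambda>u. norm (h u)"])
      show "integrable lborel (\<lambda>u. norm (h u))" using int by simp
      show "(\<lambda>u. indicator {..- t} u *\<^sub>R h u) \<in> borel_measurable lborel" for t
        using int by (intro borel_measurable_scaleR) auto
      have "((\<lambda>t. indicator {..- t} u *\<^sub>R h u) \<longlongrightarrow> 0) at_top" for u
        by (rule tendsto_eventually) (use eventually_gt_at_top[of "- u"] in \<open>eventually_elim, auto simp: indicator_def\<close>)
      thus "AE u in lborel. ((\<lambda>t. indicator {..- t} u *\<^sub>R h u) \<longlongrightarrow> 0) at_top" by simp
      show "\<forall>\<^sub>F t in at_top. AE u in lborel. norm (indicator {..- t} u *\<^sub>R h u) \<le> norm (h u)"
        by (intro always_eventually allI AE_I2) (auto simp: indicator_def)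
    qed simp
    thus ?thesis unfolding \<Phi>_def[symmetric] by (simp add: filterlim_at_bot_mirror)
  qed
  define P where "P t = c * (V (X t) * A (X t) - \<Phi> (ln (X t)))" for t
  have P': "(P has_vector_derivative f t) (at t)" if t: "t > 0" for t
  proof -
    have X0: "X t > 0" using k t by (simp add: X_def)
    have dX: "(X has_real_derivative 2 * k * t) (at t)" unfolding X_def by (auto intro!: derivative_eq_intros)
    hence dX': "(X has_vector_derivative 2 * k * t) (at t)" by (simp add: has_real_derivative_iff_has_vector_derivative)
    have "((\<lambda>t. ln (X t)) has_real_derivative (1 / X t) * (2 * k * t)) (at t)"
      by (rule DERIV_chain2[where f = ln, OF DERIV_ln_divide[OF X0] dX])
    hence dL: "((\<lambda>t. ln (X t)) has_vector_derivative (1 / X t) * (2 * k * t)) (at t)"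
      by (simp add: has_real_derivative_iff_has_vector_derivative)
    note 1 = vector_diff_chain_at[OF dX' V[OF X0], unfolded o_def]
    note 2 = vector_diff_chain_at[OF dX' A[OF X0], unfolded o_def]
    note 3 = vector_diff_chain_at[OF dL \<Phi>', unfolded o_def]
    have "(P has_vector_derivative c * ((V (X t) * ((2 * k * t) *\<^sub>R A' (X t)) + ((2 * k * t) *\<^sub>R V' (X t)) * A (X t))
       - ((1 / X t) * (2 * k * t)) *\<^sub>R h (ln (X t)))) (at t)"
      unfolding P_def by (intro has_vector_derivative_mult_right has_vector_derivative_diff has_vector_derivative_mult 1 2 3)
    also have "h (ln (X t)) = V (X t) * of_real (X t) * A' (X t)" using X0 by (simp add: h_def)
    also have "c * ((V (X t) * ((2 * k * t) *\<^sub>R A' (X t)) + ((2 * k * t) *\<^sub>R V' (X t)) * A (X t))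
       - ((1 / X t) * (2 * k * t)) *\<^sub>R (V (X t) * of_real (X t) * A' (X t))) = f t"
      unfolding f[OF t] X_def[symmetric] using X0 by (simp add: scaleR_conv_of_real field_simps)
    finally show ?thesis .
  qed
  have FTC: "(f has_integral (P b - P a)) {a..b}" if "0 < a" "a \<le> b" for a b
    by (rule fundamental_theorem_of_calculus) (use that P' in \<open>auto intro: has_vector_derivative_at_within\<close>)
  have "filterlim X (at_right 0) (at_right 0)" unfolding X_def using k by real_asymp
  note lX0 = filterlim_compose[OF lim0 this]
  have "filterlim X at_top at_top" unfolding X_def using k by real_asymp
  note lX1 = filterlim_compose[OF lim1 this]
  have "filterlim (\<lambda>t. ln (X t)) at_bot (at_right 0)" unfolding X_def using k by real_asymp
  note lL0 = filterlim_compose[OF \<Phi>_bot this]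
  have "filterlim (\<lambda>t. ln (X t)) at_top at_top" unfolding X_def using k by real_asymp
  note lL1 = filterlim_compose[OF \<Phi>_top this]
  have P0: "(P \<longlongrightarrow> c * (0 - 0)) (at_right 0)" unfolding P_def by (intro tendsto_intros lX0 lL0)
  have P1: "(P \<longlongrightarrow> c * (0 - (\<integral>y. h y \<partial>lborel))) at_top" unfolding P_def by (intro tendsto_intros lX1 lL1)
  have "((\<lambda>p. P (snd p) - P (fst p)) \<longlongrightarrow> c * (0 - (\<integral>y. h y \<partial>lborel)) - c * (0 - 0)) (at_right 0 \<times>\<^sub>F at_top)"
    by (intro tendsto_diff filterlim_compose[OF P1 filterlim_snd] filterlim_compose[OF P0 filterlim_fst])
  moreover have "\<forall>\<^sub>F p in at_right 0 \<times>\<^sub>F at_top. P (snd p) - P (fst p) = (case p of (a, b) \<Rightarrow> integral {a..b} f)"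
  proof -
    have e0: "\<forall>\<^sub>F a in at_right 0. 0 < a \<and> a < (1::real)" using eventually_at_right_real[of 0 1] by simp
    have e1: "\<forall>\<^sub>F b in at_top. (1::real) \<le> b" by (rule eventually_ge_at_top)
    show ?thesis
      using eventually_prodI[OF e0 e1]
      by eventually_elim (auto intro!: integral_unique[symmetric] FTC)
  qed
  ultimately have "((\<lambda>(a, b). integral {a..b} f) \<longlongrightarrow> c * (0 - (\<integral>y. h y \<partial>lborel)) - c * (0 - 0)) (at_right 0 \<times>\<^sub>F at_top)"
    by (rule Lim_transform_eventually)
  thus ?thesis unfolding has_improper_integral_def h_def using FTC by (auto dest: has_integral_integrable)
qed

text \<open>A bound on q that is uniform in x reduces joint integrability to that of the weight and
  of g separately.\<close>

lemma gegen_Fubini: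
  fixes q :: "real \<Rightarrow> real \<Rightarrow> complex"
  assumes lam: "Re lam > -1/2"
    and q: "(\<lambda>(x, y). q x y) \<in> borel_measurable (gegen_interval \<Otimes>\<^sub>M lborel)"
    and bound: "\<And>x y. x \<in> {-1<..<1} \<Longrightarrow> norm (q x y) \<le> g y" and g: "integrable lborel g"
  shows "integrable lborel (\<lambda>y. \<integral>x. gegen_weight lam x * q x y \<partial>gegen_interval)"
    and "integrable gegen_interval (\<lambda>x. gegen_weight lam x * (\<integral>y. q x y \<partial>lborel))"
    and "(\<integral>y. \<integral>x. gegen_weight lam x * q x y \<partial>gegen_interval \<partial>lborel)
       = (\<integral>x. gegen_weight lam x * (\<integral>y. q x y \<partial>lborel) \<partial>gegen_interval)"
proof -
  interpret sigma_finite_measure gegen_interval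
    by (rule sigma_finite_measure_restrict_space) (auto intro: sigma_finite_lborel)
  interpret pair_sigma_finite gegen_interval lborel ..
  let ?p = "\<lambda>x y. gegen_weight lam x * q x y"
  have qx: "(\<lambda>y. q x y) \<in> borel_measurable lborel" if "x \<in> {-1<..<1}" for x
    using measurable_Pair2[OF q, of x] that by simp
  have qi: "integrable lborel (\<lambda>y. q x y)" if "x \<in> {-1<..<1}" for x
    by (rule Bochner_Integration.integrable_bound[OF g qx[OF that]], rule AE_I2)
       (use bound[OF that] in \<open>auto intro: order_trans[OF _ abs_ge_self]\<close>)
  have meas: "case_prod ?p \<in> borel_measurable (gegen_interval \<Otimes>\<^sub>M lborel)"
  proof -
    have "(\<lambda>z. gegen_weight lam (fst z) * (case z of (x, y) \<Rightarrow> q x y)) \<in> borel_measurable (gegen_interval \<Otimes>\<^sub>M lborel)"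
      by (intro borel_measurable_times measurable_compose[OF measurable_fst gegen_weight_measurable'] q)
    thus ?thesis by (simp add: split_beta')
  qed
  have pint: "integrable (gegen_interval \<Otimes>\<^sub>M lborel) (case_prod ?p)"
  proof (rule Fubini_integrable[OF meas])
    have m: "(\<lambda>x. \<integral>y. norm (case (x, y) of (x, y) \<Rightarrow> ?p x y) \<partial>lborel) \<in> borel_measurable gegen_interval"
      using meas by (intro lborel.borel_measurable_lebesgue_integral) (simp add: split_beta')
    show "integrable gegen_interval (\<lambda>x. \<integral>y. norm (case (x, y) of (x, y) \<Rightarrow> ?p x y) \<partial>lborel)"
    proof (rule Bochner_Integration.integrable_bound[OF _ m])
      show "integrable gegen_interval (\<lambda>x. norm (gegen_weight lam x) * (\<integral>y. g y \<partial>lborel))"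
        by (intro integrable_mult_left integrable_norm gegen_weight_integrable lam)
      show "AE x in gegen_interval. norm (\<integral>y. norm (case (x, y) of (x, y) \<Rightarrow> ?p x y) \<partial>lborel)
         \<le> norm (norm (gegen_weight lam x) * (\<integral>y. g y \<partial>lborel))"
      proof (rule AE_I2)
        fix x assume "x \<in> space gegen_interval"
        hence x: "x \<in> {-1<..<1}" by simp
        have "(\<integral>y. norm (q x y) \<partial>lborel) \<le> (\<integral>y. g y \<partial>lborel)"
          by (rule integral_mono) (use qi[OF x] g bound[OF x] in auto)
        moreover have "(\<integral>y. norm (q x y) \<partial>lborel) \<ge> 0" by (rule Bochner_Integration.integral_nonneg) simp
        ultimately show "norm (\<integral>y. norm (case (x, y) of (x, y) \<Rightarrow> ?p x y) \<partial>lborel)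
           \<le> norm (norm (gegen_weight lam x) * (\<integral>y. g y \<partial>lborel))"
          by (auto simp: norm_mult intro!: order_trans[OF mult_left_mono abs_ge_self])
      qed
    qed
    show "AE x in gegen_interval. integrable lborel (\<lambda>y. case (x, y) of (x, y) \<Rightarrow> ?p x y)"
      by (rule AE_I2) (auto intro!: qi)
  qed
  have e: "(\<integral>y. ?p x y \<partial>lborel) = gegen_weight lam x * (\<integral>y. q x y \<partial>lborel)" for x
    by (rule integral_mult_right_zero)
  show "integrable gegen_interval (\<lambda>x. gegen_weight lam x * (\<integral>y. q x y \<partial>lborel))"
    using integrable_fst'[OF pint] by (simp add: e)
  show "integrable lborel (\<lambda>y. \<integral>x. gegen_weight lam x * q x y \<partial>gegen_interval)"
    using integrable_snd[OF pint] by simp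
  show "(\<integral>y. \<integral>x. gegen_weight lam x * q x y \<partial>gegen_interval \<partial>lborel)
       = (\<integral>x. gegen_weight lam x * (\<integral>y. q x y \<partial>lborel) \<partial>gegen_interval)"
    using Fubini_integral[OF pint] by (simp add: e)
qed

lemma cos_nonpos:
  assumes "pi / 2 \<le> x" "x \<le> 3 * pi / 2"
  shows "cos x \<le> 0"
  using sin_ge_zero[of "x - pi / 2"] assms by (simp add: sin_diff)

text \<open>After integration by parts and an exchange of integrals,
  \<open>sum_ray_evaluation\<close> applies at each point of the chord, and the resulting mean of
  \<open>Kint\<close> is the subject of \<open>pizzetti_Kint\<close>. The hypothesis on rotated
  pairs says that the whole chord stays in the right half-plane when turned by \<phi> in either
  direction.\<close>

lemma Koshliakov_pairing:
  fixes s lam W Z c :: complex and k \<phi> :: real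
  assumes s: "Re s > -1" and lam: "Re lam > -1/2" and sl: "Re (s + lam) > -1"
    and Z: "Z \<in> cone_nbhd W"
    and \<phi>: "0 < \<phi>" "\<phi> < pi / 2"
    and rot: "\<And>j. j \<in> {\<i>, - \<i>} \<Longrightarrow> exp (- j * of_real \<phi> / 2) * Z \<in> cone_nbhd (exp (- j * of_real \<phi> / 2) * W)"
    and k: "k > 0"
    and f: "\<And>t. t > 0 \<Longrightarrow> f t = c * (Koshliakov_g s (k * t\<^sup>2) *
       (\<Sum>j\<in>{\<i>, - \<i>}. \<integral>x. gegen_weight lam x * (chord W Z x + 4 * j * of_real (k * t\<^sup>2)) powr (- (s + lam + 1)) \<partial>gegen_interval) * of_real (2 * k * t))"
  shows "has_improper_integral f (c * (gegen_mass lam * (Gamma (lam + 1) / Gamma (s + lam + 1)) * exp (- s * of_real (ln 4)) / 2 *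
     (\<Sum>j\<in>{\<i>, - \<i>}. exp (lam * (- j * of_real \<phi>)) *
        (bser lam (1 / (4 * j * exp (- j * of_real \<phi>)) * (exp (- j * of_real \<phi> / 2) * Z)\<^sup>2)
         * Kint lam ((exp (- j * of_real \<phi> / 2) * W)\<^sup>2) (1 / (4 * j * exp (- j * of_real \<phi>)))))))"
proof -
  define \<mu> where "\<mu> = s + lam + 1"
  define J where "J = {\<i>, - \<i>}"
  define \<zeta> where "\<zeta> x = chord W Z x" for x
  have \<mu>: "Re \<mu> > 0" using sl by (simp add: \<mu>_def)
  have J: "finite J" "j \<in> J \<Longrightarrow> j = \<i> \<or> j = - \<i>" for j by (auto simp: J_def)
  \<comment> \<open>Half of the gap between the decay of the kernel and the growth of
    \<open>V\<close>. The gap equals (Re (s + \<lambda>) + 1)/2 + (Re \<lambda> + 1/2)/2, a sum of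
    two positive terms.\<close>
  define \<epsilon> where "\<epsilon> = (Re \<mu> - Re s / 2 - 1 / 4) / 2"
  have \<epsilon>: "\<epsilon> > 0" using sl lam by (simp add: \<epsilon>_def \<mu>_def field_simps)
  define m where "m = Re s / 2 + 1 / 4 + \<epsilon>"
  have m: "m < Re \<mu>" using \<epsilon> by (simp add: m_def \<epsilon>_def field_simps)
  obtain V C \<delta> where C: "C \<ge> 0" and \<delta>: "\<delta> > 0"
    and V': "\<And>X. X > 0 \<Longrightarrow> (V has_vector_derivative Koshliakov_g s X) (at X)"
    and V0: "\<And>X. 0 < X \<Longrightarrow> X \<le> 1 \<Longrightarrow> norm (V X) \<le> C * X powr \<delta>"
    and V_large: "\<And>X. 1 \<le> X \<Longrightarrow> norm (V X) \<le> C * X powr m"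
    and lap: "\<And>P j. Re P > 0 \<Longrightarrow> Im P \<noteq> 0 \<Longrightarrow> j = (if Im P > 0 then \<i> else - \<i>) \<Longrightarrow>
      (\<integral>y. exp (of_real y - P * of_real (exp y)) * V (exp y) \<partial>lborel) =
      2 * j * exp (j * of_real pi * s / 2) * P powr (-s - 2) * exp (- 1 / P)
      - 2 * cos (of_real pi * s / 2) * Gamma (s + 2) / of_real pi * (Nint s P + Nint s (-P))"
    unfolding m_def by (rule Koshliakov_primitive[OF s \<epsilon>]) blast
  have V_cont: "continuous_on {0<..} V"
    using V' by (intro continuous_at_imp_continuous_on) (auto dest: has_vector_derivative_continuous)
  have V_small: "norm (V X) \<le> C" if "0 < X" "X \<le> 1" for X
  proof -
    have "X powr \<delta> \<le> 1" using that \<delta> by (simp add: powr_le1)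
    hence "C * X powr \<delta> \<le> C" using C by (rule mult_left_le)
    thus ?thesis using V0[OF that] by linarith
  qed
  note hyps = s \<mu> \<mu>_def V_cont C V_small V_large m lap

  have \<zeta>c: "continuous_on S \<zeta>" for S unfolding \<zeta>_def chord_def by (intro continuous_intros)
  have \<zeta>m: "\<zeta> \<in> borel_measurable gegen_interval"
    by (intro measurable_restrict_space1) (simp add: borel_measurable_continuous_onI \<zeta>c)
  have \<zeta>pos: "Re (\<zeta> x) > 0" if "x \<in> {-1..1}" for x unfolding \<zeta>_def by (rule Re_chord_pos[OF Z that])
  obtain r0 where r0: "r0 > 0" "\<And>x. x \<in> {-1..1} \<Longrightarrow> r0 \<le> Re (\<zeta> x)"
  proof -
    have "\<exists>x\<in>{-1..1}. \<forall>y\<in>{-1..1}. Re (\<zeta> x) \<le> Re (\<zeta> y)"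
      by (rule continuous_attains_inf) (auto intro!: continuous_intros \<zeta>c)
    thus ?thesis using that \<zeta>pos by blast
  qed
  obtain R where R: "\<And>x. x \<in> {-1..1} \<Longrightarrow> norm (\<zeta> x) \<le> R"
  proof -
    have "\<exists>x\<in>{-1..1}. \<forall>y\<in>{-1..1}. norm (\<zeta> y) \<le> norm (\<zeta> x)"
      by (rule continuous_attains_sup) (auto intro!: continuous_intros \<zeta>c)
    thus ?thesis using that by blast
  qed
  have R0: "R > 0" using r0(1) r0(2)[of 0] R[of 0] complex_Re_le_cmod[of "\<zeta> 0"] by force
  \<comment> \<open>The weighted mean of the two lower bounds r0, from the real part, and 4X - R,
    from the triangle inequality, with weights proportional to 2R + r0 and r0, is
    \<open>a + b * X\<close>.\<close>
  define a where "a = r0 / 2"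
  define b where "b = 2 * r0 / (R + r0)"
  have ab: "a > 0" "b > 0" using r0 R0 by (auto simp: a_def b_def)
  have lower: "a + b * X \<le> norm (\<zeta> x + 4 * j * of_real X)" if "x \<in> {-1..1}" "j \<in> J" "X \<ge> 0" for x j X
  proof -
    let ?n = "norm (\<zeta> x + 4 * j * of_real X)"
    have "Re (\<zeta> x + 4 * j * of_real X) = Re (\<zeta> x)" using J(2)[OF that(2)] by auto
    hence n1: "r0 \<le> ?n" using r0(2)[OF that(1)] complex_Re_le_cmod[of "\<zeta> x + 4 * j * of_real X"] by linarith
    have nj: "norm j = 1" using J(2)[OF that(2)] by auto
    have "norm (4 * j * of_real X) - norm (\<zeta> x) \<le> norm (4 * j * of_real X + \<zeta> x)" by (rule norm_diff_ineq)
    hence n2: "4 * X - R \<le> ?n" using R[OF that(1)] that(3) nj by (simp add: norm_mult add.commute)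
    have "r0 * (4 * X - R) + (2 * R + r0) * r0 \<le> r0 * ?n + (2 * R + r0) * ?n"
      using n1 n2 r0(1) R0 by (intro add_mono mult_left_mono) auto
    moreover have "b * (R + r0) = 2 * r0" using r0(1) R0 by (simp add: b_def)
    moreover have "(a + b * X) * (2 * (R + r0)) = r0 * (R + r0) + 2 * X * (b * (R + r0))" by (simp add: a_def algebra_simps)
    ultimately have "(a + b * X) * (2 * (R + r0)) \<le> ?n * (2 * (R + r0))" by (simp add: algebra_simps)
    thus ?thesis using r0(1) R0 by (simp add: mult_le_cancel_right)
  qed
  have pbound: "norm ((\<zeta> x + 4 * j * of_real X) powr (- \<nu>)) \<le> (a + b * X) powr (- Re \<nu>) * exp (pi * \<bar>Im \<nu>\<bar>)"
    if "x \<in> {-1..1}" "j \<in> J" "X \<ge> 0" "Re \<nu> \<ge> 0" for x j X \<nu>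
    using norm_powr_le[OF _ lower[OF that(1-3)], of "- \<nu>"] ab that by (simp add: add_pos_nonneg)

  \<comment> \<open>A strip about the real axis on which \<zeta> + 4jX keeps a positive real part,
    so that the means are holomorphic in X there.\<close>
  define U where "U = {X :: complex. 4 * \<bar>Im X\<bar> < r0}"
  have Uo: "open U" unfolding U_def by (intro open_Collect_less continuous_intros)
  have UR: "of_real X \<in> U" for X using r0 by (simp add: U_def)
  have ReU: "Re (\<zeta> x + 4 * j * X) > 0" if "x \<in> {-1..1}" "j \<in> J" "X \<in> U" for x j X
    using r0(2)[OF that(1)] that(3) J(2)[OF that(2)] by (auto simp: U_def)
  define G where "G \<nu> j X = (\<integral>x. gegen_weight lam x * (\<zeta> x + 4 * j * X) powr (- \<nu>) \<partial>gegen_interval)" for \<nu> j X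
  have GD: "(G \<nu> j has_field_derivative (- 4 * j * \<nu>) * G (\<nu> + 1) j X) (at X)" if j: "j \<in> J" and X: "X \<in> U" for \<nu> j X
  proof -
    have "(G \<nu> j has_field_derivative (\<integral>x. gegen_weight lam x * (- 4 * j * \<nu> * (\<zeta> x + 4 * j * X) powr (- (\<nu> + 1))) \<partial>gegen_interval)) (at X)"
      unfolding G_def[abs_def]
    proof (rule gegen_param_deriv[OF lam Uo _ _ X, of "\<lambda>X x. (\<zeta> x + 4 * j * X) powr (- \<nu>)"])
      have "continuous_on (U \<times> {-1..1}) (\<lambda>p. \<zeta> (snd p))" by (intro continuous_on_compose2[OF \<zeta>c[of UNIV]] continuous_intros) auto
      moreover have "\<zeta> (snd p) + 4 * j * fst p \<noteq> 0" "0 \<le> Re (\<zeta> (snd p) + 4 * j * fst p)" if "p \<in> U \<times> {-1..1}" for p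
      proof -
        have "Re (\<zeta> (snd p) + 4 * j * fst p) > 0" using that j by (intro ReU) auto
        thus "\<zeta> (snd p) + 4 * j * fst p \<noteq> 0" "0 \<le> Re (\<zeta> (snd p) + 4 * j * fst p)" by (metis less_irrefl zero_complex.sel(1), linarith)
      qed
      ultimately show "continuous_on (U \<times> {-1..1}) (\<lambda>(X, x). (\<zeta> x + 4 * j * X) powr (- \<nu>))" unfolding split_beta
        by (intro continuous_on_powr_complex continuous_intros) blast+
      show "((\<lambda>X. (\<zeta> x + 4 * j * X) powr (- \<nu>)) has_field_derivative - 4 * j * \<nu> * (\<zeta> x + 4 * j * X) powr (- (\<nu> + 1))) (at X)"
        if "X \<in> U" "x \<in> {-1..1}" for X x
      proof (rule DERIV_cong)
        show "((\<lambda>X. (\<zeta> x + 4 * j * X) powr (- \<nu>)) has_field_derivative (- \<nu>) * (\<zeta> x + 4 * j * X) powr (- \<nu> - 1) * (4 * j)) (at X)"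
        proof (rule DERIV_chain2[where f = "\<lambda>z. z powr (- \<nu>)" and g = "\<lambda>X. \<zeta> x + 4 * j * X"])
          show "((\<lambda>z. z powr (- \<nu>)) has_field_derivative (- \<nu>) * (\<zeta> x + 4 * j * X) powr (- \<nu> - 1)) (at (\<zeta> x + 4 * j * X))"
            using ReU[OF that(2) j that(1)] by (intro has_field_derivative_powr) (auto simp: complex_nonpos_Reals_iff)
          show "((\<lambda>X. \<zeta> x + 4 * j * X) has_field_derivative 4 * j) (at X)" by (auto intro!: derivative_eq_intros)
        qed
      qed (simp add: mult_ac)
    qed
    also have "(\<integral>x. gegen_weight lam x * (- 4 * j * \<nu> * (\<zeta> x + 4 * j * X) powr (- (\<nu> + 1))) \<partial>gegen_interval)
       = (\<integral>x. (- 4 * j * \<nu>) * (gegen_weight lam x * (\<zeta> x + 4 * j * X) powr (- (\<nu> + 1))) \<partial>gegen_interval)"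
      by (simp add: mult_ac)
    also have "\<dots> = (- 4 * j * \<nu>) * G (\<nu> + 1) j X" unfolding G_def by (rule integral_mult_right_zero)
    finally show ?thesis .
  qed
  define A where "A X = (\<Sum>j\<in>J. G \<mu> j (of_real X))" for X
  \<comment> \<open>The factor j brought down by differentiation has opposite signs for the two
    kernels; it produces the cancellation in \<open>sum_ray_evaluation\<close>.\<close>
  define A' where "A' X = (\<Sum>j\<in>J. (- 4 * j * \<mu>) * G (\<mu> + 1) j (of_real X))" for X
  have AD: "(A has_vector_derivative A' X) (at X)" for X
    unfolding A_def A'_def
    by (intro has_vector_derivative_sum has_vector_derivative_real_field GD UR)
  have A'c: "continuous_on {0<..} A'" unfolding A'_def
  proof (intro continuous_intros)
    fix j assume j: "j \<in> J"
    have "continuous_on U (G (\<mu> + 1) j)" using GD[OF j] DERIV_isCont by (intro continuous_at_imp_continuous_on) blast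
    thus "continuous_on {0<..} (\<lambda>X. G (\<mu> + 1) j (of_real X))"
      by (rule continuous_on_compose2) (auto intro!: continuous_intros simp: UR)
  qed
  have wi: "integrable gegen_interval (\<lambda>x. norm (gegen_weight lam x))" using gegen_weight_integrable[OF lam] by simp
  define K1 where "K1 = 2 * exp (pi * \<bar>Im \<mu>\<bar>) * (\<integral>x. norm (gegen_weight lam x) \<partial>gegen_interval)"
  have A_bound: "norm (A X) \<le> K1 * (a + b * X) powr (- Re \<mu>)" if X: "X \<ge> 0" for X
  proof -
    have "norm (G \<mu> j (of_real X)) \<le> exp (pi * \<bar>Im \<mu>\<bar>) * (\<integral>x. norm (gegen_weight lam x) \<partial>gegen_interval) * (a + b * X) powr (- Re \<mu>)"
      if j: "j \<in> J" for j
    proof -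
      have "norm (G \<mu> j (of_real X)) \<le> (\<integral>x. norm (gegen_weight lam x) * ((a + b * X) powr (- Re \<mu>) * exp (pi * \<bar>Im \<mu>\<bar>)) \<partial>gegen_interval)"
        unfolding G_def
      proof (rule order_trans[OF integral_norm_bound integral_mono'])
        show "integrable gegen_interval (\<lambda>x. norm (gegen_weight lam x) * ((a + b * X) powr (- Re \<mu>) * exp (pi * \<bar>Im \<mu>\<bar>)))"
          by (intro integrable_mult_left wi)
        show "norm (gegen_weight lam x * (\<zeta> x + 4 * j * of_real X) powr (- \<mu>)) \<le> norm (gegen_weight lam x) * ((a + b * X) powr (- Re \<mu>) * exp (pi * \<bar>Im \<mu>\<bar>))"
          if "x \<in> space gegen_interval" for x
          unfolding norm_mult by (rule mult_left_mono[OF pbound]) (use j X \<mu> that in auto)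
      qed simp
      thus ?thesis by (simp add: mult_ac)
    qed
    hence "norm (A X) \<le> (\<Sum>j\<in>J. exp (pi * \<bar>Im \<mu>\<bar>) * (\<integral>x. norm (gegen_weight lam x) \<partial>gegen_interval) * (a + b * X) powr (- Re \<mu>))"
      unfolding A_def by (rule sum_norm_le)
    also have "\<dots> = K1 * (a + b * X) powr (- Re \<mu>)" by (simp add: J_def K1_def complex_eq_iff)
    finally show ?thesis .
  qed
  have K1: "K1 \<ge> 0" unfolding K1_def by simp
  have lim0: "((\<lambda>X. V X * A X) \<longlongrightarrow> 0) (at_right 0)"
  proof (rule Lim_null_comparison)
    show "((\<lambda>X. C * X powr \<delta> * (K1 * (a + b * X) powr (- Re \<mu>))) \<longlongrightarrow> 0) (at_right 0)"
      using ab \<delta> by real_asymp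
    show "\<forall>\<^sub>F X in at_right 0. norm (V X * A X) \<le> C * X powr \<delta> * (K1 * (a + b * X) powr (- Re \<mu>))"
      using eventually_at_right_real[of 0 1, OF zero_less_one]
    proof eventually_elim
      case (elim X)
      thus ?case unfolding norm_mult using C K1 by (intro mult_mono V0 A_bound) auto
    qed
  qed
  have lim1: "((\<lambda>X. V X * A X) \<longlongrightarrow> 0) at_top"
  proof (rule Lim_null_comparison)
    define M where "M = Re \<mu>"
    have "m < M" using m by (simp add: M_def)
    hence "((\<lambda>X. C * X powr m * (K1 * (a + b * X) powr (- M))) \<longlongrightarrow> 0) at_top"
      using ab by real_asymp
    thus "((\<lambda>X. C * X powr m * (K1 * (a + b * X) powr (- Re \<mu>))) \<longlongrightarrow> 0) at_top" by (simp add: M_def)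
    show "\<forall>\<^sub>F X in at_top. norm (V X * A X) \<le> C * X powr m * (K1 * (a + b * X) powr (- Re \<mu>))"
      using eventually_ge_at_top[of 1]
    proof eventually_elim
      case (elim X)
      thus ?case unfolding norm_mult using C K1 by (intro mult_mono V_large A_bound) auto
    qed
  qed

  define q where "q j x y = V (exp y) * of_real (exp y) * (\<zeta> x + 4 * j * of_real (exp y)) powr (- \<mu> - 1)" for j x y
  obtain K c' where Kc: "K \<ge> 0" "c' > 0"
    and wb: "\<And>y. norm (V (exp y)) * exp y * (a + b * exp y) powr (- Re \<mu> - 1) \<le> K * exp (- c' * \<bar>y\<bar>)"
    using V_weight_bound[OF hyps ab] by blast
  define E where "E = exp (pi * \<bar>Im \<mu>\<bar>)"
  have gint: "integrable lborel (\<lambda>y. E * (K * exp (- c' * \<bar>y\<bar>)))"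
    by (intro integrable_mult_right integrable_exp_abs Kc)
  have qb: "norm (q j x y) \<le> E * (K * exp (- c' * \<bar>y\<bar>))" if "j \<in> J" "x \<in> {-1<..<1}" for j x y
  proof -
    have "norm (q j x y) = norm (V (exp y)) * exp y * norm ((\<zeta> x + 4 * j * of_real (exp y)) powr (- (\<mu> + 1)))"
      by (simp add: q_def norm_mult)
    also have "\<dots> \<le> norm (V (exp y)) * exp y * ((a + b * exp y) powr (- Re (\<mu> + 1)) * exp (pi * \<bar>Im (\<mu> + 1)\<bar>))"
      using that \<mu> by (intro mult_left_mono pbound) auto
    also have "\<dots> = E * (norm (V (exp y)) * exp y * (a + b * exp y) powr (- Re \<mu> - 1))" by (simp add: E_def mult_ac)
    also have "\<dots> \<le> E * (K * exp (- c' * \<bar>y\<bar>))" using wb by (intro mult_left_mono) (auto simp: E_def)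
    finally show ?thesis .
  qed
  have qm: "(\<lambda>(x, y). q j x y) \<in> borel_measurable (gegen_interval \<Otimes>\<^sub>M lborel)" for j
  proof -
    have [measurable]: "(\<lambda>y. V (exp y)) \<in> borel_measurable borel" by (rule V_exp_measurable[OF hyps])
    have [measurable]: "\<zeta> \<in> borel_measurable gegen_interval" by (rule \<zeta>m)
    show ?thesis unfolding q_def powr_def by measurable
  qed
  note fub = gegen_Fubini[OF lam qm qb gint]
  have VG: "V (exp y) * of_real (exp y) * G (\<mu> + 1) j (of_real (exp y)) = (\<integral>x. gegen_weight lam x * q j x y \<partial>gegen_interval)" for j y
    unfolding G_def q_def by (subst integral_mult_right_zero[symmetric]) (simp add: mult_ac)
  have h: "V (exp y) * of_real (exp y) * A' (exp y) = (\<Sum>j\<in>J. (- 4 * j * \<mu>) * (\<integral>x. gegen_weight lam x * q j x y \<partial>gegen_interval))" for y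
    unfolding A'_def VG[symmetric] sum_distrib_left by (rule sum.cong) (simp_all add: mult_ac)
  have hint: "integrable lborel (\<lambda>y. V (exp y) * of_real (exp y) * A' (exp y))" unfolding h
    by (intro Bochner_Integration.integrable_sum integrable_mult_right fub)
  have "has_improper_integral f (- c * (\<integral>y. V (exp y) * of_real (exp y) * A' (exp y) \<partial>lborel))"
  proof (rule has_improper_integral_by_parts[OF V' AD A'c hint lim0 lim1 k])
    show "f t = c * (Koshliakov_g s (k * t\<^sup>2) * A (k * t\<^sup>2) * of_real (2 * k * t))" if "t > 0" for t
      unfolding f[OF that] A_def G_def J_def \<mu>_def \<zeta>_def ..
  qed
  also have "- c * (\<integral>y. V (exp y) * of_real (exp y) * A' (exp y) \<partial>lborel) = 4 * \<mu> * c * (\<Sum>j\<in>J. j * (\<integral>y. \<integral>x. gegen_weight lam x * q j x y \<partial>gegen_interval \<partial>lborel))"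
    unfolding h by (subst Bochner_Integration.integral_sum) (auto intro!: integrable_mult_right fub simp: sum_distrib_left sum_negf[symmetric] mult_ac intro: sum.cong)
  also have "(\<Sum>j\<in>J. j * (\<integral>y. \<integral>x. gegen_weight lam x * q j x y \<partial>gegen_interval \<partial>lborel))
      = (\<Sum>j\<in>J. j * (\<integral>x. gegen_weight lam x * (\<integral>y. q j x y \<partial>lborel) \<partial>gegen_interval))"
    by (intro sum.cong refl arg_cong2[of _ _ _ _ times] fub)
  also have "\<dots> = (\<Sum>j\<in>J. (\<integral>x. j * (gegen_weight lam x * (\<integral>y. q j x y \<partial>lborel)) \<partial>gegen_interval))" by simp
  also have "\<dots> = (\<integral>x. (\<Sum>j\<in>J. j * (gegen_weight lam x * (\<integral>y. q j x y \<partial>lborel))) \<partial>gegen_interval)"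
    by (rule Bochner_Integration.integral_sum[symmetric]) (intro integrable_mult_right fub)
  finally have start: "has_improper_integral f (4 * \<mu> * c * (\<integral>x. (\<Sum>j\<in>J. j * (gegen_weight lam x * (\<integral>y. q j x y \<partial>lborel))) \<partial>gegen_interval))" .
  define B where "B j = 1 / (4 * j * exp (- j * of_real \<phi>))" for j :: complex
  \<comment> \<open>The chord is a quadratic form in (W, Z), so turning both by half the angle turns
    the chord by \<phi>.\<close>
  define w where "w j = exp (- j * of_real \<phi> / 2)" for j :: complex
  have w2: "(w j)\<^sup>2 = exp (- j * of_real \<phi>)" for j by (simp add: w_def flip: exp_double)
  have wchord: "chord (w j * W) (w j * Z) x = exp (- j * of_real \<phi>) * \<zeta> x" for j x
    unfolding \<zeta>_def chord_def w2[symmetric] by (simp add: power2_eq_square algebra_simps)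
  have rot: "w j * Z \<in> cone_nbhd (w j * W)" if "j \<in> J" for j using rot[of j] that by (simp add: w_def J_def)
  have B: "Re (B j) > 0" if "j \<in> J" for j
  proof -
    have "Re (4 * j * exp (- j * of_real \<phi>)) = 4 * sin \<phi>" using J(2)[OF that] by (auto simp: Re_exp Im_exp)
    also have "\<dots> > 0" using \<phi> by (simp add: sin_gt_zero)
    finally show ?thesis unfolding B_def by (subst Re_divide) (auto simp: divide_simps sum_power2_gt_zero_iff)
  qed
  define c2 where "c2 = 2 * exp ((-s - 2) * of_real (ln 4)) / Gamma (\<mu> + 1)"
  have ev: "(\<Sum>j\<in>J. j * (gegen_weight lam x * (\<integral>y. q j x y \<partial>lborel))) =
     (\<Sum>j\<in>J. c2 * exp (lam * (- j * of_real \<phi>)) * (gegen_weight lam x * Kint lam (chord (w j * W) (w j * Z) x) (B j)))"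
    if x: "x \<in> {-1..1}" for x
  proof -
    have \<zeta>0: "\<zeta> x \<noteq> 0" using \<zeta>pos[OF x] by auto
    \<comment> \<open>The chords turned by \<phi> and by -\<phi> have positive real part, so the
      cosines of Arg \<zeta> - \<phi> and Arg \<zeta> + \<phi> are positive. Both angles are below
      pi in absolute value, which bounds |Arg \<zeta>| + \<phi> by pi/2.\<close>
    have sector: "\<bar>Arg (\<zeta> x)\<bar> + \<phi> < pi / 2"
    proof -
      let ?\<theta> = "Arg (\<zeta> x)"
      have th: "\<bar>?\<theta>\<bar> < pi / 2" using \<zeta>pos[OF x] \<zeta>0 Re_Ln_pos_lt[of "\<zeta> x"] by (simp add: Arg_eq_Im_Ln)
      have \<zeta>r: "\<zeta> x = of_real (norm (\<zeta> x)) * exp (\<i> * of_real ?\<theta>)" using Arg_eq[OF \<zeta>0] by simp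
      have cp: "cos (?\<theta> - \<sigma> * \<phi>) > 0" if "\<sigma> \<in> {1, -1}" for \<sigma> :: real
      proof -
        have "\<i> * of_real \<sigma> \<in> J" using that by (auto simp: J_def)
        hence "Re (chord (w (\<i> * of_real \<sigma>) * W) (w (\<i> * of_real \<sigma>) * Z) x) > 0" by (intro Re_chord_pos rot x)
        also have "chord (w (\<i> * of_real \<sigma>) * W) (w (\<i> * of_real \<sigma>) * Z) x = of_real (norm (\<zeta> x)) * exp (\<i> * of_real (?\<theta> - \<sigma> * \<phi>))"
          unfolding wchord by (subst \<zeta>r) (simp add: exp_diff exp_minus algebra_simps divide_inverse)
        also have "Re \<dots> = norm (\<zeta> x) * cos (?\<theta> - \<sigma> * \<phi>)" by (simp add: Re_exp)
        finally show ?thesis using \<zeta>0 by (simp add: zero_less_mult_iff)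
      qed
      have "?\<theta> + \<phi> < pi / 2"
      proof (rule ccontr)
        assume "\<not> ?thesis"
        hence "cos (?\<theta> + \<phi>) \<le> 0" using th \<phi> by (intro cos_nonpos) (auto simp: abs_less_iff)
        thus False using cp[of "-1"] by simp
      qed
      moreover have "- ?\<theta> + \<phi> < pi / 2"
      proof (rule ccontr)
        assume "\<not> ?thesis"
        hence "cos (- ?\<theta> + \<phi>) \<le> 0" using th \<phi> by (intro cos_nonpos) (auto simp: abs_less_iff)
        moreover have "cos (- ?\<theta> + \<phi>) = cos (?\<theta> - \<phi>)" by (metis cos_minus minus_diff_eq uminus_add_conv_diff)
        ultimately show False using cp[of 1] by simp
      qed
      ultimately show ?thesis by linarith
    qed
    have sre: "(\<Sum>j\<in>J. j * (\<integral>y. q j x y \<partial>lborel)) = c2 * (\<Sum>j\<in>J. exp (lam * (- j * of_real \<phi>)) * Kint lam (exp (- j * of_real \<phi>) * \<zeta> x) (B j))"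
      unfolding q_def J_def c2_def B_def by (rule sum_ray_evaluation[OF hyps \<zeta>0 \<phi>(1) sector])
    have "(\<Sum>j\<in>J. j * (gegen_weight lam x * (\<integral>y. q j x y \<partial>lborel))) = gegen_weight lam x * (\<Sum>j\<in>J. j * (\<integral>y. q j x y \<partial>lborel))"
      by (simp add: sum_distrib_left mult_ac)
    also have "\<dots> = (\<Sum>j\<in>J. c2 * exp (lam * (- j * of_real \<phi>)) * (gegen_weight lam x * Kint lam (chord (w j * W) (w j * Z) x) (B j)))"
      unfolding sre unfolding wchord sum_distrib_left by (intro sum.cong refl) (simp only: mult_ac)
    finally show ?thesis .
  qed
  have "(\<integral>x. (\<Sum>j\<in>J. j * (gegen_weight lam x * (\<integral>y. q j x y \<partial>lborel))) \<partial>gegen_interval) =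
     (\<integral>x. (\<Sum>j\<in>J. c2 * exp (lam * (- j * of_real \<phi>)) * (gegen_weight lam x * Kint lam (chord (w j * W) (w j * Z) x) (B j))) \<partial>gegen_interval)"
    by (intro Bochner_Integration.integral_cong refl ev) auto
  also have "\<dots> = (\<Sum>j\<in>J. c2 * exp (lam * (- j * of_real \<phi>)) * (\<integral>x. gegen_weight lam x * Kint lam (chord (w j * W) (w j * Z) x) (B j) \<partial>gegen_interval))"
  proof -
    have "integrable gegen_interval (\<lambda>x. c2 * exp (lam * (- j * of_real \<phi>)) * (gegen_weight lam x * Kint lam (chord (w j * W) (w j * Z) x) (B j)))"
      if j: "j \<in> J" for j
    proof -
    have kc: "continuous_on {\<zeta>. Re \<zeta> > 0} (\<lambda>\<zeta>. Kint lam \<zeta> (B j))"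
      using Kint_deriv_A[OF _ B[OF j]] DERIV_isCont by (intro continuous_at_imp_continuous_on) blast
    have "integrable gegen_interval (\<lambda>x. gegen_weight lam x * Kint lam (chord (w j * W) (w j * Z) x) (B j))"
    \<comment> \<open>Only integrability in x is wanted, so the family is taken constant in the
      complex parameter.\<close>
    proof (rule gegen_param_integrable[where h = "\<lambda>_ x. Kint lam (chord (w j * W) (w j * Z) x) (B j)" and h' = "\<lambda>_ _. 0" and U = UNIV and Z = 0, OF lam open_UNIV])
      show "continuous_on (UNIV \<times> {-1..1}) (\<lambda>(Y :: complex, x). Kint lam (chord (w j * W) (w j * Z) x) (B j))" unfolding split_beta
        by (rule continuous_on_compose2[OF kc])
           (use Re_chord_pos[OF rot[OF j]] in \<open>auto simp: chord_def[abs_def] intro!: continuous_intros\<close>)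
    qed (auto intro!: derivative_eq_intros)
    thus ?thesis by (intro integrable_mult_right) simp
    qed
    thus ?thesis by (subst Bochner_Integration.integral_sum) auto
  qed
  also have "\<dots> = (\<Sum>j\<in>J. c2 * exp (lam * (- j * of_real \<phi>)) * (gegen_mass lam * (Gamma (lam + 1) * bser lam (B j * (w j * Z)\<^sup>2) * Kint lam ((w j * W)\<^sup>2) (B j))))"
    by (intro sum.cong refl arg_cong2[of _ _ _ _ times] pizzetti_Kint lam rot B)
  also have "\<dots> = c2 * gegen_mass lam * Gamma (lam + 1) * (\<Sum>j\<in>J. exp (lam * (- j * of_real \<phi>)) * (bser lam (B j * (w j * Z)\<^sup>2) * Kint lam ((w j * W)\<^sup>2) (B j)))"
    unfolding sum_distrib_left by (intro sum.cong refl) (simp only: mult_ac)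
  finally have fin: "(\<integral>x. (\<Sum>j\<in>J. j * (gegen_weight lam x * (\<integral>y. q j x y \<partial>lborel))) \<partial>gegen_interval) =
     c2 * gegen_mass lam * Gamma (lam + 1) * (\<Sum>j\<in>J. exp (lam * (- j * of_real \<phi>)) * (bser lam (B j * (w j * Z)\<^sup>2) * Kint lam ((w j * W)\<^sup>2) (B j)))" .
  have res: "has_improper_integral f (4 * \<mu> * c * (c2 * gegen_mass lam * Gamma (lam + 1) *
    (\<Sum>j\<in>J. exp (lam * (- j * of_real \<phi>)) * (bser lam (B j * (w j * Z)\<^sup>2) * Kint lam ((w j * W)\<^sup>2) (B j)))))"
    using start unfolding fin .
  have "\<mu> \<noteq> 0" "\<mu> \<notin> \<int>\<^sub>\<le>\<^sub>0" using \<mu> Re_pos_not_nonpos_Ints[of \<mu>] by auto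
  hence Gm: "Gamma (\<mu> + 1) = \<mu> * Gamma \<mu>" "Gamma \<mu> \<noteq> 0" by (simp_all add: Gamma_plus1 Gamma_eq_zero_iff)
  have "exp ((-s - 2) * of_real (ln 4)) = exp (- s * of_real (ln 4)) / (exp (of_real (ln 4)))\<^sup>2"
    by (simp add: exp_diff exp_double[symmetric] left_diff_distrib)
  also have "(exp (of_real (ln 4)))\<^sup>2 = (16 :: complex)" by (simp add: exp_of_real)
  finally have e: "exp ((-s - 2) * of_real (ln 4)) = exp (- s * of_real (ln 4)) / 16" .
  \<comment> \<open>Gamma (\<mu> + 1) = \<mu> Gamma \<mu> absorbs the \<mu> from the derivative, and
    the constants 4, 2 and 1/16 multiply to 1/2.\<close>
  have "4 * \<mu> * c * (c2 * gegen_mass lam * Gamma (lam + 1) * S) = c * (gegen_mass lam * (Gamma (lam + 1) / Gamma \<mu>) * exp (- s * of_real (ln 4)) / 2 * S)" for S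
    unfolding c2_def e Gm(1) using Gm(2) \<open>\<mu> \<noteq> 0\<close> by (simp add: field_simps)
  note res[unfolded this]
  thus ?thesis unfolding B_def w_def \<mu>_def J_def .
qed

section \<open>Return to z, w and the products of Bessel functions\<close>

lemma sum_conj_pair: "(\<Sum>j\<in>{\<i>, - \<i>}. f j) = f \<i> + f (- \<i>)" for f :: "complex \<Rightarrow> complex"
  by (subst sum.insert) (auto simp: complex_eq_iff)

lemma abs_sin_less_cos:
  assumes "\<bar>\<alpha>\<bar> < pi / 4"
  shows "\<bar>sin \<alpha>\<bar> < cos \<alpha>"
proof -
  have "Arg (cis \<alpha>) = \<alpha>" using assms pi_gt_zero by (intro Arg_cis) auto
  thus ?thesis using assms abs_Arg_less_iff_cone[of "cis \<alpha>", OF cis_neq_zero] by (simp only: cis.sel)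
qed

lemma cone_rotate:
  assumes "z \<noteq> 0" "\<bar>Arg z\<bar> + \<bar>\<psi>\<bar> < pi / 4"
  shows "\<bar>Im (exp (\<i> * of_real \<psi>) * z)\<bar> < Re (exp (\<i> * of_real \<psi>) * z)"
proof -
  have "exp (\<i> * of_real \<psi>) * z = of_real (norm z) * exp (\<i> * of_real (Arg z + \<psi>))"
    by (subst Arg_eq[OF assms(1)]) (simp add: exp_add algebra_simps)
  hence eq: "Im (exp (\<i> * of_real \<psi>) * z) = norm z * sin (Arg z + \<psi>)" "Re (exp (\<i> * of_real \<psi>) * z) = norm z * cos (Arg z + \<psi>)"
    by (simp_all add: Re_exp Im_exp)
  have "\<bar>sin (Arg z + \<psi>)\<bar> < cos (Arg z + \<psi>)" using assms(2) by (intro abs_sin_less_cos) linarith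
  thus ?thesis unfolding eq using assms(1) by (simp add: abs_mult)
qed

text \<open>The argument of K is split as 2(vW)\<beta> with v = e^(-j\<phi>/2) and \<beta> = e^(-j
  pi/4)/(2v), so that \<beta>^2 = 1/(4j e^(-j\<phi>)) is the second argument of \<open>Kint\<close>
  produced by the rotated rays. Both factors lie in the sector required by
  \<open>Bessel_K_eq_Kint\<close>: vW by hypothesis, and \<beta> because its argument is pi/4 -
  \<phi>/2 in absolute value.\<close>

lemma Bessel_I_mult_K:
  fixes z w lam j :: complex and \<rho> \<phi> :: real
  assumes zw: "\<bar>Im z\<bar> < Re z" "\<bar>Im w\<bar> < Re w" "Re z > Re w" and \<rho>: "\<rho> > 0"
    and j: "j = \<i> \<or> j = - \<i>" and \<phi>: "0 < \<phi>" "\<phi> < pi / 2"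
    and rot: "\<bar>Im (exp (- j * of_real \<phi> / 2) * (of_real \<rho> * (z + w) / 2))\<bar> < Re (exp (- j * of_real \<phi> / 2) * (of_real \<rho> * (z + w) / 2))"
  shows "Bessel_I lam (exp (- j * of_real pi / 4) * of_real \<rho> * (z - w) / 2) * Bessel_K lam (exp (- j * of_real pi / 4) * of_real \<rho> * (z + w) / 2)
    = exp (lam * (2 * of_real (ln \<rho>) - of_real (ln 4))) / 2 * ((z - w) powr lam * (z + w) powr lam) *
      (exp (lam * (- j * of_real \<phi>)) *
        (bser lam (1 / (4 * j * exp (- j * of_real \<phi>)) * (exp (- j * of_real \<phi> / 2) * (of_real \<rho> * (z - w) / 2))\<^sup>2)
         * Kint lam ((exp (- j * of_real \<phi> / 2) * (of_real \<rho> * (z + w) / 2))\<^sup>2) (1 / (4 * j * exp (- j * of_real \<phi>)))))"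
proof -
  define v where "v = exp (- j * of_real \<phi> / 2)"
  define e where "e = exp (- j * of_real pi / 4)"
  define B where "B = 1 / (4 * j * exp (- j * of_real \<phi>))"
  define \<beta> where "\<beta> = e / (2 * v)"
  define Z where "Z = of_real \<rho> * (z - w) / 2"
  define W where "W = of_real \<rho> * (z + w) / 2"
  define l r where "l = complex_of_real (ln 2)" and "r = complex_of_real (ln \<rho>)"
  define Lm Lp where "Lm = Ln (z - w)" and "Lp = Ln (z + w)"
  have l4: "of_real (ln 4) = 2 * l" using ln_realpow[of 2 2] by (simp add: l_def)
  have nz: "z - w \<noteq> 0" "z + w \<noteq> 0" "v \<noteq> 0" "e \<noteq> 0" "j \<noteq> 0"
  proof -
    show "z - w \<noteq> 0" "z + w \<noteq> 0" using zw by (auto simp: complex_eq_iff)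
  qed (use j in \<open>auto simp: v_def e_def\<close>)
  have ex: "exp l = 2" "exp r = of_real \<rho>" "exp Lm = z - w" "exp Lp = z + w"
    using \<rho> nz by (simp_all add: l_def r_def Lm_def Lp_def exp_of_real)
  have "e\<^sup>2 = exp (- j * of_real pi / 2)" by (simp add: e_def flip: exp_double)
  also have "\<dots> = - j" using j by (auto simp: complex_eq_iff Re_exp Im_exp)
  also have "\<dots> = 1 / j" using j by auto
  finally have e2: "e\<^sup>2 = 1 / j" .
  have v2: "v\<^sup>2 = exp (- j * of_real \<phi>)" by (simp add: v_def flip: exp_double)
  have \<beta>2: "\<beta>\<^sup>2 = B" unfolding B_def v2[symmetric] using nz by (simp add: \<beta>_def power_divide power_mult_distrib e2)
  have \<beta>_exp: "\<beta> = exp (- l - j * of_real pi / 4 + j * of_real \<phi> / 2)"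
  proof -
    have "\<beta> = exp (- j * of_real pi / 4 - (l + (- j * of_real \<phi> / 2)))"
      by (simp only: \<beta>_def e_def v_def exp_diff exp_add ex(1))
    also have "- j * of_real pi / 4 - (l + (- j * of_real \<phi> / 2)) = - l - j * of_real pi / 4 + j * of_real \<phi> / 2" by simp
    finally show ?thesis .
  qed
  have Im_L: "\<bar>Im Lm\<bar> < pi / 2" "\<bar>Im Lp\<bar> < pi / 4"
    unfolding Lm_def Lp_def using zw Im_Ln_less[of "z - w"] Im_Ln_cone[OF cone_add[OF zw(1,2)]] by simp_all
  have i0: "Im l = 0" "Im r = 0" "Re (j * of_real x) = 0" "\<bar>Im (j * of_real x)\<bar> = \<bar>x\<bar>" for x
    using j by (auto simp: l_def r_def)
  have L3: "Ln \<beta> = - l - j * of_real pi / 4 + j * of_real \<phi> / 2"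
    unfolding \<beta>_exp using \<phi> j i0 by (intro Ln_exp) auto
  have \<beta>c: "\<bar>Im \<beta>\<bar> < Re \<beta>"
  proof -
    define \<alpha> where "\<alpha> = pi / 4 - \<phi> / 2"
    have "\<bar>\<alpha>\<bar> < pi / 4" using \<phi> by (auto simp: \<alpha>_def)
    hence sc: "\<bar>sin \<alpha>\<bar> < cos \<alpha>" by (rule abs_sin_less_cos)
    have "- l - j * of_real pi / 4 + j * of_real \<phi> / 2 = - j * of_real \<alpha> - l" by (simp add: \<alpha>_def field_simps)
    hence \<beta>\<alpha>: "\<beta> = exp (- j * of_real \<alpha>) / 2" unfolding \<beta>_exp by (simp only: exp_diff ex(1))
    have "\<bar>Im \<beta>\<bar> = \<bar>sin \<alpha>\<bar> / 2" "Re \<beta> = cos \<alpha> / 2" unfolding \<beta>\<alpha> using j by (auto simp: Re_exp Im_exp)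
    thus ?thesis using sc by simp
  qed
  have L1: "Ln (e * of_real \<rho> * (z - w) / 4) = - j * of_real pi / 4 - 2 * l + r + Lm"
    using Im_L j i0 by (intro Ln_unique) (auto simp: exp_add exp_diff exp_double ex e_def abs_less_iff)
  have L2: "Ln (v * W) = - j * of_real \<phi> / 2 + r - l + Lp"
  proof (rule Ln_unique)
    show "exp (- j * of_real \<phi> / 2 + r - l + Lp) = v * W" by (simp only: exp_add exp_diff ex v_def W_def) simp
  qed (use Im_L j i0 \<phi> in \<open>auto simp: abs_less_iff\<close>)
  have xI: "e * of_real \<rho> * (z - w) / 2 / 2 = e * of_real \<rho> * (z - w) / 4" by simp
  have "(e * of_real \<rho> * (z - w) / 2 / 2)\<^sup>2 = B * (v * Z)\<^sup>2"
    using nz by (simp add: Z_def \<beta>_def power_divide power_mult_distrib flip: \<beta>2)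
  hence I: "Bessel_I lam (e * of_real \<rho> * (z - w) / 2) = (e * of_real \<rho> * (z - w) / 4) powr lam * bser lam (B * (v * Z)\<^sup>2)"
    unfolding Bessel_I_eq_bser by simp
  have xK: "e * of_real \<rho> * (z + w) / 2 = 2 * (v * W) * \<beta>" using nz by (simp add: W_def \<beta>_def)
  have Wc: "\<bar>Im (v * W)\<bar> < Re (v * W)" using rot by (simp only: v_def W_def)
  have K: "Bessel_K lam (e * of_real \<rho> * (z + w) / 2) = (v * W) powr lam * \<beta> powr (- lam) * Kint lam ((v * W)\<^sup>2) B / 2"
    unfolding xK Bessel_K_eq_Kint[OF Wc \<beta>c] \<beta>2 ..
  \<comment> \<open>The rotation by pi/4 in the power from I cancels against the one in
    \<beta>^(-\<lambda>), and \<phi> survives only as e^(-j\<lambda>\<phi>).\<close>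
  have "(e * of_real \<rho> * (z - w) / 4) powr lam * ((v * W) powr lam * \<beta> powr (- lam)) =
    exp (lam * (- j * of_real pi / 4 - 2 * l + r + Lm) + (lam * (- j * of_real \<phi> / 2 + r - l + Lp) + (- lam) * (- l - j * of_real pi / 4 + j * of_real \<phi> / 2)))"
    unfolding exp_add powr_def L1 L2 L3 using nz \<rho> by (simp add: W_def \<beta>_def)
  also have "\<dots> = exp (lam * (2 * r - 2 * l) + (lam * Lm + lam * Lp) + lam * (- j * of_real \<phi>))"
    by (rule arg_cong[of _ _ exp]) (simp add: field_simps)
  also have "\<dots> = exp (lam * (2 * r - 2 * l)) * ((z - w) powr lam * (z + w) powr lam) * exp (lam * (- j * of_real \<phi>))"
    unfolding exp_add powr_def using nz by (simp add: Lm_def Lp_def)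
  finally have P: "(e * of_real \<rho> * (z - w) / 4) powr lam * ((v * W) powr lam * \<beta> powr (- lam)) =
    exp (lam * (2 * r - 2 * l)) * ((z - w) powr lam * (z + w) powr lam) * exp (lam * (- j * of_real \<phi>))" .
  have "Bessel_I lam (e * of_real \<rho> * (z - w) / 2) * Bessel_K lam (e * of_real \<rho> * (z + w) / 2) =
    ((e * of_real \<rho> * (z - w) / 4) powr lam * ((v * W) powr lam * \<beta> powr (- lam))) * (bser lam (B * (v * Z)\<^sup>2) * Kint lam ((v * W)\<^sup>2) B) / 2"
    unfolding I K by (simp add: mult_ac)
  thus ?thesis unfolding P e_def[symmetric] v_def[symmetric] B_def[symmetric] Z_def[symmetric] W_def[symmetric] r_def[symmetric] l4
    by (simp add: mult_ac)
qed

theorem theorem2p1: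
  fixes z w s lam :: complex and \<rho> :: real
  assumes "z \<noteq> 0" and "w \<noteq> 0"
    and "\<bar>Arg z\<bar> < pi / 4" and "\<bar>Arg w\<bar> < pi / 4"
    and "Re z > Re w"
    and "\<rho> > 0"
    and "Re s > -1" and "Re lam > -1 / 2" and "Re (s + lam) > -1"
  defines "\<epsilon> \<equiv> exp (\<i> * of_real pi / 4)"
  shows "has_improper_integral
     (\<lambda>t. of_real t powr (s + 1) * Koshliakov_F s (of_real (\<rho> * t)) *
          (kernel_A s lam z w (t\<^sup>2) + kernel_A s lam z w (- (t\<^sup>2))))
     (Gamma (lam + 1) / Gamma (s + lam + 1) * of_real (2 * \<rho>) powr s *
       (Bessel_I lam (of_real \<rho> * cnj \<epsilon> * (z - w) / 2) * Bessel_K lam (of_real \<rho> * cnj \<epsilon> * (z + w) / 2)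
        + Bessel_I lam (of_real \<rho> * \<epsilon> * (z - w) / 2) * Bessel_K lam (of_real \<rho> * \<epsilon> * (z + w) / 2)))"
proof -
  note zw0 = assms(1,2) and Arg_zw = assms(3,4) and \<rho> = assms(6) and s = assms(7) and sl = assms(9)
  have lam: "Re lam > -1/2" using assms(8) by simp
  have zw: "\<bar>Im z\<bar> < Re z" "\<bar>Im w\<bar> < Re w" "Re z > Re w" using abs_Arg_less_iff_cone[OF zw0(1)] abs_Arg_less_iff_cone[OF zw0(2)] Arg_zw assms(5) by blast+
  define \<mu> where "\<mu> = s + lam + 1"
  define \<Lambda> where "\<Lambda> = (z - w) powr lam * (z + w) powr lam"
  define l r where "l = complex_of_real (ln 2)" and "r = complex_of_real (ln \<rho>)"
  have l4: "of_real (ln 4) = 2 * l" using ln_realpow[of 2 2] by (simp add: l_def)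
  define W where "W = of_real \<rho> * (z + w) / 2"
  define Z where "Z = of_real \<rho> * (z - w) / 2"
  \<comment> \<open>With this choice |Arg z| + \<phi>/2 and |Arg w| + \<phi>/2 are both below pi/4,
    so z and w can be turned by \<phi>/2 either way without leaving the sector.\<close>
  define \<phi> where "\<phi> = pi / 4 - max \<bar>Arg z\<bar> \<bar>Arg w\<bar>"
  have \<phi>: "0 < \<phi>" "\<phi> < pi / 2" "\<bar>Arg z\<bar> + \<phi> / 2 < pi / 4" "\<bar>Arg w\<bar> + \<phi> / 2 < pi / 4"
    using Arg_zw pi_gt_zero by (auto simp: \<phi>_def max_def field_simps)
  have cone: "\<bar>Im (exp (- j * of_real \<phi> / 2) * (of_real \<rho> * u))\<bar> < Re (exp (- j * of_real \<phi> / 2) * (of_real \<rho> * u))"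
    if "j = \<i> \<or> j = - \<i>" "u = z \<or> u = w" for j u
  proof -
    define \<psi> where "\<psi> = - Im j * \<phi> / 2"
    have \<psi>: "- j * of_real \<phi> / 2 = \<i> * of_real \<psi>" "\<bar>\<psi>\<bar> = \<phi> / 2"
      using that(1) \<phi>(1) by (auto simp: \<psi>_def complex_eq_iff)
    have "\<bar>Im (exp (\<i> * of_real \<psi>) * u)\<bar> < Re (exp (\<i> * of_real \<psi>) * u)"
      using that(2) zw0 \<phi> \<psi>(2) by (intro cone_rotate) auto
    from cone_of_real_mult[OF this \<rho>] show ?thesis unfolding \<psi>(1) by (simp only: mult_ac)
  qed
  have rot: "exp (- j * of_real \<phi> / 2) * Z \<in> cone_nbhd (exp (- j * of_real \<phi> / 2) * W)" if "j \<in> {\<i>, - \<i>}" for j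
  proof -
    have eq: "e * W + e * Z = e * (of_real \<rho> * z)" "e * W - e * Z = e * (of_real \<rho> * w)" for e
      by (simp_all add: W_def Z_def field_simps)
    show ?thesis unfolding cone_nbhd_def mem_Collect_eq eq using cone that by blast
  qed
  have Z: "Z \<in> cone_nbhd W"
  proof -
    have eq: "W + Z = of_real \<rho> * z" "W - Z = of_real \<rho> * w" by (simp_all add: W_def Z_def field_simps)
    show ?thesis unfolding cone_nbhd_def mem_Collect_eq eq using zw cone_of_real_mult[OF _ \<rho>] by blast
  qed
  \<comment> \<open>For X = k t^2 this makes 2 sqrt X = \<rho> t, the argument of the Koshliakov
    kernel.\<close>
  define k where "k = \<rho>\<^sup>2 / 4"
  have k: "k > 0" using \<rho> by (simp add: k_def)
  \<comment> \<open>Collects the constant of \<open>kernel_A_eq\<close>, the factor \<rho>^(2\<mu>)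
    from rescaling the chord, and the factor \<rho>^(-2) (\<rho>/2)^(-s) from the substitution X =
    \<rho>^2 t^2/4.\<close>
  define c where "c = exp ((s - lam) * of_real (ln 4)) * \<Lambda> / gegen_mass lam * exp (2 * r * \<mu>) * exp (- 2 * r) * exp (- s * (r - l))"
  \<comment> \<open>Multiplying z and w by \<rho> scales the chord by \<rho>^2, and the same factor
    turns j t^2 into 4jX.\<close>
  have chord_scale: "chord ((z + w) / 2) ((z - w) / 2) x + j * of_real (t\<^sup>2) = of_real (inverse (\<rho>\<^sup>2)) * (chord W Z x + 4 * j * of_real (k * t\<^sup>2))" for x t j
    using \<rho> by (simp add: chord_def W_def Z_def k_def power2_eq_square field_simps)
  have inv_powr: "complex_of_real (inverse (\<rho>\<^sup>2)) powr (- \<mu>) = exp (2 * r * \<mu>)"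
    using \<rho> by (simp add: powr_def Ln_of_real r_def ln_inverse ln_realpow mult_ac del: of_real_inverse of_real_power)
  have kernel: "kernel_A s lam z w (t\<^sup>2) + kernel_A s lam z w (- (t\<^sup>2)) =
     exp ((s - lam) * of_real (ln 4)) * \<Lambda> / gegen_mass lam * exp (2 * r * \<mu>) *
      (\<Sum>j\<in>{\<i>, - \<i>}. \<integral>x. gegen_weight lam x * (chord W Z x + 4 * j * of_real (k * t\<^sup>2)) powr (- \<mu>) \<partial>gegen_interval)" for t
  proof -
    have shift: "(\<integral>x. gegen_weight lam x * (chord ((z + w) / 2) ((z - w) / 2) x + j * of_real (t\<^sup>2)) powr (- \<mu>) \<partial>gegen_interval) =
       exp (2 * r * \<mu>) * (\<integral>x. gegen_weight lam x * (chord W Z x + 4 * j * of_real (k * t\<^sup>2)) powr (- \<mu>) \<partial>gegen_interval)"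
      if j: "j \<in> {\<i>, - \<i>}" for j
    proof (subst integral_mult_right_zero[symmetric], intro Bochner_Integration.integral_cong refl)
      fix x assume "x \<in> space gegen_interval"
      hence "Re (chord W Z x) > 0" by (intro Re_chord_pos[OF Z]) auto
      hence "Re (chord W Z x + 4 * j * of_real (k * t\<^sup>2)) > 0" using j by auto
      moreover have "Re (complex_of_real (inverse (\<rho>\<^sup>2))) > 0" using \<rho> by simp
      ultimately show "gegen_weight lam x * (chord ((z + w) / 2) ((z - w) / 2) x + j * of_real (t\<^sup>2)) powr (- \<mu>) =
         exp (2 * r * \<mu>) * (gegen_weight lam x * (chord W Z x + 4 * j * of_real (k * t\<^sup>2)) powr (- \<mu>))"
        unfolding chord_scale by (subst powr_mult_Re_pos) (simp_all only: inv_powr mult_ac)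
    qed
    have neg: "\<i> * of_real (- (t\<^sup>2)) = (- \<i>) * of_real (t\<^sup>2)" by simp
    have "kernel_A s lam z w (t\<^sup>2) + kernel_A s lam z w (- (t\<^sup>2)) = exp ((s - lam) * of_real (ln 4)) * \<Lambda> / gegen_mass lam *
      (\<Sum>j\<in>{\<i>, - \<i>}. \<integral>x. gegen_weight lam x * (chord ((z + w) / 2) ((z - w) / 2) x + j * of_real (t\<^sup>2)) powr (- \<mu>) \<partial>gegen_interval)"
      unfolding kernel_A_eq[OF zw lam] neg sum_conj_pair \<Lambda>_def \<mu>_def by (simp only: distrib_left)
    also have "(\<Sum>j\<in>{\<i>, - \<i>}. \<integral>x. gegen_weight lam x * (chord ((z + w) / 2) ((z - w) / 2) x + j * of_real (t\<^sup>2)) powr (- \<mu>) \<partial>gegen_interval)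
       = (\<Sum>j\<in>{\<i>, - \<i>}. exp (2 * r * \<mu>) * (\<integral>x. gegen_weight lam x * (chord W Z x + 4 * j * of_real (k * t\<^sup>2)) powr (- \<mu>) \<partial>gegen_interval))"
      by (intro sum.cong refl shift)
    finally show ?thesis by (simp only: sum_distrib_left[symmetric] mult.assoc)
  qed
  have g: "of_real t powr (s + 1) * Koshliakov_F s (of_real (\<rho> * t)) =
     exp (- 2 * r) * exp (- s * (r - l)) * (Koshliakov_g s (k * t\<^sup>2) * of_real (2 * k * t))" if t: "t > 0" for t
  proof -
    have kt: "k * t\<^sup>2 = (\<rho> * t / 2)\<^sup>2" by (simp add: k_def power2_eq_square)
    have sq: "2 * sqrt (k * t\<^sup>2) = \<rho> * t" unfolding kt using \<rho> t by simp
    have "ln (k * t\<^sup>2) = 2 * (ln \<rho> + ln t - ln 2)" unfolding kt using \<rho> t by (simp add: ln_realpow ln_mult ln_div)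
    hence ln_kt: "s / 2 * of_real (ln (k * t\<^sup>2)) = s * (r + of_real (ln t) - l)" by (simp only:) (simp add: r_def l_def algebra_simps)
    have "complex_of_real (k * t\<^sup>2) powr (s / 2) = exp (s / 2 * of_real (ln (k * t\<^sup>2)))"
      using k t by (simp add: powr_def Ln_of_real del: of_real_mult of_real_power)
    hence pw: "of_real (k * t\<^sup>2) powr (s / 2) = exp (s * (r + of_real (ln t) - l))" unfolding ln_kt .
    have tp: "of_real t powr (s + 1) = exp (s * of_real (ln t)) * of_real t"
      using t by (simp add: powr_def Ln_of_real distrib_right exp_add exp_of_real)
    have k2: "complex_of_real (2 * k * t) = of_real (\<rho>\<^sup>2) * of_real t / 2" by (simp add: k_def)
    have r1: "exp (- 2 * r) * of_real (\<rho>\<^sup>2) = 1" using \<rho> by (simp add: r_def exp_minus exp_double exp_of_real)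
    have e1: "exp (- s * (r - l)) * exp (s * (r + of_real (ln t) - l)) = exp (s * of_real (ln t))"
      unfolding exp_add[symmetric] by (rule arg_cong[of _ _ exp]) (simp add: algebra_simps)
    have "exp (- 2 * r) * exp (- s * (r - l)) * (2 * exp (s * (r + of_real (ln t) - l)) * F * of_real (2 * k * t)) =
        (exp (- 2 * r) * of_real (\<rho>\<^sup>2)) * (exp (- s * (r - l)) * exp (s * (r + of_real (ln t) - l))) * of_real t * F" for F
      unfolding k2 by (simp only: mult_ac times_divide_eq_left times_divide_eq_right) simp
    hence kk: "exp (- 2 * r) * exp (- s * (r - l)) * (2 * exp (s * (r + of_real (ln t) - l)) * F * of_real (2 * k * t)) =
        exp (s * of_real (ln t)) * of_real t * F" for F unfolding r1 e1 by simp
    show ?thesis unfolding Koshliakov_g_def sq pw tp by (rule kk[symmetric])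
  qed
  define S where "S j = exp (lam * (- j * of_real \<phi>)) *
        (bser lam (1 / (4 * j * exp (- j * of_real \<phi>)) * (exp (- j * of_real \<phi> / 2) * Z)\<^sup>2)
         * Kint lam ((exp (- j * of_real \<phi> / 2) * W)\<^sup>2) (1 / (4 * j * exp (- j * of_real \<phi>))))" for j
  have "has_improper_integral
     (\<lambda>t. of_real t powr (s + 1) * Koshliakov_F s (of_real (\<rho> * t)) *
          (kernel_A s lam z w (t\<^sup>2) + kernel_A s lam z w (- (t\<^sup>2))))
     (c * (gegen_mass lam * (Gamma (lam + 1) / Gamma (s + lam + 1)) * exp (- s * of_real (ln 4)) / 2 * (\<Sum>j\<in>{\<i>, - \<i>}. S j)))"
    unfolding S_def
  proof (rule Koshliakov_pairing[OF s lam sl Z \<phi>(1,2) rot k])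
    show "of_real t powr (s + 1) * Koshliakov_F s (of_real (\<rho> * t)) * (kernel_A s lam z w (t\<^sup>2) + kernel_A s lam z w (- (t\<^sup>2))) =
      c * (Koshliakov_g s (k * t\<^sup>2) * (\<Sum>j\<in>{\<i>, - \<i>}. \<integral>x. gegen_weight lam x * (chord W Z x + 4 * j * of_real (k * t\<^sup>2)) powr (- (s + lam + 1)) \<partial>gegen_interval) * of_real (2 * k * t))"
      if "t > 0" for t
      unfolding g[OF that] kernel c_def \<mu>_def[symmetric] by (simp only: mult_ac times_divide_eq_left times_divide_eq_right)
  qed
  also have "c * (gegen_mass lam * (Gamma (lam + 1) / Gamma (s + lam + 1)) * exp (- s * of_real (ln 4)) / 2 * (\<Sum>j\<in>{\<i>, - \<i>}. S j)) =
     Gamma (lam + 1) / Gamma (s + lam + 1) * of_real (2 * \<rho>) powr s * (\<Sum>j\<in>{\<i>, - \<i>}. exp (lam * (2 * r - of_real (ln 4))) / 2 * \<Lambda> * S j)"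
  proof -
    have p: "of_real (2 * \<rho>) powr s = exp (s * (l + r))"
      using \<rho> by (simp add: powr_def Ln_of_real ln_mult l_def r_def del: of_real_mult)
    have "exp ((s - lam) * (2 * l)) * exp (2 * r * \<mu>) * exp (- 2 * r) * exp (- s * (r - l)) * exp (- s * (2 * l)) =
       exp (s * (l + r)) * exp (lam * (2 * r - 2 * l))"
      unfolding exp_add[symmetric] by (rule arg_cong[of _ _ exp]) (simp add: \<mu>_def algebra_simps)
    hence E: "c * gegen_mass lam * exp (- s * of_real (ln 4)) = of_real (2 * \<rho>) powr s * exp (lam * (2 * r - of_real (ln 4))) * \<Lambda>"
      unfolding c_def l4 p using gegen_mass_nonzero[OF lam] by (simp add: field_simps)
    have "c * (gegen_mass lam * g * exp (- s * of_real (ln 4)) / 2 * \<Sigma>) = g * of_real (2 * \<rho>) powr s * (exp (lam * (2 * r - of_real (ln 4))) / 2 * \<Lambda> * \<Sigma>)" for g \<Sigma>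
    proof -
      have "c * (gegen_mass lam * g * exp (- s * of_real (ln 4)) / 2 * \<Sigma>) = (c * gegen_mass lam * exp (- s * of_real (ln 4))) * (g * \<Sigma> / 2)" by simp
      also have "\<dots> = g * of_real (2 * \<rho>) powr s * (exp (lam * (2 * r - of_real (ln 4))) / 2 * \<Lambda> * \<Sigma>)" unfolding E by simp
      finally show ?thesis .
    qed
    thus ?thesis by (simp only: sum_distrib_left[symmetric])
  qed
  also have "(\<Sum>j\<in>{\<i>, - \<i>}. exp (lam * (2 * r - of_real (ln 4))) / 2 * \<Lambda> * S j) =
     (\<Sum>j\<in>{\<i>, - \<i>}. Bessel_I lam (exp (- j * of_real pi / 4) * of_real \<rho> * (z - w) / 2) * Bessel_K lam (exp (- j * of_real pi / 4) * of_real \<rho> * (z + w) / 2))"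
  proof (intro sum.cong refl)
    fix j assume j: "j \<in> {\<i>, - \<i>}"
    hence j': "j = \<i> \<or> j = - \<i>" by simp
    show "exp (lam * (2 * r - of_real (ln 4))) / 2 * \<Lambda> * S j = Bessel_I lam (exp (- j * of_real pi / 4) * of_real \<rho> * (z - w) / 2) * Bessel_K lam (exp (- j * of_real pi / 4) * of_real \<rho> * (z + w) / 2)"
      unfolding S_def W_def Z_def r_def \<Lambda>_def
      by (rule Bessel_I_mult_K[OF zw \<rho> j' \<phi>(1,2) cone_nbhd_norm_less(3)[OF rot[OF j], unfolded W_def], symmetric])
  qed
  also have "\<dots> = Bessel_I lam (of_real \<rho> * cnj \<epsilon> * (z - w) / 2) * Bessel_K lam (of_real \<rho> * cnj \<epsilon> * (z + w) / 2)
        + Bessel_I lam (of_real \<rho> * \<epsilon> * (z - w) / 2) * Bessel_K lam (of_real \<rho> * \<epsilon> * (z + w) / 2)"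
  proof -
    \<comment> \<open>The index j belongs to e^(-j pi/4), so j = i gives the summand with the
      conjugate of \<epsilon>.\<close>
    have e: "exp (- \<i> * of_real pi / 4) = cnj \<epsilon>" "exp (- (- \<i>) * of_real pi / 4) = \<epsilon>" by (simp_all add: \<epsilon>_def exp_cnj)
    show ?thesis unfolding sum_conj_pair e by (simp only: mult_ac)
  qed
  finally show ?thesis .
qed

end
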